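(* Let $T>0$. Let $s\in(0,1)$, $\alpha\in[0,1)$ be such that $\alpha+2s\notin\{1,2\}$, and let $f\in C^{\alpha+2s}_b(\mathbb{R}^N)$, $g\in C^{0,\alpha}_b([0,T]\times\mathbb{R}^N)$. Then the mild solution $v$ to $$v_t(t,x)=Lv(t,\cdot)(x)+g(t,x),\quad 0\le t\le T,\ x\in\mathbb{R}^N;\qquad v(0,x)=f(x),\quad x\in\mathbb{R}^N,\qquad( * )$$ where $L$ is the generator of the Ornstein–Uhlenbeck semigroup with fractional diffusion of order $s$ described in the context, belongs to $C^{0,\alpha+2s}_b([0,T]\times\mathbb{R}^N)$, and there is $C>0$, independent of $f$ and $g$, such that $$\|v\|_{C^{0,\alpha+2s}_b([0,T]\times\mathbb{R}^N)}\le C\big(\|f\|_{C^{\alpha+2s}_b(\mathbb{R}^N)}+\|g\|_{C^{0,\alpha}_b([0,T]\times\mathbb{R}^N)}\big).$$ Let $s\in(0,1)$, $\alpha\in[0,1)$ be such that $\alpha+2s=:k\in\{1,2\}$. Then for every $f\in Z^k_b(\mathbb{R}^N)$, $g\in C^{0,\alpha}_b([0,T]\times\mathbb{R}^N)$ the mild solution to $( * )$ belongs to $Z^{0,k}_b([0,T]\times\mathbb{R}^N)$, and there is $C>0$, independent of $f$ and $g$, such that $$\|v\|_{Z^{0,k}_b([0,T]\times\mathbb{R}^N)}\le C\big(\|f\|_{Z^k_b(\mathbb{R}^N)}+\|g\|_{C^{0,\alpha}_b([0,T]\times\mathbb{R}^N)}\big).$$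
   Context: The semigroup. $Q$ is a symmetric positive definite $N\times N$ real matrix, $B$ is any $N\times N$ real matrix. For $t>0$ set $$g_t(z)=\frac1{(2\pi)^N}\int_{\mathbb{R}^N}\exp\Big(-\tfrac12\int_0^t|Q^{1/2}e^{-\sigma B^*}\xi|^{2s}\,d\sigma\Big)e^{-i\langle\xi,z\rangle}\,d\xi,$$ which is a probability density on $\mathbb{R}^N$, and $P_tf(x)=\int_{\mathbb{R}^N}f(e^{-tB}x+z)g_t(z)\,dz$, $P_0=I$, $f\in C_b(\mathbb{R}^N)$. $(P_t)$ is a semigroup on $C_b(\mathbb{R}^N)$; its generator $L$ is the unique closed operator in $C_b(\mathbb{R}^N)$ with $R(\lambda,L)f(x)=\int_0^\infty e^{-\lambda t}P_tf(x)\,dt$ for $\lambda>0$ (heuristically $Lu=\frac12\mathrm{Tr}^s(QD^2u)-\langle Bx,\nabla u\rangle$, where $\mathrm{Tr}^s(QD^2)$ has symbol $-\langle Q\xi,\xi\rangle^s$). The mild solution of $( * )$ is by definition $v(t,x)=P_tf(x)+\int_0^tP_{t-r}g(r,\cdot)(x)\,dr$, $t\in[0,T]$, $x\in\mathbb{R}^N$. Function spaces. $C_b$: bounded continuous functions with sup norm. For $\sigma\in(0,1)$, $C^\sigma_b(\mathbb{R}^N)$: bounded $\sigma$-Hölder continuous functions, norm $\|f\|_\infty+\sup_{x,\,h\ne0}|f(x+h)-f(x)|/|h|^\sigma$. For $n\in\mathbb{N}$, $C^n_b(\mathbb{R}^N)$: functions with bounded continuous derivatives up to order $n$, norm given by sum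 of sup norms; $C^{n+\sigma}_b(\mathbb{R}^N)$: $f\in C^n_b$ whose $n$-th order derivative is $\sigma$-Hölder, norm $\|f\|_{C^n_b}$ plus the $\sigma$-Hölder seminorm of $D^nf$. $Z^1_b(\mathbb{R}^N)$: bounded continuous $f$ with $[f]_{Z^1}=\sup_{x,\,h\ne0}|f(x+2h)-2f(x+h)+f(x)|/|h|<\infty$, norm $\|f\|_\infty+[f]_{Z^1}$. $Z^2_b(\mathbb{R}^N)$: $f\in C^1_b$ with $[Df]_{Z^1}<\infty$, norm $\|f\|_{C^1_b}+[Df]_{Z^1}$. For $\gamma>0$, $C^{0,\gamma}_b([0,T]\times\mathbb{R}^N)$: bounded continuous $g$ with $g(t,\cdot)\in C^\gamma_b(\mathbb{R}^N)$ for all $t$, norm $\sup_t\|g(t,\cdot)\|_{C^\gamma_b}<\infty$, and, if $\gamma\ge1$, all space derivatives of order $\le[\gamma]$ continuous on $[0,T]\times\mathbb{R}^N$. $C^{0,0}_b([0,T]\times\mathbb{R}^N):=C_b([0,T]\times\mathbb{R}^N)$. $Z^{0,k}_b([0,T]\times\mathbb{R}^N)$: bounded continuous $g$ with $g(t,\cdot)\in Z^k_b(\mathbb{R}^N)$ for all $t$, norm $\sup_t\|g(t,\cdot)\|_{Z^k_b}<\infty$, and, if $k\ge2$, $g\in C^{0,k-1}_b([0,T]\times\mathbb{R}^N)$. *)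

theory Defs
  imports "HOL-Analysis.Analysis"
begin

definition sym_pos_def :: "real^'n^'n \<Rightarrow> bool" where
  "sym_pos_def Q \<longleftrightarrow> transpose Q = Q \<and> (\<forall>x. x \<noteq> 0 \<longrightarrow> 0 < x \<bullet> (Q *v x))"

text \<open>The symmetric positive semidefinite square root; it is unique, so the choice is harmless.\<close>
definition mat_sqrt :: "real^'n^'n \<Rightarrow> real^'n^'n" where
  "mat_sqrt Q = (SOME R. transpose R = R \<and> (\<forall>x. 0 \<le> x \<bullet> (R *v x)) \<and> R ** R = Q)"

text \<open>On \<open>real^'n^'n\<close> the operations \<open>*\<close> and \<open>^\<close> are componentwise, hence the
  explicit iteration of \<open>**\<close>.\<close>
definition mat_exp :: "real^'n^'n \<Rightarrow> real^'n^'n" where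
  "mat_exp A = (\<Sum>k. (1 / fact k) *\<^sub>R (((**) A ^^ k) (mat 1)))"

definition ou_symbol :: "real^'n^'n \<Rightarrow> real^'n^'n \<Rightarrow> real \<Rightarrow> real \<Rightarrow> real^'n \<Rightarrow> real" where
  "ou_symbol Q B s t \<xi> =
     exp (- (1/2) * (LINT \<sigma>:{0..t}|lborel.
        norm (mat_sqrt Q *v (mat_exp ((- \<sigma>) *\<^sub>R transpose B) *v \<xi>)) powr (2 * s)))"

text \<open>The symbol is even in \<open>\<xi>\<close>, so the integral below is a real number and \<open>Re\<close>
  only converts the type.\<close>
definition ou_density :: "real^'n^'n \<Rightarrow> real^'n^'n \<Rightarrow> real \<Rightarrow> real \<Rightarrow> real^'n \<Rightarrow> real" where
  "ou_density Q B s t z =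
     Re (1 / (2 * of_real pi) ^ CARD('n) *
        (LINT \<xi>|lborel. of_real (ou_symbol Q B s t \<xi>) * exp (- \<i> * of_real (\<xi> \<bullet> z))))"

definition ou_semigroup ::
    "real^'n^'n \<Rightarrow> real^'n^'n \<Rightarrow> real \<Rightarrow> real \<Rightarrow> (real^'n \<Rightarrow> real) \<Rightarrow> real^'n \<Rightarrow> real" where
  "ou_semigroup Q B s t f x =
     (if t = 0 then f x
      else (LINT z|lborel. f (mat_exp ((- t) *\<^sub>R B) *v x + z) * ou_density Q B s t z))"

text \<open>The mild solution of \<open>v\<^sub>t = L v + g\<close>, \<open>v(0) = f\<close>, where \<open>L\<close> is the generator of
  \<open>ou_semigroup Q B s\<close>. By definition it is given by the variation of constants formula, which
  involves \<open>L\<close> only through its semigroup.\<close>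
definition ou_mild_solution ::
    "real^'n^'n \<Rightarrow> real^'n^'n \<Rightarrow> real \<Rightarrow> (real^'n \<Rightarrow> real) \<Rightarrow> (real \<Rightarrow> real^'n \<Rightarrow> real)
      \<Rightarrow> real \<Rightarrow> real^'n \<Rightarrow> real" where
  "ou_mild_solution Q B s f g t x =
     ou_semigroup Q B s t f x + (LINT r:{0..t}|lborel. ou_semigroup Q B s (t - r) (g r) x)"

text \<open>\<open>partial_derivs f [i\<^sub>1,\<dots>,i\<^sub>k]\<close> is the iterated partial derivative
  \<open>\<partial>\<^bsub>i\<^sub>1\<^esub> \<dots> \<partial>\<^bsub>i\<^sub>k\<^esub> f\<close>. The derivative \<open>D\<^sup>k f(x)\<close> is the tensor of the values
  at all index lists of length \<open>k\<close>.\<close>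
fun partial_derivs :: "(real^'n \<Rightarrow> real) \<Rightarrow> 'n list \<Rightarrow> real^'n \<Rightarrow> real" where
  "partial_derivs f [] x = f x"
| "partial_derivs f (i # is) x = frechet_derivative (partial_derivs f is) (at x) (axis i 1)"

definition tensor_norm :: "nat \<Rightarrow> ('n::finite list \<Rightarrow> real) \<Rightarrow> real" where
  "tensor_norm k A = sqrt (\<Sum>is | length is = k. (A is)\<^sup>2)"

text \<open>Norms take values in \<open>ennreal\<close>, so that suprema of unbounded sets are infinite.
  The quotients at \<open>h = 0\<close> are excluded from the suprema.\<close>

definition Cn_norm :: "nat \<Rightarrow> (real^'n \<Rightarrow> real) \<Rightarrow> ennreal" where
  "Cn_norm n f = (\<Sum>k\<le>n. SUP x. ennreal (tensor_norm k (\<lambda>is. partial_derivs f is x)))"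

definition Cn_space :: "nat \<Rightarrow> (real^'n \<Rightarrow> real) set" where
  "Cn_space n = {f.
     (\<forall>is x. length is < n \<longrightarrow> partial_derivs f is differentiable (at x)) \<and>
     (\<forall>is. length is \<le> n \<longrightarrow>
        continuous_on UNIV (partial_derivs f is) \<and> bounded (range (partial_derivs f is)))}"

definition hoelder_seminorm :: "nat \<Rightarrow> real \<Rightarrow> (real^'n \<Rightarrow> real) \<Rightarrow> ennreal" where
  "hoelder_seminorm n \<sigma> f = (SUP x. SUP h\<in>-{0}. ennreal
     (tensor_norm n (\<lambda>is. partial_derivs f is (x + h) - partial_derivs f is x) / norm h powr \<sigma>))"

definition zygmund_seminorm :: "nat \<Rightarrow> (real^'n \<Rightarrow> real) \<Rightarrow> ennreal" where
  "zygmund_seminorm n f = (SUP x. SUP h\<in>-{0}. ennreal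
     (tensor_norm n (\<lambda>is. partial_derivs f is (x + 2 *\<^sub>R h) - 2 * partial_derivs f is (x + h)
        + partial_derivs f is x) / norm h))"

text \<open>\<open>C\<^sup>\<gamma>\<^sub>b\<close> for real \<open>\<gamma> \<ge> 0\<close>; for integer \<open>\<gamma>\<close> there is no Hoelder seminorm.\<close>

definition C_norm :: "real \<Rightarrow> (real^'n \<Rightarrow> real) \<Rightarrow> ennreal" where
  "C_norm \<gamma> f = Cn_norm (nat \<lfloor>\<gamma>\<rfloor>) f +
     (if \<gamma> \<in> \<int> then 0 else hoelder_seminorm (nat \<lfloor>\<gamma>\<rfloor>) (frac \<gamma>) f)"

definition C_space :: "real \<Rightarrow> (real^'n \<Rightarrow> real) set" where
  "C_space \<gamma> = {f \<in> Cn_space (nat \<lfloor>\<gamma>\<rfloor>).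
     \<gamma> \<notin> \<int> \<longrightarrow> hoelder_seminorm (nat \<lfloor>\<gamma>\<rfloor>) (frac \<gamma>) f < \<infinity>}"

text \<open>\<open>Z\<^sup>k\<^sub>b\<close> for \<open>k \<ge> 1\<close>; only \<open>k = 1\<close> and \<open>k = 2\<close> are used.\<close>

definition Z_norm :: "nat \<Rightarrow> (real^'n \<Rightarrow> real) \<Rightarrow> ennreal" where
  "Z_norm k f = Cn_norm (k - 1) f + zygmund_seminorm (k - 1) f"

definition Z_space :: "nat \<Rightarrow> (real^'n \<Rightarrow> real) set" where
  "Z_space k = {f \<in> Cn_space (k - 1). zygmund_seminorm (k - 1) f < \<infinity>}"

text \<open>Functions on \<open>[0,T] \<times> \<real>\<^sup>N\<close> are curried; their values at times outside \<open>[0,T]\<close>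
  play no role.\<close>

definition bounded_continuous_strip :: "real \<Rightarrow> (real \<Rightarrow> real^'n \<Rightarrow> real) \<Rightarrow> bool" where
  "bounded_continuous_strip T g \<longleftrightarrow>
     continuous_on ({0..T} \<times> UNIV) (\<lambda>(t, x). g t x) \<and>
     bounded ((\<lambda>(t, x). g t x) ` ({0..T} \<times> UNIV))"

definition C0_norm :: "real \<Rightarrow> real \<Rightarrow> (real \<Rightarrow> real^'n \<Rightarrow> real) \<Rightarrow> ennreal" where
  "C0_norm T \<gamma> g = (SUP t\<in>{0..T}. C_norm \<gamma> (g t))"

definition C0_space :: "real \<Rightarrow> real \<Rightarrow> (real \<Rightarrow> real^'n \<Rightarrow> real) set" where
  "C0_space T \<gamma> = {g. bounded_continuous_strip T g \<and>
     (\<forall>t\<in>{0..T}. g t \<in> C_space \<gamma>) \<and> C0_norm T \<gamma> g < \<infinity> \<and>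
     (\<forall>is. length is \<le> nat \<lfloor>\<gamma>\<rfloor> \<longrightarrow>
        continuous_on ({0..T} \<times> UNIV) (\<lambda>(t, x). partial_derivs (g t) is x))}"

definition Z0_norm :: "real \<Rightarrow> nat \<Rightarrow> (real \<Rightarrow> real^'n \<Rightarrow> real) \<Rightarrow> ennreal" where
  "Z0_norm T k g = (SUP t\<in>{0..T}. Z_norm k (g t))"

definition Z0_space :: "real \<Rightarrow> nat \<Rightarrow> (real \<Rightarrow> real^'n \<Rightarrow> real) set" where
  "Z0_space T k = {g. bounded_continuous_strip T g \<and>
     (\<forall>t\<in>{0..T}. g t \<in> Z_space k) \<and> Z0_norm T k g < \<infinity> \<and>
     (k \<ge> 2 \<longrightarrow> g \<in> C0_space T (real (k - 1)))}"

end

(* The Fourier symbol of g_t, rescaled to unit time, is exp (- stable_exponent). Splitting the exponent into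
   a smooth part and the exponential of a bounded (Bernstein) remainder and shifting contours shows that the
   rescaled kernels and all their derivatives have an L^1 norm (with a small polynomial weight) bounded
   uniformly in t. Hence P_t f is smooth, with |D^k P_t f| <= C t^((alpha - k)/(2s)) [f]_alpha for k >= 1. In the
   Duhamel integral these bounds are integrable at 0 as long as k < alpha + 2s; for the top order difference
   the integral is split at tau = |h|^(2s), using the bound for n derivatives before and for n + m derivatives
   after that time, m = 1 (Hoelder) or m = 2 (Zygmund). *)
theory Submission
  imports Defs "HOL-Probability.Probability" "HOL-Complex_Analysis.Complex_Analysis"
begin

text \<open>The stable exponent is not smooth at the origin, which obstructs the shift of contour
  and leaves the kernels with polynomial decay only. Replacing |R \<eta>|^(2s) by (1 + |R
  \<eta>|^2)^s gives an exponent that is holomorphic in a strip, hence an exponentially decaying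
  transform. The error (1 + \<lambda>)^s - \<lambda>^s is the Laplace transform of a probability
  measure: multiplication by it averages Gaussian multipliers, that is, convolves the transform with
  probability measures, and its exponential is summed as a power series. The weight (1 +
  |z|)^\<delta> makes the kernels tight, which gives the continuity in time of P_t f. The choice
  \<delta> = s/N is due to the N one-dimensional Gaussian factors, each of cost (1 +
  u)^(\<delta>/2), and to the measure having moments only below order s. Derivatives are never taken
  under an integral sign: candidates for them are indexed by lists of directions and linked by
  integrals along segments, from which differentiability follows. At integer order a first
  difference would leave the integral of 1/\<tau>, a logarithm; a second difference avoids
  it.\<close>

section \<open>Fourier transforms and multipliers in a weighted L^1 norm\<close>

lemma lborel_distr_translate: "distr lborel borel (\<lambda>x::'a::euclidean_space. x + c) = lborel"
proof -
  have "(\<lambda>x::'a. x + c) = (+) c" by (simp add: fun_eq_iff add.commute)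
  then show ?thesis using lborel_distr_plus[of c] by simp
qed

lemma nn_integral_translate:
  fixes f :: "'a::euclidean_space \<Rightarrow> ennreal"
  assumes [measurable]: "f \<in> borel_measurable borel"
  shows "(\<integral>\<^sup>+x. f (x + c) \<partial>lborel) = (\<integral>\<^sup>+x. f x \<partial>lborel)"
  by (subst (2) lborel_distr_translate[symmetric, of c]) (simp add: nn_integral_distr)

lemma integral_translate:
  fixes f :: "'a::euclidean_space \<Rightarrow> 'b::{banach,second_countable_topology}"
  assumes [measurable]: "f \<in> borel_measurable borel"
  shows "(\<integral>x. f (x + c) \<partial>lborel) = (\<integral>x. f x \<partial>lborel)"
  by (subst (2) lborel_distr_translate[symmetric, of c]) (simp add: integral_distr)

lemma integrable_translate:
  fixes f :: "'a::euclidean_space \<Rightarrow> 'b::{banach,second_countable_topology}"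
  assumes "integrable lborel f"
  shows "integrable lborel (\<lambda>x. f (x + c))"
proof -
  have [measurable]: "f \<in> borel_measurable borel" using assms by auto
  have "integrable (distr lborel borel (\<lambda>x. x + c)) f" using assms by (simp add: lborel_distr_translate)
  then show ?thesis by (simp add: integrable_distr_eq)
qed

lemma integral_scale:
  fixes f :: "'a::euclidean_space \<Rightarrow> 'b::{banach,second_countable_topology}"
  assumes [measurable]: "f \<in> borel_measurable borel" and "c > 0"
  shows "(\<integral>x. f x \<partial>lborel) = c ^ DIM('a) *\<^sub>R (\<integral>x. f (c *\<^sub>R x) \<partial>lborel)"
  using assms(2) by (subst lborel_affine[of c 0])
    (auto simp: integral_density integral_distr)

text \<open>Sign as in \<open>ou_density\<close>, without the factor (2 \<pi>)^(-N), which is moved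
  into \<open>kernel\<close>.\<close>

definition fourier :: "('a::euclidean_space \<Rightarrow> complex) \<Rightarrow> 'a \<Rightarrow> complex" where
  "fourier m z = (\<integral>\<eta>. m \<eta> * exp (- \<i> * of_real (\<eta> \<bullet> z)) \<partial>lborel)"

text \<open>The norm is taken on the transform side, where multiplication of symbols acts as
  convolution. Values in \<open>ennreal\<close> allow estimates to be chained before finiteness is
  known.\<close>

definition weight_norm :: "real \<Rightarrow> ('a::euclidean_space \<Rightarrow> complex) \<Rightarrow> ennreal" where
  "weight_norm \<delta> m = (\<integral>\<^sup>+z. ennreal ((1 + norm z) powr \<delta> * norm (fourier m z)) \<partial>lborel)"

lemma fourier_measurable [measurable]:
  assumes [measurable]: "m \<in> borel_measurable borel"
  shows "fourier m \<in> borel_measurable borel"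
  unfolding fourier_def[abs_def] by measurable

lemma integrable_fourier_integrand:
  assumes "integrable lborel (m :: 'a::euclidean_space \<Rightarrow> complex)"
  shows "integrable lborel (\<lambda>\<eta>. m \<eta> * exp (- \<i> * of_real (\<eta> \<bullet> z)))"
proof (rule Bochner_Integration.integrable_bound[OF assms])
  have [measurable]: "m \<in> borel_measurable borel" using assms by auto
  show "(\<lambda>\<eta>. m \<eta> * exp (- \<i> * of_real (\<eta> \<bullet> z))) \<in> borel_measurable lborel" by measurable
qed (simp add: norm_mult)

text \<open>A character multiplier translates the transform by x, and the weight is
  submultiplicative: 1 + |z| \<le> (1 + |x|) (1 + |z - x|).\<close>

lemma weight_norm_translate:
  assumes [measurable]: "m \<in> borel_measurable borel" and "0 \<le> \<delta>"
  shows "weight_norm \<delta> (\<lambda>\<eta>. m \<eta> * exp (\<i> * of_real (\<eta> \<bullet> x))) \<le> ennreal ((1 + norm x) powr \<delta>) * weight_norm \<delta> m"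
proof -
  have 1: "fourier (\<lambda>\<eta>. m \<eta> * exp (\<i> * of_real (\<eta> \<bullet> x))) z = fourier m (z + - x)" for z
    unfolding fourier_def
    by (simp add: mult.assoc exp_add[symmetric] inner_diff_right algebra_simps)
  have 2: "(1 + norm z) powr \<delta> \<le> (1 + norm x) powr \<delta> * (1 + norm (z + - x)) powr \<delta>" for z
  proof -
    have "norm z \<le> norm (z - x) + norm x" using norm_triangle_ineq[of "z - x" x] by simp
    also have "\<dots> \<le> norm (z - x) + norm x + norm x * norm (z - x)" by simp
    finally have "1 + norm z \<le> (1 + norm x) * (1 + norm (z + - x))" by (simp add: algebra_simps)
    then show ?thesis using assms(2)
      by (subst powr_mult[symmetric]) (auto intro!: powr_mono2)
  qed
  have "weight_norm \<delta> (\<lambda>\<eta>. m \<eta> * exp (\<i> * of_real (\<eta> \<bullet> x)))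
     \<le> (\<integral>\<^sup>+z. ennreal ((1 + norm x) powr \<delta>) * ennreal ((1 + norm (z + - x)) powr \<delta> * norm (fourier m (z + - x))) \<partial>lborel)"
    unfolding weight_norm_def 1
    by (intro nn_integral_mono) (simp add: ennreal_mult[symmetric] mult.assoc[symmetric] mult_right_mono[OF 2[simplified]])
  also have "\<dots> = ennreal ((1 + norm x) powr \<delta>) * (\<integral>\<^sup>+z. ennreal ((1 + norm (z + - x)) powr \<delta> * norm (fourier m (z + - x))) \<partial>lborel)"
    by (intro nn_integral_cmult) measurable
  also have "(\<integral>\<^sup>+z. ennreal ((1 + norm (z + - x)) powr \<delta> * norm (fourier m (z + - x))) \<partial>lborel) = weight_norm \<delta> m"
    unfolding weight_norm_def by (rule nn_integral_translate) measurable
  finally show ?thesis .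
qed

text \<open>Minkowski's inequality for an averaged multiplier: Fubini pulls the average out of the
  transform, and Tonelli then out of the norm. The bound by 1 and the integrability of
  \<open>m\<close> give the joint integrability that Fubini asks for.\<close>

lemma weight_norm_average:
  fixes m :: "'a::euclidean_space \<Rightarrow> complex" and a :: "'b \<Rightarrow> 'a \<Rightarrow> complex"
  assumes "prob_space M" and a[measurable]: "(\<lambda>(\<omega>, \<eta>). a \<omega> \<eta>) \<in> borel_measurable (M \<Otimes>\<^sub>M borel)"
    and le: "\<And>\<omega> \<eta>. norm (a \<omega> \<eta>) \<le> 1" and m: "integrable lborel m"
  shows "weight_norm \<delta> (\<lambda>\<eta>. (\<integral>\<omega>. a \<omega> \<eta> \<partial>M) * m \<eta>) \<le> (\<integral>\<^sup>+\<omega>. weight_norm \<delta> (\<lambda>\<eta>. a \<omega> \<eta> * m \<eta>) \<partial>M)"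
proof -
  interpret M: prob_space M by fact
  interpret P: pair_sigma_finite M "lborel :: 'a measure" ..
  have [measurable]: "m \<in> borel_measurable borel" using m by auto
  have sp: "sets (M \<Otimes>\<^sub>M lborel) = sets (M \<Otimes>\<^sub>M (borel :: 'a measure))" by (rule sets_pair_measure_cong) auto
  have [measurable]: "(\<lambda>(\<omega>, \<eta>). a \<omega> \<eta>) \<in> borel_measurable (M \<Otimes>\<^sub>M lborel)"
    using a by (simp add: measurable_cong_sets[OF sp refl])
  have int: "integrable (M \<Otimes>\<^sub>M lborel) (\<lambda>(\<omega>,\<eta>). a \<omega> \<eta> * (m \<eta> * exp (- \<i> * of_real (\<eta> \<bullet> z))))" for z
  proof (rule Bochner_Integration.integrable_bound)
    show "integrable (M \<Otimes>\<^sub>M lborel) (\<lambda>(\<omega>,\<eta>). 1 * m \<eta>)"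
      using m by (intro P.Fubini_integrable) auto
    show "AE x in M \<Otimes>\<^sub>M lborel. norm (case x of (\<omega>,\<eta>) \<Rightarrow> a \<omega> \<eta> * (m \<eta> * exp (- \<i> * of_real (\<eta> \<bullet> z))))
        \<le> norm (case x of (\<omega>,\<eta>) \<Rightarrow> 1 * m \<eta>)"
      using le by (intro always_eventually) (auto simp: norm_mult intro!: mult_left_le_one_le)
  qed measurable
  have 1: "fourier (\<lambda>\<eta>. (\<integral>\<omega>. a \<omega> \<eta> \<partial>M) * m \<eta>) z = (\<integral>\<omega>. fourier (\<lambda>\<eta>. a \<omega> \<eta> * m \<eta>) z \<partial>M)" for z
  proof -
    have "fourier (\<lambda>\<eta>. (\<integral>\<omega>. a \<omega> \<eta> \<partial>M) * m \<eta>) z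
        = (\<integral>\<eta>. (\<integral>\<omega>. a \<omega> \<eta> * (m \<eta> * exp (- \<i> * of_real (\<eta> \<bullet> z))) \<partial>M) \<partial>lborel)"
      unfolding fourier_def by (simp add: mult.assoc)
    also have "\<dots> = (\<integral>\<omega>. (\<integral>\<eta>. a \<omega> \<eta> * (m \<eta> * exp (- \<i> * of_real (\<eta> \<bullet> z))) \<partial>lborel) \<partial>M)"
      by (rule P.Fubini_integral[OF int])
    finally show ?thesis by (simp add: fourier_def mult.assoc)
  qed
  have F: "(\<lambda>(\<omega>,z). fourier (\<lambda>\<eta>. a \<omega> \<eta> * m \<eta>) z) \<in> borel_measurable (M \<Otimes>\<^sub>M lborel)"
    unfolding fourier_def by measurable
  have F': "(\<lambda>\<omega>. fourier (\<lambda>\<eta>. a \<omega> \<eta> * m \<eta>) z) \<in> borel_measurable M" for z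
    using measurable_compose[OF _ F, of "\<lambda>\<omega>. (\<omega>, z)" M] by simp
  have "weight_norm \<delta> (\<lambda>\<eta>. (\<integral>\<omega>. a \<omega> \<eta> \<partial>M) * m \<eta>)
    \<le> (\<integral>\<^sup>+z. (\<integral>\<^sup>+\<omega>. ennreal ((1 + norm z) powr \<delta> * norm (fourier (\<lambda>\<eta>. a \<omega> \<eta> * m \<eta>) z)) \<partial>M) \<partial>lborel)"
    unfolding weight_norm_def 1
  proof (rule nn_integral_mono)
    fix z :: 'a
    have "ennreal (norm (\<integral>\<omega>. fourier (\<lambda>\<eta>. a \<omega> \<eta> * m \<eta>) z \<partial>M)) \<le> (\<integral>\<^sup>+\<omega>. norm (fourier (\<lambda>\<eta>. a \<omega> \<eta> * m \<eta>) z) \<partial>M)"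
    proof (rule integral_norm_bound_ennreal)
      show "integrable M (\<lambda>\<omega>. fourier (\<lambda>\<eta>. a \<omega> \<eta> * m \<eta>) z)"
        using P.integrable_fst[OF int] by (simp add: fourier_def mult.assoc)
    qed
    then have "ennreal ((1 + norm z) powr \<delta>) * ennreal (norm (\<integral>\<omega>. fourier (\<lambda>\<eta>. a \<omega> \<eta> * m \<eta>) z \<partial>M))
      \<le> ennreal ((1 + norm z) powr \<delta>) * (\<integral>\<^sup>+\<omega>. norm (fourier (\<lambda>\<eta>. a \<omega> \<eta> * m \<eta>) z) \<partial>M)"
      by (rule mult_left_mono) simp
    then show "ennreal ((1 + norm z) powr \<delta> * norm (\<integral>\<omega>. fourier (\<lambda>\<eta>. a \<omega> \<eta> * m \<eta>) z \<partial>M))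
       \<le> (\<integral>\<^sup>+\<omega>. ennreal ((1 + norm z) powr \<delta> * norm (fourier (\<lambda>\<eta>. a \<omega> \<eta> * m \<eta>) z)) \<partial>M)"
      by (simp only: ennreal_mult[OF powr_ge_zero norm_ge_zero])
        (subst nn_integral_cmult, use F' in measurable)
  qed
  also have "\<dots> = (\<integral>\<^sup>+\<omega>. weight_norm \<delta> (\<lambda>\<eta>. a \<omega> \<eta> * m \<eta>) \<partial>M)"
    unfolding weight_norm_def
  proof (rule P.Fubini')
    have "(\<lambda>p. ennreal ((1 + norm (snd p)) powr \<delta> * norm ((\<lambda>(\<omega>,z). fourier (\<lambda>\<eta>. a \<omega> \<eta> * m \<eta>) z) p))) \<in> borel_measurable (M \<Otimes>\<^sub>M lborel)"
      using F by measurable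
    then show "(\<lambda>(\<omega>,z). ennreal ((1 + norm z) powr \<delta> * norm (fourier (\<lambda>\<eta>. a \<omega> \<eta> * m \<eta>) z))) \<in> borel_measurable (M \<Otimes>\<^sub>M lborel)"
      by (simp add: case_prod_beta')
  qed
  finally show ?thesis .
qed

lemma weight_norm_add:
  assumes "integrable lborel m1" "integrable lborel m2"
  shows "weight_norm \<delta> (\<lambda>\<eta>. m1 \<eta> + m2 \<eta>) \<le> weight_norm \<delta> m1 + weight_norm \<delta> m2"
proof -
  have [measurable]: "m1 \<in> borel_measurable borel" "m2 \<in> borel_measurable borel" using assms by auto
  have 1: "fourier (\<lambda>\<eta>. m1 \<eta> + m2 \<eta>) z = fourier m1 z + fourier m2 z" for z
    unfolding fourier_def distrib_right
    by (intro Bochner_Integration.integral_add integrable_fourier_integrand assms)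
  have "weight_norm \<delta> (\<lambda>\<eta>. m1 \<eta> + m2 \<eta>) \<le> (\<integral>\<^sup>+z. ennreal ((1 + norm z) powr \<delta> * norm (fourier m1 z)) + ennreal ((1 + norm z) powr \<delta> * norm (fourier m2 z)) \<partial>lborel)"
    unfolding weight_norm_def 1
  proof (rule nn_integral_mono)
    fix z :: 'a
    have "(1 + norm z) powr \<delta> * norm (fourier m1 z + fourier m2 z)
      \<le> (1 + norm z) powr \<delta> * norm (fourier m1 z) + (1 + norm z) powr \<delta> * norm (fourier m2 z)"
      unfolding distrib_left[symmetric] by (intro mult_left_mono norm_triangle_ineq) auto
    then show "ennreal ((1 + norm z) powr \<delta> * norm (fourier m1 z + fourier m2 z))
       \<le> ennreal ((1 + norm z) powr \<delta> * norm (fourier m1 z)) + ennreal ((1 + norm z) powr \<delta> * norm (fourier m2 z))"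
      by (subst ennreal_plus[symmetric]) (auto intro: ennreal_leI simp del: ennreal_plus)
  qed
  also have "\<dots> = weight_norm \<delta> m1 + weight_norm \<delta> m2"
    unfolding weight_norm_def by (intro nn_integral_add) measurable
  finally show ?thesis .
qed

lemma weight_norm_cmult:
  assumes [measurable]: "m \<in> borel_measurable borel"
  shows "weight_norm \<delta> (\<lambda>\<eta>. c * m \<eta>) = ennreal (norm c) * weight_norm \<delta> m"
proof -
  have 1: "fourier (\<lambda>\<eta>. c * m \<eta>) z = c * fourier m z" for z
    unfolding fourier_def by (simp add: mult.assoc)
  show ?thesis unfolding weight_norm_def 1
    by (subst nn_integral_cmult[symmetric])
      (auto simp: norm_mult ennreal_mult[symmetric] mult_ac intro!: nn_integral_cong)
qed

lemma weight_norm_sum: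
  assumes "finite I" "\<And>i. i \<in> I \<Longrightarrow> integrable lborel (m i)"
  shows "weight_norm \<delta> (\<lambda>\<eta>. \<Sum>i\<in>I. m i \<eta>) \<le> (\<Sum>i\<in>I. weight_norm \<delta> (m i))"
  using assms
proof (induction I rule: finite_induct)
  case empty
  then show ?case by (simp add: weight_norm_def fourier_def)
next
  case (insert i I)
  have "weight_norm \<delta> (\<lambda>\<eta>. m i \<eta> + (\<Sum>i\<in>I. m i \<eta>)) \<le> weight_norm \<delta> (m i) + weight_norm \<delta> (\<lambda>\<eta>. \<Sum>i\<in>I. m i \<eta>)"
    using insert by (intro weight_norm_add Bochner_Integration.integrable_sum) auto
  also have "\<dots> \<le> weight_norm \<delta> (m i) + (\<Sum>i\<in>I. weight_norm \<delta> (m i))"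
    using insert by (intro add_left_mono) auto
  finally show ?case using insert by simp
qed

lemma fourier_tendsto:
  assumes "integrable lborel M" and [measurable]: "\<And>n. m n \<in> borel_measurable borel" "m' \<in> borel_measurable borel"
    and "\<And>n \<eta>. norm (m n \<eta>) \<le> M \<eta>" and "\<And>\<eta>. (\<lambda>n. m n \<eta>) \<longlonglongrightarrow> m' \<eta>"
  shows "(\<lambda>n. fourier (m n) z) \<longlonglongrightarrow> fourier m' z"
  unfolding fourier_def
proof (rule integral_dominated_convergence[where w = M])
  show "AE \<eta> in lborel. norm (m i \<eta> * exp (- \<i> * of_real (\<eta> \<bullet> z))) \<le> M \<eta>" for i
    using assms(4) by (simp add: norm_mult)
  show "AE \<eta> in lborel. (\<lambda>i. m i \<eta> * exp (- \<i> * of_real (\<eta> \<bullet> z))) \<longlonglongrightarrow> m' \<eta> * exp (- \<i> * of_real (\<eta> \<bullet> z))"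
    using assms(5) by (auto intro!: tendsto_intros)
qed (use assms(1) in \<open>auto\<close>)

text \<open>Lower semicontinuity by Fatou: domination makes the transforms converge pointwise, and
  the bound \<open>C\<close> survives the liminf.\<close>

lemma weight_norm_limit:
  assumes "integrable lborel M" and [measurable]: "\<And>n. m n \<in> borel_measurable borel" "m' \<in> borel_measurable borel"
    and "\<And>n \<eta>. norm (m n \<eta>) \<le> M \<eta>" and "\<And>\<eta>. (\<lambda>n. m n \<eta>) \<longlonglongrightarrow> m' \<eta>"
    and "\<And>n. weight_norm \<delta> (m n) \<le> C"
  shows "weight_norm \<delta> m' \<le> C"
proof -
  have "weight_norm \<delta> m' = (\<integral>\<^sup>+z. liminf (\<lambda>n. ennreal ((1 + norm z) powr \<delta> * norm (fourier (m n) z))) \<partial>lborel)"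
    unfolding weight_norm_def
  proof (intro nn_integral_cong)
    fix z
    have "(\<lambda>n. ennreal ((1 + norm z) powr \<delta> * norm (fourier (m n) z))) \<longlonglongrightarrow> ennreal ((1 + norm z) powr \<delta> * norm (fourier m' z))"
      by (intro tendsto_intros tendsto_ennrealI fourier_tendsto[OF assms(1-5)])
    then show "ennreal ((1 + norm z) powr \<delta> * norm (fourier m' z)) = liminf (\<lambda>n. ennreal ((1 + norm z) powr \<delta> * norm (fourier (m n) z)))"
      by (intro lim_imp_Liminf[symmetric]) auto
  qed
  also have "\<dots> \<le> liminf (\<lambda>n. weight_norm \<delta> (m n))"
    unfolding weight_norm_def by (rule nn_integral_liminf) measurable
  also have "\<dots> \<le> C"
    by (rule Liminf_le) (use assms(6) in auto)
  finally show ?thesis .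
qed

text \<open>The k-th term of the exponential series costs D^k / k!, so every partial sum costs at
  most exp D. The pointwise bound on \<phi> dominates the partial sums by exp 1 times |m|, and
  \<open>weight_norm_limit\<close> then reaches the full exponential.\<close>

lemma weight_norm_exp_mult:
  fixes \<phi> :: "'a::euclidean_space \<Rightarrow> complex"
  assumes m: "integrable lborel m" and \<phi>[measurable]: "\<phi> \<in> borel_measurable borel" and le: "\<And>\<eta>. norm (\<phi> \<eta>) \<le> 1"
    and D: "0 \<le> D"
    and mult: "\<And>m. integrable lborel m \<Longrightarrow> weight_norm \<delta> (\<lambda>\<eta>. \<phi> \<eta> * m \<eta>) \<le> ennreal D * weight_norm \<delta> m"
  shows "weight_norm \<delta> (\<lambda>\<eta>. exp (\<phi> \<eta>) * m \<eta>) \<le> ennreal (exp D) * weight_norm \<delta> m"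
proof -
  have [measurable]: "m \<in> borel_measurable borel" using m by auto
  have int: "integrable lborel (\<lambda>\<eta>. \<phi> \<eta> ^ k * m \<eta>)" for k
    by (rule Bochner_Integration.integrable_bound[OF m])
      (auto simp: norm_mult norm_power intro!: mult_left_le_one_le power_le_one le)
  have pow: "weight_norm \<delta> (\<lambda>\<eta>. \<phi> \<eta> ^ k * m \<eta>) \<le> ennreal (D ^ k) * weight_norm \<delta> m" for k
  proof (induction k)
    case (Suc k)
    have "weight_norm \<delta> (\<lambda>\<eta>. \<phi> \<eta> ^ Suc k * m \<eta>) \<le> ennreal D * weight_norm \<delta> (\<lambda>\<eta>. \<phi> \<eta> ^ k * m \<eta>)"
      using mult[OF int[of k]] by (simp add: mult.assoc)
    also have "\<dots> \<le> ennreal D * (ennreal (D ^ k) * weight_norm \<delta> m)"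
      by (rule mult_left_mono[OF Suc]) simp
    finally show ?case using D by (simp add: ennreal_mult mult.assoc)
  qed simp
  define p where "p n \<eta> = (\<Sum>k<n. of_real (inverse (fact k)) * (\<phi> \<eta> ^ k * m \<eta>))" for n \<eta>
  have [measurable]: "p n \<in> borel_measurable borel" for n unfolding p_def by measurable
  have sums: "(\<lambda>n. \<Sum>k<n. of_real (inverse (fact k)) * x ^ k) \<longlonglongrightarrow> exp x" for x :: complex
    using exp_converges[of x] by (simp add: sums_def scaleR_conv_of_real)
  have sums': "(\<Sum>k<n. inverse (fact k) * D ^ k) \<le> exp D" if "0 \<le> D" for n and D :: real
    using sum_le_suminf[OF summable_exp[of D], of "{..<n}"] that by (simp add: exp_def)
  show ?thesis
  proof (rule weight_norm_limit[where m = p and M = "\<lambda>\<eta>. exp 1 * norm (m \<eta>)"])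
    show "integrable lborel (\<lambda>\<eta>. exp 1 * norm (m \<eta>))" using m by simp
    show "(\<lambda>n. p n \<eta>) \<longlonglongrightarrow> exp (\<phi> \<eta>) * m \<eta>" for \<eta>
    proof -
      have "p n \<eta> = (\<Sum>k<n. of_real (inverse (fact k)) * \<phi> \<eta> ^ k) * m \<eta>" for n
        unfolding p_def sum_distrib_right by (simp only: mult.assoc)
      then show ?thesis using tendsto_mult[OF sums tendsto_const] by simp
    qed
    show "norm (p n \<eta>) \<le> exp 1 * norm (m \<eta>)" for n \<eta>
    proof -
      have "norm (p n \<eta>) \<le> (\<Sum>k<n. (inverse (fact k) * 1 ^ k) * norm (m \<eta>))"
        unfolding p_def
      proof (rule order_trans[OF norm_sum], rule sum_mono)
        fix k
        have "norm (\<phi> \<eta>) ^ k * norm (m \<eta>) \<le> 1 * norm (m \<eta>)"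
          by (intro mult_right_mono power_le_one le) auto
        then have "inverse (fact k) * (norm (\<phi> \<eta>) ^ k * norm (m \<eta>)) \<le> inverse (fact k) * norm (m \<eta>)"
          by (intro mult_left_mono) auto
        then show "norm (of_real (inverse (fact k)) * (\<phi> \<eta> ^ k * m \<eta>)) \<le> (inverse (fact k) * 1 ^ k) * norm (m \<eta>)"
          by (simp only: norm_mult norm_power norm_of_real power_one mult_1_right) simp
      qed
      also have "\<dots> = (\<Sum>k<n. inverse (fact k) * 1 ^ k) * norm (m \<eta>)"
        by (rule sum_distrib_right[symmetric])
      also have "\<dots> \<le> exp 1 * norm (m \<eta>)" by (intro mult_right_mono sums') auto
      finally show ?thesis .
    qed
    show "weight_norm \<delta> (p n) \<le> ennreal (exp D) * weight_norm \<delta> m" for n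
    proof -
      have "weight_norm \<delta> (p n) \<le> (\<Sum>k<n. weight_norm \<delta> (\<lambda>\<eta>. of_real (inverse (fact k)) * (\<phi> \<eta> ^ k * m \<eta>)))"
        unfolding p_def[abs_def]
        by (rule weight_norm_sum) (auto intro!: int Bochner_Integration.integrable_mult_right simp del: of_real_inverse)
      also have "\<dots> \<le> (\<Sum>k<n. ennreal (inverse (fact k) * D ^ k) * weight_norm \<delta> m)"
      proof (rule sum_mono)
        fix k
        have "weight_norm \<delta> (\<lambda>\<eta>. of_real (inverse (fact k)) * (\<phi> \<eta> ^ k * m \<eta>))
           = ennreal (norm (of_real (inverse (fact k)) :: complex)) * weight_norm \<delta> (\<lambda>\<eta>. \<phi> \<eta> ^ k * m \<eta>)"
          by (rule weight_norm_cmult) measurable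
        also have "norm (of_real (inverse (fact k)) :: complex) = inverse (fact k)"
          by (simp only: norm_of_real) simp
        also have "ennreal (inverse (fact k)) * weight_norm \<delta> (\<lambda>\<eta>. \<phi> \<eta> ^ k * m \<eta>)
          \<le> ennreal (inverse (fact k)) * (ennreal (D ^ k) * weight_norm \<delta> m)"
          by (rule mult_left_mono[OF pow]) simp
        also have "\<dots> = ennreal (inverse (fact k) * D ^ k) * weight_norm \<delta> m"
          using D by (simp only: mult.assoc[symmetric]) (subst ennreal_mult, auto)
        finally show "weight_norm \<delta> (\<lambda>\<eta>. of_real (inverse (fact k)) * (\<phi> \<eta> ^ k * m \<eta>)) \<le> \<dots>" .
      qed
      also have "\<dots> = ennreal (\<Sum>k<n. inverse (fact k) * D ^ k) * weight_norm \<delta> m"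
        using D by (simp only: sum_distrib_right[symmetric]) (subst sum_ennreal, auto)
      also have "\<dots> \<le> ennreal (exp D) * weight_norm \<delta> m"
        by (intro mult_right_mono ennreal_leI sums' D) auto
      finally show ?thesis .
    qed
  qed measurable
qed

section \<open>Elementary improper integrals\<close>

lemma set_integrable_nonneg_lborel:
  fixes f :: "real \<Rightarrow> real"
  assumes "(f has_integral I) S" "\<And>x. x \<in> S \<Longrightarrow> 0 \<le> f x" and [measurable]: "S \<in> sets borel" "f \<in> borel_measurable borel"
  shows "set_integrable lborel S f" "(LINT x:S|lborel. f x) = I"
proof -
  have "f absolutely_integrable_on S"
    by (rule nonnegative_absolutely_integrable_1) (use assms in auto)
  then show 1: "set_integrable lborel S f"
    unfolding set_integrable_def by (subst (asm) integrable_completion) auto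
  show "(LINT x:S|lborel. f x) = I"
    using set_borel_integral_eq_integral(2)[OF 1] assms(1) by (simp add: integral_unique)
qed

lemma set_integrable_powr_near_0:
  fixes a c :: real
  assumes "-1 < a" "0 \<le> c"
  shows "set_integrable lborel {0..c} (\<lambda>x. x powr a)" "(LINT x:{0..c}|lborel. x powr a) = c powr (a + 1) / (a + 1)"
  by (rule set_integrable_nonneg_lborel[OF has_integral_powr_from_0[OF assms]]; simp)+

lemma set_integrable_powr_at_top:
  fixes a e :: real
  assumes "e < -1" "0 < a"
  shows "set_integrable lborel {a..} (\<lambda>x. x powr e)" "(LINT x:{a..}|lborel. x powr e) = - (a powr (e + 1)) / (e + 1)"
  by (rule set_integrable_nonneg_lborel[OF has_integral_powr_to_inf[OF assms]]; simp)+

lemma nn_integral_inverse_1_plus_square: "(\<integral>\<^sup>+x. ennreal (1 / (1 + x\<^sup>2)) \<partial>lborel) < \<infinity>"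
proof -
  have 1: "(\<integral>\<^sup>+x\<in>{0..}. ennreal (1 / (1 + x\<^sup>2)) \<partial>lborel) = ennreal (pi / 2 - arctan 0)"
    by (rule nn_integral_FTC_atLeast)
      (auto intro!: derivative_eq_intros tendsto_arctan_at_top simp: add_pos_nonneg power2_eq_square field_simps)
  have 2: "(\<integral>\<^sup>+x\<in>{..0}. ennreal (1 / (1 + x\<^sup>2)) \<partial>lborel) = (\<integral>\<^sup>+x\<in>{0..}. ennreal (1 / (1 + x\<^sup>2)) \<partial>lborel)"
    by (subst nn_integral_real_affine[where c="-1" and t=0])
      (auto simp: indicator_def intro!: nn_integral_cong)
  have "(\<integral>\<^sup>+x. ennreal (1 / (1 + x\<^sup>2)) \<partial>lborel)
     \<le> (\<integral>\<^sup>+x. ennreal (1 / (1 + x\<^sup>2)) * indicator {..0} x + ennreal (1 / (1 + x\<^sup>2)) * indicator {0..} x \<partial>lborel)"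
    by (intro nn_integral_mono) (auto simp: indicator_def)
  also have "\<dots> = (\<integral>\<^sup>+x\<in>{..0}. ennreal (1 / (1 + x\<^sup>2)) \<partial>lborel) + (\<integral>\<^sup>+x\<in>{0..}. ennreal (1 / (1 + x\<^sup>2)) \<partial>lborel)"
    by (intro nn_integral_add) auto
  also have "\<dots> < \<infinity>" unfolding 2 1 by (simp add: ennreal_plus[symmetric] del: ennreal_plus)
  finally show ?thesis .
qed

text \<open>1 + |x|^2 dominates 1 + (x . b)^2 for every basis vector b, so the function lies below a
  product of unnormalised Cauchy densities, whose integral factorises. It is the standard majorant
  for symbols and transforms below.\<close>

lemma integrable_inverse_1_plus_norm_square_power:
  "integrable lborel (\<lambda>x::'a::euclidean_space. 1 / (1 + (norm x)\<^sup>2) ^ DIM('a))"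
proof (rule integrableI_bounded)
  have "(\<integral>\<^sup>+x. ennreal (norm (1 / (1 + (norm x)\<^sup>2) ^ DIM('a))) \<partial>(lborel :: 'a measure))
    \<le> (\<integral>\<^sup>+x. (\<Prod>b\<in>Basis. ennreal (1 / (1 + (x \<bullet> b)\<^sup>2))) \<partial>(lborel :: 'a measure))"
  proof (rule nn_integral_mono)
    fix x :: 'a
    have "1 / (1 + (norm x)\<^sup>2) ^ DIM('a) = prod (\<lambda>b. 1 / (1 + (norm x)\<^sup>2)) (Basis :: 'a set)"
      by (simp add: power_divide)
    also have "\<dots> \<le> (\<Prod>b\<in>Basis. 1 / (1 + (x \<bullet> b)\<^sup>2))"
    proof (rule prod_mono)
      fix b :: 'a assume b: "b \<in> Basis"
      have "(x \<bullet> b)\<^sup>2 \<le> (norm x)\<^sup>2"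
        using Basis_le_norm[OF b, of x] abs_le_square_iff[of "x \<bullet> b" "norm x"] by simp
      then show "0 \<le> 1 / (1 + (norm x)\<^sup>2) \<and> 1 / (1 + (norm x)\<^sup>2) \<le> 1 / (1 + (x \<bullet> b)\<^sup>2)"
        by (auto intro!: frac_le add_pos_nonneg)
    qed
    finally have "ennreal (1 / (1 + (norm x)\<^sup>2) ^ DIM('a)) \<le> ennreal (\<Prod>b\<in>Basis. 1 / (1 + (x \<bullet> b)\<^sup>2))"
      by (rule ennreal_leI)
    also have "\<dots> = (\<Prod>b\<in>Basis. ennreal (1 / (1 + (x \<bullet> b)\<^sup>2)))"
      by (rule prod_ennreal[symmetric]) auto
    finally show "ennreal (norm (1 / (1 + (norm x)\<^sup>2) ^ DIM('a))) \<le> (\<Prod>b\<in>Basis. ennreal (1 / (1 + (x \<bullet> b)\<^sup>2)))"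
      by simp
  qed
  also have "\<dots> = prod (\<lambda>b. (\<integral>\<^sup>+x. ennreal (1 / (1 + x\<^sup>2)) \<partial>lborel)) (Basis :: 'a set)"
    by (rule nn_integral_lborel_prod) auto
  also have "\<dots> < \<infinity>"
    using nn_integral_inverse_1_plus_square by (simp add: ennreal_prod_eq_top less_top[symmetric] power_eq_top_ennreal)
  finally show "(\<integral>\<^sup>+x. ennreal (norm (1 / (1 + (norm x)\<^sup>2) ^ DIM('a))) \<partial>(lborel :: 'a measure)) < \<infinity>" .
qed simp

section \<open>Gaussian and Bernstein multipliers\<close>

text \<open>The Gaussian is the characteristic function of a standard normal variable X, hence an
  average of characters with translation vector sqrt(2u) X p. Each costs one translation factor;
  \<delta> \<le> 1 makes its dependence on X linear, so that E|X| \<le> 1 suffices.\<close>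

lemma weight_norm_gaussian_1d:
  fixes m :: "'a::euclidean_space \<Rightarrow> complex"
  assumes m: "integrable lborel m" and u: "0 \<le> u" and d: "0 \<le> \<delta>" "\<delta> \<le> 1"
  shows "weight_norm \<delta> (\<lambda>\<eta>. of_real (exp (- u * (\<eta> \<bullet> p)\<^sup>2)) * m \<eta>)
     \<le> ennreal ((1 + u) powr (\<delta> / 2) * (1 + 2 * norm p)) * weight_norm \<delta> m"
proof -
  have [measurable]: "m \<in> borel_measurable borel" using m by auto
  define a :: "real \<Rightarrow> 'a \<Rightarrow> complex" where "a x \<eta> = exp (\<i> * of_real (\<eta> \<bullet> ((sqrt (2 * u) * x) *\<^sub>R p)))" for x \<eta>
  have int_a: "(\<integral>x. a x \<eta> \<partial>std_normal_distribution) = of_real (exp (- u * (\<eta> \<bullet> p)\<^sup>2))" for \<eta>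
  proof -
    have "(\<integral>x. a x \<eta> \<partial>std_normal_distribution) = char std_normal_distribution (sqrt (2 * u) * (\<eta> \<bullet> p))"
      unfolding char_def a_def by (simp add: mult_ac)
    also have "\<dots> = of_real (exp (- u * (\<eta> \<bullet> p)\<^sup>2))"
      unfolding char_std_normal_distribution using u by (simp add: power_mult_distrib)
    finally show ?thesis .
  qed
  have pr: "prob_space std_normal_distribution"
    by (rule prob_space_normal_density) simp
  have "weight_norm \<delta> (\<lambda>\<eta>. of_real (exp (- u * (\<eta> \<bullet> p)\<^sup>2)) * m \<eta>)
     \<le> (\<integral>\<^sup>+x. weight_norm \<delta> (\<lambda>\<eta>. a x \<eta> * m \<eta>) \<partial>std_normal_distribution)"
    unfolding int_a[symmetric]
    by (rule weight_norm_average[OF pr _ _ m]) (auto simp: a_def[abs_def] norm_exp_i_times)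
  also have "\<dots> \<le> (\<integral>\<^sup>+x. ennreal ((1 + u) powr (\<delta> / 2)) * weight_norm \<delta> m * ennreal (1 + 3/2 * norm p * \<bar>x\<bar>) \<partial>std_normal_distribution)"
  proof (rule nn_integral_mono)
    fix x :: real
    have "1 + sqrt (2 * u) * \<bar>x\<bar> * norm p \<le> sqrt (1 + u) * (1 + 3/2 * norm p * \<bar>x\<bar>)"
    proof -
      \<comment> \<open>3/2 is a rational bound for sqrt 2; after the average over |X| it is rounded
        up to the 2 of the statement.\<close>
      have "sqrt 2 * sqrt u \<le> 3/2 * sqrt (1 + u)"
        using u by (intro mult_mono real_le_lsqrt) (auto simp: power2_eq_square)
      then have "sqrt (2 * u) * \<bar>x\<bar> * norm p \<le> 3/2 * sqrt (1 + u) * \<bar>x\<bar> * norm p"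
        by (intro mult_right_mono) (auto simp: real_sqrt_mult)
      moreover have "1 \<le> sqrt (1 + u)" using u by simp
      ultimately show ?thesis unfolding distrib_left mult_1_right by (intro add_mono) (auto simp: mult_ac)
    qed
    then have "(1 + sqrt (2 * u) * \<bar>x\<bar> * norm p) powr \<delta> \<le> (sqrt (1 + u) * (1 + 3/2 * norm p * \<bar>x\<bar>)) powr \<delta>"
      using d u by (intro powr_mono2) (auto intro!: add_nonneg_nonneg)
    also have "\<dots> = (1 + u) powr (\<delta> / 2) * (1 + 3/2 * norm p * \<bar>x\<bar>) powr \<delta>"
      using u by (simp add: powr_mult powr_half_sqrt[symmetric] powr_powr)
    also have "\<dots> \<le> (1 + u) powr (\<delta> / 2) * (1 + 3/2 * norm p * \<bar>x\<bar>) powr 1"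
      using d by (intro mult_left_mono powr_mono) auto
    finally have *: "(1 + sqrt (2 * u) * \<bar>x\<bar> * norm p) powr \<delta> \<le> (1 + u) powr (\<delta> / 2) * (1 + 3/2 * norm p * \<bar>x\<bar>)"
      by simp
    have "weight_norm \<delta> (\<lambda>\<eta>. a x \<eta> * m \<eta>) \<le> ennreal ((1 + norm ((sqrt (2 * u) * x) *\<^sub>R p)) powr \<delta>) * weight_norm \<delta> m"
      using weight_norm_translate[of m \<delta> "(sqrt (2 * u) * x) *\<^sub>R p"] d by (simp add: a_def mult.commute)
    also have "\<dots> \<le> ennreal ((1 + u) powr (\<delta> / 2) * (1 + 3/2 * norm p * \<bar>x\<bar>)) * weight_norm \<delta> m"
      using u * by (intro mult_right_mono ennreal_leI) (auto simp: abs_mult)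
    also have "\<dots> = ennreal ((1 + u) powr (\<delta> / 2)) * weight_norm \<delta> m * ennreal (1 + 3/2 * norm p * \<bar>x\<bar>)"
      by (subst ennreal_mult) (auto simp: mult_ac)
    finally show "weight_norm \<delta> (\<lambda>\<eta>. a x \<eta> * m \<eta>) \<le> \<dots>" .
  qed
  also have "\<dots> = ennreal ((1 + u) powr (\<delta> / 2)) * weight_norm \<delta> m * (\<integral>\<^sup>+x. ennreal (1 + 3/2 * norm p * \<bar>x\<bar>) \<partial>std_normal_distribution)"
    by (rule nn_integral_cmult) simp
  also have "(\<integral>\<^sup>+x. ennreal (1 + 3/2 * norm p * \<bar>x\<bar>) \<partial>std_normal_distribution) \<le> ennreal (1 + 2 * norm p)"
  proof -
    interpret prob_space std_normal_distribution by fact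
    have i: "integrable std_normal_distribution (\<lambda>x. \<bar>x\<bar>)"
      using integrable_std_normal_moment_abs[of 1] by (simp add: integrable_real_density)
    have "expectation (\<lambda>x. \<bar>x\<bar>) = sqrt (2 / pi)"
      using integral_std_normal_moment_abs_odd[of 0] by (simp add: integral_real_density)
    also have "\<dots> \<le> 1" using pi_gt3 by simp
    finally have e: "expectation (\<lambda>x. \<bar>x\<bar>) \<le> 1" .
    have "(\<integral>\<^sup>+x. ennreal (1 + 3/2 * norm p * \<bar>x\<bar>) \<partial>std_normal_distribution) = ennreal (expectation (\<lambda>x. 1 + 3/2 * norm p * \<bar>x\<bar>))"
      using i by (intro nn_integral_eq_integral) auto
    also have "expectation (\<lambda>x. 1 + 3/2 * norm p * \<bar>x\<bar>) = 1 + 3/2 * norm p * expectation (\<lambda>x. \<bar>x\<bar>)"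
      using i prob_space by (simp add: )
    also have "\<dots> \<le> 1 + 2 * norm p"
      using mult_mono[OF order_refl e, of "3/2 * norm p"] integral_nonneg_AE[of "\<lambda>x. \<bar>x\<bar>" std_normal_distribution]
        norm_ge_zero[of p] by (simp, linarith)
    finally show ?thesis by (simp add: ennreal_leI)
  qed
  finally have *: "weight_norm \<delta> (\<lambda>\<eta>. of_real (exp (- u * (\<eta> \<bullet> p)\<^sup>2)) * m \<eta>)
     \<le> ennreal ((1 + u) powr (\<delta> / 2)) * weight_norm \<delta> m * ennreal (1 + 2 * norm p)"
    by (simp add: mult_left_mono)
  have "ennreal ((1 + u) powr (\<delta> / 2)) * weight_norm \<delta> m * ennreal (1 + 2 * norm p)
    = ennreal ((1 + u) powr (\<delta> / 2) * (1 + 2 * norm p)) * weight_norm \<delta> m"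
    by (subst ennreal_mult) (auto simp: mult_ac)
  with * show ?thesis by (simp only:)
qed

text \<open>With R' the adjoint, |R \<eta>|^2 is the sum over the basis of (\<eta> . R'b)^2, so the
  Gaussian is a product of \<open>DIM('a)\<close> one-dimensional ones, and |R'b| \<le> c holds for
  each of them.\<close>

lemma weight_norm_gaussian:
  fixes m :: "'a::euclidean_space \<Rightarrow> complex" and R :: "'a \<Rightarrow> 'a"
  assumes m: "integrable lborel m" and u: "0 \<le> u" and d: "0 \<le> \<delta>" "\<delta> \<le> 1" and R: "linear R"
    and le: "\<And>x. norm (R x) \<le> c * norm x" and c: "0 \<le> c"
  shows "weight_norm \<delta> (\<lambda>\<eta>. of_real (exp (- u * (norm (R \<eta>))\<^sup>2)) * m \<eta>)
     \<le> ennreal (((1 + u) powr (\<delta> / 2) * (1 + 2 * c)) ^ DIM('a)) * weight_norm \<delta> m"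
proof -
  define K where "K = (1 + u) powr (\<delta> / 2) * (1 + 2 * c)"
  have K: "0 \<le> K" using c by (simp add: K_def)
  have lin: "linear R" by fact
  have adj: "norm (adjoint R b) \<le> c * norm b" for b
  proof (cases "norm (adjoint R b) = 0")
    case False
    have "norm (adjoint R b) * norm (adjoint R b) = R (adjoint R b) \<bullet> b"
      by (simp add: adjoint_works[OF lin, symmetric] norm_eq_sqrt_inner)
    also have "\<dots> \<le> norm (R (adjoint R b)) * norm b" by (rule norm_cauchy_schwarz)
    also have "\<dots> \<le> c * norm (adjoint R b) * norm b" by (intro mult_right_mono le) auto
    finally show ?thesis using False by (simp add: mult.commute mult.left_commute)
  qed (use c in auto)
  have [measurable]: "m \<in> borel_measurable borel" using m by auto
  have "weight_norm \<delta> (\<lambda>\<eta>. of_real (exp (- u * (\<Sum>b\<in>S. (\<eta> \<bullet> adjoint R b)\<^sup>2))) * m \<eta>) \<le> ennreal (K ^ card S) * weight_norm \<delta> m"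
    if "finite S" "S \<subseteq> Basis" for S :: "'a set"
    using that
  proof (induction S)
    case (insert b S)
    have "weight_norm \<delta> (\<lambda>\<eta>. of_real (exp (- u * (\<Sum>b\<in>insert b S. (\<eta> \<bullet> adjoint R b)\<^sup>2))) * m \<eta>)
      = weight_norm \<delta> (\<lambda>\<eta>. of_real (exp (- u * (\<eta> \<bullet> adjoint R b)\<^sup>2)) * (of_real (exp (- u * (\<Sum>b\<in>S. (\<eta> \<bullet> adjoint R b)\<^sup>2))) * m \<eta>))"
    proof -
      have "exp (- u * (\<Sum>b\<in>insert b S. (\<eta> \<bullet> adjoint R b)\<^sup>2)) = exp (- u * (\<eta> \<bullet> adjoint R b)\<^sup>2) * exp (- u * (\<Sum>b\<in>S. (\<eta> \<bullet> adjoint R b)\<^sup>2))" for \<eta>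
        unfolding exp_add[symmetric] sum.insert[OF insert.hyps] distrib_left ..
      then show ?thesis by (simp only: of_real_mult mult.assoc)
    qed
    also have "\<dots> \<le> ennreal ((1 + u) powr (\<delta> / 2) * (1 + 2 * norm (adjoint R b))) * weight_norm \<delta> (\<lambda>\<eta>. of_real (exp (- u * (\<Sum>b\<in>S. (\<eta> \<bullet> adjoint R b)\<^sup>2))) * m \<eta>)"
    proof (rule weight_norm_gaussian_1d[OF _ u d])
      show "integrable lborel (\<lambda>\<eta>. of_real (exp (- u * (\<Sum>b\<in>S. (\<eta> \<bullet> adjoint R b)\<^sup>2))) * m \<eta>)"
        by (rule Bochner_Integration.integrable_bound[OF m])
          (auto simp: norm_mult sum_nonneg u intro!: mult_left_le_one_le)
    qed
    also have "\<dots> \<le> ennreal K * (ennreal (K ^ card S) * weight_norm \<delta> m)"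
      using insert.prems insert.IH adj[of b] unfolding K_def
      by (intro mult_mono ennreal_leI mult_left_mono) auto
    also have "\<dots> = ennreal (K ^ card (insert b S)) * weight_norm \<delta> m"
      using insert.hyps K by (simp add: ennreal_mult mult.assoc)
    finally show ?case .
  qed simp
  from this[of Basis] show ?thesis
    unfolding K_def by (simp add: adjoint_works[OF lin] norm_eq_sqrt_inner euclidean_inner[of "R _" "R _"] power2_eq_square sum_nonneg)
qed

text \<open>Integrand of the Bernstein representation of a power: the integral of (1 - exp(-l u))
  u^(-1-s) over u > 0 is a constant times l^s.\<close>

definition bernstein_integrand :: "real \<Rightarrow> real \<Rightarrow> real \<Rightarrow> real" where
  "bernstein_integrand s l u = indicator {0<..} u * ((1 - exp (- l * u)) * u powr (-1 - s))"

lemma bernstein_integrand_measurable [measurable]: "bernstein_integrand s l \<in> borel_measurable borel"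
  unfolding bernstein_integrand_def by measurable

lemma bernstein_integrand_nonneg: "0 \<le> l \<Longrightarrow> 0 \<le> bernstein_integrand s l u"
  unfolding bernstein_integrand_def by (auto simp: indicator_def)

text \<open>Two regimes: 1 - exp(-u) \<le> u leaves u^(-s) near 0, and at infinity the power is
  u^(\<beta>-1-s). The condition \<beta> < s is the integrability of that tail.\<close>

lemma integrable_bernstein_weight:
  assumes s: "0 < s" "s < 1" and b: "0 \<le> \<beta>" "\<beta> < s"
  shows "integrable lborel (\<lambda>u. (1 + \<bar>u\<bar>) powr \<beta> * bernstein_integrand s 1 u)"
proof (rule Bochner_Integration.integrable_bound)
  show "integrable lborel (\<lambda>u. 2 * (indicator {0..1} u *\<^sub>R u powr (-s)) + 2 * (indicator {1..} u *\<^sub>R u powr (\<beta> - 1 - s)))"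
    using set_integrable_powr_near_0[of "-s" 1] set_integrable_powr_at_top[of "\<beta> - 1 - s" 1] s b
    unfolding set_integrable_def
    by (intro Bochner_Integration.integrable_add integrable_mult_right) auto
  have "(1 + \<bar>u\<bar>) powr \<beta> * bernstein_integrand s 1 u \<le> 2 * (indicator {0..1} u *\<^sub>R u powr (-s)) + 2 * (indicator {1..} u *\<^sub>R u powr (\<beta> - 1 - s))" for u
  proof (cases "u > 0")
    case u: True
    have e1: "1 - exp (-u) \<le> u" using exp_ge_add_one_self[of "-u"] by simp
    have e2: "1 - exp (-u) \<le> 1" by simp
    have pos: "0 \<le> indicator {0..1} u *\<^sub>R u powr (-s)" "0 \<le> indicator {1..} u *\<^sub>R u powr (\<beta> - 1 - s)" by auto
    show ?thesis
    proof (cases "u \<le> 1")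
      case True
      have "(1 + \<bar>u\<bar>) powr \<beta> \<le> 2 powr 1" using b s u True by (intro powr_mono_both) auto
      then have "(1 + \<bar>u\<bar>) powr \<beta> * ((1 - exp (-u)) * u powr (-1 - s)) \<le> 2 * (u * u powr (-1 - s))"
        using u e1 by (intro mult_mono) auto
      also have "u * u powr (-1 - s) = u powr (-s)"
        using u powr_add[of u 1 "-1-s"] by simp
      finally show ?thesis using True u by (auto simp: bernstein_integrand_def indicator_def)
    next
      case False
      have "(1 + \<bar>u\<bar>) powr \<beta> \<le> (2 * u) powr \<beta>" using b u False by (intro powr_mono2) auto
      also have "\<dots> = 2 powr \<beta> * u powr \<beta>" using u by (simp add: powr_mult)
      also have "\<dots> \<le> 2 powr 1 * u powr \<beta>" using b s by (intro mult_right_mono powr_mono) auto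
      finally have "(1 + \<bar>u\<bar>) powr \<beta> * ((1 - exp (-u)) * u powr (-1 - s)) \<le> (2 * u powr \<beta>) * (1 * u powr (-1 - s))"
        using u e2 by (intro mult_mono) auto
      also have "\<dots> = 2 * u powr (\<beta> - 1 - s)"
        using powr_add[of u \<beta> "-1-s"] by (simp add: algebra_simps)
      finally show ?thesis using False u by (simp add: bernstein_integrand_def)
    qed
  qed (simp add: bernstein_integrand_def)
  then show "AE u in lborel. norm ((1 + \<bar>u\<bar>) powr \<beta> * bernstein_integrand s 1 u)
      \<le> norm (2 * (indicator {0..1} u *\<^sub>R u powr (-s)) + 2 * (indicator {1..} u *\<^sub>R u powr (\<beta> - 1 - s)))"
    using bernstein_integrand_nonneg[of 1 s] by (intro always_eventually) (auto simp: abs_mult)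
qed measurable

text \<open>The value is \<Gamma>(1 - s) / s.\<close>

definition bernstein_const :: "real \<Rightarrow> real" where
  "bernstein_const s = (\<integral>u. bernstein_integrand s 1 u \<partial>lborel)"

lemma integrable_bernstein_1: "0 < s \<Longrightarrow> s < 1 \<Longrightarrow> integrable lborel (bernstein_integrand s 1)"
  using integrable_bernstein_weight[of s 0] by (rule Bochner_Integration.integrable_bound) (auto intro!: always_eventually)

lemma bernstein_integrand_scale:
  assumes "0 < l"
  shows "bernstein_integrand s 1 (0 + l * u) = l powr (-1 - s) * bernstein_integrand s l u"
  using assms by (auto simp: bernstein_integrand_def indicator_def powr_mult zero_less_mult_iff)

text \<open>The substitution u -> l u relates the integrands with parameters l and 1 and produces
  the factor l^s.\<close>

lemma bernstein_integral:
  assumes s: "0 < s" "s < 1" and l: "0 \<le> l"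
  shows "integrable lborel (bernstein_integrand s l)" "(\<integral>u. bernstein_integrand s l u \<partial>lborel) = l powr s * bernstein_const s"
proof -
  have "integrable lborel (bernstein_integrand s l) \<and> (\<integral>u. bernstein_integrand s l u \<partial>lborel) = l powr s * bernstein_const s"
  proof (cases "l = 0")
    case True
    then show ?thesis by (simp add: bernstein_integrand_def[abs_def])
  next
    case False
    with l have l: "0 < l" by simp
    have sc: "bernstein_integrand s l u = l powr (1 + s) * bernstein_integrand s 1 (0 + l * u)" for u
      unfolding bernstein_integrand_scale[OF l] mult.assoc[symmetric] powr_add[symmetric] using l by simp
    have 1: "integrable lborel (bernstein_integrand s l)"
      unfolding sc[abs_def]
      by (intro integrable_mult_right lborel_integrable_real_affine integrable_bernstein_1 s) (use l in auto)
    have "bernstein_const s = l * (\<integral>u. bernstein_integrand s 1 (0 + l * u) \<partial>lborel)"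
      unfolding bernstein_const_def
      by (subst lborel_integral_real_affine[where c=l and t=0]) (use l in auto)
    then have "l powr s * bernstein_const s = (l powr s * l) * (\<integral>u. bernstein_integrand s 1 (0 + l * u) \<partial>lborel)" by simp
    also have "l powr s * l = l powr (1 + s)" using l by (simp add: powr_add)
    also have "\<dots> * (\<integral>u. bernstein_integrand s 1 (0 + l * u) \<partial>lborel) = (\<integral>u. bernstein_integrand s l u \<partial>lborel)"
      unfolding sc by simp
    finally show ?thesis using 1 by simp
  qed
  then show "integrable lborel (bernstein_integrand s l)" "(\<integral>u. bernstein_integrand s l u \<partial>lborel) = l powr s * bernstein_const s" by auto
qed

lemma bernstein_const_pos:
  assumes s: "0 < s" "s < 1"
  shows "0 < bernstein_const s"
proof -
  have "bernstein_const s \<noteq> 0"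
  proof
    assume "bernstein_const s = 0"
    then have "AE u in lborel. bernstein_integrand s 1 u = 0"
      unfolding bernstein_const_def
      using integral_nonneg_eq_0_iff_AE[OF integrable_bernstein_1[OF s]] bernstein_integrand_nonneg by auto
    then have "AE u in lborel. \<not> (0 \<le> u \<and> u \<le> (1::real))"
      using AE_lborel_singleton[of "0::real"] by eventually_elim (auto simp: bernstein_integrand_def)
    then have "{0..1::real} \<in> null_sets lborel"
      by (subst AE_iff_null_sets) auto
    then show False by (simp add: null_sets_def)
  qed
  moreover have "0 \<le> bernstein_const s"
    unfolding bernstein_const_def by (intro integral_nonneg_AE always_eventually) (auto simp: bernstein_integrand_nonneg)
  ultimately show ?thesis by simp
qed

text \<open>The probability measure whose Laplace transform is \<open>(1 + \<lambda>)\<^sup>s - \<lambda>\<^sup>s\<close>.\<close>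

definition bernstein_measure :: "real \<Rightarrow> real measure" where
  "bernstein_measure s = density lborel (\<lambda>u. ennreal (bernstein_integrand s 1 u / bernstein_const s))"

lemma sets_bernstein_measure [measurable_cong, simp]: "sets (bernstein_measure s) = sets borel"
  by (simp add: bernstein_measure_def)

context
  fixes s :: real
  assumes s: "0 < s" "s < 1"
begin

lemma bernstein_density_nonneg: "0 \<le> bernstein_integrand s 1 u / bernstein_const s"
  using bernstein_const_pos[OF s] bernstein_integrand_nonneg[of 1 s u] by simp

lemma prob_space_bernstein_measure: "prob_space (bernstein_measure s)"
proof (rule prob_spaceI)
  have "emeasure (bernstein_measure s) (space (bernstein_measure s)) = (\<integral>\<^sup>+u. ennreal (bernstein_integrand s 1 u / bernstein_const s) \<partial>lborel)"
    unfolding bernstein_measure_def by (simp add: emeasure_density)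
  also have "\<dots> = ennreal (\<integral>u. bernstein_integrand s 1 u / bernstein_const s \<partial>lborel)"
    using bernstein_density_nonneg integrable_bernstein_1[OF s] by (intro nn_integral_eq_integral) auto
  also have "\<dots> = 1"
    using bernstein_const_pos[OF s] by (simp add: bernstein_const_def[symmetric])
  finally show "emeasure (bernstein_measure s) (space (bernstein_measure s)) = 1" .
qed

lemma AE_bernstein_measure_pos: "AE u in bernstein_measure s. 0 < u"
  unfolding bernstein_measure_def by (subst AE_density) (auto simp: bernstein_integrand_def indicator_def)

text \<open>Multiplying 1 - exp(-u) by exp(-l u) gives the difference of the integrands with
  parameters 1 + l and l, and each of these integrates to its power.\<close>

lemma laplace_bernstein_measure:
  assumes l: "0 \<le> l"
  shows "(\<integral>u. exp (- l * u) \<partial>bernstein_measure s) = (1 + l) powr s - l powr s"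
proof -
  have "(\<integral>u. exp (- l * u) \<partial>bernstein_measure s) = (\<integral>u. (bernstein_integrand s 1 u / bernstein_const s) * exp (- l * u) \<partial>lborel)"
    unfolding bernstein_measure_def by (subst integral_real_density) (auto simp: bernstein_density_nonneg)
  also have "\<dots> = (\<integral>u. (bernstein_integrand s (1 + l) u - bernstein_integrand s l u) / bernstein_const s \<partial>lborel)"
  proof (intro Bochner_Integration.integral_cong refl)
    fix u
    have "bernstein_integrand s 1 u * exp (- l * u) = bernstein_integrand s (1 + l) u - bernstein_integrand s l u"
    proof -
      have "exp (- (1 + l) * u) = exp (- 1 * u) * exp (- l * u)"
        by (simp add: exp_add[symmetric] algebra_simps)
      then show ?thesis by (simp add: bernstein_integrand_def indicator_def algebra_simps)
    qed
    then show "(bernstein_integrand s 1 u / bernstein_const s) * exp (- l * u) = (bernstein_integrand s (1 + l) u - bernstein_integrand s l u) / bernstein_const s"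
      by (simp add: field_simps)
  qed
  also have "\<dots> = ((1 + l) powr s * bernstein_const s - l powr s * bernstein_const s) / bernstein_const s"
    using bernstein_integral[OF s, of "1 + l"] bernstein_integral[OF s, of l] l by simp
  also have "\<dots> = (1 + l) powr s - l powr s"
    using bernstein_const_pos[OF s] by (simp add: field_simps)
  finally show ?thesis .
qed

text \<open>A Laplace transform of a probability measure on the half-line lies between 0 and
  1.\<close>

lemma powr_increment_bounds:
  assumes l: "0 \<le> l"
  shows "0 \<le> (1 + l) powr s - l powr s" "(1 + l) powr s - l powr s \<le> 1"
proof -
  interpret prob_space "bernstein_measure s" by (rule prob_space_bernstein_measure)
  show "0 \<le> (1 + l) powr s - l powr s"
    unfolding laplace_bernstein_measure[OF l, symmetric] by simp
  show "(1 + l) powr s - l powr s \<le> 1"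
    unfolding laplace_bernstein_measure[OF l, symmetric]
  proof (rule integral_le_const)
    show ae: "AE x in bernstein_measure s. exp (- l * x) \<le> 1"
      using AE_bernstein_measure_pos by eventually_elim (use l in auto)
    show "integrable (bernstein_measure s) (\<lambda>x. exp (- l * x))"
      by (rule integrable_const_bound[where B=1]) (use ae in auto)
  qed
qed

text \<open>The exponent s/2 lies below s, the critical order of the tail u^(-1-s), so the moment is
  finite.\<close>

definition bernstein_moment :: real where
  "bernstein_moment = (\<integral>u. (1 + \<bar>u\<bar>) powr (s / 2) \<partial>bernstein_measure s)"

lemma nn_integral_bernstein_moment: "(\<integral>\<^sup>+u. ennreal ((1 + \<bar>u\<bar>) powr (s / 2)) \<partial>bernstein_measure s) = ennreal bernstein_moment"
  unfolding bernstein_moment_def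
proof (rule nn_integral_eq_integral)
  have "integrable lborel (\<lambda>u. ((1 + \<bar>u\<bar>) powr (s / 2) * bernstein_integrand s 1 u) / bernstein_const s)"
    using integrable_bernstein_weight[OF s, of "s/2"] s by auto
  then show "integrable (bernstein_measure s) (\<lambda>u. (1 + \<bar>u\<bar>) powr (s / 2))"
    unfolding bernstein_measure_def
    by (subst integrable_real_density) (auto simp: bernstein_density_nonneg mult.commute)
qed simp

lemma bernstein_moment_nonneg: "0 \<le> bernstein_moment"
  unfolding bernstein_moment_def by simp

text \<open>Subordination: the increment is the average of exp(-u |R \<eta>|^2) over
  \<open>bernstein_measure\<close>. With weight exponent s / \<open>DIM('a)\<close> the
  \<open>DIM('a)\<close> Gaussian factors together cost (1 + u)^(s/2), whose average is
  \<open>bernstein_moment\<close>.\<close>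

lemma weight_norm_powr_increment:
  fixes m :: "'a::euclidean_space \<Rightarrow> complex" and R :: "'a \<Rightarrow> 'a"
  assumes m: "integrable lborel m" and R: "linear R"
    and le: "\<And>x. norm (R x) \<le> c * norm x" and c: "0 \<le> c"
  shows "weight_norm (s / DIM('a)) (\<lambda>\<eta>. of_real ((1 + (norm (R \<eta>))\<^sup>2) powr s - ((norm (R \<eta>))\<^sup>2) powr s) * m \<eta>)
     \<le> ennreal ((1 + 2 * c) ^ DIM('a) * bernstein_moment) * weight_norm (s / DIM('a)) m"
proof -
  let ?\<delta> = "s / DIM('a)"
  have d: "0 \<le> ?\<delta>" "?\<delta> \<le> 1"
  proof -
    have "1 \<le> real DIM('a)" using DIM_positive[where 'a='a] by linarith
    then have "s \<le> real DIM('a)" using s by linarith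
    then show "0 \<le> ?\<delta>" "?\<delta> \<le> 1" using s by (auto simp: divide_le_eq)
  qed
  \<comment> \<open>The absolute value changes nothing almost everywhere, as the measure lives on u
    > 0; it makes the multiplier bounded by 1 for every u.\<close>
  define a :: "real \<Rightarrow> 'a \<Rightarrow> complex" where "a u \<eta> = of_real (exp (- \<bar>u\<bar> * (norm (R \<eta>))\<^sup>2))" for u \<eta>
  have [measurable]: "R \<in> borel_measurable borel"
    by (intro borel_measurable_continuous_onI linear_continuous_on linear_conv_bounded_linear[THEN iffD1] R)
  have int_a: "(\<integral>u. a u \<eta> \<partial>bernstein_measure s) = of_real ((1 + (norm (R \<eta>))\<^sup>2) powr s - ((norm (R \<eta>))\<^sup>2) powr s)" for \<eta>
    unfolding laplace_bernstein_measure[OF zero_le_power2, symmetric] a_def integral_complex_of_real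
  proof (intro arg_cong[where f=of_real] integral_cong_AE)
    show "AE u in bernstein_measure s. exp (- \<bar>u\<bar> * (norm (R \<eta>))\<^sup>2) = exp (- (norm (R \<eta>))\<^sup>2 * u)"
      using AE_bernstein_measure_pos by eventually_elim (simp add: mult.commute)
  qed auto
  have "weight_norm ?\<delta> (\<lambda>\<eta>. of_real ((1 + (norm (R \<eta>))\<^sup>2) powr s - ((norm (R \<eta>))\<^sup>2) powr s) * m \<eta>)
      \<le> (\<integral>\<^sup>+u. weight_norm ?\<delta> (\<lambda>\<eta>. a u \<eta> * m \<eta>) \<partial>bernstein_measure s)"
    unfolding int_a[symmetric]
    by (rule weight_norm_average[OF prob_space_bernstein_measure _ _ m]) (auto simp: a_def[abs_def])
  also have "\<dots> \<le> (\<integral>\<^sup>+u. ennreal ((1 + 2 * c) ^ DIM('a)) * weight_norm ?\<delta> m * ennreal ((1 + \<bar>u\<bar>) powr (s / 2)) \<partial>bernstein_measure s)"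
  proof (rule nn_integral_mono)
    fix u :: real
    have "weight_norm ?\<delta> (\<lambda>\<eta>. a u \<eta> * m \<eta>) \<le> ennreal (((1 + \<bar>u\<bar>) powr (?\<delta> / 2) * (1 + 2 * c)) ^ DIM('a)) * weight_norm ?\<delta> m"
      unfolding a_def by (rule weight_norm_gaussian[OF m _ d R le c]) simp
    also have "((1 + \<bar>u\<bar>) powr (?\<delta> / 2) * (1 + 2 * c)) ^ DIM('a) = (1 + 2 * c) ^ DIM('a) * (1 + \<bar>u\<bar>) powr (s / 2)"
      by (simp add: power_mult_distrib powr_power)
    also have "ennreal \<dots> * weight_norm ?\<delta> m = ennreal ((1 + 2 * c) ^ DIM('a)) * weight_norm ?\<delta> m * ennreal ((1 + \<bar>u\<bar>) powr (s / 2))"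
      using c by (subst ennreal_mult) (auto simp: mult_ac)
    finally show "weight_norm ?\<delta> (\<lambda>\<eta>. a u \<eta> * m \<eta>) \<le> \<dots>" .
  qed
  also have "\<dots> = ennreal ((1 + 2 * c) ^ DIM('a)) * weight_norm ?\<delta> m * ennreal bernstein_moment"
    unfolding nn_integral_bernstein_moment[symmetric] by (rule nn_integral_cmult) measurable
  also have "\<dots> = ennreal ((1 + 2 * c) ^ DIM('a) * bernstein_moment) * weight_norm ?\<delta> m"
    using c bernstein_moment_nonneg by (subst ennreal_mult) (auto simp: mult_ac)
  finally show ?thesis .
qed

end

section \<open>Splitting the stable exponent\<close>

lemma prob_space_unit_interval: "prob_space (restrict_space lborel {0..1::real})"
  by (rule prob_space_restrict_space) auto

text \<open>\<open>R \<theta>\<close> stands for Q^(1/2) exp(-t \<theta> B') with B' the transpose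
  of B and \<theta> in [0,1] the rescaled time. The ellipticity constants are parameters, so that
  one bound serves every t.\<close>

definition admissible :: "real \<Rightarrow> real \<Rightarrow> (real \<Rightarrow> 'a::euclidean_space \<Rightarrow> 'a) \<Rightarrow> bool" where
  "admissible c0 c1 R \<longleftrightarrow> continuous_on UNIV (\<lambda>(\<theta>, \<eta>). R \<theta> \<eta>) \<and> (\<forall>\<theta>. linear (R \<theta>)) \<and>
     (\<forall>\<theta> \<eta>. c0 * norm \<eta> \<le> norm (R \<theta> \<eta>) \<and> norm (R \<theta> \<eta>) \<le> c1 * norm \<eta>)"

lemma admissibleD:
  assumes "admissible c0 c1 R"
  shows "continuous_on UNIV (\<lambda>(\<theta>, \<eta>). R \<theta> \<eta>)" "linear (R \<theta>)" "c0 * norm \<eta> \<le> norm (R \<theta> \<eta>)" "norm (R \<theta> \<eta>) \<le> c1 * norm \<eta>"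
  using assms by (auto simp: admissible_def)

text \<open>The 1 under the power removes the singularity at \<eta> = 0: as a polynomial in \<eta>
  the base extends to complex arguments and stays in the right half plane near the real
  space.\<close>

definition smooth_exponent :: "(real \<Rightarrow> 'a::euclidean_space \<Rightarrow> 'a) \<Rightarrow> real \<Rightarrow> 'a \<Rightarrow> real" where
  "smooth_exponent R s \<eta> = 1/2 * (\<integral>\<theta>. (1 + (norm (R \<theta> \<eta>))\<^sup>2) powr s \<partial>restrict_space lborel {0..1})"

definition stable_exponent :: "(real \<Rightarrow> 'a::euclidean_space \<Rightarrow> 'a) \<Rightarrow> real \<Rightarrow> 'a \<Rightarrow> real" where
  "stable_exponent R s \<eta> = 1/2 * (\<integral>\<theta>. ((norm (R \<theta> \<eta>))\<^sup>2) powr s \<partial>restrict_space lborel {0..1})"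

lemma admissible_measurable:
  assumes "admissible c0 c1 R"
  shows "(\<lambda>(\<theta>, \<eta>). R \<theta> \<eta>) \<in> borel_measurable (restrict_space lborel A \<Otimes>\<^sub>M borel)"
proof -
  have 1: "(\<lambda>(\<theta>, \<eta>). R \<theta> \<eta>) \<in> borel_measurable (borel \<Otimes>\<^sub>M borel)"
    unfolding borel_prod by (intro borel_measurable_continuous_onI admissibleD(1)[OF assms])
  have "(\<lambda>p. (fst p, snd p)) \<in> restrict_space lborel A \<Otimes>\<^sub>M borel \<rightarrow>\<^sub>M borel \<Otimes>\<^sub>M borel"
    by (intro measurable_Pair measurable_compose[OF measurable_fst measurable_restrict_space1]) auto
  from measurable_compose[OF this 1] show ?thesis by (simp add: case_prod_beta')
qed

text \<open>For each \<theta> the integrands differ by a power increment, which lies in [0,1]; the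
  prefactor 1/2 gives the last bound.\<close>

lemma smooth_minus_stable_bounds:
  assumes "admissible c0 c1 R" and s: "0 < s" "s < 1"
  shows "integrable (restrict_space lborel {0..1}) (\<lambda>\<theta>. (1 + (norm (R \<theta> \<eta>))\<^sup>2) powr s)"
    "integrable (restrict_space lborel {0..1}) (\<lambda>\<theta>. ((norm (R \<theta> \<eta>))\<^sup>2) powr s)"
    "smooth_exponent R s \<eta> - stable_exponent R s \<eta> = 1/2 * (\<integral>\<theta>. (1 + (norm (R \<theta> \<eta>))\<^sup>2) powr s - ((norm (R \<theta> \<eta>))\<^sup>2) powr s \<partial>restrict_space lborel {0..1})"
    "\<bar>smooth_exponent R s \<eta> - stable_exponent R s \<eta>\<bar> \<le> 1/2"
proof -
  interpret U: prob_space "restrict_space lborel {0..1::real}" by (rule prob_space_unit_interval)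
  note M[measurable] = admissible_measurable[OF assms(1), of "{0..1}"]
  have [measurable]: "(\<lambda>\<theta>. R \<theta> \<eta>) \<in> borel_measurable (restrict_space lborel {0..1})"
    using measurable_compose[OF _ M, of "\<lambda>\<theta>. (\<theta>, \<eta>)"] by simp
  have le: "(norm (R \<theta> \<eta>))\<^sup>2 \<le> (c1 * norm \<eta>)\<^sup>2" for \<theta>
    using admissibleD(4)[OF assms(1)] by (intro power_mono) auto
  show 1: "integrable (restrict_space lborel {0..1}) (\<lambda>\<theta>. (1 + (norm (R \<theta> \<eta>))\<^sup>2) powr s)"
    by (rule U.integrable_const_bound[where B="(1 + (c1 * norm \<eta>)\<^sup>2) powr s"])
      (use s le in \<open>auto intro!: powr_mono2 AE_I2\<close>)
  show 2: "integrable (restrict_space lborel {0..1}) (\<lambda>\<theta>. ((norm (R \<theta> \<eta>))\<^sup>2) powr s)"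
    by (rule U.integrable_const_bound[where B="((c1 * norm \<eta>)\<^sup>2) powr s"])
      (use s le in \<open>auto intro!: powr_mono2 AE_I2\<close>)
  show 3: "smooth_exponent R s \<eta> - stable_exponent R s \<eta> = 1/2 * (\<integral>\<theta>. (1 + (norm (R \<theta> \<eta>))\<^sup>2) powr s - ((norm (R \<theta> \<eta>))\<^sup>2) powr s \<partial>restrict_space lborel {0..1})"
    unfolding smooth_exponent_def stable_exponent_def using 1 2 by (simp add: right_diff_distrib)
  have "\<bar>\<integral>\<theta>. (1 + (norm (R \<theta> \<eta>))\<^sup>2) powr s - ((norm (R \<theta> \<eta>))\<^sup>2) powr s \<partial>restrict_space lborel {0..1}\<bar> \<le> 1"
    unfolding abs_le_iff
  proof
    show "(\<integral>\<theta>. (1 + (norm (R \<theta> \<eta>))\<^sup>2) powr s - ((norm (R \<theta> \<eta>))\<^sup>2) powr s \<partial>restrict_space lborel {0..1}) \<le> 1"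
      by (rule U.integral_le_const) (use 1 2 powr_increment_bounds[OF s] in \<open>auto intro!: AE_I2\<close>)
    have "0 \<le> (\<integral>\<theta>. (1 + (norm (R \<theta> \<eta>))\<^sup>2) powr s - ((norm (R \<theta> \<eta>))\<^sup>2) powr s \<partial>restrict_space lborel {0..1})"
      by (rule integral_nonneg_AE) (use powr_increment_bounds(1)[OF s] in \<open>auto intro!: AE_I2\<close>)
    then show "- (\<integral>\<theta>. (1 + (norm (R \<theta> \<eta>))\<^sup>2) powr s - ((norm (R \<theta> \<eta>))\<^sup>2) powr s \<partial>restrict_space lborel {0..1}) \<le> 1"
      by linarith
  qed
  then show "\<bar>smooth_exponent R s \<eta> - stable_exponent R s \<eta>\<bar> \<le> 1/2"
    unfolding 3 by simp
qed

lemma exponent_measurable: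
  assumes "admissible c0 c1 R"
  shows "smooth_exponent R s \<in> borel_measurable borel" "stable_exponent R s \<in> borel_measurable borel"
proof -
  interpret U: prob_space "restrict_space lborel {0..1::real}" by (rule prob_space_unit_interval)
  note M[measurable] = admissible_measurable[OF assms(1), of "{0..1}"]
  have M'[measurable]: "(\<lambda>(\<eta>, \<theta>). R \<theta> \<eta>) \<in> borel_measurable (borel \<Otimes>\<^sub>M restrict_space lborel {0..1})"
    using measurable_compose[OF measurable_pair_swap' M] by (simp add: case_prod_beta')
  show "smooth_exponent R s \<in> borel_measurable borel" "stable_exponent R s \<in> borel_measurable borel"
    unfolding smooth_exponent_def[abs_def] stable_exponent_def[abs_def] by measurable
qed

text \<open>exp(-stable) = exp(smooth - stable) exp(-smooth). Multiplication by the difference of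
  the exponents is an average over \<theta> of power increments, all with the same multiplier bound
  \<open>?D\<close>, and \<open>weight_norm_exp_mult\<close> exponentiates this.\<close>

theorem weight_norm_stable_le_smooth:
  fixes R :: "real \<Rightarrow> 'a::euclidean_space \<Rightarrow> 'a"
  assumes R: "admissible c0 c1 R" and s: "0 < s" "s < 1" and c1: "0 \<le> c1" and m: "integrable lborel (\<lambda>\<eta>. of_real (exp (- smooth_exponent R s \<eta>)) * m \<eta>)"
  shows "weight_norm (s / DIM('a)) (\<lambda>\<eta>. of_real (exp (- stable_exponent R s \<eta>)) * m \<eta>)
     \<le> ennreal (exp ((1 + 2 * c1) ^ DIM('a) * bernstein_moment s)) * weight_norm (s / DIM('a)) (\<lambda>\<eta>. of_real (exp (- smooth_exponent R s \<eta>)) * m \<eta>)"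
proof -
  let ?\<delta> = "s / DIM('a)" and ?D = "(1 + 2 * c1) ^ DIM('a) * bernstein_moment s"
  let ?\<phi> = "\<lambda>\<eta>. complex_of_real (smooth_exponent R s \<eta> - stable_exponent R s \<eta>)"
  note exponent_measurable[OF R, measurable]
  note M[measurable] = admissible_measurable[OF R, of "{0..1}"]
  have D: "0 \<le> ?D" using c1 bernstein_moment_nonneg[OF s] by simp
  have "weight_norm ?\<delta> (\<lambda>\<eta>. exp (?\<phi> \<eta>) * (of_real (exp (- smooth_exponent R s \<eta>)) * m \<eta>))
      \<le> ennreal (exp ?D) * weight_norm ?\<delta> (\<lambda>\<eta>. of_real (exp (- smooth_exponent R s \<eta>)) * m \<eta>)"
  proof (rule weight_norm_exp_mult[OF m _ _ D])
    show "norm (?\<phi> \<eta>) \<le> 1" for \<eta> using smooth_minus_stable_bounds(4)[OF R s, of \<eta>] unfolding norm_of_real by linarith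
    fix m :: "'a \<Rightarrow> complex" assume m: "integrable lborel m"
    then have [measurable]: "m \<in> borel_measurable borel" by auto
    let ?a = "\<lambda>\<theta> \<eta>. complex_of_real ((1 + (norm (R \<theta> \<eta>))\<^sup>2) powr s - ((norm (R \<theta> \<eta>))\<^sup>2) powr s)"
    have "weight_norm ?\<delta> (\<lambda>\<eta>. (\<integral>\<theta>. ?a \<theta> \<eta> \<partial>restrict_space lborel {0..1}) * m \<eta>) \<le> (\<integral>\<^sup>+\<theta>. weight_norm ?\<delta> (\<lambda>\<eta>. ?a \<theta> \<eta> * m \<eta>) \<partial>restrict_space lborel {0..1})"
    proof (rule weight_norm_average[OF prob_space_unit_interval _ _ m])
      show "norm (?a \<theta> \<eta>) \<le> 1" for \<theta> \<eta> using powr_increment_bounds[OF s, of "(norm (R \<theta> \<eta>))\<^sup>2"] unfolding norm_of_real by simp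
    qed measurable
    also have "\<dots> \<le> (\<integral>\<^sup>+\<theta>. ennreal ?D * weight_norm ?\<delta> m \<partial>restrict_space lborel {0..1::real})"
    proof (rule nn_integral_mono)
      fix \<theta>
      show "weight_norm ?\<delta> (\<lambda>\<eta>. ?a \<theta> \<eta> * m \<eta>) \<le> ennreal ?D * weight_norm ?\<delta> m"
        by (rule weight_norm_powr_increment[OF s m _ _ c1]) (rule admissibleD[OF R])+
    qed
    also have "(\<integral>\<^sup>+\<theta>. ennreal ?D * weight_norm ?\<delta> m \<partial>restrict_space lborel {0..1::real}) = ennreal ?D * weight_norm ?\<delta> m"
      using prob_space.emeasure_space_1[OF prob_space_unit_interval] by simp
    finally have *: "weight_norm ?\<delta> (\<lambda>\<eta>. (\<integral>\<theta>. ?a \<theta> \<eta> \<partial>restrict_space lborel {0..1}) * m \<eta>) \<le> ennreal ?D * weight_norm ?\<delta> m" .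
    have "weight_norm ?\<delta> (\<lambda>\<eta>. ?\<phi> \<eta> * m \<eta>) = weight_norm ?\<delta> (\<lambda>\<eta>. (1/2) * ((\<integral>\<theta>. ?a \<theta> \<eta> \<partial>restrict_space lborel {0..1}) * m \<eta>))"
      unfolding smooth_minus_stable_bounds(3)[OF R s] integral_complex_of_real by simp
    also have "\<dots> = ennreal (1/2) * weight_norm ?\<delta> (\<lambda>\<eta>. (\<integral>\<theta>. ?a \<theta> \<eta> \<partial>restrict_space lborel {0..1}) * m \<eta>)"
    proof -
      interpret U: prob_space "restrict_space lborel {0..1::real}" by (rule prob_space_unit_interval)
      have [measurable]: "(\<lambda>(\<eta>, \<theta>). R \<theta> \<eta>) \<in> borel_measurable (borel \<Otimes>\<^sub>M restrict_space lborel {0..1})"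
        using measurable_compose[OF measurable_pair_swap' M] by (simp add: case_prod_beta')
      have [measurable]: "(\<lambda>\<eta>. \<integral>\<theta>. ?a \<theta> \<eta> \<partial>restrict_space lborel {0..1}) \<in> borel_measurable borel"
        by (rule U.borel_measurable_lebesgue_integral) measurable
      show ?thesis by (subst weight_norm_cmult) (auto simp: ennreal_divide_numeral[symmetric] divide_ennreal_def)
    qed
    also have "\<dots> \<le> 1 * weight_norm ?\<delta> (\<lambda>\<eta>. (\<integral>\<theta>. ?a \<theta> \<eta> \<partial>restrict_space lborel {0..1}) * m \<eta>)"
    proof (rule mult_right_mono)
      show "ennreal (1/2) \<le> 1" by (simp only: ennreal_le_1)
    qed simp
    also note *
    finally show "weight_norm ?\<delta> (\<lambda>\<eta>. ?\<phi> \<eta> * m \<eta>) \<le> ennreal ?D * weight_norm ?\<delta> m" by simp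
  qed measurable
  also have "(\<lambda>\<eta>. exp (?\<phi> \<eta>) * (of_real (exp (- smooth_exponent R s \<eta>)) * m \<eta>)) = (\<lambda>\<eta>. of_real (exp (- stable_exponent R s \<eta>)) * m \<eta>)"
  proof
    fix \<eta>
    have "exp (?\<phi> \<eta>) * of_real (exp (- smooth_exponent R s \<eta>)) = of_real (exp (- stable_exponent R s \<eta>))"
      unfolding exp_of_real of_real_mult[symmetric] exp_add[symmetric] by simp
    then show "exp (?\<phi> \<eta>) * (of_real (exp (- smooth_exponent R s \<eta>)) * m \<eta>) = of_real (exp (- stable_exponent R s \<eta>)) * m \<eta>"
      by (simp only: mult.assoc[symmetric])
  qed
  finally show ?thesis .
qed

section \<open>Decay of the smooth symbol and of its transform by a shift of contour\<close>

lemma powr_exp_decay: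
  fixes c s :: real
  assumes c: "0 < c" and s: "0 < s"
  obtains C where "0 \<le> C" "\<And>r. 0 \<le> r \<Longrightarrow> (r + 1) ^ k * exp (- c * (r\<^sup>2) powr s) \<le> C / (1 + r\<^sup>2) ^ N"
proof
  \<comment> \<open>This gives 2 s M \<ge> k + 2 N, so that exp(-y) \<le> M! / y^M beats both r^k
    and (1 + r^2)^N for r \<ge> 1.\<close>
  define M where "M = nat \<lceil>(real k + 2 * real N) / (2 * s)\<rceil>"
  define C where "C = 2 ^ k * 2 ^ N * (1 + fact M / c ^ M)"
  show "0 \<le> C" using c by (simp add: C_def)
  have M: "real k + 2 * real N \<le> 2 * s * real M"
  proof -
    have "(real k + 2 * real N) / (2 * s) \<le> real M" unfolding M_def by linarith
    then show ?thesis using s by (simp add: field_simps)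
  qed
  fix r :: real assume r: "0 \<le> r"
  have "(r + 1) ^ k * exp (- c * (r\<^sup>2) powr s) * (1 + r\<^sup>2) ^ N \<le> C"
  proof (cases "r \<le> 1")
    case True
    have "(r + 1) ^ k * exp (- c * (r\<^sup>2) powr s) * (1 + r\<^sup>2) ^ N \<le> 2 ^ k * 1 * 2 ^ N"
      using True r c power_le_one[of r 2] by (intro mult_mono power_mono) auto
    also have "\<dots> \<le> 2 ^ k * 2 ^ N * (1 + fact M / c ^ M)" using c by simp
    finally show ?thesis by (simp add: C_def)
  next
    case False
    then have r1: "1 \<le> r" by simp
    define y where "y = c * (r\<^sup>2) powr s"
    have y: "0 < y" using r1 c by (simp add: y_def)
    have "y ^ M / fact M \<le> exp y"
      using sum_le_suminf[OF summable_exp[of y], of "{M}"] y by (simp add: exp_def divide_inverse mult.commute)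
    then have "exp (- y) \<le> fact M / y ^ M"
      using y by (simp add: exp_minus field_simps)
    also have "y ^ M = c ^ M * r powr (2 * s * M)"
    proof -
      have "(r\<^sup>2) powr s = r powr (2 * s)" using r1 by (simp add: powr_powr flip: powr_numeral)
      then show ?thesis using r1 by (simp add: y_def power_mult_distrib powr_power mult.commute)
    qed
    also have "fact M / (c ^ M * r powr (2 * s * M)) \<le> fact M / (c ^ M * r ^ (k + 2 * N))"
    proof -
      have "r ^ (k + 2 * N) \<le> r powr (2 * s * M)"
        using r1 M by (subst powr_realpow[symmetric]) (auto intro!: powr_mono)
      then show ?thesis using c r1 by (intro divide_left_mono mult_left_mono mult_pos_pos) auto
    qed
    finally have e: "exp (- y) \<le> fact M / (c ^ M * r ^ (k + 2 * N))" .
    have r2: "1 \<le> r\<^sup>2" using r1 by (rule one_le_power)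
    have "(r + 1) ^ k * exp (- y) * (1 + r\<^sup>2) ^ N \<le> (2 * r) ^ k * (fact M / (c ^ M * r ^ (k + 2 * N))) * (2 * r\<^sup>2) ^ N"
      using r1 r2 e c by (intro mult_mono power_mono) auto
    also have "\<dots> = 2 ^ k * 2 ^ N * (fact M / c ^ M)"
      using r1 c by (simp add: power_mult_distrib power_add power_mult[symmetric] field_simps)
    also have "\<dots> \<le> C" unfolding C_def by (intro mult_left_mono) auto
    finally show ?thesis by (simp add: y_def)
  qed
  then show "(r + 1) ^ k * exp (- c * (r\<^sup>2) powr s) \<le> C / (1 + r\<^sup>2) ^ N"
    by (subst pos_le_divide_eq) (auto intro!: zero_less_power add_pos_nonneg)
qed

lemma integral_unit_interval_FTC:
  fixes F f :: "real \<Rightarrow> complex"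
  assumes "\<And>x. x \<in> {0..1} \<Longrightarrow> (F has_vector_derivative f x) (at x within {0..1})" "continuous_on {0..1} f"
  shows "has_bochner_integral (restrict_space lborel {0..1}) f (F 1 - F 0)"
proof -
  have "(f has_integral (F 1 - F 0)) {0..1}"
    by (rule fundamental_theorem_of_calculus) (use assms in auto)
  moreover have si: "set_integrable lborel {0..1} f"
    by (rule borel_integrable_atLeastAtMost') (use assms in auto)
  ultimately have "(LINT x:{0..1}|lborel. f x) = F 1 - F 0"
    using set_borel_integral_eq_integral(2)[OF si] by (simp add: integral_unique)
  with si show ?thesis
    by (simp add: has_bochner_integral_iff set_lebesgue_integral_def set_integrable_def integral_restrict_space integrable_restrict_space)
qed

text \<open>A primitive takes the place of Cauchy's theorem: the integral over a segment depends on
  its end points only, so the four sides of a rectangle cancel.\<close>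

lemma holomorphic_segment_integral:
  fixes F f :: "complex \<Rightarrow> complex"
  assumes F: "\<And>x. x \<in> S \<Longrightarrow> (F has_field_derivative f x) (at x within S)" and "continuous_on S f"
    and seg: "\<And>r. r \<in> {0..1} \<Longrightarrow> a + of_real r * d \<in> S"
  shows "has_bochner_integral (restrict_space lborel {0..1}) (\<lambda>r. d * f (a + of_real r * d)) (F (a + d) - F a)"
proof -
  have "has_bochner_integral (restrict_space lborel {0..1}) (\<lambda>r. d * f (a + of_real r * d)) (F (a + of_real 1 * d) - F (a + of_real 0 * d))"
  proof (rule integral_unit_interval_FTC)
    fix x :: real assume x: "x \<in> {0..1}"
    have "((\<lambda>r. a + of_real r * d) has_vector_derivative d) (at x within {0..1})"
      unfolding has_vector_derivative_def
      by (auto intro!: derivative_eq_intros simp: scaleR_conv_of_real)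
    moreover have "(F has_field_derivative f (a + of_real x * d)) (at (a + of_real x * d) within ((\<lambda>r. a + of_real r * d) ` {0..1}))"
      using seg x by (intro has_field_derivative_subset[OF F]) auto
    ultimately show "((\<lambda>r. F (a + of_real r * d)) has_vector_derivative d * f (a + of_real x * d)) (at x within {0..1})"
      using field_vector_diff_chain_within[of "\<lambda>r. a + of_real r * d" d x "{0..1}" F] by (simp add: o_def)
  next
    show "continuous_on {0..1} (\<lambda>r. d * f (a + of_real r * d))"
      using seg by (intro continuous_intros continuous_on_compose2[OF assms(2)]) auto
  qed
  then show ?thesis by simp
qed

text \<open>By translation invariance the inner L^1 norm does not depend on r; this prepares the
  Fubini steps along segments.\<close>

lemma integrable_translate_pair:
  fixes g :: "'a::euclidean_space \<Rightarrow> 'b::{banach,second_countable_topology}"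
  assumes g: "integrable lborel g"
  shows "integrable (restrict_space lborel {0..1::real} \<Otimes>\<^sub>M lborel) (\<lambda>(r, x). g (x + r *\<^sub>R e))"
proof -
  let ?U = "restrict_space lborel {0..1::real}"
  interpret U: prob_space ?U by (rule prob_space_unit_interval)
  interpret P: pair_sigma_finite ?U "lborel :: 'a measure" ..
  have [measurable]: "g \<in> borel_measurable borel" using g by auto
  have mp: "(\<lambda>p. snd p + fst p *\<^sub>R e) \<in> ?U \<Otimes>\<^sub>M lborel \<rightarrow>\<^sub>M borel"
    using measurable_compose[OF measurable_fst measurable_restrict_space1[of "\<lambda>x. x" lborel borel "{0..1::real}"], of "lborel :: 'a measure"]
      measurable_compose[OF measurable_snd[of ?U "lborel :: 'a measure"], of "\<lambda>x. x" borel]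
    by (intro borel_measurable_add borel_measurable_scaleR) auto
  show ?thesis
  proof (rule P.Fubini_integrable)
    have "(\<integral>\<eta>. norm (g (\<eta> + r *\<^sub>R e)) \<partial>lborel) = (\<integral>\<eta>. norm (g \<eta>) \<partial>lborel)" for r
      by (subst integral_translate) auto
    then show "integrable ?U (\<lambda>r. \<integral>\<eta>. norm (case (r, \<eta>) of (r, \<eta>) \<Rightarrow> g (\<eta> + r *\<^sub>R e)) \<partial>lborel)" by simp
    show "AE r in ?U. integrable lborel (\<lambda>\<eta>. case (r, \<eta>) of (r, \<eta>) \<Rightarrow> g (\<eta> + r *\<^sub>R e))"
      using integrable_translate[OF g] by simp
    show "(\<lambda>(r, \<eta>). g (\<eta> + r *\<^sub>R e)) \<in> borel_measurable (?U \<Otimes>\<^sub>M lborel)"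
      using measurable_compose[OF mp, of g borel] by (simp add: case_prod_beta')
  qed
qed

text \<open>The contour shift. Cauchy's theorem is applied on the rectangle with corners \<open>0\<close>, \<open>1\<close>,
  \<open>1 + \<i>\<tau>\<close>, \<open>\<i>\<tau>\<close>; after integration over \<open>\<eta>\<close> the two vertical sides cancel by translation invariance.\<close>

lemma integral_contour_shift:
  fixes h :: "'a::euclidean_space \<Rightarrow> complex \<Rightarrow> complex"
  assumes hol: "\<And>\<eta>. h \<eta> holomorphic_on {\<omega>. \<bar>Im \<omega>\<bar> < \<kappa>}" and \<tau>: "\<bar>\<tau>\<bar> < \<kappa>"
    and shift: "\<And>\<eta> r \<omega>. h (\<eta> + r *\<^sub>R e) \<omega> = h \<eta> (\<omega> + of_real r)"
    and meas: "(\<lambda>(\<eta>, \<sigma>). h \<eta> (\<i> * of_real \<sigma>)) \<in> borel_measurable (borel \<Otimes>\<^sub>M borel)"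
    and bound: "\<And>\<eta> \<sigma>. \<bar>\<sigma>\<bar> \<le> \<bar>\<tau>\<bar> \<Longrightarrow> norm (h \<eta> (\<i> * of_real \<sigma>)) \<le> g \<eta>" and g: "integrable lborel g"
  shows "(\<integral>\<eta>. h \<eta> 0 \<partial>lborel) = (\<integral>\<eta>. h \<eta> (\<i> * of_real \<tau>) \<partial>lborel)"
proof -
  let ?S = "{\<omega>. \<bar>Im \<omega>\<bar> < \<kappa>}" and ?U = "restrict_space lborel {0..1::real}"
  interpret U: prob_space ?U by (rule prob_space_unit_interval)
  interpret P: pair_sigma_finite ?U "lborel :: 'a measure" ..
  have S: "convex ?S" "open ?S"
  proof -
    have eq: "?S = Im -` {-\<kappa><..<\<kappa>}" by (auto simp: abs_less_iff)
    show "open ?S" unfolding eq by (intro open_vimage continuous_intros)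
    show "convex ?S" unfolding eq
      by (intro convex_linear_vimage bounded_linear.linear bounded_linear_Im) auto
  qed
  have [measurable]: "(\<lambda>\<eta>. h \<eta> (\<i> * of_real \<sigma>)) \<in> borel_measurable borel" for \<sigma>
    using measurable_compose[OF _ meas, of "\<lambda>\<eta>. (\<eta>, \<sigma>)"] by simp
  have [measurable]: "g \<in> borel_measurable borel" using g by auto
  have I1: "integrable lborel (\<lambda>\<eta>. h \<eta> (\<i> * of_real \<sigma>))" if "\<bar>\<sigma>\<bar> \<le> \<bar>\<tau>\<bar>" for \<sigma>
    by (rule Bochner_Integration.integrable_bound[OF g])
      (use bound[OF that] in \<open>auto intro!: AE_I2 order.trans[OF _ abs_ge_self]\<close>)
  have le: "\<bar>\<tau> * \<sigma>\<bar> \<le> \<bar>\<tau>\<bar>" if "\<sigma> \<in> {0..1}" for \<sigma>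
    using that by (auto simp: abs_mult intro!: mult_left_le)
  define A where "A \<sigma> = (\<integral>\<eta>. h \<eta> (\<i> * of_real \<sigma>) \<partial>lborel)" for \<sigma>
  have A: "(\<integral>\<eta>. h (\<eta> + r *\<^sub>R e) (\<i> * of_real \<sigma>) \<partial>lborel) = A \<sigma>" for \<sigma> r
    unfolding A_def by (subst integral_translate) auto
  \<comment> \<open>With a primitive F, the difference of the two horizontal sides equals that of
    the two vertical ones. The shift law turns the real part of \<omega> into a translation of
    \<eta>, which is why translates of h appear instead of its values off the imaginary
    axis.\<close>
  have rot: "(\<integral>r. h (\<eta> + r *\<^sub>R e) (\<i> * of_real 0) - h (\<eta> + r *\<^sub>R e) (\<i> * of_real \<tau>) \<partial>?U)
     = (\<integral>\<sigma>. \<i> * of_real \<tau> * h (\<eta> + 0 *\<^sub>R e) (\<i> * of_real (\<tau> * \<sigma>)) - \<i> * of_real \<tau> * h (\<eta> + 1 *\<^sub>R e) (\<i> * of_real (\<tau> * \<sigma>)) \<partial>?U)" (is "?L = ?R") for \<eta>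
  proof -
    obtain F where F: "\<And>x. x \<in> ?S \<Longrightarrow> (F has_field_derivative h \<eta> x) (at x within ?S)"
      using holomorphic_convex_primitive'[OF S hol] by blast
    note seg = holomorphic_segment_integral[OF F holomorphic_on_imp_continuous_on[OF hol]]
    have k: "0 < \<kappa>" using \<tau> by linarith
    have t: "\<bar>r * \<tau>\<bar> < \<kappa>" if "r \<in> {0..1}" for r
      using le[OF that] \<tau> by (simp add: mult.commute)
    have "has_bochner_integral ?U (\<lambda>r. 1 * h \<eta> (0 + of_real r * 1) - 1 * h \<eta> (\<i> * of_real \<tau> + of_real r * 1)) ((F (0 + 1) - F 0) - (F (\<i> * of_real \<tau> + 1) - F (\<i> * of_real \<tau>)))"
      by (intro has_bochner_integral_diff seg) (use k \<tau> in auto)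
    then have L: "?L = (F (0 + 1) - F 0) - (F (\<i> * of_real \<tau> + 1) - F (\<i> * of_real \<tau>))"
      unfolding shift by (simp add: has_bochner_integral_iff)
    have "has_bochner_integral ?U (\<lambda>r. (\<i> * of_real \<tau>) * h \<eta> (0 + of_real r * (\<i> * of_real \<tau>)) - (\<i> * of_real \<tau>) * h \<eta> (1 + of_real r * (\<i> * of_real \<tau>)))
       ((F (0 + \<i> * of_real \<tau>) - F 0) - (F (1 + \<i> * of_real \<tau>) - F 1))"
      by (intro has_bochner_integral_diff seg) (use k t in auto)
    then have R: "?R = (F (0 + \<i> * of_real \<tau>) - F 0) - (F (1 + \<i> * of_real \<tau>) - F 1)"
      unfolding shift by (simp add: has_bochner_integral_iff mult_ac add_ac)
    show ?thesis unfolding L R by (simp add: add_ac)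
  qed
  have mp: "(\<lambda>p. snd p + fst p *\<^sub>R e) \<in> ?U \<Otimes>\<^sub>M lborel \<rightarrow>\<^sub>M borel"
    using measurable_compose[OF measurable_fst measurable_restrict_space1[of "\<lambda>x. x" lborel borel "{0..1::real}"], of "lborel :: 'a measure"]
      measurable_compose[OF measurable_snd[of ?U "lborel :: 'a measure"], of "\<lambda>x. x" borel]
    by (intro borel_measurable_add borel_measurable_scaleR) auto
  note intg = integrable_translate_pair[OF g, of e]
  have int1: "integrable (?U \<Otimes>\<^sub>M lborel) (\<lambda>(r, \<eta>). h (\<eta> + r *\<^sub>R e) (\<i> * of_real \<sigma>))" if "\<bar>\<sigma>\<bar> \<le> \<bar>\<tau>\<bar>" for \<sigma>
  proof (rule Bochner_Integration.integrable_bound[OF intg])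
    show "(\<lambda>(r, \<eta>). h (\<eta> + r *\<^sub>R e) (\<i> * of_real \<sigma>)) \<in> borel_measurable (?U \<Otimes>\<^sub>M lborel)"
      using measurable_compose[OF mp, of "\<lambda>\<eta>. h \<eta> (\<i> * of_real \<sigma>)" borel] by (simp add: case_prod_beta')
  qed (use bound[OF that] in \<open>auto intro!: AE_I2 order.trans[OF _ abs_ge_self]\<close>)
  have int2: "integrable (?U \<Otimes>\<^sub>M lborel) (\<lambda>(\<sigma>, \<eta>). \<i> * of_real \<tau> * h (\<eta> + r *\<^sub>R e) (\<i> * of_real (\<tau> * \<sigma>)))" for r :: real
  proof (rule Bochner_Integration.integrable_bound)
    show "integrable (?U \<Otimes>\<^sub>M lborel) (\<lambda>(\<sigma>, \<eta>). \<bar>\<tau>\<bar> * g (\<eta> + r *\<^sub>R e))"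
    proof (rule P.Fubini_integrable)
      show "AE x in ?U. integrable lborel (\<lambda>\<eta>. case (x, \<eta>) of (\<sigma>, \<eta>) \<Rightarrow> \<bar>\<tau>\<bar> * g (\<eta> + r *\<^sub>R e))"
        using integrable_translate[OF g] by simp
    qed auto
    have m: "(\<lambda>p. (snd p + r *\<^sub>R e, \<tau> * fst p)) \<in> ?U \<Otimes>\<^sub>M lborel \<rightarrow>\<^sub>M borel \<Otimes>\<^sub>M borel"
      using measurable_compose[OF measurable_fst measurable_restrict_space1[of "\<lambda>x. x" lborel borel "{0..1::real}"], of "lborel :: 'a measure"] by measurable
    from measurable_compose[OF m meas]
    show "(\<lambda>(\<sigma>, \<eta>). \<i> * of_real \<tau> * h (\<eta> + r *\<^sub>R e) (\<i> * of_real (\<tau> * \<sigma>))) \<in> borel_measurable (?U \<Otimes>\<^sub>M lborel)"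
      by (auto simp: case_prod_beta' intro!: borel_measurable_times)
    show "AE p in ?U \<Otimes>\<^sub>M lborel. norm (case p of (\<sigma>, \<eta>) \<Rightarrow> \<i> * of_real \<tau> * h (\<eta> + r *\<^sub>R e) (\<i> * of_real (\<tau> * \<sigma>)))
        \<le> norm (case p of (\<sigma>, \<eta>) \<Rightarrow> \<bar>\<tau>\<bar> * g (\<eta> + r *\<^sub>R e))"
    proof (rule AE_I2)
      fix p assume "p \<in> space (?U \<Otimes>\<^sub>M (lborel :: 'a measure))"
      then obtain \<sigma> \<eta> where p: "p = (\<sigma>, \<eta>)" "\<sigma> \<in> {0..1}" by (cases p) (auto simp: space_pair_measure)
      have "norm (h (\<eta> + r *\<^sub>R e) (\<i> * of_real (\<tau> * \<sigma>))) \<le> \<bar>g (\<eta> + r *\<^sub>R e)\<bar>"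
        using bound[OF le[OF p(2)]] by (rule order.trans[OF _ abs_ge_self])
      then show "norm (case p of (\<sigma>, \<eta>) \<Rightarrow> \<i> * of_real \<tau> * h (\<eta> + r *\<^sub>R e) (\<i> * of_real (\<tau> * \<sigma>)))
        \<le> norm (case p of (\<sigma>, \<eta>) \<Rightarrow> \<bar>\<tau>\<bar> * g (\<eta> + r *\<^sub>R e))"
        unfolding p by (simp add: norm_mult abs_mult mult_left_mono)
    qed
  qed
  have "A 0 - A \<tau> = (\<integral>r. (\<integral>\<eta>. h (\<eta> + r *\<^sub>R e) (\<i> * of_real 0) - h (\<eta> + r *\<^sub>R e) (\<i> * of_real \<tau>) \<partial>lborel) \<partial>?U)"
  proof -
    have "(\<integral>\<eta>. h (\<eta> + r *\<^sub>R e) (\<i> * of_real 0) - h (\<eta> + r *\<^sub>R e) (\<i> * of_real \<tau>) \<partial>lborel) = A 0 - A \<tau>" for r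
      unfolding A[symmetric, of _ r]
      by (intro Bochner_Integration.integral_diff integrable_translate I1) auto
    then show ?thesis using U.prob_space by simp
  qed
  also have "\<dots> = (\<integral>\<eta>. (\<integral>r. h (\<eta> + r *\<^sub>R e) (\<i> * of_real 0) - h (\<eta> + r *\<^sub>R e) (\<i> * of_real \<tau>) \<partial>?U) \<partial>lborel)"
    using Bochner_Integration.integrable_diff[OF int1[of 0] int1[of \<tau>]]
    by (intro P.Fubini_integral[symmetric]) (simp add: case_prod_beta')
  also have "\<dots> = (\<integral>\<eta>. (\<integral>\<sigma>. \<i> * of_real \<tau> * h (\<eta> + 0 *\<^sub>R e) (\<i> * of_real (\<tau> * \<sigma>)) - \<i> * of_real \<tau> * h (\<eta> + 1 *\<^sub>R e) (\<i> * of_real (\<tau> * \<sigma>)) \<partial>?U) \<partial>lborel)"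
    unfolding rot ..
  also have "\<dots> = (\<integral>\<sigma>. (\<integral>\<eta>. \<i> * of_real \<tau> * h (\<eta> + 0 *\<^sub>R e) (\<i> * of_real (\<tau> * \<sigma>)) - \<i> * of_real \<tau> * h (\<eta> + 1 *\<^sub>R e) (\<i> * of_real (\<tau> * \<sigma>)) \<partial>lborel) \<partial>?U)"
    using Bochner_Integration.integrable_diff[OF int2[of 0] int2[of 1]]
    by (intro P.Fubini_integral) (simp add: case_prod_beta')
  also have "\<dots> = (\<integral>\<sigma>. 0 \<partial>?U)"
  proof (rule Bochner_Integration.integral_cong[OF refl])
    fix \<sigma> assume "\<sigma> \<in> space ?U"
    then have *: "\<bar>\<tau> * \<sigma>\<bar> \<le> \<bar>\<tau>\<bar>" using le by simp
    have "(\<integral>\<eta>. \<i> * of_real \<tau> * h (\<eta> + 0 *\<^sub>R e) (\<i> * of_real (\<tau> * \<sigma>)) - \<i> * of_real \<tau> * h (\<eta> + 1 *\<^sub>R e) (\<i> * of_real (\<tau> * \<sigma>)) \<partial>lborel)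
       = \<i> * of_real \<tau> * A (\<tau> * \<sigma>) - \<i> * of_real \<tau> * A (\<tau> * \<sigma>)"
      using I1[OF *] integrable_translate[OF I1[OF *]]
      by (subst Bochner_Integration.integral_diff) (auto simp: A[of 1, simplified] A[of 0, simplified] intro!: integrable_mult_right simp del: of_real_mult)
    then show "(\<integral>\<eta>. \<i> * of_real \<tau> * h (\<eta> + 0 *\<^sub>R e) (\<i> * of_real (\<tau> * \<sigma>)) - \<i> * of_real \<tau> * h (\<eta> + 1 *\<^sub>R e) (\<i> * of_real (\<tau> * \<sigma>)) \<partial>lborel) = 0" by simp
  qed
  finally show ?thesis by (simp add: A_def)
qed

text \<open>Symbol of the iterated derivative along the negatives of \<open>vs\<close>: under the
  phase exp(-\<i> \<eta> . z) the factor \<i> (\<eta> . v) belongs to -d/dv. This sign arises when a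
  derivative in x is moved from f to the kernel.\<close>

definition monomial_symbol :: "'a::euclidean_space list \<Rightarrow> 'a \<Rightarrow> complex" where
  "monomial_symbol vs \<eta> = (\<Prod>v\<leftarrow>vs. \<i> * of_real (\<eta> \<bullet> v))"

lemma monomial_symbol_simps [simp]:
  "monomial_symbol [] \<eta> = 1" "monomial_symbol (v # vs) \<eta> = \<i> * of_real (\<eta> \<bullet> v) * monomial_symbol vs \<eta>"
  by (simp_all add: monomial_symbol_def)

lemma monomial_symbol_measurable [measurable]: "monomial_symbol vs \<in> borel_measurable borel"
proof (induction vs)
  case (Cons v vs)
  then have [measurable]: "monomial_symbol vs \<in> borel_measurable borel" .
  show ?case unfolding monomial_symbol_simps[abs_def] by measurable
qed simp

lemma cos_half_pi_pos:
  assumes "0 < s" "s < 1"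
  shows "0 < cos (s * pi / 2)"
proof (rule cos_gt_zero)
  show "s * pi / 2 < pi / 2" using assms by simp
qed (use assms in simp)

text \<open>In the right half plane the argument of w^s is at most s \<pi>/2 in absolute value,
  where the cosine is still positive; moreover |w| \<ge> Re w.\<close>

lemma Re_powr_of_real_ge:
  assumes w: "0 < Re w" and s: "0 < s" "s < 1"
  shows "cos (s * pi / 2) * (Re w) powr s \<le> Re (w powr of_real s)"
proof -
  have w0: "w \<noteq> 0" using w by auto
  have im: "\<bar>Im (Ln w)\<bar> < pi / 2" using Re_Ln_pos_lt[OF w0] w by simp
  have c: "cos (s * pi / 2) \<le> cos (s * Im (Ln w))"
  proof -
    have "\<bar>s * Im (Ln w)\<bar> \<le> s * (pi / 2)" using im s by (simp add: abs_mult)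
    moreover have "s * (pi / 2) \<le> 1 * (pi / 2)" using s by (intro mult_right_mono) auto
    ultimately have "cos (s * pi / 2) \<le> cos \<bar>s * Im (Ln w)\<bar>"
      by (intro cos_monotone_0_pi_le) auto
    then show ?thesis by simp
  qed
  have pos: "0 \<le> cos (s * pi / 2)" using cos_half_pi_pos[OF s] by simp
  have "Re (w powr of_real s) = norm w powr s * cos (s * Im (Ln w))"
    using w0 by (simp add: powr_def exp_eq_polar Re_exp Re_Ln mult.commute)
  moreover have "(Re w) powr s * cos (s * pi / 2) \<le> norm w powr s * cos (s * Im (Ln w))"
    using c pos w s by (intro mult_mono powr_mono2 complex_Re_le_cmod) auto
  ultimately show ?thesis by (simp add: mult.commute)
qed

lemma continuous_on_powr_Re_pos:
  fixes f :: "'a::topological_space \<Rightarrow> complex"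
  assumes "\<And>x. x \<in> A \<Longrightarrow> 0 < Re (f x)" "continuous_on A f"
  shows "continuous_on A (\<lambda>x. f x powr c)"
proof (rule continuous_on_powr_complex)
  show "A \<subseteq> {z. 0 \<le> Re (f z) \<or> Im (f z) \<noteq> 0}" using assms(1) by (auto intro: less_imp_le)
  show "0 < Re c" if "z \<in> A" "f z = 0" for z using assms(1)[OF that(1)] that(2) by simp
qed (use assms in auto)

lemma prod_list_norm_nonneg: "0 \<le> (\<Prod>v\<leftarrow>vs. norm v)"
  by (induction vs) auto

text \<open>The 2 and the + 1 keep both the width and its product with c at most 1/2, including the
  case c = 0.\<close>

definition strip_width :: "real \<Rightarrow> real" where "strip_width c = 1 / (2 * (c + 1))"

context
  fixes R :: "real \<Rightarrow> 'a::euclidean_space \<Rightarrow> 'a" and c0 c1 s :: real and e :: 'a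
  assumes R: "admissible c0 c1 R" and c0: "0 < c0" and c1: "0 \<le> c1" and s: "0 < s" "s < 1" and e: "norm e \<le> 1"
begin

text \<open>Continuation to complex \<omega> of the real polynomial r -> 1 + |R(\<eta> + r e)|^2.
  The bilinear form is extended without conjugation, which keeps it holomorphic.\<close>

definition complex_square :: "real \<Rightarrow> 'a \<Rightarrow> complex \<Rightarrow> complex" where
  "complex_square \<theta> \<eta> \<omega> = 1 + of_real (R \<theta> \<eta> \<bullet> R \<theta> \<eta>) + 2 * \<omega> * of_real (R \<theta> \<eta> \<bullet> R \<theta> e) + \<omega>\<^sup>2 * of_real (R \<theta> e \<bullet> R \<theta> e)"

definition complex_exponent :: "'a \<Rightarrow> complex \<Rightarrow> complex" where
  "complex_exponent \<eta> \<omega> = 1/2 * (\<integral>\<theta>. complex_square \<theta> \<eta> \<omega> powr of_real s \<partial>restrict_space lborel {0..1})"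

lemma strip_width: "0 < strip_width c1" "strip_width c1 \<le> 1/2" "strip_width c1 * c1 \<le> 1/2"
  using c1 by (auto simp: strip_width_def field_simps)

lemma R_linear: "R \<theta> (\<eta> + r *\<^sub>R v) = R \<theta> \<eta> + r *\<^sub>R R \<theta> v"
  using admissibleD(2)[OF R, of \<theta>] by (simp add: linear_add linear_scale)

lemma complex_square_shift: "complex_square \<theta> (\<eta> + r *\<^sub>R e) \<omega> = complex_square \<theta> \<eta> (\<omega> + of_real r)"
  unfolding complex_square_def R_linear
  by (simp add: inner_simps algebra_simps power2_eq_square inner_commute)

text \<open>The real part is 1 + |R(\<eta> + Re \<omega> e)|^2 - (Im \<omega>)^2 |R e|^2. The added
  1 pays for the negative term, and at least half of it is left.\<close>

lemma Re_complex_square: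
  assumes "\<bar>Im \<omega>\<bar> < strip_width c1"
  shows "1/2 + c0\<^sup>2 * (norm (\<eta> + Re \<omega> *\<^sub>R e))\<^sup>2 \<le> Re (complex_square \<theta> \<eta> \<omega>)"
proof -
  have eq: "Re (complex_square \<theta> \<eta> \<omega>) = 1 + (norm (R \<theta> (\<eta> + Re \<omega> *\<^sub>R e)))\<^sup>2 - (Im \<omega> * norm (R \<theta> e))\<^sup>2"
    unfolding complex_square_def R_linear power2_norm_eq_inner power_mult_distrib
    by (simp add: inner_simps power2_eq_square inner_commute algebra_simps)
  have "\<bar>Im \<omega> * norm (R \<theta> e)\<bar> \<le> strip_width c1 * (c1 * 1)"
    using assms admissibleD(4)[OF R, of \<theta> e] mult_left_mono[OF e c1] unfolding abs_mult abs_norm_cancel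
    by (intro mult_mono) auto
  also have "\<dots> \<le> 1/2" using strip_width(3) by simp
  finally have "\<bar>Im \<omega> * norm (R \<theta> e)\<bar>\<^sup>2 \<le> (1/2)\<^sup>2" by (intro power_mono) auto
  then have 1: "(Im \<omega> * norm (R \<theta> e))\<^sup>2 \<le> 1/2" by (simp add: power2_eq_square)
  have "(c0 * norm (\<eta> + Re \<omega> *\<^sub>R e))\<^sup>2 \<le> (norm (R \<theta> (\<eta> + Re \<omega> *\<^sub>R e)))\<^sup>2"
    using admissibleD(3)[OF R] c0 by (intro power_mono) auto
  then show ?thesis unfolding eq using 1 by (simp add: power_mult_distrib)
qed

lemma complex_square_not_nonpos: "\<bar>Im \<omega>\<bar> < strip_width c1 \<Longrightarrow> 0 < Re (complex_square \<theta> \<eta> \<omega>)" "\<bar>Im \<omega>\<bar> < strip_width c1 \<Longrightarrow> complex_square \<theta> \<eta> \<omega> \<notin> \<real>\<^sub>\<le>\<^sub>0"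
proof -
  assume "\<bar>Im \<omega>\<bar> < strip_width c1"
  from Re_complex_square[OF this, of \<eta> \<theta>] show "0 < Re (complex_square \<theta> \<eta> \<omega>)"
    by (smt (verit) mult_nonneg_nonneg zero_le_power2 half_gt_zero_iff)
  then show "complex_square \<theta> \<eta> \<omega> \<notin> \<real>\<^sub>\<le>\<^sub>0" by (auto simp: complex_nonpos_Reals_iff)
qed

lemma R_continuous: "continuous_on UNIV (\<lambda>\<theta>. R \<theta> \<eta>)"
  using continuous_on_compose2[OF admissibleD(1)[OF R], of UNIV "\<lambda>\<theta>. (\<theta>, \<eta>)"] by (simp add: continuous_on_Pair continuous_on_id continuous_on_const)

lemma complex_square_continuous: "continuous_on UNIV (\<lambda>(\<omega>, \<theta>). complex_square \<theta> \<eta> \<omega>)"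
proof -
  have 1: "continuous_on UNIV (\<lambda>p::complex \<times> real. R (snd p) \<eta>)" for \<eta>
    by (rule continuous_on_compose2[OF R_continuous]) (auto intro: continuous_intros)
  show ?thesis unfolding complex_square_def case_prod_beta'
    by (intro continuous_intros 1)
qed

lemma has_bochner_integral_complex_square:
  assumes "\<bar>Im \<omega>\<bar> < strip_width c1"
  shows "integrable (restrict_space lborel {0..1}) (\<lambda>\<theta>. complex_square \<theta> \<eta> \<omega> powr of_real s)"
    "(\<integral>\<theta>. complex_square \<theta> \<eta> \<omega> powr of_real s \<partial>restrict_space lborel {0..1}) = integral (cbox 0 1) (\<lambda>\<theta>. complex_square \<theta> \<eta> \<omega> powr of_real s)"
    "(\<lambda>\<theta>. complex_square \<theta> \<eta> \<omega> powr of_real s) integrable_on cbox 0 1"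
proof -
  have "continuous_on {0..1} (\<lambda>\<theta>. complex_square \<theta> \<eta> \<omega>)"
    unfolding complex_square_def by (intro continuous_intros continuous_on_subset[OF R_continuous] subset_UNIV)
  then have "continuous_on {0..1} (\<lambda>\<theta>. complex_square \<theta> \<eta> \<omega> powr of_real s)"
    by (intro continuous_on_powr_Re_pos complex_square_not_nonpos(1)[OF assms])
  then have si: "set_integrable lborel {0..1} (\<lambda>\<theta>. complex_square \<theta> \<eta> \<omega> powr of_real s)"
    by (rule borel_integrable_atLeastAtMost')
  then show "integrable (restrict_space lborel {0..1}) (\<lambda>\<theta>. complex_square \<theta> \<eta> \<omega> powr of_real s)"
    by (simp add: set_integrable_def integrable_restrict_space)
  show "(\<integral>\<theta>. complex_square \<theta> \<eta> \<omega> powr of_real s \<partial>restrict_space lborel {0..1}) = integral (cbox 0 1) (\<lambda>\<theta>. complex_square \<theta> \<eta> \<omega> powr of_real s)"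
    using set_borel_integral_eq_integral(2)[OF si] by (simp add: set_lebesgue_integral_def integral_restrict_space)
  show "(\<lambda>\<theta>. complex_square \<theta> \<eta> \<omega> powr of_real s) integrable_on cbox 0 1"
    using set_borel_integral_eq_integral(1)[OF si] by simp
qed

text \<open>Leibniz rule in \<theta>: on the strip \<open>complex_square\<close> stays in the right
  half plane, where the power is holomorphic and its derivative jointly continuous.\<close>

lemma complex_exponent_holomorphic: "complex_exponent \<eta> holomorphic_on {\<omega>. \<bar>Im \<omega>\<bar> < strip_width c1}"
proof -
  let ?S = "{\<omega>. \<bar>Im \<omega>\<bar> < strip_width c1}"
  let ?D = "\<lambda>\<theta> \<omega>. 2 * of_real (R \<theta> \<eta> \<bullet> R \<theta> e) + 2 * \<omega> * of_real (R \<theta> e \<bullet> R \<theta> e)"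
  have eq: "?S = Im -` {-strip_width c1<..<strip_width c1}" by (auto simp: abs_less_iff)
  have cS: "convex ?S" unfolding eq by (intro convex_linear_vimage bounded_linear.linear bounded_linear_Im) auto
  have "(\<lambda>\<omega>. integral (cbox 0 1) (\<lambda>\<theta>. complex_square \<theta> \<eta> \<omega> powr of_real s)) holomorphic_on ?S"
  proof (rule leibniz_rule_holomorphic[where fx = "\<lambda>\<omega> \<theta>. of_real s * complex_square \<theta> \<eta> \<omega> powr (of_real s - 1) * ?D \<theta> \<omega>"])
    fix \<omega> and \<theta> :: real assume \<omega>: "\<omega> \<in> ?S"
    have "((\<lambda>\<omega>. complex_square \<theta> \<eta> \<omega>) has_field_derivative ?D \<theta> \<omega>) (at \<omega> within ?S)"
      unfolding complex_square_def by (auto intro!: derivative_eq_intros)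
    then show "((\<lambda>\<omega>. complex_square \<theta> \<eta> \<omega> powr of_real s) has_field_derivative of_real s * complex_square \<theta> \<eta> \<omega> powr (of_real s - 1) * ?D \<theta> \<omega>) (at \<omega> within ?S)"
      using complex_square_not_nonpos(2)[of \<omega> \<theta> \<eta>] \<omega> by (auto intro!: derivative_eq_intros)
  next
    show "(\<lambda>\<theta>. complex_square \<theta> \<eta> \<omega> powr of_real s) integrable_on cbox 0 1" if "\<omega> \<in> ?S" for \<omega>
      using has_bochner_integral_complex_square(3) that by simp
    have 1: "continuous_on (?S \<times> cbox 0 1) (\<lambda>p::complex \<times> real. R (snd p) \<eta>)" for \<eta>
      by (rule continuous_on_compose2[OF R_continuous]) (auto intro: continuous_intros)
    show "continuous_on (?S \<times> cbox 0 1) (\<lambda>(\<omega>, \<theta>). of_real s * complex_square \<theta> \<eta> \<omega> powr (of_real s - 1) * ?D \<theta> \<omega>)"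
      unfolding case_prod_beta'
      by (intro continuous_on_mult continuous_on_add continuous_on_const continuous_on_of_real continuous_on_inner 1 continuous_on_fst continuous_on_id
          continuous_on_powr_Re_pos continuous_on_subset[OF complex_square_continuous[unfolded case_prod_beta']] subset_UNIV)
        (auto intro!: complex_square_not_nonpos(1))
  qed (rule cS)
  then have "(\<lambda>\<omega>. 1/2 * integral (cbox 0 1) (\<lambda>\<theta>. complex_square \<theta> \<eta> \<omega> powr of_real s)) holomorphic_on ?S"
    by (intro holomorphic_intros)
  then show ?thesis
    by (rule holomorphic_transform) (use has_bochner_integral_complex_square(2) in \<open>auto simp: complex_exponent_def\<close>)
qed

lemma complex_exponent_0: "complex_exponent \<eta> 0 = of_real (smooth_exponent R s \<eta>)"
proof -
  have "complex_square \<theta> \<eta> 0 powr of_real s = of_real ((1 + (norm (R \<theta> \<eta>))\<^sup>2) powr s)" for \<theta>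
  proof -
    have "complex_square \<theta> \<eta> 0 = of_real (1 + (norm (R \<theta> \<eta>))\<^sup>2)" by (simp add: complex_square_def power2_norm_eq_inner)
    then show ?thesis by (simp only:) (rule powr_of_real; simp)
  qed
  then show ?thesis unfolding complex_exponent_def smooth_exponent_def by simp
qed

text \<open>Uniform in the shift \<sigma>: the real part of the square dominates c0^2 |\<eta>|^2,
  and the complex power loses only the factor cos(s \<pi>/2).\<close>

lemma Re_complex_exponent:
  assumes "\<bar>\<sigma>\<bar> < strip_width c1"
  shows "cos (s * pi / 2) * (c0\<^sup>2) powr s / 2 * ((norm \<eta>)\<^sup>2) powr s \<le> Re (complex_exponent \<eta> (\<i> * of_real \<sigma>))"
proof -
  interpret U: prob_space "restrict_space lborel {0..1::real}" by (rule prob_space_unit_interval)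
  have \<omega>: "\<bar>Im (\<i> * of_real \<sigma>)\<bar> < strip_width c1" using assms by simp
  note int = has_bochner_integral_complex_square(1)[OF \<omega>, of \<eta>]
  have pos: "0 \<le> cos (s * pi / 2)" using cos_half_pi_pos[OF s] by simp
  have "cos (s * pi / 2) * ((c0\<^sup>2) powr s * ((norm \<eta>)\<^sup>2) powr s) \<le> (\<integral>\<theta>. Re (complex_square \<theta> \<eta> (\<i> * of_real \<sigma>) powr of_real s) \<partial>restrict_space lborel {0..1})"
  proof (rule U.integral_ge_const)
    show "integrable (restrict_space lborel {0..1}) (\<lambda>\<theta>. Re (complex_square \<theta> \<eta> (\<i> * of_real \<sigma>) powr of_real s))"
      using int by simp
    show "AE \<theta> in restrict_space lborel {0..1}. cos (s * pi / 2) * ((c0\<^sup>2) powr s * ((norm \<eta>)\<^sup>2) powr s) \<le> Re (complex_square \<theta> \<eta> (\<i> * of_real \<sigma>) powr of_real s)"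
    proof (rule AE_I2)
      fix \<theta>
      have le: "c0\<^sup>2 * (norm \<eta>)\<^sup>2 \<le> Re (complex_square \<theta> \<eta> (\<i> * of_real \<sigma>))"
        using Re_complex_square[OF \<omega>, of \<eta> \<theta>] by simp
      have "cos (s * pi / 2) * (c0\<^sup>2 * (norm \<eta>)\<^sup>2) powr s \<le> cos (s * pi / 2) * Re (complex_square \<theta> \<eta> (\<i> * of_real \<sigma>)) powr s"
        using le pos s by (intro mult_left_mono powr_mono2) auto
      also have "\<dots> \<le> Re (complex_square \<theta> \<eta> (\<i> * of_real \<sigma>) powr of_real s)"
        by (rule Re_powr_of_real_ge[OF complex_square_not_nonpos(1)[OF \<omega>] s])
      finally show "cos (s * pi / 2) * ((c0\<^sup>2) powr s * ((norm \<eta>)\<^sup>2) powr s) \<le> Re (complex_square \<theta> \<eta> (\<i> * of_real \<sigma>) powr of_real s)"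
        by (simp add: powr_mult)
    qed
  qed
  also have "\<dots> = Re (\<integral>\<theta>. complex_square \<theta> \<eta> (\<i> * of_real \<sigma>) powr of_real s \<partial>restrict_space lborel {0..1})"
    using int by simp
  finally show ?thesis unfolding complex_exponent_def by (simp add: field_simps)
qed

definition complex_monomial :: "'a list \<Rightarrow> 'a \<Rightarrow> complex \<Rightarrow> complex" where
  "complex_monomial vs \<eta> \<omega> = (\<Prod>v\<leftarrow>vs. \<i> * (of_real (\<eta> \<bullet> v) + \<omega> * of_real (e \<bullet> v)))"

lemma complex_monomial_simps [simp]:
  "complex_monomial [] \<eta> \<omega> = 1"
  "complex_monomial (v # vs) \<eta> \<omega> = \<i> * (of_real (\<eta> \<bullet> v) + \<omega> * of_real (e \<bullet> v)) * complex_monomial vs \<eta> \<omega>"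
  by (simp_all add: complex_monomial_def)

lemma complex_monomial_shift: "complex_monomial vs (\<eta> + r *\<^sub>R e) \<omega> = complex_monomial vs \<eta> (\<omega> + of_real r)"
  by (induction vs) (auto simp: inner_simps algebra_simps)

lemma complex_monomial_holomorphic: "complex_monomial vs \<eta> holomorphic_on S"
proof (induction vs)
  case (Cons v vs)
  then show ?case unfolding complex_monomial_simps[abs_def] by (intro holomorphic_intros)
qed simp

lemma complex_monomial_0: "complex_monomial vs \<eta> 0 = monomial_symbol vs \<eta>"
  by (induction vs) auto

lemma norm_complex_monomial:
  assumes "\<bar>\<sigma>\<bar> \<le> 1"
  shows "norm (complex_monomial vs \<eta> (\<i> * of_real \<sigma>)) \<le> (\<Prod>v\<leftarrow>vs. norm v) * (norm \<eta> + 1) ^ length vs"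
proof (induction vs)
  case (Cons v vs)
  have "norm (of_real (\<eta> \<bullet> v) + \<i> * of_real \<sigma> * of_real (e \<bullet> v) :: complex) \<le> \<bar>\<eta> \<bullet> v\<bar> + \<bar>\<sigma>\<bar> * \<bar>e \<bullet> v\<bar>"
    by (rule order.trans[OF norm_triangle_ineq]) (simp add: norm_mult)
  also have "\<dots> \<le> norm \<eta> * norm v + 1 * (1 * norm v)"
  proof (intro add_mono mult_mono assms)
    show "\<bar>e \<bullet> v\<bar> \<le> 1 * norm v" using Cauchy_Schwarz_ineq2[of e v] e mult_right_mono[OF e norm_ge_zero[of v]] by linarith
  qed (auto simp: Cauchy_Schwarz_ineq2)
  also have "\<dots> = norm v * (norm \<eta> + 1)" by (simp add: algebra_simps)
  finally have "norm (of_real (\<eta> \<bullet> v) + \<i> * of_real \<sigma> * of_real (e \<bullet> v) :: complex) * norm (complex_monomial vs \<eta> (\<i> * of_real \<sigma>))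
     \<le> (norm v * (norm \<eta> + 1)) * ((\<Prod>v\<leftarrow>vs. norm v) * (norm \<eta> + 1) ^ length vs)"
    using Cons.IH by (intro mult_mono) auto
  then show ?case by (simp add: norm_mult mult_ac)
qed simp

text \<open>The Fourier integrand at \<eta> + \<omega> e. For \<omega> = \<i> \<sigma> its phase has
  modulus exp(\<sigma> (e . z)), the source of the decay in z.\<close>

definition complex_symbol :: "'a list \<Rightarrow> 'a \<Rightarrow> 'a \<Rightarrow> complex \<Rightarrow> complex" where
  "complex_symbol vs z \<eta> \<omega> = exp (- complex_exponent \<eta> \<omega>) * complex_monomial vs \<eta> \<omega> * exp (- \<i> * (of_real (\<eta> \<bullet> z) + \<omega> * of_real (e \<bullet> z)))"

lemma complex_symbol_holomorphic: "complex_symbol vs z \<eta> holomorphic_on {\<omega>. \<bar>Im \<omega>\<bar> < strip_width c1}"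
  unfolding complex_symbol_def[abs_def]
  by (intro holomorphic_intros complex_exponent_holomorphic complex_monomial_holomorphic)

lemma complex_symbol_shift: "complex_symbol vs z (\<eta> + r *\<^sub>R e) \<omega> = complex_symbol vs z \<eta> (\<omega> + of_real r)"
  unfolding complex_symbol_def complex_exponent_def complex_square_shift complex_monomial_shift
  by (simp add: inner_simps algebra_simps)

lemma complex_symbol_measurable: "(\<lambda>(\<eta>, \<sigma>). complex_symbol vs z \<eta> (\<i> * of_real \<sigma>)) \<in> borel_measurable (borel \<Otimes>\<^sub>M borel)"
proof -
  let ?U = "restrict_space lborel {0..1::real}"
  interpret U: prob_space ?U by (rule prob_space_unit_interval)
  have M: "(\<lambda>(\<theta>, \<eta>). R \<theta> \<eta>) \<in> borel_measurable (?U \<Otimes>\<^sub>M borel)" by (rule admissible_measurable[OF R])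
  have [measurable]: "(\<lambda>p. R (snd p) (fst (fst p))) \<in> borel_measurable ((borel \<Otimes>\<^sub>M (borel :: real measure)) \<Otimes>\<^sub>M ?U)"
    using measurable_compose[OF _ M, of "\<lambda>p. (snd p, fst (fst p))" "(borel \<Otimes>\<^sub>M (borel :: real measure)) \<Otimes>\<^sub>M ?U"] by simp
  have [measurable]: "(\<lambda>p. R (snd p) e) \<in> borel_measurable ((borel \<Otimes>\<^sub>M (borel :: real measure)) \<Otimes>\<^sub>M ?U)" for e
    using measurable_compose[OF _ M, of "\<lambda>p. (snd p, e)" "(borel \<Otimes>\<^sub>M (borel :: real measure)) \<Otimes>\<^sub>M ?U"] by simp
  have [measurable]: "(\<lambda>p. complex_exponent (fst p) (\<i> * of_real (snd p))) \<in> borel_measurable (borel \<Otimes>\<^sub>M borel)"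
    unfolding complex_exponent_def complex_square_def
    by (intro borel_measurable_times borel_measurable_const U.borel_measurable_lebesgue_integral) (simp add: case_prod_beta')
  have [measurable]: "(\<lambda>p. complex_monomial vs (fst p) (\<i> * of_real (snd p))) \<in> borel_measurable (borel \<Otimes>\<^sub>M borel)"
  proof (induction vs)
    case (Cons v vs)
    then have [measurable]: "(\<lambda>p. complex_monomial vs (fst p) (\<i> * of_real (snd p))) \<in> borel_measurable (borel \<Otimes>\<^sub>M borel)" .
    show ?case unfolding complex_monomial_simps by measurable
  qed simp
  show ?thesis unfolding complex_symbol_def case_prod_beta' by measurable
qed

lemma norm_complex_symbol:
  assumes "\<bar>\<sigma>\<bar> < strip_width c1"
  shows "norm (complex_symbol vs z \<eta> (\<i> * of_real \<sigma>)) \<le>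
    (\<Prod>v\<leftarrow>vs. norm v) * exp (\<sigma> * (e \<bullet> z)) * ((norm \<eta> + 1) ^ length vs * exp (- (cos (s * pi / 2) * (c0\<^sup>2) powr s / 2) * ((norm \<eta>)\<^sup>2) powr s))"
proof -
  have "norm (exp (- complex_exponent \<eta> (\<i> * of_real \<sigma>))) \<le> exp (- (cos (s * pi / 2) * (c0\<^sup>2) powr s / 2) * ((norm \<eta>)\<^sup>2) powr s)"
    using Re_complex_exponent[OF assms, of \<eta>] by simp
  moreover have "norm (complex_monomial vs \<eta> (\<i> * of_real \<sigma>)) \<le> (\<Prod>v\<leftarrow>vs. norm v) * (norm \<eta> + 1) ^ length vs"
    using norm_complex_monomial[of \<sigma>] assms strip_width(2) by simp
  moreover have "norm (exp (- \<i> * (of_real (\<eta> \<bullet> z) + \<i> * of_real \<sigma> * of_real (e \<bullet> z)))) = exp (\<sigma> * (e \<bullet> z))"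
    by simp
  ultimately have "norm (complex_symbol vs z \<eta> (\<i> * of_real \<sigma>)) \<le>
     exp (- (cos (s * pi / 2) * (c0\<^sup>2) powr s / 2) * ((norm \<eta>)\<^sup>2) powr s) * ((\<Prod>v\<leftarrow>vs. norm v) * (norm \<eta> + 1) ^ length vs) * exp (\<sigma> * (e \<bullet> z))"
    unfolding complex_symbol_def norm_mult
    by (intro mult_mono mult_nonneg_nonneg) (auto intro!: mult_nonneg_nonneg prod_list_norm_nonneg simp del: norm_exp_eq_Re)
  then show ?thesis by (simp add: mult_ac)
qed

end

definition smooth_symbol :: "(real \<Rightarrow> 'a::euclidean_space \<Rightarrow> 'a) \<Rightarrow> real \<Rightarrow> 'a list \<Rightarrow> 'a \<Rightarrow> complex" where
  "smooth_symbol R s vs \<eta> = of_real (exp (- smooth_exponent R s \<eta>)) * monomial_symbol vs \<eta>"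

definition stable_symbol :: "(real \<Rightarrow> 'a::euclidean_space \<Rightarrow> 'a) \<Rightarrow> real \<Rightarrow> 'a list \<Rightarrow> 'a \<Rightarrow> complex" where
  "stable_symbol R s vs \<eta> = of_real (exp (- stable_exponent R s \<eta>)) * monomial_symbol vs \<eta>"

lemma symbol_measurable:
  assumes "admissible c0 c1 R"
  shows "smooth_symbol R s vs \<in> borel_measurable borel" "stable_symbol R s vs \<in> borel_measurable borel"
  unfolding smooth_symbol_def[abs_def] stable_symbol_def[abs_def]
  using exponent_measurable[OF assms, measurable] by measurable

text \<open>A shift by -\<i> \<kappa> along the direction of z turns the phase into exp(-\<kappa>
  |z|), while the exponent keeps enough real part to integrate the symbol. The constant is chosen
  before R, which makes the later kernel bounds uniform in time.\<close>

lemma smooth_symbol_bounds: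
  fixes c0 c1 s :: real
  assumes c: "0 < c0" "0 \<le> c1" and s: "0 < s" "s < 1"
  obtains C where "0 \<le> C"
    "\<And>(R :: real \<Rightarrow> 'a::euclidean_space \<Rightarrow> 'a) vs \<eta>. admissible c0 c1 R \<Longrightarrow> length vs = k \<Longrightarrow>
      norm (smooth_symbol R s vs \<eta>) \<le> (\<Prod>v\<leftarrow>vs. norm v) * C / (1 + (norm \<eta>)\<^sup>2) ^ DIM('a)"
    "\<And>(R :: real \<Rightarrow> 'a \<Rightarrow> 'a) vs. admissible c0 c1 R \<Longrightarrow> length vs = k \<Longrightarrow>
      weight_norm (s / DIM('a)) (smooth_symbol R s vs) \<le> ennreal ((\<Prod>v\<leftarrow>vs. norm v) * C)"
proof -
  let ?c = "cos (s * pi / 2) * (c0\<^sup>2) powr s / 2" and ?N = "DIM('a)"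
  \<comment> \<open>Half the width keeps the closed range of shifts inside the open strip.\<close>
  define \<kappa> where "\<kappa> = strip_width c1 / 2"
  have \<kappa>: "0 < \<kappa>" "\<kappa> < strip_width c1"   proof -
    have "0 < strip_width c1" using c by (simp add: strip_width_def)
    then show "0 < \<kappa>" "\<kappa> < strip_width c1" by (simp_all add: \<kappa>_def)
  qed
  have "0 < ?c" using c cos_half_pi_pos[OF s] by simp
  from powr_exp_decay[OF this s(1), of k ?N] obtain C where C: "0 \<le> C"
    "\<And>r. 0 \<le> r \<Longrightarrow> (r + 1) ^ k * exp (- ?c * (r\<^sup>2) powr s) \<le> C / (1 + r\<^sup>2) ^ ?N" by blast
  have half: "(0::real) < 1/2" by simp
  \<comment> \<open>With exponent 1/2 the power of r^2 is r itself: (1 + |z|) exp(-\<kappa> |z|)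
    gets an integrable majorant, and 1 + |z| dominates the weight.\<close>
  from powr_exp_decay[OF \<kappa>(1) half, of 1 ?N] obtain C' where C': "0 \<le> C'"
    "\<And>r. 0 \<le> r \<Longrightarrow> (r + 1) ^ 1 * exp (- \<kappa> * (r\<^sup>2) powr (1/2)) \<le> C' / (1 + r\<^sup>2) ^ ?N" by blast
  define I where "I = (\<integral>x. 1 / (1 + (norm x)\<^sup>2) ^ ?N \<partial>(lborel :: 'a measure))"
  have I: "0 \<le> I" unfolding I_def by simp
  note int = integrable_inverse_1_plus_norm_square_power[where 'a='a]
  have sym: "norm (complex_symbol R s e vs z \<eta> (\<i> * of_real \<sigma>)) \<le> (\<Prod>v\<leftarrow>vs. norm v) * exp (\<sigma> * (e \<bullet> z)) * (C * (1 / (1 + (norm \<eta>)\<^sup>2) ^ ?N))"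
    if R: "admissible c0 c1 R" and vs: "length vs = k" and e: "norm e \<le> 1" and \<sigma>: "\<bar>\<sigma>\<bar> < strip_width c1"
    for R :: "real \<Rightarrow> 'a \<Rightarrow> 'a" and e vs z \<eta> \<sigma>
  proof -
    have "norm (complex_symbol R s e vs z \<eta> (\<i> * of_real \<sigma>)) \<le> (\<Prod>v\<leftarrow>vs. norm v) * exp (\<sigma> * (e \<bullet> z)) * ((norm \<eta> + 1) ^ k * exp (- ?c * ((norm \<eta>)\<^sup>2) powr s))"
      using norm_complex_symbol[OF R c s e \<sigma>, of vs z \<eta>] vs by simp
    also have "\<dots> \<le> (\<Prod>v\<leftarrow>vs. norm v) * exp (\<sigma> * (e \<bullet> z)) * (C * (1 / (1 + (norm \<eta>)\<^sup>2) ^ ?N))"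
      using C(2)[of "norm \<eta>"] by (intro mult_left_mono mult_nonneg_nonneg prod_list_norm_nonneg) auto
    finally show ?thesis .
  qed
  have sym0: "complex_symbol R s e vs z \<eta> 0 = smooth_symbol R s vs \<eta> * exp (- \<i> * of_real (\<eta> \<bullet> z))"
    if R: "admissible c0 c1 R" and e: "norm e \<le> 1" for R :: "real \<Rightarrow> 'a \<Rightarrow> 'a" and e vs z \<eta>
    unfolding complex_symbol_def[OF R c s e] smooth_symbol_def complex_monomial_0[OF R c s e] complex_exponent_0[OF R c s e]
    by (simp add: exp_of_real flip: of_real_minus)
  have four: "norm (fourier (smooth_symbol R s vs) z) \<le> (\<Prod>v\<leftarrow>vs. norm v) * exp (- \<kappa> * norm z) * (C * I)"
    if R: "admissible c0 c1 R" and vs: "length vs = k" for R :: "real \<Rightarrow> 'a \<Rightarrow> 'a" and vs :: "'a list" and z :: 'a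
  proof -
    \<comment> \<open>Unit vector along z, or 0 if z = 0, so that e . z = |z| in both cases.\<close>
    let ?e = "sgn z"
    have e: "norm ?e \<le> 1" by (simp add: norm_sgn)
    have ez: "?e \<bullet> z = norm z" by (cases "z = 0") (auto simp: sgn_div_norm power2_norm_eq_inner[symmetric] power2_eq_square)
    have "fourier (smooth_symbol R s vs) z = (\<integral>\<eta>. complex_symbol R s ?e vs z \<eta> 0 \<partial>lborel)"
      unfolding fourier_def sym0[OF R e] ..
    also have "\<dots> = (\<integral>\<eta>. complex_symbol R s ?e vs z \<eta> (\<i> * of_real (- \<kappa>)) \<partial>lborel)"
    proof (rule integral_contour_shift[where \<kappa> = "strip_width c1" and e = ?e])
      show "complex_symbol R s ?e vs z \<eta> holomorphic_on {\<omega>. \<bar>Im \<omega>\<bar> < strip_width c1}" for \<eta>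
        by (rule complex_symbol_holomorphic[OF R c s e])
      show "complex_symbol R s ?e vs z (\<eta> + r *\<^sub>R ?e) \<omega> = complex_symbol R s ?e vs z \<eta> (\<omega> + of_real r)" for \<eta> r \<omega>
        by (rule complex_symbol_shift[OF R c s e])
      show "(\<lambda>(\<eta>, \<sigma>). complex_symbol R s ?e vs z \<eta> (\<i> * of_real \<sigma>)) \<in> borel_measurable (borel \<Otimes>\<^sub>M borel)"
        by (rule complex_symbol_measurable[OF R c s e])
      show "integrable lborel (\<lambda>\<eta>::'a. ((\<Prod>v\<leftarrow>vs. norm v) * exp (\<kappa> * norm z)) * (C * (1 / (1 + (norm \<eta>)\<^sup>2) ^ ?N)))"
        by (intro integrable_mult_right int)
      fix \<eta> :: 'a and \<sigma> :: real assume \<sigma>: "\<bar>\<sigma>\<bar> \<le> \<bar>- \<kappa>\<bar>"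
      have "\<sigma> * norm z \<le> \<kappa> * norm z" using \<sigma> \<kappa> by (intro mult_right_mono) auto
      then have "(\<Prod>v\<leftarrow>vs. norm v) * exp (\<sigma> * (?e \<bullet> z)) * (C * (1 / (1 + (norm \<eta>)\<^sup>2) ^ ?N)) \<le> (\<Prod>v\<leftarrow>vs. norm v) * exp (\<kappa> * norm z) * (C * (1 / (1 + (norm \<eta>)\<^sup>2) ^ ?N))"
        unfolding ez using C(1) by (intro mult_right_mono mult_left_mono prod_list_norm_nonneg) auto
      with sym[OF R vs e, of \<sigma> z \<eta>] \<sigma> \<kappa>
      show "norm (complex_symbol R s ?e vs z \<eta> (\<i> * of_real \<sigma>)) \<le> ((\<Prod>v\<leftarrow>vs. norm v) * exp (\<kappa> * norm z)) * (C * (1 / (1 + (norm \<eta>)\<^sup>2) ^ ?N))" by simp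
    qed (use \<kappa> in simp)
    also have "norm \<dots> \<le> (\<integral>\<eta>. (\<Prod>v\<leftarrow>vs. norm v) * exp (- \<kappa> * norm z) * (C * (1 / (1 + (norm \<eta>)\<^sup>2) ^ ?N)) \<partial>(lborel :: 'a measure))"
    proof (rule Bochner_Integration.integral_norm_bound_integral)
      show "integrable lborel (\<lambda>\<eta>. complex_symbol R s ?e vs z \<eta> (\<i> * of_real (- \<kappa>)))"
      proof (rule Bochner_Integration.integrable_bound)
        show "integrable lborel (\<lambda>\<eta>::'a. (\<Prod>v\<leftarrow>vs. norm v) * exp (- \<kappa> * norm z) * (C * (1 / (1 + (norm \<eta>)\<^sup>2) ^ ?N)))"
          by (intro integrable_mult_right int)
        show "(\<lambda>\<eta>. complex_symbol R s ?e vs z \<eta> (\<i> * of_real (- \<kappa>))) \<in> borel_measurable lborel"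
          using measurable_compose[OF _ complex_symbol_measurable[OF R c s e, of vs z], of "\<lambda>\<eta>. (\<eta>, - \<kappa>)" borel] by simp
        show "AE \<eta> in lborel. norm (complex_symbol R s ?e vs z \<eta> (\<i> * of_real (- \<kappa>))) \<le> norm ((\<Prod>v\<leftarrow>vs. norm v) * exp (- \<kappa> * norm z) * (C * (1 / (1 + (norm \<eta>)\<^sup>2) ^ ?N)))"
        proof (rule AE_I2)
          fix \<eta>
          have "\<bar>- \<kappa>\<bar> < strip_width c1" using \<kappa> by simp
          from sym[OF R vs e this, of z \<eta>]
          show "norm (complex_symbol R s ?e vs z \<eta> (\<i> * of_real (- \<kappa>))) \<le> norm ((\<Prod>v\<leftarrow>vs. norm v) * exp (- \<kappa> * norm z) * (C * (1 / (1 + (norm \<eta>)\<^sup>2) ^ ?N)))"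
            unfolding ez real_norm_def by (rule order.trans[OF _ abs_ge_self])
        qed
      qed
      show "integrable lborel (\<lambda>\<eta>::'a. (\<Prod>v\<leftarrow>vs. norm v) * exp (- \<kappa> * norm z) * (C * (1 / (1 + (norm \<eta>)\<^sup>2) ^ ?N)))"
        by (intro integrable_mult_right int)
      show "norm (complex_symbol R s ?e vs z \<eta> (\<i> * of_real (- \<kappa>))) \<le> (\<Prod>v\<leftarrow>vs. norm v) * exp (- \<kappa> * norm z) * (C * (1 / (1 + (norm \<eta>)\<^sup>2) ^ ?N))" for \<eta>
        using sym[OF R vs e, of "- \<kappa>" z \<eta>] \<kappa> unfolding ez by simp
    qed
    also have "\<dots> = (\<Prod>v\<leftarrow>vs. norm v) * exp (- \<kappa> * norm z) * (C * I)"
      unfolding I_def by (simp only: integral_mult_right_zero)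
    finally show ?thesis .
  qed
  show ?thesis
  proof (rule that[of "C + C * I * (C' * I)"])
    show "0 \<le> C + C * I * (C' * I)" using C C' I by (intro add_nonneg_nonneg mult_nonneg_nonneg)
    fix R :: "real \<Rightarrow> 'a \<Rightarrow> 'a" and vs :: "'a list" assume R: "admissible c0 c1 R" and vs: "length vs = k"
    have nn: "0 \<le> (\<Prod>v\<leftarrow>vs. norm v)" by (rule prod_list_norm_nonneg)
    show "norm (smooth_symbol R s vs \<eta>) \<le> (\<Prod>v\<leftarrow>vs. norm v) * (C + C * I * (C' * I)) / (1 + (norm \<eta>)\<^sup>2) ^ ?N" for \<eta>
    proof -
      have "norm (smooth_symbol R s vs \<eta>) \<le> (\<Prod>v\<leftarrow>vs. norm v) * C / (1 + (norm \<eta>)\<^sup>2) ^ ?N"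
      proof -
        \<comment> \<open>Zero direction, zero shift and z = 0 reduce \<open>sym\<close> to the
          pointwise bound on the plain symbol.\<close>
        have 0: "norm (0::'a) \<le> 1" "\<bar>0\<bar> < strip_width c1" using \<kappa> by auto
        have "norm (complex_symbol R s 0 vs 0 \<eta> 0) \<le> (\<Prod>v\<leftarrow>vs. norm v) * (C * (1 / (1 + (norm \<eta>)\<^sup>2) ^ ?N))"
          using sym[OF R vs 0, of 0 \<eta>] by simp
        then show ?thesis unfolding sym0[OF R 0(1)] by simp
      qed
      also have "\<dots> \<le> (\<Prod>v\<leftarrow>vs. norm v) * (C + C * I * (C' * I)) / (1 + (norm \<eta>)\<^sup>2) ^ ?N"
        using C C' I nn by (intro divide_right_mono mult_left_mono) auto
      finally show ?thesis .
    qed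
    have "weight_norm (s / ?N) (smooth_symbol R s vs) \<le> (\<integral>\<^sup>+z. ennreal (((\<Prod>v\<leftarrow>vs. norm v) * (C * I) * C') * (1 / (1 + (norm z)\<^sup>2) ^ ?N)) \<partial>(lborel :: 'a measure))"
      unfolding weight_norm_def
    proof (intro nn_integral_mono ennreal_leI)
      fix z :: 'a
      have N: "1 \<le> real ?N" using DIM_positive[where 'a='a] by linarith
      then have "s \<le> real ?N" using s by linarith
      then have d: "s / real ?N \<le> 1" using N by (simp add: divide_le_eq)
      have "(1 + norm z) powr (s / ?N) \<le> (1 + norm z) powr 1" by (rule powr_mono[OF d]) simp
      then have "(1 + norm z) powr (s / ?N) * norm (fourier (smooth_symbol R s vs) z) \<le> (norm z + 1) * ((\<Prod>v\<leftarrow>vs. norm v) * exp (- \<kappa> * norm z) * (C * I))"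
        using four[OF R vs, of z] by (intro mult_mono) auto
      also have "\<dots> = ((norm z + 1) ^ 1 * exp (- \<kappa> * ((norm z)\<^sup>2) powr (1/2))) * ((\<Prod>v\<leftarrow>vs. norm v) * (C * I))"
      proof -
        have "((norm z)\<^sup>2) powr (1/2) = norm z" by (simp add: powr_half_sqrt)
        then show ?thesis by (simp only: power_one_right add.commute mult_ac)
      qed
      also have "\<dots> \<le> (C' / (1 + (norm z)\<^sup>2) ^ ?N) * ((\<Prod>v\<leftarrow>vs. norm v) * (C * I))"
        using C I nn by (intro mult_right_mono C'(2)) auto
      finally show "(1 + norm z) powr (s / ?N) * norm (fourier (smooth_symbol R s vs) z) \<le> ((\<Prod>v\<leftarrow>vs. norm v) * (C * I) * C') * (1 / (1 + (norm z)\<^sup>2) ^ ?N)"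
        by (simp add: mult_ac)
    qed
    also have "\<dots> = ennreal ((\<integral>z. ((\<Prod>v\<leftarrow>vs. norm v) * (C * I) * C') * (1 / (1 + (norm z)\<^sup>2) ^ ?N) \<partial>(lborel :: 'a measure)))"
      using C C' I nn by (intro nn_integral_eq_integral integrable_mult_right int AE_I2 mult_nonneg_nonneg) auto
    also have "\<dots> = ennreal ((\<Prod>v\<leftarrow>vs. norm v) * (C * I) * C' * I)"
      unfolding I_def by (simp only: integral_mult_right_zero)
    also have "\<dots> \<le> ennreal ((\<Prod>v\<leftarrow>vs. norm v) * (C + C * I * (C' * I)))"
    proof (rule ennreal_leI)
      have "P * (C * I) * C' * I \<le> P * (C + C * I * (C' * I))" if "0 \<le> P" "0 \<le> C" for P C C' I :: real
        using that by (simp add: algebra_simps)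
      then show "(\<Prod>v\<leftarrow>vs. norm v) * (C * I) * C' * I \<le> (\<Prod>v\<leftarrow>vs. norm v) * (C + C * I * (C' * I))"
        using nn C(1) by blast
    qed
    finally show "weight_norm (s / ?N) (smooth_symbol R s vs) \<le> ennreal ((\<Prod>v\<leftarrow>vs. norm v) * (C + C * I * (C' * I)))" .
  qed
qed

text \<open>Transfer from the smooth symbol: the pointwise bound loses exp 1, since the exponents
  differ by at most 1/2, and the weighted bound loses \<open>?D\<close> through the exponential
  multiplier.\<close>

theorem stable_symbol_bounds:
  fixes c0 c1 s :: real
  assumes c: "0 < c0" "0 \<le> c1" and s: "0 < s" "s < 1"
  obtains C where "0 \<le> C"
    "\<And>(R :: real \<Rightarrow> 'a::euclidean_space \<Rightarrow> 'a) vs \<eta>. admissible c0 c1 R \<Longrightarrow> length vs = k \<Longrightarrow>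
      norm (stable_symbol R s vs \<eta>) \<le> (\<Prod>v\<leftarrow>vs. norm v) * C / (1 + (norm \<eta>)\<^sup>2) ^ DIM('a)"
    "\<And>(R :: real \<Rightarrow> 'a \<Rightarrow> 'a) vs. admissible c0 c1 R \<Longrightarrow> length vs = k \<Longrightarrow>
      weight_norm (s / DIM('a)) (stable_symbol R s vs) \<le> ennreal ((\<Prod>v\<leftarrow>vs. norm v) * C)"
proof -
  let ?D = "exp ((1 + 2 * c1) ^ DIM('a) * bernstein_moment s)"
  show ?thesis
  proof (rule smooth_symbol_bounds[OF assms, of k, where 'a='a], rule that)
    fix C :: real assume C: "0 \<le> C"
    "\<And>(R :: real \<Rightarrow> 'a \<Rightarrow> 'a) vs \<eta>. admissible c0 c1 R \<Longrightarrow> length vs = k \<Longrightarrow>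
      norm (smooth_symbol R s vs \<eta>) \<le> (\<Prod>v\<leftarrow>vs. norm v) * C / (1 + (norm \<eta>)\<^sup>2) ^ DIM('a)"
    "\<And>(R :: real \<Rightarrow> 'a \<Rightarrow> 'a) vs. admissible c0 c1 R \<Longrightarrow> length vs = k \<Longrightarrow>
      weight_norm (s / DIM('a)) (smooth_symbol R s vs) \<le> ennreal ((\<Prod>v\<leftarrow>vs. norm v) * C)"
    show "0 \<le> exp 1 * C + ?D * C" using C by simp
    fix R :: "real \<Rightarrow> 'a \<Rightarrow> 'a" and vs :: "'a list" assume R: "admissible c0 c1 R" and vs: "length vs = k"
    note symbol_measurable[OF R, measurable]
    have nn: "0 \<le> (\<Prod>v\<leftarrow>vs. norm v)" by (rule prod_list_norm_nonneg)
    show "norm (stable_symbol R s vs \<eta>) \<le> (\<Prod>v\<leftarrow>vs. norm v) * (exp 1 * C + ?D * C) / (1 + (norm \<eta>)\<^sup>2) ^ DIM('a)" for \<eta>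
    proof -
      have "exp (- stable_exponent R s \<eta>) \<le> exp (1 + - smooth_exponent R s \<eta>)"
        unfolding exp_le_cancel_iff using smooth_minus_stable_bounds(4)[OF R s, of \<eta>] by linarith
      then have "norm (stable_symbol R s vs \<eta>) \<le> exp 1 * norm (smooth_symbol R s vs \<eta>)"
        unfolding stable_symbol_def smooth_symbol_def norm_mult norm_of_real exp_add mult.assoc[symmetric] abs_exp_cancel
        by (intro mult_right_mono) auto
      also have "\<dots> \<le> exp 1 * ((\<Prod>v\<leftarrow>vs. norm v) * C / (1 + (norm \<eta>)\<^sup>2) ^ DIM('a))"
        by (intro mult_left_mono C(2) R vs) auto
      also have "\<dots> = (\<Prod>v\<leftarrow>vs. norm v) * (exp 1 * C) / (1 + (norm \<eta>)\<^sup>2) ^ DIM('a)" by simp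
      also have "\<dots> \<le> (\<Prod>v\<leftarrow>vs. norm v) * (exp 1 * C + ?D * C) / (1 + (norm \<eta>)\<^sup>2) ^ DIM('a)"
        using C(1) nn by (intro divide_right_mono mult_left_mono) auto
      finally show ?thesis .
    qed
    have int: "integrable lborel (\<lambda>\<eta>. of_real (exp (- smooth_exponent R s \<eta>)) * monomial_symbol vs \<eta>)"
      unfolding smooth_symbol_def[symmetric]
    proof (rule Bochner_Integration.integrable_bound)
      show "integrable lborel (\<lambda>\<eta>::'a. ((\<Prod>v\<leftarrow>vs. norm v) * C) * (1 / (1 + (norm \<eta>)\<^sup>2) ^ DIM('a)))"
        by (intro integrable_mult_right integrable_inverse_1_plus_norm_square_power)
      show "AE \<eta> in lborel. norm (smooth_symbol R s vs \<eta>) \<le> norm (((\<Prod>v\<leftarrow>vs. norm v) * C) * (1 / (1 + (norm \<eta>)\<^sup>2) ^ DIM('a)))"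
      proof (rule AE_I2)
        fix \<eta>
        show "norm (smooth_symbol R s vs \<eta>) \<le> norm (((\<Prod>v\<leftarrow>vs. norm v) * C) * (1 / (1 + (norm \<eta>)\<^sup>2) ^ DIM('a)))"
          unfolding real_norm_def by (rule order.trans[OF _ abs_ge_self]) (use C(2)[OF R vs, of \<eta>] in simp)
      qed
    qed measurable
    have "weight_norm (s / DIM('a)) (stable_symbol R s vs) \<le> ennreal ?D * weight_norm (s / DIM('a)) (smooth_symbol R s vs)"
      unfolding stable_symbol_def[abs_def] smooth_symbol_def[abs_def]
      by (rule weight_norm_stable_le_smooth[OF R s c(2) int])
    also have "\<dots> \<le> ennreal ?D * ennreal ((\<Prod>v\<leftarrow>vs. norm v) * C)"
      by (intro mult_left_mono C(3) R vs) auto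
    also have "\<dots> = ennreal (?D * ((\<Prod>v\<leftarrow>vs. norm v) * C))"
      using C(1) nn by (intro ennreal_mult[symmetric]) auto
    also have "\<dots> \<le> ennreal ((\<Prod>v\<leftarrow>vs. norm v) * (exp 1 * C + ?D * C))"
    proof (rule ennreal_leI)
      have "D * (P * C) \<le> P * (E * C + D * C)" if "0 \<le> P" "0 \<le> C" "0 \<le> E" for D P C E :: real
        using that by (simp add: algebra_simps)
      from this[OF nn C(1), of "exp 1" ?D] show "?D * ((\<Prod>v\<leftarrow>vs. norm v) * C) \<le> (\<Prod>v\<leftarrow>vs. norm v) * (exp 1 * C + ?D * C)"
        by simp
    qed
    finally show "weight_norm (s / DIM('a)) (stable_symbol R s vs) \<le> ennreal ((\<Prod>v\<leftarrow>vs. norm v) * (exp 1 * C + ?D * C))" .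
  qed
qed

section \<open>Gaussian integrals and Fourier inversion at the origin\<close>

lemma lborel_product:
  fixes f :: "'a::euclidean_space \<Rightarrow> real \<Rightarrow> complex"
  assumes int: "\<And>b. b \<in> Basis \<Longrightarrow> integrable lborel (f b)"
  shows "integrable lborel (\<lambda>x. \<Prod>b\<in>Basis. f b (x \<bullet> b))"
    "(\<integral>x. (\<Prod>b\<in>Basis. f b (x \<bullet> b)) \<partial>lborel) = (\<Prod>b\<in>Basis. \<integral>x. f b x \<partial>lborel)"
proof -
  have P: "product_sigma_finite (\<lambda>_::'a. lborel :: real measure)"
    by (rule product_sigma_finite.intro) (rule sigma_finite_lborel)
  have f: "f b \<in> borel_measurable borel" if "b \<in> Basis" for b
    using borel_measurable_integrable[OF int[OF that]] by simp
  have m: "(\<lambda>x. \<Prod>b\<in>Basis. f b (x \<bullet> b)) \<in> borel_measurable borel"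
    by (intro borel_measurable_prod measurable_compose[OF _ f] borel_measurable_inner) auto
  have m2: "(\<lambda>f. \<Sum>b\<in>(Basis::'a set). f b *\<^sub>R b) \<in> (\<Pi>\<^sub>M b\<in>Basis. lborel) \<rightarrow>\<^sub>M borel" by measurable
  have eq: "(\<Prod>b\<in>Basis. f b ((\<Sum>b\<in>(Basis::'a set). g b *\<^sub>R b) \<bullet> b)) = (\<Prod>b\<in>Basis. f b (g b))" for g
    by (intro prod.cong) (auto simp: inner_sum_left inner_Basis if_distrib cong: if_cong)
  show "integrable lborel (\<lambda>x. \<Prod>b\<in>Basis. f b (x \<bullet> b))"
    by (subst lborel_eq, subst integrable_distr_eq[OF m2 m]) (simp only: eq, intro product_sigma_finite.product_integrable_prod[OF P] int finite_Basis)
  show "(\<integral>x. (\<Prod>b\<in>Basis. f b (x \<bullet> b)) \<partial>lborel) = (\<Prod>b\<in>Basis. \<integral>x. f b x \<partial>lborel)"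
    by (subst lborel_eq, subst integral_distr[OF m2 m]) (simp only: eq, intro product_sigma_finite.product_integral_prod[OF P] int finite_Basis)
qed

lemma sum_inner_squares: "(\<Sum>b\<in>Basis. - (z \<bullet> b)\<^sup>2 / 2) = - (norm z)\<^sup>2 / 2" for z :: "'a::euclidean_space"
proof -
  have "(norm z)\<^sup>2 = (\<Sum>b\<in>Basis. (z \<bullet> b)\<^sup>2)"
    unfolding power2_norm_eq_inner by (subst euclidean_inner) (simp add: power2_eq_square)
  then show ?thesis by (simp add: sum_negf sum_divide_distrib)
qed

definition gaussian :: "'a::euclidean_space \<Rightarrow> real" where
  "gaussian z = (\<Prod>b\<in>Basis. std_normal_density (z \<bullet> b))"

lemma gaussian_eq: "gaussian (z::'a::euclidean_space) = gaussian (0::'a) * exp (- (norm z)\<^sup>2 / 2)"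
proof -
  have "gaussian z = (\<Prod>b\<in>(Basis::'a set). 1 / sqrt (2 * pi)) * (\<Prod>b\<in>Basis. exp (- (z \<bullet> b)\<^sup>2 / 2))"
    unfolding gaussian_def std_normal_density_def prod.distrib[symmetric] ..
  also have "(\<Prod>b\<in>Basis. exp (- (z \<bullet> b)\<^sup>2 / 2)) = exp (\<Sum>b\<in>Basis. - (z \<bullet> b)\<^sup>2 / 2)"
    by (simp add: exp_sum)
  also have "(\<Sum>b\<in>Basis. - (z \<bullet> b)\<^sup>2 / 2) = - (norm z)\<^sup>2 / 2" by (rule sum_inner_squares)
  finally show ?thesis unfolding gaussian_def[of 0] std_normal_density_def by simp
qed

lemma gaussian_measurable [measurable]: "gaussian \<in> borel_measurable borel"
  unfolding gaussian_def[abs_def] by (intro borel_measurable_prod) measurable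

lemma gaussian_nonneg: "0 \<le> gaussian z"
  unfolding gaussian_def by (intro prod_nonneg) auto

lemma gaussian_0: "gaussian (0::'a::euclidean_space) = 1 / sqrt (2 * pi) ^ DIM('a)" "0 < gaussian (0::'a)"
  unfolding gaussian_def std_normal_density_def by (simp_all add: power_divide)

text \<open>Integrand and phase both factorise over the basis, which leaves characteristic functions
  of the standard normal law.\<close>

lemma gaussian_fourier:
  fixes y :: "'a::euclidean_space"
  shows "integrable lborel (gaussian :: 'a \<Rightarrow> real)"
    "fourier (\<lambda>z. of_real (gaussian z)) y = of_real (exp (- (norm y)\<^sup>2 / 2))"
proof -
  have i: "integrable lborel (\<lambda>x. complex_of_real (std_normal_density x) * exp (- \<i> * of_real (x * c)))" for c
  proof (rule Bochner_Integration.integrable_bound)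
    show "integrable lborel std_normal_density" by simp
  qed (auto simp: norm_mult)
  have e: "(\<integral>x. complex_of_real (std_normal_density x) * exp (- \<i> * of_real (x * c)) \<partial>lborel) = of_real (exp (- c\<^sup>2 / 2))" for c
  proof -
    have "(\<integral>x. complex_of_real (std_normal_density x) * exp (- \<i> * of_real (x * c)) \<partial>lborel) = char std_normal_distribution (- c)"
      unfolding char_def by (subst integral_density) (auto simp: scaleR_conv_of_real mult_ac)
    then show ?thesis unfolding char_std_normal_distribution by simp
  qed
  have eq: "of_real (gaussian z) * exp (- \<i> * of_real (z \<bullet> y)) = (\<Prod>b\<in>Basis. complex_of_real (std_normal_density (z \<bullet> b)) * exp (- \<i> * of_real ((z \<bullet> b) * (y \<bullet> b))))" for z y :: 'a
    unfolding gaussian_def euclidean_inner[of z y] prod.distrib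
    by (simp add: exp_sum[symmetric] sum_distrib_left sum_negf)
  have "integrable lborel (\<lambda>z::'a. complex_of_real (gaussian z) * exp (- \<i> * of_real (z \<bullet> 0)))"
    unfolding eq by (rule lborel_product(1)[OF i])
  then show "integrable lborel (gaussian :: 'a \<Rightarrow> real)"
    using integrable_Re[of lborel "\<lambda>z::'a. complex_of_real (gaussian z)"] by simp
  have "fourier (\<lambda>z. of_real (gaussian z)) y = (\<Prod>b\<in>Basis. of_real (exp (- (y \<bullet> b)\<^sup>2 / 2)))"
    unfolding fourier_def eq lborel_product(2)[OF i] e ..
  also have "\<dots> = of_real (exp (\<Sum>b\<in>Basis. - (y \<bullet> b)\<^sup>2 / 2))" by (simp add: exp_sum)
  also have "(\<Sum>b\<in>Basis. - (y \<bullet> b)\<^sup>2 / 2) = - (norm y)\<^sup>2 / 2" by (rule sum_inner_squares)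
  finally show "fourier (\<lambda>z. of_real (gaussian z)) y = of_real (exp (- (norm y)\<^sup>2 / 2))" .
qed

text \<open>The transform of the normalised Gaussian at 0 is its total mass, which is therefore 1;
  dividing by its value at 0 gives the integral.\<close>

lemma integral_gaussian_exp: "(\<integral>y. exp (- (norm y)\<^sup>2 / 2) \<partial>(lborel :: 'a::euclidean_space measure)) = sqrt (2 * pi) ^ DIM('a)"
  "integrable (lborel :: 'a measure) (\<lambda>y. exp (- (norm y)\<^sup>2 / 2))"
proof -
  have eq: "exp (- (norm y)\<^sup>2 / 2) = gaussian y / gaussian (0::'a)" for y :: 'a
    using gaussian_eq[of y] gaussian_0(2)[where 'a='a] by (simp add: field_simps)
  show "integrable (lborel :: 'a measure) (\<lambda>y. exp (- (norm y)\<^sup>2 / 2))"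
    unfolding eq using gaussian_fourier(1)[where 'a='a] by simp
  have "of_real (\<integral>y. gaussian y \<partial>(lborel::'a measure)) = fourier (\<lambda>z. of_real (gaussian z)) (0::'a)"
    by (simp add: fourier_def)
  then have "(\<integral>y. gaussian y \<partial>(lborel::'a measure)) = 1" by (simp add: gaussian_fourier(2))
  then show "(\<integral>y. exp (- (norm y)\<^sup>2 / 2) \<partial>(lborel :: 'a measure)) = sqrt (2 * pi) ^ DIM('a)"
    unfolding eq by (simp add: gaussian_0(1))
qed

text \<open>Inversion at the origin by Gaussian regularisation: a factor gaussian(\<epsilon> z) is
  inserted, Fubini moves the transform onto it, and the result averages m over a region shrinking to
  0. Both sides converge by dominated convergence.\<close>

theorem integral_fourier:
  fixes m :: "'a::euclidean_space \<Rightarrow> complex"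
  assumes m: "integrable lborel m" and fm: "integrable lborel (fourier m)"
    and bound: "\<And>\<eta>. norm (m \<eta>) \<le> B" and cont: "isCont m 0"
  shows "(\<integral>z. fourier m z \<partial>lborel) = of_real ((2 * pi) ^ DIM('a)) * m 0"
proof -
  have [measurable]: "m \<in> borel_measurable borel" using m by auto
  define \<epsilon> where "\<epsilon> n = 1 / real (Suc n)" for n
  have \<epsilon>: "0 < \<epsilon> n" for n by (simp add: \<epsilon>_def)
  have \<epsilon>0: "\<epsilon> \<longlonglongrightarrow> 0" unfolding \<epsilon>_def[abs_def] by (rule LIMSEQ_Suc[OF lim_1_over_n])
  \<comment> \<open>Fubini, then \<eta> = \<epsilon> y. The Jacobian \<epsilon>^N of this
    substitution is the one that rescales the inner integral over z to the transform of the Gaussian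
    at y.\<close>
  have eq: "(\<integral>z. fourier m z * of_real (gaussian (\<epsilon> n *\<^sub>R z)) \<partial>lborel) = (\<integral>y. m (\<epsilon> n *\<^sub>R y) * of_real (exp (- (norm y)\<^sup>2 / 2)) \<partial>lborel)" for n
  proof -
    let ?e = "\<epsilon> n"
    have ig: "integrable lborel (\<lambda>z::'a. gaussian (?e *\<^sub>R z))"
    proof -
      have "integrable (density (distr lborel borel (\<lambda>x. 0 + (1 / ?e) *\<^sub>R x)) (\<lambda>_. ennreal (\<bar>1 / ?e\<bar> ^ DIM('a)))) (\<lambda>z::'a. gaussian (?e *\<^sub>R z))"
        using \<epsilon>[of n] gaussian_fourier(1)[where 'a='a] by (subst integrable_real_density) (auto simp: integrable_distr_eq)
      then show ?thesis using lborel_affine[of "1/?e" "0::'a"] \<epsilon>[of n] by simp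
    qed
    have ip: "integrable (lborel \<Otimes>\<^sub>M lborel) (\<lambda>(\<eta>, z). m \<eta> * exp (- \<i> * of_real (\<eta> \<bullet> z)) * of_real (gaussian (?e *\<^sub>R z)))"
    proof (rule lborel_pair.Fubini_integrable)
      show "integrable lborel (\<lambda>\<eta>. \<integral>z. norm (case (\<eta>, z) of (\<eta>, z) \<Rightarrow> m \<eta> * exp (- \<i> * of_real (\<eta> \<bullet> z)) * of_real (gaussian (?e *\<^sub>R z))) \<partial>lborel)"
        using m by (simp add: norm_mult)
      show "AE \<eta> in lborel. integrable lborel (\<lambda>z. case (\<eta>, z) of (\<eta>, z) \<Rightarrow> m \<eta> * exp (- \<i> * of_real (\<eta> \<bullet> z)) * of_real (gaussian (?e *\<^sub>R z)))"
      proof (rule AE_I2)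
        fix \<eta> :: 'a
        show "integrable lborel (\<lambda>z. case (\<eta>, z) of (\<eta>, z) \<Rightarrow> m \<eta> * exp (- \<i> * of_real (\<eta> \<bullet> z)) * of_real (gaussian (?e *\<^sub>R z)))"
          by (rule Bochner_Integration.integrable_bound[OF integrable_mult_right[OF ig, of "norm (m \<eta>)"]])
            (auto simp: norm_mult)
      qed
    qed measurable
    have "(\<integral>z. fourier m z * of_real (gaussian (?e *\<^sub>R z)) \<partial>lborel) = (\<integral>z. (\<integral>\<eta>. m \<eta> * exp (- \<i> * of_real (\<eta> \<bullet> z)) * of_real (gaussian (?e *\<^sub>R z)) \<partial>lborel) \<partial>lborel)"
      unfolding fourier_def by simp
    also have "\<dots> = (\<integral>\<eta>. (\<integral>z. m \<eta> * exp (- \<i> * of_real (\<eta> \<bullet> z)) * of_real (gaussian (?e *\<^sub>R z)) \<partial>lborel) \<partial>lborel)"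
      by (rule lborel_pair.Fubini_integral[OF ip])
    also have "\<dots> = ?e ^ DIM('a) *\<^sub>R (\<integral>y. (\<integral>z. m (?e *\<^sub>R y) * exp (- \<i> * of_real ((?e *\<^sub>R y) \<bullet> z)) * of_real (gaussian (?e *\<^sub>R z)) \<partial>lborel) \<partial>lborel)"
      by (rule integral_scale) (measurable, rule \<epsilon>)
    also have "\<dots> = (\<integral>y. ?e ^ DIM('a) *\<^sub>R (\<integral>z. m (?e *\<^sub>R y) * exp (- \<i> * of_real ((?e *\<^sub>R y) \<bullet> z)) * of_real (gaussian (?e *\<^sub>R z)) \<partial>lborel) \<partial>lborel)"
      by simp
    also have "\<dots> = (\<integral>y. m (?e *\<^sub>R y) * of_real (exp (- (norm y)\<^sup>2 / 2)) \<partial>lborel)"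
    proof (rule Bochner_Integration.integral_cong[OF refl])
      fix y :: 'a
      have "of_real (exp (- (norm y)\<^sup>2 / 2)) = (\<integral>z. of_real (gaussian z) * exp (- \<i> * of_real (z \<bullet> y)) \<partial>lborel)"
        unfolding gaussian_fourier(2)[symmetric] fourier_def ..
      also have "\<dots> = ?e ^ DIM('a) *\<^sub>R (\<integral>z. of_real (gaussian (?e *\<^sub>R z)) * exp (- \<i> * of_real ((?e *\<^sub>R z) \<bullet> y)) \<partial>lborel)"
        by (rule integral_scale) (measurable, rule \<epsilon>)
      finally have "m (?e *\<^sub>R y) * of_real (exp (- (norm y)\<^sup>2 / 2)) = ?e ^ DIM('a) *\<^sub>R (m (?e *\<^sub>R y) * (\<integral>z. of_real (gaussian (?e *\<^sub>R z)) * exp (- \<i> * of_real ((?e *\<^sub>R z) \<bullet> y)) \<partial>lborel))"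
        by simp
      also have "m (?e *\<^sub>R y) * (\<integral>z. of_real (gaussian (?e *\<^sub>R z)) * exp (- \<i> * of_real ((?e *\<^sub>R z) \<bullet> y)) \<partial>lborel)
         = (\<integral>z. m (?e *\<^sub>R y) * (of_real (gaussian (?e *\<^sub>R z)) * exp (- \<i> * of_real ((?e *\<^sub>R z) \<bullet> y))) \<partial>lborel)"
        by (rule integral_mult_right_zero[symmetric])
      also have "\<dots> = (\<integral>z. m (?e *\<^sub>R y) * exp (- \<i> * of_real ((?e *\<^sub>R y) \<bullet> z)) * of_real (gaussian (?e *\<^sub>R z)) \<partial>lborel)"
        by (simp add: mult_ac inner_commute)
      finally show "?e ^ DIM('a) *\<^sub>R (\<integral>z. m (?e *\<^sub>R y) * exp (- \<i> * of_real ((?e *\<^sub>R y) \<bullet> z)) * of_real (gaussian (?e *\<^sub>R z)) \<partial>lborel)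
        = m (?e *\<^sub>R y) * of_real (exp (- (norm y)\<^sup>2 / 2))" by simp
    qed
    finally show ?thesis .
  qed
  have L: "(\<lambda>n. \<integral>z. fourier m z * of_real (gaussian (\<epsilon> n *\<^sub>R z)) \<partial>lborel) \<longlonglongrightarrow> (\<integral>z. fourier m z * of_real (gaussian (0::'a)) \<partial>lborel)"
  proof (rule integral_dominated_convergence[where w="\<lambda>z. norm (fourier m z) * gaussian (0::'a)"])
    show "integrable lborel (\<lambda>z. norm (fourier m z) * gaussian (0::'a))" using fm by simp
    show "AE z in lborel. (\<lambda>n. fourier m z * of_real (gaussian (\<epsilon> n *\<^sub>R z))) \<longlonglongrightarrow> fourier m z * of_real (gaussian (0::'a))"
    proof (rule AE_I2)
      fix z :: 'a
      have "(\<lambda>n. gaussian (0::'a) * exp (- (norm (\<epsilon> n *\<^sub>R z))\<^sup>2 / 2)) \<longlonglongrightarrow> gaussian (0::'a) * exp (- (norm (0 *\<^sub>R z))\<^sup>2 / 2)"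
        by (intro tendsto_intros \<epsilon>0) auto
      then have "(\<lambda>n. gaussian (\<epsilon> n *\<^sub>R z)) \<longlonglongrightarrow> gaussian (0::'a)"
        unfolding gaussian_eq[symmetric] by simp
      then show "(\<lambda>n. fourier m z * of_real (gaussian (\<epsilon> n *\<^sub>R z))) \<longlonglongrightarrow> fourier m z * of_real (gaussian (0::'a))"
        by (intro tendsto_intros)
    qed
    show "AE z in lborel. norm (fourier m z * of_real (gaussian (\<epsilon> n *\<^sub>R z))) \<le> norm (fourier m z) * gaussian (0::'a)" for n
    proof (rule AE_I2)
      fix z :: 'a
      have "gaussian (\<epsilon> n *\<^sub>R z) \<le> gaussian (0::'a)"
        unfolding gaussian_eq[of "\<epsilon> n *\<^sub>R z"] using gaussian_0(2)[where 'a='a] by (intro mult_left_le) auto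
      then show "norm (fourier m z * of_real (gaussian (\<epsilon> n *\<^sub>R z))) \<le> norm (fourier m z) * gaussian (0::'a)"
        using gaussian_nonneg[of "\<epsilon> n *\<^sub>R z"] by (auto simp: norm_mult intro!: mult_left_mono)
    qed
  qed (use fm in auto)
  have R: "(\<lambda>n. \<integral>y. m (\<epsilon> n *\<^sub>R y) * of_real (exp (- (norm y)\<^sup>2 / 2)) \<partial>lborel) \<longlonglongrightarrow> (\<integral>y. m 0 * of_real (exp (- (norm (y::'a))\<^sup>2 / 2)) \<partial>lborel)"
  proof (rule integral_dominated_convergence[where w="\<lambda>y. B * exp (- (norm y)\<^sup>2 / 2)"])
    show "integrable lborel (\<lambda>y::'a. B * exp (- (norm y)\<^sup>2 / 2))" using integral_gaussian_exp(2)[where 'a='a] by simp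
    show "AE y in lborel. (\<lambda>n. m (\<epsilon> n *\<^sub>R y) * of_real (exp (- (norm y)\<^sup>2 / 2))) \<longlonglongrightarrow> m 0 * of_real (exp (- (norm y)\<^sup>2 / 2))"
    proof (rule AE_I2)
      fix y :: 'a
      have "(\<lambda>n. \<epsilon> n *\<^sub>R y) \<longlonglongrightarrow> 0 *\<^sub>R y" by (intro tendsto_intros \<epsilon>0)
      then have "(\<lambda>n. m (\<epsilon> n *\<^sub>R y)) \<longlonglongrightarrow> m 0" using isCont_tendsto_compose[OF cont] by simp
      then show "(\<lambda>n. m (\<epsilon> n *\<^sub>R y) * of_real (exp (- (norm y)\<^sup>2 / 2))) \<longlonglongrightarrow> m 0 * of_real (exp (- (norm y)\<^sup>2 / 2))"
        by (intro tendsto_intros)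
    qed
    show "AE y in lborel. norm (m (\<epsilon> n *\<^sub>R y) * of_real (exp (- (norm y)\<^sup>2 / 2))) \<le> B * exp (- (norm y)\<^sup>2 / 2)" for n
      using bound by (intro AE_I2) (auto simp: norm_mult intro!: mult_right_mono)
  qed auto
  have "(\<integral>z. fourier m z * of_real (gaussian (0::'a)) \<partial>lborel) = (\<integral>y. m 0 * of_real (exp (- (norm (y::'a))\<^sup>2 / 2)) \<partial>lborel)"
    by (rule LIMSEQ_unique[OF L]) (use R in \<open>simp only: eq\<close>)
  then have "(\<integral>z. fourier m z \<partial>lborel) * of_real (gaussian (0::'a)) = m 0 * of_real (sqrt (2 * pi) ^ DIM('a))"
    by (simp only: integral_mult_right_zero integral_mult_left_zero integral_complex_of_real integral_gaussian_exp(1))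
  then have "(\<integral>z. fourier m z \<partial>lborel) = m 0 * of_real (sqrt (2 * pi) ^ DIM('a) * sqrt (2 * pi) ^ DIM('a))"
    unfolding gaussian_0(1) by (simp add: field_simps)
  also have "sqrt (2 * pi) ^ DIM('a) * sqrt (2 * pi) ^ DIM('a) = (2 * pi) ^ DIM('a)"
    unfolding power_mult_distrib[symmetric] by simp
  finally show ?thesis by (simp add: mult.commute)
qed

section \<open>The kernels and their derivatives\<close>

text \<open>Time enters through \<open>R t\<close> alone, with ellipticity constants common to all
  t. Joint continuity in t, \<theta> and \<eta> yields measurability and continuity of the kernels
  in time.\<close>

locale symbol_family =
  fixes R :: "real \<Rightarrow> real \<Rightarrow> 'a::euclidean_space \<Rightarrow> 'a" and s c0 c1 :: real
  assumes s: "0 < s" "s < 1" and c: "0 < c0" "0 \<le> c1"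
    and R: "\<And>t. admissible c0 c1 (R t)"
    and R_cont: "continuous_on UNIV (\<lambda>(t, \<theta>, \<eta>). R t \<theta> \<eta>)"
begin

text \<open>For \<open>vs = []\<close> this will be the density at time t rescaled to unit width.
  Each entry of \<open>vs\<close> stands for a derivative along its negative.\<close>

definition kernel :: "real \<Rightarrow> 'a list \<Rightarrow> 'a \<Rightarrow> real" where
  "kernel t vs z = Re (fourier (stable_symbol (R t) s vs) z) / (2 * pi) ^ DIM('a)"

lemma stable_symbol_measurable [measurable]: "stable_symbol (R t) s vs \<in> borel_measurable borel"
  by (rule symbol_measurable(2)[OF R])

lemma stable_symbol_integrable: "integrable lborel (stable_symbol (R t) s vs)"
proof -
  obtain C where C: "0 \<le> C" "\<And>\<eta>. norm (stable_symbol (R t) s vs \<eta>) \<le> (\<Prod>v\<leftarrow>vs. norm v) * C / (1 + (norm \<eta>)\<^sup>2) ^ DIM('a)"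
    by (rule stable_symbol_bounds[OF c s, of "length vs"]) (use R in blast)
  show ?thesis
  proof (rule Bochner_Integration.integrable_bound)
    show "integrable lborel (\<lambda>\<eta>::'a. ((\<Prod>v\<leftarrow>vs. norm v) * C) * (1 / (1 + (norm \<eta>)\<^sup>2) ^ DIM('a)))"
      by (intro integrable_mult_right integrable_inverse_1_plus_norm_square_power)
    show "AE \<eta> in lborel. norm (stable_symbol (R t) s vs \<eta>) \<le> norm (((\<Prod>v\<leftarrow>vs. norm v) * C) * (1 / (1 + (norm \<eta>)\<^sup>2) ^ DIM('a)))"
    proof (rule AE_I2)
      fix \<eta>
      show "norm (stable_symbol (R t) s vs \<eta>) \<le> norm (((\<Prod>v\<leftarrow>vs. norm v) * C) * (1 / (1 + (norm \<eta>)\<^sup>2) ^ DIM('a)))"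
        unfolding real_norm_def by (rule order.trans[OF _ abs_ge_self]) (use C(2)[of \<eta>] in simp)
    qed
  qed measurable
qed

lemma kernel_weight_bound:
  obtains C where "0 \<le> C"
    "\<And>t vs. length vs = k \<Longrightarrow> (\<integral>\<^sup>+z. ennreal ((1 + norm z) powr (s / DIM('a)) * \<bar>kernel t vs z\<bar>) \<partial>lborel) \<le> ennreal ((\<Prod>v\<leftarrow>vs. norm v) * C)"
proof (rule stable_symbol_bounds[OF c s, of k, where 'a='a], rule that)
  fix C assume C: "0 \<le> C" and "\<And>(R :: real \<Rightarrow> 'a \<Rightarrow> 'a) vs \<eta>. admissible c0 c1 R \<Longrightarrow> length vs = k \<Longrightarrow>
      norm (stable_symbol R s vs \<eta>) \<le> (\<Prod>v\<leftarrow>vs. norm v) * C / (1 + (norm \<eta>)\<^sup>2) ^ DIM('a)"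
    and w: "\<And>(R :: real \<Rightarrow> 'a \<Rightarrow> 'a) vs. admissible c0 c1 R \<Longrightarrow> length vs = k \<Longrightarrow>
      weight_norm (s / DIM('a)) (stable_symbol R s vs) \<le> ennreal ((\<Prod>v\<leftarrow>vs. norm v) * C)"
  show "0 \<le> C" by fact
  fix t and vs :: "'a list" assume vs: "length vs = k"
  have "(\<integral>\<^sup>+z. ennreal ((1 + norm z) powr (s / DIM('a)) * \<bar>kernel t vs z\<bar>) \<partial>lborel) \<le> weight_norm (s / DIM('a)) (stable_symbol (R t) s vs)"
    unfolding weight_norm_def
  proof (intro nn_integral_mono ennreal_leI mult_left_mono)
    fix z
    have "1 \<le> (2 * pi) ^ DIM('a)" using pi_ge_two by (intro one_le_power) simp
    then have "\<bar>kernel t vs z\<bar> \<le> \<bar>Re (fourier (stable_symbol (R t) s vs) z)\<bar> / 1"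
      unfolding kernel_def abs_divide by (intro divide_left_mono) auto
    also have "\<dots> \<le> norm (fourier (stable_symbol (R t) s vs) z)" by (simp add: abs_Re_le_cmod)
    finally show "\<bar>kernel t vs z\<bar> \<le> norm (fourier (stable_symbol (R t) s vs) z)" .
  qed simp
  also have "\<dots> \<le> ennreal ((\<Prod>v\<leftarrow>vs. norm v) * C)" by (rule w[OF R vs])
  finally show "(\<integral>\<^sup>+z. ennreal ((1 + norm z) powr (s / DIM('a)) * \<bar>kernel t vs z\<bar>) \<partial>lborel) \<le> ennreal ((\<Prod>v\<leftarrow>vs. norm v) * C)" .
qed

lemma kernel_measurable1 [measurable]: "kernel t vs \<in> borel_measurable borel"
  unfolding kernel_def[abs_def] by measurable

lemma kernel_bound:
  obtains C where "0 \<le> C"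
    "\<And>t vs. length vs = k \<Longrightarrow> integrable lborel (\<lambda>z. (1 + norm z) powr (s / DIM('a)) * \<bar>kernel t vs z\<bar>)"
    "\<And>t vs. length vs = k \<Longrightarrow> (\<integral>z. (1 + norm z) powr (s / DIM('a)) * \<bar>kernel t vs z\<bar> \<partial>lborel) \<le> (\<Prod>v\<leftarrow>vs. norm v) * C"
    "\<And>t vs. length vs = k \<Longrightarrow> integrable lborel (kernel t vs)"
    "\<And>t vs. length vs = k \<Longrightarrow> (\<integral>z. \<bar>kernel t vs z\<bar> \<partial>lborel) \<le> (\<Prod>v\<leftarrow>vs. norm v) * C"
proof (rule kernel_weight_bound[of k], rule that)
  fix C assume C: "0 \<le> C" and w: "\<And>t vs. length vs = k \<Longrightarrow> (\<integral>\<^sup>+z. ennreal ((1 + norm z) powr (s / DIM('a)) * \<bar>kernel t vs z\<bar>) \<partial>lborel) \<le> ennreal ((\<Prod>v\<leftarrow>vs. norm v) * C)"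
  show "0 \<le> C" by fact
  fix t and vs :: "'a list" assume vs: "length vs = k"
  show 1: "integrable lborel (\<lambda>z. (1 + norm z) powr (s / DIM('a)) * \<bar>kernel t vs z\<bar>)"
    by (rule integrableI_bounded) (use w[OF vs, of t] in \<open>auto simp: abs_mult intro: le_less_trans\<close>)
  show 2: "(\<integral>z. (1 + norm z) powr (s / DIM('a)) * \<bar>kernel t vs z\<bar> \<partial>lborel) \<le> (\<Prod>v\<leftarrow>vs. norm v) * C"
    by (rule integral_real_bounded) (use w[OF vs, of t] mult_nonneg_nonneg[OF prod_list_norm_nonneg C] in auto)
  have le: "\<bar>kernel t vs z\<bar> \<le> (1 + norm z) powr (s / DIM('a)) * \<bar>kernel t vs z\<bar>" for z
  proof -
    have "1 \<le> (1 + norm z) powr (s / DIM('a))" using s by (intro ge_one_powr_ge_zero) auto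
    then show ?thesis using mult_right_mono[of 1 _ "\<bar>kernel t vs z\<bar>"] by simp
  qed
  show 3: "integrable lborel (kernel t vs)"
    by (rule Bochner_Integration.integrable_bound[OF 1]) (use le in \<open>auto simp: abs_mult\<close>)
  have "(\<integral>z. \<bar>kernel t vs z\<bar> \<partial>lborel) \<le> (\<integral>z. (1 + norm z) powr (s / DIM('a)) * \<bar>kernel t vs z\<bar> \<partial>lborel)"
    by (rule integral_mono) (use 1 3 le in auto)
  with 2 show "(\<integral>z. \<bar>kernel t vs z\<bar> \<partial>lborel) \<le> (\<Prod>v\<leftarrow>vs. norm v) * C" by simp
qed

lemma kernel_integrable: "integrable lborel (kernel t vs)"
  by (rule kernel_bound[of "length vs"]) auto

lemma kernel_linear: "kernel t ((a *\<^sub>R v + w) # vs) z = a * kernel t (v # vs) z + kernel t (w # vs) z"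
proof -
  have "stable_symbol (R t) s ((a *\<^sub>R v + w) # vs) \<eta> = of_real a * stable_symbol (R t) s (v # vs) \<eta> + stable_symbol (R t) s (w # vs) \<eta>" for \<eta>
    by (simp add: stable_symbol_def inner_simps algebra_simps)
  then have "fourier (stable_symbol (R t) s ((a *\<^sub>R v + w) # vs)) z =
     (\<integral>\<eta>. of_real a * (stable_symbol (R t) s (v # vs) \<eta> * exp (- \<i> * of_real (\<eta> \<bullet> z))) + stable_symbol (R t) s (w # vs) \<eta> * exp (- \<i> * of_real (\<eta> \<bullet> z)) \<partial>lborel)"
    unfolding fourier_def by (simp add: algebra_simps)
  also have "\<dots> = of_real a * fourier (stable_symbol (R t) s (v # vs)) z + fourier (stable_symbol (R t) s (w # vs)) z"
    unfolding fourier_def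
      Bochner_Integration.integral_add[OF integrable_mult_right[OF integrable_fourier_integrand[OF stable_symbol_integrable]] integrable_fourier_integrand[OF stable_symbol_integrable]]
      integral_mult_right_zero ..
  finally show ?thesis unfolding kernel_def by (simp add: add_divide_distrib)
qed

lemma R_measurable [measurable]: "(\<lambda>p. R (fst (fst p)) (snd p) (snd (fst p))) \<in> borel_measurable ((borel \<Otimes>\<^sub>M borel) \<Otimes>\<^sub>M restrict_space lborel {0..1})"
proof -
  have 1: "(\<lambda>(t, \<theta>, \<eta>). R t \<theta> \<eta>) \<in> borel_measurable (borel \<Otimes>\<^sub>M (borel \<Otimes>\<^sub>M borel))"
    unfolding borel_prod by (rule borel_measurable_continuous_onI[OF R_cont])
  have 2: "(\<lambda>p. (fst (fst p), snd p, snd (fst p))) \<in> ((borel \<Otimes>\<^sub>M borel) \<Otimes>\<^sub>M restrict_space lborel {0..1}) \<rightarrow>\<^sub>M borel \<Otimes>\<^sub>M ((borel :: real measure) \<Otimes>\<^sub>M borel)"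
    using measurable_compose[OF measurable_snd measurable_restrict_space1[of "\<lambda>x. x" lborel borel "{0..1::real}"], of "borel \<Otimes>\<^sub>M borel"]
    by (intro measurable_Pair) auto
  from measurable_compose[OF 2 1] show ?thesis by simp
qed

lemma stable_exponent_measurable [measurable]: "(\<lambda>p. stable_exponent (R (fst p)) s (snd p)) \<in> borel_measurable (borel \<Otimes>\<^sub>M borel)"
proof -
  interpret U: prob_space "restrict_space lborel {0..1::real}" by (rule prob_space_unit_interval)
  show ?thesis unfolding stable_exponent_def
    by (intro borel_measurable_times borel_measurable_const U.borel_measurable_lebesgue_integral) (simp add: case_prod_beta')
qed

text \<open>The directions may depend on t as well, since they will be transported by the flow;
  Fubini in time needs this form.\<close>

lemma kernel_measurable:
  assumes E: "\<And>h. h \<in> set hs \<Longrightarrow> (\<lambda>t. E t h) \<in> borel_measurable borel"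
  shows "(\<lambda>p. kernel (fst p) (map (E (fst p)) hs) (snd p)) \<in> borel_measurable (borel \<Otimes>\<^sub>M borel)"
proof -
  have m: "(\<lambda>p. monomial_symbol (map (E (fst (fst p))) hs) (snd p)) \<in> borel_measurable (((borel :: real measure) \<Otimes>\<^sub>M (borel :: 'a measure)) \<Otimes>\<^sub>M lborel)"
    using E
  proof (induction hs)
    case (Cons h hs)
    then have [measurable]: "(\<lambda>p. monomial_symbol (map (E (fst (fst p))) hs) (snd p)) \<in> borel_measurable (((borel :: real measure) \<Otimes>\<^sub>M (borel :: 'a measure)) \<Otimes>\<^sub>M lborel)"
      "(\<lambda>t. E t h) \<in> borel_measurable borel" by auto
    show ?case unfolding list.map monomial_symbol_simps by measurable
  qed simp
  have 2: "(\<lambda>p. (fst (fst p), snd p)) \<in> ((borel :: real measure) \<Otimes>\<^sub>M (borel :: 'a measure)) \<Otimes>\<^sub>M lborel \<rightarrow>\<^sub>M borel \<Otimes>\<^sub>M borel"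
    by (intro measurable_Pair) auto
  have e: "(\<lambda>p. stable_exponent (R (fst (fst p))) s (snd p)) \<in> borel_measurable (((borel :: real measure) \<Otimes>\<^sub>M (borel :: 'a measure)) \<Otimes>\<^sub>M lborel)"
    using measurable_compose[OF 2 stable_exponent_measurable] by simp
  have "(\<lambda>p. fourier (stable_symbol (R (fst p)) s (map (E (fst p)) hs)) (snd p)) \<in> borel_measurable (borel \<Otimes>\<^sub>M borel)"
    unfolding fourier_def stable_symbol_def
    by (intro lborel.borel_measurable_lebesgue_integral) (use m e in \<open>simp add: case_prod_beta'\<close>)
  then show ?thesis unfolding kernel_def by measurable
qed

lemma exp_segment:
  "exp (- \<i> * of_real (\<eta> \<bullet> (z - w))) - exp (- \<i> * of_real (\<eta> \<bullet> z))
    = (\<integral>r. \<i> * of_real (\<eta> \<bullet> w) * exp (- \<i> * of_real (\<eta> \<bullet> (z - r *\<^sub>R w))) \<partial>restrict_space lborel {0..1})"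
proof -
  let ?c = "\<i> * of_real (\<eta> \<bullet> w)" and ?a = "- \<i> * of_real (\<eta> \<bullet> z)"
  have "has_bochner_integral (restrict_space lborel {0..1}) (\<lambda>r. ?c * exp (?a + of_real r * ?c)) (exp (?a + ?c) - exp ?a)"
    by (rule holomorphic_segment_integral[where S=UNIV]) (auto intro!: DERIV_exp continuous_intros)
  then show ?thesis by (simp add: has_bochner_integral_iff inner_simps algebra_simps)
qed

text \<open>The derivative in integrated form: the phase is integrated along the segment from z to z
  - w, and Fubini exchanges this with the integral over \<eta>.\<close>

lemma kernel_segment:
  "integrable (restrict_space lborel {0..1}) (\<lambda>r. kernel t (w # vs) (z - r *\<^sub>R w))"
  "kernel t vs (z - w) - kernel t vs z = (\<integral>r. kernel t (w # vs) (z - r *\<^sub>R w) \<partial>restrict_space lborel {0..1})"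
proof -
  let ?U = "restrict_space lborel {0..1::real}" and ?m = "stable_symbol (R t) s vs"
  interpret U: prob_space ?U by (rule prob_space_unit_interval)
  interpret P: pair_sigma_finite ?U "lborel :: 'a measure" ..
  have [measurable]: "(\<lambda>p. fst p) \<in> ?U \<Otimes>\<^sub>M (lborel :: 'a measure) \<rightarrow>\<^sub>M borel"
    using measurable_compose[OF measurable_fst measurable_restrict_space1[of "\<lambda>x. x" lborel borel "{0..1::real}"], of "lborel :: 'a measure"] by simp
  have cons: "stable_symbol (R t) s (w # vs) \<eta> = \<i> * of_real (\<eta> \<bullet> w) * ?m \<eta>" for \<eta>
    by (simp add: stable_symbol_def mult_ac)
  have int: "integrable (?U \<Otimes>\<^sub>M lborel) (\<lambda>(r, \<eta>). stable_symbol (R t) s (w # vs) \<eta> * exp (- \<i> * of_real (\<eta> \<bullet> (z - r *\<^sub>R w))))"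
  proof (rule P.Fubini_integrable)
    show "AE r in ?U. integrable lborel (\<lambda>\<eta>. case (r, \<eta>) of (r, \<eta>) \<Rightarrow> stable_symbol (R t) s (w # vs) \<eta> * exp (- \<i> * of_real (\<eta> \<bullet> (z - r *\<^sub>R w))))"
      unfolding prod.case by (intro AE_I2 integrable_fourier_integrand stable_symbol_integrable)
    show "integrable ?U (\<lambda>r. \<integral>\<eta>. norm (case (r, \<eta>) of (r, \<eta>) \<Rightarrow> stable_symbol (R t) s (w # vs) \<eta> * exp (- \<i> * of_real (\<eta> \<bullet> (z - r *\<^sub>R w)))) \<partial>lborel)"
      by (simp add: norm_mult)
    show "(\<lambda>(r, \<eta>). stable_symbol (R t) s (w # vs) \<eta> * exp (- \<i> * of_real (\<eta> \<bullet> (z - r *\<^sub>R w)))) \<in> borel_measurable (?U \<Otimes>\<^sub>M lborel)"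
      unfolding case_prod_beta' inner_diff_right inner_scaleR_right by measurable
  qed
  have f: "integrable ?U (\<lambda>r. fourier (stable_symbol (R t) s (w # vs)) (z - r *\<^sub>R w))"
    using P.integrable_fst[OF int] by (simp add: fourier_def)
  then show "integrable ?U (\<lambda>r. kernel t (w # vs) (z - r *\<^sub>R w))"
    unfolding kernel_def by (intro Bochner_Integration.integrable_divide integrable_Re)
  have "fourier ?m (z - w) - fourier ?m z = (\<integral>\<eta>. ?m \<eta> * (exp (- \<i> * of_real (\<eta> \<bullet> (z - w))) - exp (- \<i> * of_real (\<eta> \<bullet> z))) \<partial>lborel)"
    unfolding fourier_def right_diff_distrib
    by (intro Bochner_Integration.integral_diff[symmetric] integrable_fourier_integrand stable_symbol_integrable)
  also have "\<dots> = (\<integral>\<eta>. (\<integral>r. stable_symbol (R t) s (w # vs) \<eta> * exp (- \<i> * of_real (\<eta> \<bullet> (z - r *\<^sub>R w))) \<partial>?U) \<partial>lborel)"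
    unfolding exp_segment cons integral_mult_right_zero[symmetric] by (simp add: mult_ac)
  also have "\<dots> = (\<integral>r. fourier (stable_symbol (R t) s (w # vs)) (z - r *\<^sub>R w) \<partial>?U)"
    unfolding fourier_def by (rule P.Fubini_integral[OF int])
  finally have "Re (fourier ?m (z - w)) - Re (fourier ?m z) = Re (\<integral>r. fourier (stable_symbol (R t) s (w # vs)) (z - r *\<^sub>R w) \<partial>?U)"
    by (metis minus_complex.sel(1))
  also have "\<dots> = (\<integral>r. Re (fourier (stable_symbol (R t) s (w # vs)) (z - r *\<^sub>R w)) \<partial>?U)"
    using f by simp
  finally show "kernel t vs (z - w) - kernel t vs z = (\<integral>r. kernel t (w # vs) (z - r *\<^sub>R w) \<partial>?U)"
    unfolding kernel_def by (simp add: diff_divide_distrib[symmetric])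
qed

text \<open>Dominated convergence in \<theta>; the convergent sequence \<open>\<eta>\<close> is
  bounded, which provides the majorant through the upper ellipticity bound.\<close>

lemma stable_exponent_tendsto:
  assumes "(\<lambda>n. t n) \<longlonglongrightarrow> t0" "(\<lambda>n. \<eta> n) \<longlonglongrightarrow> \<eta>0"
  shows "(\<lambda>n. stable_exponent (R (t n)) s (\<eta> n)) \<longlonglongrightarrow> stable_exponent (R t0) s \<eta>0"
proof -
  let ?U = "restrict_space lborel {0..1::real}"
  interpret U: prob_space ?U by (rule prob_space_unit_interval)
  obtain K where K: "\<And>n. norm (\<eta> n) \<le> K"
    using convergent_imp_bounded[OF assms(2)] by (auto simp: bounded_iff)
  have [measurable]: "(\<lambda>\<theta>. R t \<theta> \<eta>) \<in> borel_measurable ?U" for t \<eta>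
    using measurable_compose[OF _ admissible_measurable[OF R], of "\<lambda>\<theta>. (\<theta>, \<eta>)"] by simp
  have "(\<lambda>n. \<integral>\<theta>. ((norm (R (t n) \<theta> (\<eta> n)))\<^sup>2) powr s \<partial>?U) \<longlonglongrightarrow> (\<integral>\<theta>. ((norm (R t0 \<theta> \<eta>0))\<^sup>2) powr s \<partial>?U)"
  proof (rule integral_dominated_convergence[where w="\<lambda>_. ((c1 * K)\<^sup>2) powr s"])
    show "AE \<theta> in ?U. (\<lambda>n. ((norm (R (t n) \<theta> (\<eta> n)))\<^sup>2) powr s) \<longlonglongrightarrow> ((norm (R t0 \<theta> \<eta>0))\<^sup>2) powr s"
    proof (rule AE_I2)
      fix \<theta>
      have "(\<lambda>n. R (t n) \<theta> (\<eta> n)) \<longlonglongrightarrow> R t0 \<theta> \<eta>0"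
        using continuous_on_tendsto_compose[OF R_cont, of "\<lambda>n. (t n, \<theta>, \<eta> n)" "(t0, \<theta>, \<eta>0)"] assms
        by (simp add: tendsto_Pair)
      then show "(\<lambda>n. ((norm (R (t n) \<theta> (\<eta> n)))\<^sup>2) powr s) \<longlonglongrightarrow> ((norm (R t0 \<theta> \<eta>0))\<^sup>2) powr s"
        using s by (intro tendsto_powr2 tendsto_intros) (auto intro!: always_eventually)
    qed
    show "AE \<theta> in ?U. norm (((norm (R (t n) \<theta> (\<eta> n)))\<^sup>2) powr s) \<le> ((c1 * K)\<^sup>2) powr s" for n
    proof (rule AE_I2)
      fix \<theta>
      have "norm (R (t n) \<theta> (\<eta> n)) \<le> c1 * K"
        using admissibleD(4)[OF R, of "t n" \<theta> "\<eta> n"] mult_left_mono[OF K[of n] c(2)] by linarith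
      then have "((norm (R (t n) \<theta> (\<eta> n)))\<^sup>2) powr s \<le> ((c1 * K)\<^sup>2) powr s"
        using s by (intro powr_mono2 power_mono) auto
      then show "norm (((norm (R (t n) \<theta> (\<eta> n)))\<^sup>2) powr s) \<le> ((c1 * K)\<^sup>2) powr s" by simp
    qed
  qed auto
  then show ?thesis unfolding stable_exponent_def by (intro tendsto_intros)
qed

text \<open>Inversion at the origin, where the symbol is 1 because every \<open>R t \<theta>\<close>
  is linear and so the exponent vanishes.\<close>

lemma integral_kernel: "(\<integral>z. kernel t [] z \<partial>lborel) = 1"
proof -
  let ?m = "stable_symbol (R t) s []"
  have nn: "0 \<le> stable_exponent (R t) s \<eta>" for \<eta> unfolding stable_exponent_def by simp
  have "R t \<theta> 0 = 0" for \<theta> using admissibleD(2)[OF R] linear_0 by blast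
  then have m0: "?m 0 = 1" using s by (simp add: stable_symbol_def stable_exponent_def)
  have fm: "integrable lborel (fourier ?m)"
  proof (rule integrableI_bounded)
    obtain C where w: "weight_norm (s / DIM('a)) ?m \<le> ennreal ((\<Prod>v\<leftarrow>[]. norm (v::'a)) * C)"
      by (rule stable_symbol_bounds[OF c s, of 0, where 'a='a]) (use R in force)
    have "(\<integral>\<^sup>+z. ennreal (norm (fourier ?m z)) \<partial>lborel) \<le> weight_norm (s / DIM('a)) ?m"
      unfolding weight_norm_def
    proof (intro nn_integral_mono ennreal_leI)
      fix z :: 'a
      have "1 \<le> (1 + norm z) powr (s / DIM('a))" using s by (intro ge_one_powr_ge_zero) auto
      then show "norm (fourier ?m z) \<le> (1 + norm z) powr (s / DIM('a)) * norm (fourier ?m z)"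
        using mult_right_mono[of 1 _ "norm (fourier ?m z)"] by simp
    qed
    also note w
    finally show "(\<integral>\<^sup>+z. ennreal (norm (fourier ?m z)) \<partial>lborel) < \<infinity>" by (auto intro: le_less_trans)
  qed measurable
  have "(\<integral>z. fourier ?m z \<partial>lborel) = of_real ((2 * pi) ^ DIM('a)) * ?m 0"
  proof (rule integral_fourier[OF stable_symbol_integrable fm])
    show "norm (?m \<eta>) \<le> 1" for \<eta> using nn by (simp add: stable_symbol_def)
    have "isCont (\<lambda>\<eta>. stable_exponent (R t) s \<eta>) 0"
      unfolding continuous_within_sequentially comp_def using stable_exponent_tendsto[of "\<lambda>_. t" t _ 0] by auto
    then show "isCont ?m 0"
      unfolding stable_symbol_def[abs_def] monomial_symbol_simps by (intro continuous_intros)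
  qed
  then have e: "(\<integral>z. fourier ?m z \<partial>lborel) = of_real ((2 * pi) ^ DIM('a))" by (simp only: m0 mult_1_right)
  have "(\<integral>z. Re (fourier ?m z) \<partial>lborel) = (2 * pi) ^ DIM('a)"
    using fm by (simp add: e)
  then show ?thesis unfolding kernel_def by simp
qed

text \<open>Dominated convergence in frequency: the majorant of the symbols does not depend on
  t.\<close>

lemma kernel_tendsto:
  assumes "t \<longlonglongrightarrow> t0"
  shows "(\<lambda>n. kernel (t n) [] z) \<longlonglongrightarrow> kernel t0 [] z"
proof -
  obtain C where C: "0 \<le> C" "\<And>t \<eta>. norm (stable_symbol (R t) s [] \<eta>) \<le> (\<Prod>v\<leftarrow>[]. norm (v::'a)) * C / (1 + (norm \<eta>)\<^sup>2) ^ DIM('a)"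
    by (rule stable_symbol_bounds[OF c s, of 0, where 'a='a]) (use R in force)
  have "(\<lambda>n. fourier (stable_symbol (R (t n)) s []) z) \<longlonglongrightarrow> fourier (stable_symbol (R t0) s []) z"
  proof (rule fourier_tendsto)
    show "integrable lborel (\<lambda>\<eta>::'a. C * (1 / (1 + (norm \<eta>)\<^sup>2) ^ DIM('a)))"
      by (intro integrable_mult_right integrable_inverse_1_plus_norm_square_power)
    show "norm (stable_symbol (R (t n)) s [] \<eta>) \<le> C * (1 / (1 + (norm \<eta>)\<^sup>2) ^ DIM('a))" for n \<eta>
      using C(2)[of "t n" \<eta>] by simp
    show "(\<lambda>n. stable_symbol (R (t n)) s [] \<eta>) \<longlonglongrightarrow> stable_symbol (R t0) s [] \<eta>" for \<eta>
      unfolding stable_symbol_def by (intro tendsto_intros stable_exponent_tendsto assms)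
  qed measurable
  then show ?thesis unfolding kernel_def by (intro tendsto_intros) auto
qed

end

section \<open>Square root of \<open>Q\<close> and matrix exponential\<close>

lemma symmetric_matrixI:
  fixes A :: "real^'n^'n"
  assumes "\<And>x y. (A *v x) \<bullet> y = x \<bullet> (A *v y)"
  shows "transpose A = A"
proof -
  have "A $ j $ i = A $ i $ j" for i j
  proof -
    have "A $ j $ i = (A *v axis i 1) \<bullet> axis j 1" by (simp add: matrix_vector_mult_basis column_def inner_axis)
    also have "\<dots> = axis i 1 \<bullet> (A *v axis j 1)" by (rule assms)
    also have "\<dots> = A $ i $ j" by (simp add: matrix_vector_mult_basis column_def inner_axis')
    finally show ?thesis .
  qed
  then show ?thesis by (simp add: transpose_def vec_eq_iff)
qed

lemma inner_transpose:
  fixes A :: "real^'n^'n"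
  shows "(A *v x) \<bullet> y = x \<bullet> (transpose A *v y)"
  by (simp add: dot_lmul_matrix[symmetric] inner_commute vector_transpose_matrix)

text \<open>The quadratic form attains a positive minimum on the compact unit sphere. K is enlarged
  to be at least q, so that q^2/K^2 \<le> 1 later.\<close>

lemma sym_pos_def_bounds:
  fixes Q :: "real^'n^'n"
  assumes "sym_pos_def Q"
  obtains q K where "0 < q" "q \<le> K" "\<And>x. q * (norm x)\<^sup>2 \<le> x \<bullet> (Q *v x)" "\<And>x. norm (Q *v x) \<le> K * norm x"
proof -
  obtain k where "0 < k" and k: "\<And>x. norm (Q *v x) \<le> norm x * k"
    using bounded_linear.pos_bounded[OF matrix_vector_mul_bounded_linear[of Q]] by blast
  have ne: "sphere (0::real^'n) 1 \<noteq> {}" by simp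
  have co: "continuous_on (sphere 0 1) (\<lambda>x. x \<bullet> (Q *v x))"
    by (intro continuous_intros bounded_linear.continuous_on[OF matrix_vector_mul_bounded_linear])
  from continuous_attains_inf[OF compact_sphere ne co]
  obtain x0 where x0: "x0 \<in> sphere 0 1" "\<And>x. x \<in> sphere 0 1 \<Longrightarrow> x0 \<bullet> (Q *v x0) \<le> x \<bullet> (Q *v x)"
    by blast
  define q where "q = x0 \<bullet> (Q *v x0)"
  have "x0 \<noteq> 0" using x0(1) by auto
  then have q: "0 < q" using assms by (simp add: sym_pos_def_def q_def)
  have le: "q * (norm x)\<^sup>2 \<le> x \<bullet> (Q *v x)" for x
  proof (cases "x = 0")
    case False
    have "q \<le> (x /\<^sub>R norm x) \<bullet> (Q *v (x /\<^sub>R norm x))"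
      unfolding q_def using False by (intro x0(2)) simp
    also have "\<dots> = (x \<bullet> (Q *v x)) / (norm x)\<^sup>2"
      by (simp add: matrix_vector_mult_scaleR power2_eq_square divide_inverse)
    finally show ?thesis using False by (simp add: pos_le_divide_eq)
  qed simp
  show ?thesis
  proof (rule that[of q "max q k"])
    show "norm (Q *v x) \<le> max q k * norm x" for x
      using k[of x] mult_right_mono[of k "max q k" "norm x"] by (simp add: mult.commute)
  qed (use q le in auto)
qed

text \<open>The square root of \<open>Q\<close> is \<open>\<surd>c (I - Y)\<close> where \<open>Y\<close> is the fixed point of \<open>Y \<mapsto> (A + Y\<^sup>2) / 2\<close> with
  \<open>A = I - Q / c\<close>; this map is a contraction of a small ball as soon as \<open>\<parallel>A\<parallel> < 1\<close>.\<close>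

lemma mat_sqrt_exists:
  fixes Q :: "real^'n^'n"
  assumes Q: "sym_pos_def Q"
  shows "\<exists>R::real^'n^'n. transpose R = R \<and> (\<forall>x. 0 \<le> x \<bullet> (R *v x)) \<and> R ** R = Q"
proof -
  obtain q K where q: "0 < q" "q \<le> K" "\<And>x. q * (norm x)\<^sup>2 \<le> x \<bullet> (Q *v x)" "\<And>x. norm (Q *v x) \<le> K * norm x"
    using sym_pos_def_bounds[OF Q] by metis
  have symQ: "(Q *v x) \<bullet> y = x \<bullet> (Q *v y)" for x y
    using inner_transpose[of Q x y] Q unfolding sym_pos_def_def by metis
  \<comment> \<open>This c minimises 1 - 2 q/c + K^2/c^2, the bound for |x - Q x / c|^2 on unit
    vectors that the two estimates on Q allow; the minimum is 1 - q^2/K^2.\<close>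
  define c where "c = K\<^sup>2 / q"
  have c: "0 < c" using q by (simp add: c_def)
  define A where "A = id_blinfun - (1 / c) *\<^sub>R Blinfun ((*v) Q)"
  have A: "blinfun_apply A x = x - (1 / c) *\<^sub>R (Q *v x)" for x
    unfolding A_def by (simp add: blinfun.diff_left blinfun.scaleR_left bounded_linear_Blinfun_apply matrix_vector_mul_bounded_linear)
  define \<rho> where "\<rho> = sqrt (1 - q\<^sup>2 / K\<^sup>2)"
  have qK: "0 < q\<^sup>2 / K\<^sup>2" "q\<^sup>2 / K\<^sup>2 \<le> 1" using q by (auto simp: power_mono)
  have \<rho>: "0 \<le> \<rho>" "\<rho> < 1" using qK by (auto simp: \<rho>_def)
  have nA: "norm A \<le> \<rho>"
  proof (rule norm_blinfun_bound[OF \<rho>(1)])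
    fix x
    have "(norm (Q *v x))\<^sup>2 \<le> (K * norm x)\<^sup>2" by (intro power_mono q(4)) simp
    then have 1: "(norm (Q *v x))\<^sup>2 / c\<^sup>2 \<le> (K * norm x)\<^sup>2 / c\<^sup>2" by (rule divide_right_mono) simp
    have 2: "2 / c * (q * (norm x)\<^sup>2) \<le> 2 / c * (x \<bullet> (Q *v x))" using c q(3)[of x] by (intro mult_left_mono) auto
    have "(norm (blinfun_apply A x))\<^sup>2 = (norm x)\<^sup>2 - 2 / c * (x \<bullet> (Q *v x)) + (norm (Q *v x))\<^sup>2 / c\<^sup>2"
    proof -
      have "(norm (blinfun_apply A x))\<^sup>2 = x \<bullet> x - (1 / c) * (x \<bullet> (Q *v x)) - ((1 / c) * ((Q *v x) \<bullet> x) - (1 / c) * ((1 / c) * ((Q *v x) \<bullet> (Q *v x))))"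
        unfolding A power2_norm_eq_inner inner_diff_left inner_diff_right inner_scaleR_left inner_scaleR_right using c by (simp add: field_simps)
      moreover have "(Q *v x) \<bullet> x = x \<bullet> (Q *v x)" by (rule inner_commute)
      moreover have alg: "a - (1 / c) * p - ((1 / c) * p - (1 / c) * ((1 / c) * q)) = a - 2 / c * p + q / c\<^sup>2" for a p q
        using c by (simp add: field_simps power2_eq_square)
      ultimately show ?thesis unfolding power2_norm_eq_inner by (simp only: alg)
    qed
    also have "\<dots> \<le> (norm x)\<^sup>2 - 2 / c * (q * (norm x)\<^sup>2) + (K * norm x)\<^sup>2 / c\<^sup>2" using 1 2 by linarith
    also have "\<dots> = (1 - q\<^sup>2 / K\<^sup>2) * (norm x)\<^sup>2"
    proof -
      have h1: "2 / c * q = 2 * (q\<^sup>2 / K\<^sup>2)" by (simp add: c_def power2_eq_square)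
      have h2: "K\<^sup>2 / c\<^sup>2 = q\<^sup>2 / K\<^sup>2" using q by (simp add: c_def power2_eq_square)
      have "2 / c * (q * (norm x)\<^sup>2) = 2 * (q\<^sup>2 / K\<^sup>2) * (norm x)\<^sup>2"
        unfolding h1[symmetric] by simp
      moreover have "(K * norm x)\<^sup>2 / c\<^sup>2 = q\<^sup>2 / K\<^sup>2 * (norm x)\<^sup>2"
        unfolding h2[symmetric] power_mult_distrib by simp
      ultimately show ?thesis by (simp only: left_diff_distrib) simp
    qed
    also have "\<dots> = (\<rho> * norm x)\<^sup>2" using qK by (simp add: \<rho>_def power_mult_distrib)
    finally show "norm (blinfun_apply A x) \<le> \<rho> * norm x" by (rule power2_le_imp_le) (use \<rho> in simp)
  qed
  define w where "w = sqrt (1 - \<rho>)"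
  have w: "0 < w" "w \<le> 1" "w * w = 1 - \<rho>" using \<rho> by (auto simp: w_def)
  \<comment> \<open>The smaller fixed point of r -> (\<rho> + r^2)/2, so that f maps the ball of
    radius r into itself. The same r is a Lipschitz constant of f there.\<close>
  define r where "r = 1 - w"
  have r: "0 \<le> r" "r < 1" "(\<rho> + r * r) / 2 = r"
    using w by (auto simp: r_def field_simps)
  define f where "f Y = (1/2) *\<^sub>R (A + (Y o\<^sub>L Y))" for Y :: "(real^'n) \<Rightarrow>\<^sub>L (real^'n)"
  define S where "S = {Y :: (real^'n) \<Rightarrow>\<^sub>L (real^'n). norm Y \<le> r \<and> (\<forall>x y. blinfun_apply Y x \<bullet> y = x \<bullet> blinfun_apply Y y)}"
  have fS: "f Y \<in> S" if Y: "Y \<in> S" for Y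
  proof -
    have "norm (Y o\<^sub>L Y) \<le> r * r"
      using Y r by (intro order.trans[OF norm_blinfun_compose] mult_mono) (auto simp: S_def)
    then have "norm (A + (Y o\<^sub>L Y)) \<le> \<rho> + r * r"
      using norm_triangle_ineq[of A "Y o\<^sub>L Y"] nA by linarith
    then have "norm (f Y) \<le> (\<rho> + r * r) / 2" by (simp add: f_def)
    moreover have "blinfun_apply (f Y) x \<bullet> y = x \<bullet> blinfun_apply (f Y) y" for x y
      using Y by (simp add: f_def A S_def blinfun.add_left blinfun.scaleR_left inner_simps symQ)
    ultimately show ?thesis using r by (simp add: S_def)
  qed
  have lip: "dist (f Y) (f Z) \<le> r * dist Y Z" if Y: "Y \<in> S" and Z: "Z \<in> S" for Y Z
  proof -
    have eq: "(Y o\<^sub>L Y) - (Z o\<^sub>L Z) = (Y o\<^sub>L (Y - Z)) + ((Y - Z) o\<^sub>L Z)"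
      by (rule blinfun_eqI) (simp add: blinfun.diff_left blinfun.diff_right blinfun.add_left)
    have "norm (Y o\<^sub>L (Y - Z)) \<le> r * norm (Y - Z)"
      using Y by (intro order.trans[OF norm_blinfun_compose] mult_right_mono) (auto simp: S_def)
    moreover have "norm ((Y - Z) o\<^sub>L Z) \<le> norm (Y - Z) * r"
      using Z by (intro order.trans[OF norm_blinfun_compose] mult_left_mono) (auto simp: S_def)
    ultimately have "norm ((Y o\<^sub>L Y) - (Z o\<^sub>L Z)) \<le> 2 * (r * norm (Y - Z))"
      unfolding eq using norm_triangle_ineq[of "Y o\<^sub>L (Y - Z)" "(Y - Z) o\<^sub>L Z"] by (simp add: mult.commute)
    moreover have "f Y - f Z = (1/2) *\<^sub>R ((Y o\<^sub>L Y) - (Z o\<^sub>L Z))" unfolding f_def scaleR_right_diff_distrib[symmetric] by simp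
    ultimately show ?thesis by (simp add: dist_norm)
  qed
  have "closed S"
  proof -
    have "S = cball 0 r \<inter> (\<Inter>x. \<Inter>y. {Y :: (real^'n) \<Rightarrow>\<^sub>L (real^'n). blinfun_apply Y x \<bullet> y = x \<bullet> blinfun_apply Y y})" by (auto simp: S_def dist_norm)
    also have "closed \<dots>"
      by (intro closed_Int closed_cball closed_INT ballI closed_Collect_eq continuous_intros)
    finally show ?thesis .
  qed
  moreover have "S \<noteq> {}" using r(1) by (auto simp: S_def intro!: exI[of _ 0])
  moreover have "f ` S \<subseteq> S" using fS by blast
  ultimately obtain Y where Y: "Y \<in> S" "f Y = Y"
    using Banach_fix[of S r f] r(1,2) lip by (auto simp: complete_eq_closed)
  \<comment> \<open>The fixed-point equation, read as I - A = (I - Y)^2; multiplied by c it says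
    that the square of \<open>R\<close> is \<open>Q\<close>.\<close>
  have AY: "blinfun_apply A x = 2 *\<^sub>R blinfun_apply Y x - blinfun_apply Y (blinfun_apply Y x)" for x
  proof -
    have "2 *\<^sub>R blinfun_apply Y x = 2 *\<^sub>R blinfun_apply (f Y) x" by (simp add: Y)
    also have "\<dots> = blinfun_apply A x + blinfun_apply Y (blinfun_apply Y x)" by (simp add: f_def blinfun.add_left blinfun.scaleR_left)
    finally show ?thesis by (simp add: algebra_simps)
  qed
  define R where "R = matrix (\<lambda>x. sqrt c *\<^sub>R (x - blinfun_apply Y x))"
  have lin: "linear (\<lambda>x. sqrt c *\<^sub>R (x - blinfun_apply Y x))"
    by (intro linearI) (auto simp: blinfun.add_right blinfun.scaleR_right algebra_simps)
  have R: "R *v x = sqrt c *\<^sub>R (x - blinfun_apply Y x)" for x unfolding R_def by (rule matrix_works) (simp add: linear_matrix_vector_mul_eq lin)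
  have "transpose R = R"
    using Y(1) by (intro symmetric_matrixI) (auto simp: R S_def inner_simps)
  moreover have "0 \<le> x \<bullet> (R *v x)" for x
  proof -
    have "x \<bullet> blinfun_apply Y x \<le> norm x * (norm Y * norm x)"
      using norm_cauchy_schwarz[of x "blinfun_apply Y x"] norm_blinfun[of Y x] by (meson mult_left_mono norm_ge_zero order.trans)
    also have "\<dots> \<le> norm x * (1 * norm x)"
      using Y(1) r by (intro mult_left_mono mult_right_mono) (auto simp: S_def)
    finally have "x \<bullet> blinfun_apply Y x \<le> x \<bullet> x" by (simp add: norm_eq_sqrt_inner)
    then show ?thesis using c by (simp add: R inner_diff_right)
  qed
  moreover have "R ** R = Q"
  proof -
    have "(R ** R) *v x = Q *v x" for x
    proof -
      have "(R ** R) *v x = (sqrt c * sqrt c) *\<^sub>R (x - blinfun_apply A x)"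
        unfolding matrix_vector_mul_assoc[symmetric] R AY
        by (simp add: blinfun.scaleR_right blinfun.diff_right algebra_simps scaleR_2)
      also have "\<dots> = Q *v x" using c by (simp add: A)
      finally show ?thesis .
    qed
    then show ?thesis by (simp add: matrix_eq)
  qed
  ultimately show ?thesis by blast
qed

text \<open>Existence of a root makes the choice in \<open>mat_sqrt\<close> meaningful, and its
  symmetry moves one factor across the inner product. The size of \<open>mat_sqrt Q\<close> can then
  be read off the quadratic form of \<open>Q\<close>.\<close>

lemma norm_mat_sqrt:
  fixes Q :: "real^'n^'n"
  assumes Q: "sym_pos_def Q"
  shows "(norm (mat_sqrt Q *v x))\<^sup>2 = x \<bullet> (Q *v x)"
proof -
  have R: "transpose (mat_sqrt Q) = mat_sqrt Q \<and> (\<forall>x. 0 \<le> x \<bullet> (mat_sqrt Q *v x)) \<and> mat_sqrt Q ** mat_sqrt Q = Q"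
    unfolding mat_sqrt_def by (rule someI_ex[OF mat_sqrt_exists[OF Q]])
  have "(norm (mat_sqrt Q *v x))\<^sup>2 = x \<bullet> (mat_sqrt Q *v (mat_sqrt Q *v x))"
    unfolding power2_norm_eq_inner using inner_transpose[of "mat_sqrt Q" x "mat_sqrt Q *v x"] R by simp
  then show ?thesis using R by (simp add: matrix_vector_mul_assoc)
qed

lemma mat_sqrt_bounds:
  fixes Q :: "real^'n^'n"
  assumes Q: "sym_pos_def Q"
  obtains q K where "0 < q" "0 < K" "\<And>x. q * norm x \<le> norm (mat_sqrt Q *v x)" "\<And>x. norm (mat_sqrt Q *v x) \<le> K * norm x"
proof -
  obtain q k where q: "0 < q" "q \<le> k" "\<And>x. q * (norm x)\<^sup>2 \<le> x \<bullet> (Q *v x)" "\<And>x. norm (Q *v x) \<le> k * norm x"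
    using sym_pos_def_bounds[OF Q] by metis
  show ?thesis
  proof (rule that[of "sqrt q" "sqrt k"])
    fix x
    have "(sqrt q * norm x)\<^sup>2 \<le> (norm (mat_sqrt Q *v x))\<^sup>2"
      using q by (simp add: norm_mat_sqrt[OF Q] power_mult_distrib)
    then show "sqrt q * norm x \<le> norm (mat_sqrt Q *v x)" by (rule power2_le_imp_le) simp
    have "x \<bullet> (Q *v x) \<le> norm x * (k * norm x)"
      using norm_cauchy_schwarz[of x "Q *v x"] q(4)[of x] by (meson mult_left_mono norm_ge_zero order.trans)
    moreover have "(sqrt k)\<^sup>2 = k" using q by simp
    ultimately have "(norm (mat_sqrt Q *v x))\<^sup>2 \<le> (sqrt k * norm x)\<^sup>2"
      unfolding norm_mat_sqrt[OF Q] power_mult_distrib by (simp add: power2_eq_square mult_ac)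
    then show "norm (mat_sqrt Q *v x) \<le> sqrt k * norm x" by (rule power2_le_imp_le) (use q in simp)
  qed (use q in auto)
qed

definition mat_pow :: "real^'n^'n \<Rightarrow> nat \<Rightarrow> real^'n^'n" where
  "mat_pow A k = ((**) A ^^ k) (mat 1)"

lemma mat_pow_simps: "mat_pow A 0 = mat 1" "mat_pow A (Suc k) = A ** mat_pow A k"
  by (simp_all add: mat_pow_def)

lemma mat_pow_scale: "((**) (c *\<^sub>R A) ^^ k) (mat 1) = c ^ k *\<^sub>R mat_pow A k"
  by (induction k) (simp_all add: mat_pow_simps matrix_matrix_mult_def vec_eq_iff sum_distrib_left mult_ac)

lemma mat_pow_entry:
  fixes A :: "real^'n^'n"
  obtains K where "0 < K" "\<And>x. norm (A *v x) \<le> K * norm x" "\<And>k i j. \<bar>mat_pow A k $ i $ j\<bar> \<le> K ^ k"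
proof -
  obtain K where K: "0 < K" "\<And>x. norm (A *v x) \<le> norm x * K"
    using bounded_linear.pos_bounded[OF matrix_vector_mul_bounded_linear[of A]] by blast
  have le: "norm (mat_pow A k *v x) \<le> K ^ k * norm x" for k x
  proof (induction k)
    case (Suc k)
    have "norm (mat_pow A (Suc k) *v x) \<le> norm (mat_pow A k *v x) * K"
      using K(2)[of "mat_pow A k *v x"] by (simp add: mat_pow_simps matrix_vector_mul_assoc)
    also have "\<dots> \<le> K ^ k * norm x * K" using K(1) by (intro mult_right_mono Suc) auto
    finally show ?case by (simp add: mult_ac)
  qed (simp add: mat_pow_simps)
  show ?thesis
  proof (rule that[OF K(1)])
    show "norm (A *v x) \<le> K * norm x" for x using K(2)[of x] by (simp add: mult.commute)
    fix k i j
    have "\<bar>mat_pow A k $ i $ j\<bar> = \<bar>(mat_pow A k *v axis j 1) $ i\<bar>" by (simp add: matrix_vector_mult_basis column_def)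
    also have "\<dots> \<le> norm (mat_pow A k *v axis j 1)" by (rule component_le_norm_cart)
    also have "\<dots> \<le> K ^ k" using le[of k "axis j 1"] by simp
    finally show "\<bar>mat_pow A k $ i $ j\<bar> \<le> K ^ k" .
  qed
qed

text \<open>Entrywise the exponential of x A is a scalar power series in x, so that termwise
  differentiation of real series applies.\<close>

lemma mat_exp_entry:
  fixes A :: "real^'n^'n"
  shows "summable (\<lambda>k. mat_pow A k $ i $ j / fact k * x ^ k)"
    "mat_exp (x *\<^sub>R A) $ i $ j = (\<Sum>k. mat_pow A k $ i $ j / fact k * x ^ k)"
proof -
  obtain K where K: "0 < K" "\<And>k i j. \<bar>mat_pow A k $ i $ j\<bar> \<le> K ^ k" using mat_pow_entry[of A] by metis
  show s: "summable (\<lambda>k. mat_pow A k $ i $ j / fact k * x ^ k)" for i j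
  proof (rule summable_comparison_test'[OF summable_exp[of "K * \<bar>x\<bar>"]])
    fix k
    show "norm (mat_pow A k $ i $ j / fact k * x ^ k) \<le> inverse (fact k) * (K * \<bar>x\<bar>) ^ k"
      using mult_right_mono[OF K(2)[of k i j], of "\<bar>x\<bar> ^ k / fact k"]
      by (simp add: abs_mult power_mult_distrib power_abs field_simps)
  qed
  have "(\<lambda>n. (\<Sum>k<n. (1 / fact k) *\<^sub>R (x ^ k *\<^sub>R mat_pow A k))) \<longlonglongrightarrow> (\<chi> i j. \<Sum>k. mat_pow A k $ i $ j / fact k * x ^ k)"
  proof (intro vec_tendstoI)
    fix i j
    show "(\<lambda>n. (\<Sum>k<n. (1 / fact k) *\<^sub>R (x ^ k *\<^sub>R mat_pow A k)) $ i $ j) \<longlonglongrightarrow> (\<chi> i j. \<Sum>k. mat_pow A k $ i $ j / fact k * x ^ k) $ i $ j"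
      using summable_LIMSEQ[OF s[of i j]] by (simp add: mult_ac)
  qed
  then have "mat_exp (x *\<^sub>R A) = (\<chi> i j. \<Sum>k. mat_pow A k $ i $ j / fact k * x ^ k)"
    unfolding mat_exp_def mat_pow_scale by (intro sums_unique[symmetric]) (simp add: sums_def)
  then show "mat_exp (x *\<^sub>R A) $ i $ j = (\<Sum>k. mat_pow A k $ i $ j / fact k * x ^ k)" by simp
qed

lemma mat_exp_0: "mat_exp (0 :: real^'n^'n) = mat 1"
proof -
  have "mat_exp (0 *\<^sub>R (0::real^'n^'n)) $ i $ j = mat 1 $ i $ j" for i j
    unfolding mat_exp_entry(2) by (subst powser_zero) (simp add: mat_pow_simps)
  then show ?thesis by (simp add: vec_eq_iff)
qed

lemma mat_exp_derivative:
  fixes A :: "real^'n^'n"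
  shows "((\<lambda>x. mat_exp (x *\<^sub>R A) $ i $ j) has_real_derivative (A ** mat_exp (x *\<^sub>R A)) $ i $ j) (at x)"
proof -
  have "((\<lambda>x. mat_exp (x *\<^sub>R A) $ i $ j) has_real_derivative (\<Sum>k. diffs (\<lambda>k. mat_pow A k $ i $ j / fact k) k * x ^ k)) (at x)"
    unfolding mat_exp_entry(2) by (rule termdiffs_strong_converges_everywhere[OF mat_exp_entry(1)])
  also have "(\<Sum>k. diffs (\<lambda>k. mat_pow A k $ i $ j / fact k) k * x ^ k) = (\<Sum>k. \<Sum>l\<in>UNIV. A $ i $ l * (mat_pow A k $ l $ j / fact k * x ^ k))"
  proof (rule suminf_cong)
    fix k
    have "diffs (\<lambda>k. mat_pow A k $ i $ j / fact k) k = (A ** mat_pow A k) $ i $ j / fact k"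
      by (simp add: diffs_def mat_pow_simps fact_Suc del: of_nat_Suc)
    then show "diffs (\<lambda>k. mat_pow A k $ i $ j / fact k) k * x ^ k = (\<Sum>l\<in>UNIV. A $ i $ l * (mat_pow A k $ l $ j / fact k * x ^ k))"
      by (simp add: matrix_matrix_mult_def sum_divide_distrib sum_distrib_right mult.assoc)
  qed
  also have "\<dots> = (\<Sum>l\<in>UNIV. \<Sum>k. A $ i $ l * (mat_pow A k $ l $ j / fact k * x ^ k))"
    by (intro suminf_sum summable_mult mat_exp_entry(1))
  also have "\<dots> = (\<Sum>l\<in>UNIV. A $ i $ l * mat_exp (x *\<^sub>R A) $ l $ j)"
    unfolding mat_exp_entry(2) by (intro sum.cong refl suminf_mult mat_exp_entry(1))
  also have "\<dots> = (A ** mat_exp (x *\<^sub>R A)) $ i $ j"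
    by (simp add: matrix_matrix_mult_def)
  finally show ?thesis .
qed

lemma mat_exp_vector_derivative:
  fixes A :: "real^'n^'n"
  shows "((\<lambda>x. mat_exp (x *\<^sub>R A) *v v) has_vector_derivative A *v (mat_exp (x *\<^sub>R A) *v v)) (at x)"
proof -
  have "((\<lambda>x. (mat_exp (x *\<^sub>R A) *v v) $ i) has_real_derivative (A *v (mat_exp (x *\<^sub>R A) *v v)) $ i) (at x)" for i
    unfolding matrix_vector_mul_assoc unfolding matrix_vector_mult_def
    by (auto intro!: derivative_eq_intros mat_exp_derivative)
  then show ?thesis
    unfolding has_vector_derivative_def has_real_derivative_iff_has_vector_derivative
    by (subst has_derivative_componentwise_within) (auto simp: Basis_vec_def inner_axis)
qed

lemma mat_exp_continuous: "continuous_on UNIV (\<lambda>x. mat_exp (x *\<^sub>R A))"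
  unfolding continuous_on_eq_continuous_at[OF open_UNIV]
  by (auto simp: isCont_def intro!: vec_tendstoI DERIV_isCont[OF mat_exp_derivative, unfolded isCont_def])

text \<open>Energy argument for y = exp(x A) v: the derivative 2 y . A y of |y|^2 is at most 2 K
  |y|^2 in absolute value, so exp(2 K x) |y|^2 is nondecreasing and exp(-2 K x) |y|^2
  nonincreasing.\<close>

lemma mat_exp_bounds:
  fixes A :: "real^'n^'n"
  obtains K where "0 < K" "\<And>x v. 0 \<le> x \<Longrightarrow> norm (mat_exp (x *\<^sub>R A) *v v) \<le> exp (K * x) * norm v"
    "\<And>x v. 0 \<le> x \<Longrightarrow> exp (- K * x) * norm v \<le> norm (mat_exp (x *\<^sub>R A) *v v)"
proof -
  obtain K where K: "0 < K" "\<And>x. norm (A *v x) \<le> K * norm x" using mat_pow_entry[of A] by metis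
  have le: "\<bar>y \<bullet> (A *v y)\<bar> \<le> K * (y \<bullet> y)" for y
  proof -
    have "\<bar>y \<bullet> (A *v y)\<bar> \<le> norm y * norm (A *v y)" by (rule Cauchy_Schwarz_ineq2)
    also have "\<dots> \<le> norm y * (K * norm y)" by (intro mult_left_mono K) auto
    also have "\<dots> = K * (y \<bullet> y)" by (simp add: power2_norm_eq_inner[symmetric] power2_eq_square)
    finally show ?thesis .
  qed
  \<comment> \<open>Both monotonicity statements at once: (\<epsilon>, c) = (1, K) gives the lower
    bound and (-1, -K) the upper one.\<close>
  have mono: "0 \<le> \<epsilon> * (exp (2 * c * x) * ((mat_exp (x *\<^sub>R A) *v v) \<bullet> (mat_exp (x *\<^sub>R A) *v v)) - v \<bullet> v)"
    if x: "0 \<le> x" and \<epsilon>: "\<epsilon> * c = K" "\<bar>\<epsilon>\<bar> = 1" for \<epsilon> c x v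
  proof -
    let ?y = "\<lambda>x. mat_exp (x *\<^sub>R A) *v v"
    have "\<epsilon> * (exp (2 * c * 0) * (?y 0 \<bullet> ?y 0)) \<le> \<epsilon> * (exp (2 * c * x) * (?y x \<bullet> ?y x))"
    proof (rule DERIV_nonneg_imp_nondecreasing[OF x])
      fix u :: real
      have d: "(?y has_derivative (\<lambda>h. h *\<^sub>R (A *v ?y u))) (at u)"
        using mat_exp_vector_derivative[of A v u] by (simp add: has_vector_derivative_def)
      have "((\<lambda>u. ?y u \<bullet> ?y u) has_derivative (\<lambda>h. ?y u \<bullet> (h *\<^sub>R (A *v ?y u)) + (h *\<^sub>R (A *v ?y u)) \<bullet> ?y u)) (at u)"
        by (rule has_derivative_inner[OF d d])
      then have "((\<lambda>u. ?y u \<bullet> ?y u) has_real_derivative 2 * (?y u \<bullet> (A *v ?y u))) (at u)"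
        unfolding has_field_derivative_def
        by (rule has_derivative_eq_rhs) (auto simp: fun_eq_iff inner_commute algebra_simps)
      then have "((\<lambda>u. \<epsilon> * (exp (2 * c * u) * (?y u \<bullet> ?y u))) has_real_derivative
          \<epsilon> * (2 * c * exp (2 * c * u) * (?y u \<bullet> ?y u) + exp (2 * c * u) * (2 * (?y u \<bullet> (A *v ?y u))))) (at u)"
        by (auto intro!: derivative_eq_intros)
      moreover have "\<epsilon> * (2 * c * exp (2 * c * u) * (?y u \<bullet> ?y u) + exp (2 * c * u) * (2 * (?y u \<bullet> (A *v ?y u))))
         = 2 * exp (2 * c * u) * ((\<epsilon> * c) * (?y u \<bullet> ?y u) + \<epsilon> * (?y u \<bullet> (A *v ?y u)))" by (simp add: algebra_simps)
      moreover have "\<bar>\<epsilon> * (?y u \<bullet> (A *v ?y u))\<bar> \<le> K * (?y u \<bullet> ?y u)" using le[of "?y u"] \<epsilon> by (simp add: abs_mult)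
      ultimately show "\<exists>y. ((\<lambda>u. \<epsilon> * (exp (2 * c * u) * (?y u \<bullet> ?y u))) has_real_derivative y) (at u) \<and> 0 \<le> y"
        using \<epsilon>(1) by (intro exI conjI) (assumption, simp)
    qed
    then show ?thesis by (simp add: mat_exp_0 algebra_simps)
  qed
  show ?thesis
  proof (rule that[OF K(1)])
    fix x :: real and v :: "real^'n" assume x: "0 \<le> x"
    let ?y = "mat_exp (x *\<^sub>R A) *v v"
    define e where "e = exp (K * x)"
    have e: "0 < e" by (simp add: e_def)
    have e1: "exp (2 * (- K) * x) = inverse (e * e)"
      unfolding e_def exp_add[symmetric] exp_minus[symmetric] by (rule arg_cong[where f=exp]) simp
    have e2: "exp (2 * K * x) = e * e"
      unfolding e_def exp_add[symmetric] by (rule arg_cong[where f=exp]) simp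
    have e3: "exp (- K * x) = inverse e"
      unfolding e_def exp_minus[symmetric] by simp
    have "inverse (e * e) * (?y \<bullet> ?y) \<le> v \<bullet> v"
      using mono[OF x, of "-1" "-K" v] e1 by simp
    then have "?y \<bullet> ?y \<le> (e * e) * (v \<bullet> v)"
      using e by (simp add: field_simps)
    then have "(norm ?y)\<^sup>2 \<le> (e * norm v)\<^sup>2"
      unfolding power_mult_distrib power2_norm_eq_inner by (simp add: power2_eq_square)
    then have "norm ?y \<le> e * norm v" by (rule power2_le_imp_le) (use e in simp)
    then show "norm ?y \<le> exp (K * x) * norm v" unfolding e_def .
    have "v \<bullet> v \<le> (e * e) * (?y \<bullet> ?y)"
      using mono[OF x, of "1" "K" v] e2 by simp
    then have "(norm v)\<^sup>2 \<le> (e * norm ?y)\<^sup>2"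
      unfolding power_mult_distrib power2_norm_eq_inner by (simp add: power2_eq_square)
    then have "norm v \<le> e * norm ?y" by (rule power2_le_imp_le) (use e in simp)
    then show "exp (- K * x) * norm v \<le> norm ?y" unfolding e3 using e by (simp add: field_simps)
  qed
qed

section \<open>Averages of functions against the kernels\<close>

context symbol_family
begin

abbreviation unit_measure :: "real measure" where "unit_measure \<equiv> restrict_space lborel {0..1}"

lemma integrable_bounded_mult:
  fixes f K :: "'a \<Rightarrow> real"
  assumes "integrable lborel K" "f \<in> borel_measurable borel" "\<And>x. \<bar>f x\<bar> \<le> A"
  shows "integrable lborel (\<lambda>z. f z * K z)" "\<bar>\<integral>z. f z * K z \<partial>lborel\<bar> \<le> A * (\<integral>z. \<bar>K z\<bar> \<partial>lborel)"
proof -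
  have [measurable]: "K \<in> borel_measurable borel" "f \<in> borel_measurable borel" using assms by auto
  have A: "0 \<le> A" using assms(3)[of 0] by linarith
  have i: "integrable lborel (\<lambda>z. A * \<bar>K z\<bar>)" using assms(1) by simp
  have le: "norm (f z * K z) \<le> A * \<bar>K z\<bar>" for z
    using assms(3)[of z] by (auto simp: abs_mult intro!: mult_right_mono)
  show "integrable lborel (\<lambda>z. f z * K z)"
    by (rule Bochner_Integration.integrable_bound[OF i]) (use le A in \<open>auto simp: abs_mult\<close>)
  then have "norm (\<integral>z. f z * K z \<partial>lborel) \<le> (\<integral>z. A * \<bar>K z\<bar> \<partial>lborel)"
    by (rule Bochner_Integration.integral_norm_bound_integral[OF _ i]) (use le in auto)
  then show "\<bar>\<integral>z. f z * K z \<partial>lborel\<bar> \<le> A * (\<integral>z. \<bar>K z\<bar> \<partial>lborel)" by simp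
qed

lemma integral_translate_mult:
  fixes f K :: "'a \<Rightarrow> real"
  assumes [measurable]: "f \<in> borel_measurable borel" "K \<in> borel_measurable borel"
  shows "(\<integral>z. f (z + w) * K z \<partial>lborel) = (\<integral>z. f z * K (z - w) \<partial>lborel)"
  using integral_translate[of "\<lambda>z. f z * K (z - w)" w] by simp

text \<open>Translating f by w amounts to translating the kernel by -w, and
  \<open>kernel_segment\<close> writes the change of the kernel as an integral of its derivative.
  Thus f needs to be bounded and measurable only.\<close>

lemma kernel_shift:
  fixes f :: "'a \<Rightarrow> real"
  assumes f[measurable]: "f \<in> borel_measurable borel" and A: "\<And>x. \<bar>f x\<bar> \<le> A"
  shows "integrable unit_measure (\<lambda>r. \<integral>z. f (z + r *\<^sub>R w) * kernel t (w # vs) z \<partial>lborel)"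
    "(\<integral>z. f (z + w) * kernel t vs z \<partial>lborel) - (\<integral>z. f z * kernel t vs z \<partial>lborel)
      = (\<integral>r. (\<integral>z. f (z + r *\<^sub>R w) * kernel t (w # vs) z \<partial>lborel) \<partial>unit_measure)"
proof -
  interpret U: prob_space unit_measure by (rule prob_space_unit_interval)
  interpret P: pair_sigma_finite unit_measure "lborel :: 'a measure" ..
  note tr = integrable_translate_pair[OF kernel_integrable[of t "w # vs"], of "- w"]
  have int: "integrable (unit_measure \<Otimes>\<^sub>M lborel) (\<lambda>(r, z). f z * kernel t (w # vs) (z - r *\<^sub>R w))"
  proof (rule Bochner_Integration.integrable_bound[OF integrable_mult_right[OF tr, of A]])
    have "(\<lambda>p. f (snd p) * (case p of (r, z) \<Rightarrow> kernel t (w # vs) (z + r *\<^sub>R (- w)))) \<in> borel_measurable (unit_measure \<Otimes>\<^sub>M lborel)"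
      using borel_measurable_integrable[OF tr] measurable_compose[OF measurable_snd, of f "lborel :: 'a measure" borel unit_measure]
      by (intro borel_measurable_times) auto
    then show "(\<lambda>(r, z). f z * kernel t (w # vs) (z - r *\<^sub>R w)) \<in> borel_measurable (unit_measure \<Otimes>\<^sub>M lborel)"
      by (simp add: case_prod_beta')
    have "0 \<le> A" using A[of 0] by linarith
    then show "AE p in unit_measure \<Otimes>\<^sub>M lborel. norm (case p of (r, z) \<Rightarrow> f z * kernel t (w # vs) (z - r *\<^sub>R w))
        \<le> norm (A * (case p of (r, z) \<Rightarrow> kernel t (w # vs) (z + r *\<^sub>R (- w))))"
      using A by (intro AE_I2) (auto simp: abs_mult intro!: mult_right_mono)
  qed
  have eq: "(\<integral>z. f (z + r *\<^sub>R w) * kernel t (w # vs) z \<partial>lborel) = (\<integral>z. f z * kernel t (w # vs) (z - r *\<^sub>R w) \<partial>lborel)" for r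
    by (rule integral_translate_mult) auto
  show "integrable unit_measure (\<lambda>r. \<integral>z. f (z + r *\<^sub>R w) * kernel t (w # vs) z \<partial>lborel)"
    unfolding eq using P.integrable_fst[OF int] by simp
  have K: "integrable lborel (\<lambda>z. kernel t vs (z - w))"
    using integrable_translate[OF kernel_integrable[of t vs], of "- w"] by simp
  have "(\<integral>z. f (z + w) * kernel t vs z \<partial>lborel) - (\<integral>z. f z * kernel t vs z \<partial>lborel) = (\<integral>z. f z * (kernel t vs (z - w) - kernel t vs z) \<partial>lborel)"
    unfolding right_diff_distrib integral_translate_mult[OF f kernel_measurable1]
    by (intro Bochner_Integration.integral_diff[symmetric] integrable_bounded_mult[OF _ f A] K kernel_integrable)
  also have "\<dots> = (\<integral>z. (\<integral>r. f z * kernel t (w # vs) (z - r *\<^sub>R w) \<partial>unit_measure) \<partial>lborel)"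
    unfolding kernel_segment(2) by simp
  also have "\<dots> = (\<integral>r. (\<integral>z. f z * kernel t (w # vs) (z - r *\<^sub>R w) \<partial>lborel) \<partial>unit_measure)"
    by (rule P.Fubini_integral[OF int])
  finally show "(\<integral>z. f (z + w) * kernel t vs z \<partial>lborel) - (\<integral>z. f z * kernel t vs z \<partial>lborel)
      = (\<integral>r. (\<integral>z. f (z + r *\<^sub>R w) * kernel t (w # vs) z \<partial>lborel) \<partial>unit_measure)" unfolding eq .
qed

text \<open>Instead of being mollified, \<open>f\<close> is averaged over the segment in direction \<open>w\<close>: against the average
  the derivative of the kernel becomes a difference of the kernel, by \<open>kernel_shift\<close>.\<close>

lemma kernel_hoelder:
  fixes f :: "'a \<Rightarrow> real"
  assumes f[measurable]: "f \<in> borel_measurable borel" and A: "\<And>x. \<bar>f x\<bar> \<le> A"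
    and H: "\<And>x y. norm (x - y) \<le> 1 \<Longrightarrow> \<bar>f x - f y\<bar> \<le> H" and w: "norm w = 1"
  shows "\<bar>\<integral>z. f z * kernel t (w # vs) z \<partial>lborel\<bar> \<le> H * ((\<integral>z. \<bar>kernel t (w # vs) z\<bar> \<partial>lborel) + (\<integral>z. \<bar>kernel t vs z\<bar> \<partial>lborel))"
proof -
  interpret U: prob_space unit_measure by (rule prob_space_unit_interval)
  let ?I = "\<integral>z. f z * kernel t (w # vs) z \<partial>lborel"
  let ?J = "\<lambda>r. \<integral>z. f (z + r *\<^sub>R w) * kernel t (w # vs) z \<partial>lborel"
  have 1: "\<bar>?I - ?J r\<bar> \<le> H * (\<integral>z. \<bar>kernel t (w # vs) z\<bar> \<partial>lborel)" if r: "r \<in> {0..1}" for r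
  proof -
    have m: "(\<lambda>z. f (z + r *\<^sub>R w)) \<in> borel_measurable borel" by measurable
    have "?I - ?J r = (\<integral>z. (f z - f (z + r *\<^sub>R w)) * kernel t (w # vs) z \<partial>lborel)"
      unfolding left_diff_distrib
      by (intro Bochner_Integration.integral_diff[symmetric] integrable_bounded_mult(1)[OF kernel_integrable f A] integrable_bounded_mult(1)[OF kernel_integrable m A])
    moreover have "\<bar>\<dots>\<bar> \<le> H * (\<integral>z. \<bar>kernel t (w # vs) z\<bar> \<partial>lborel)"
      by (rule integrable_bounded_mult(2)[OF kernel_integrable]) (use r w in \<open>auto intro!: H\<close>)
    ultimately show ?thesis by simp
  qed
  have "\<bar>?I - (\<integral>r. ?J r \<partial>unit_measure)\<bar> = \<bar>\<integral>r. ?I - ?J r \<partial>unit_measure\<bar>"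
    using kernel_shift(1)[OF f A] U.prob_space by simp
  also have "\<dots> \<le> (\<integral>r. H * (\<integral>z. \<bar>kernel t (w # vs) z\<bar> \<partial>lborel) \<partial>unit_measure)"
    unfolding real_norm_def[symmetric]
    by (rule Bochner_Integration.integral_norm_bound_integral) (use kernel_shift(1)[OF f A] 1 in auto)
  finally have 2: "\<bar>?I - (\<integral>r. ?J r \<partial>unit_measure)\<bar> \<le> H * (\<integral>z. \<bar>kernel t (w # vs) z\<bar> \<partial>lborel)"
    using U.prob_space by simp
  have m: "(\<lambda>z. f (z + w)) \<in> borel_measurable borel" by measurable
  have "(\<integral>r. ?J r \<partial>unit_measure) = (\<integral>z. (f (z + w) - f z) * kernel t vs z \<partial>lborel)"
    unfolding kernel_shift(2)[OF f A, symmetric] left_diff_distrib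
    by (intro Bochner_Integration.integral_diff[symmetric] integrable_bounded_mult(1)[OF kernel_integrable f A] integrable_bounded_mult(1)[OF kernel_integrable m A])
  moreover have "\<bar>\<dots>\<bar> \<le> H * (\<integral>z. \<bar>kernel t vs z\<bar> \<partial>lborel)"
    by (rule integrable_bounded_mult(2)[OF kernel_integrable]) (use w in \<open>auto intro!: H\<close>)
  ultimately have "\<bar>\<integral>r. ?J r \<partial>unit_measure\<bar> \<le> H * (\<integral>z. \<bar>kernel t vs z\<bar> \<partial>lborel)" by simp
  with 2 show ?thesis unfolding distrib_left by linarith
qed

end

section \<open>Smoothing estimates for the semigroup\<close>

text \<open>\<open>E t\<close> stands for exp(-t B). Its norm is bounded by M for times in [0, T]
  only, which is how T enters the constants.\<close>

locale ou_kernel = symbol_family R s c0 c1 for R :: "real \<Rightarrow> real \<Rightarrow> 'a::euclidean_space \<Rightarrow> 'a" and s c0 c1 +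
  fixes E :: "real \<Rightarrow> 'a \<Rightarrow> 'a" and T M :: real
  assumes T: "0 < T" and E_linear: "\<And>t. linear (E t)" and E_cont: "continuous_on UNIV (\<lambda>(t, x). E t x)"
    and E_bound: "\<And>t x. 0 \<le> t \<Longrightarrow> t \<le> T \<Longrightarrow> norm (E t x) \<le> M * norm x" and M: "1 \<le> M" and E_0: "\<And>x. E 0 x = x"
begin

lemma E_simps: "E t (x + y) = E t x + E t y" "E t (r *\<^sub>R x) = r *\<^sub>R E t x"
  using E_linear by (auto simp: linear_add linear_scale)

lemma E_tendsto:
  assumes "t \<longlonglongrightarrow> t0" "x \<longlonglongrightarrow> x0"
  shows "(\<lambda>n. E (t n) (x n)) \<longlonglongrightarrow> E t0 x0"
  using continuous_on_tendsto_compose[OF E_cont, of "\<lambda>n. (t n, x n)" "(t0, x0)"] assms by (simp add: tendsto_Pair)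

lemma E_measurable: "(\<lambda>p. E (fst p) (snd p)) \<in> borel_measurable (borel \<Otimes>\<^sub>M borel)"
  using borel_measurable_continuous_onI[OF E_cont] by (simp add: borel_prod case_prod_beta')

lemma E_measurable1: "(\<lambda>t. E t h) \<in> borel_measurable borel"
  using measurable_compose[OF _ E_measurable, of "\<lambda>t. (t, h)"] by simp

lemma prod_list_E:
  assumes "0 \<le> t" "t \<le> T"
  shows "(\<Prod>v\<leftarrow>map (E t) hs. norm v) \<le> M ^ length hs * (\<Prod>h\<leftarrow>hs. norm h)"
proof (induction hs)
  case (Cons h hs)
  have "norm (E t h) * (\<Prod>v\<leftarrow>map (E t) hs. norm v) \<le> (M * norm h) * (M ^ length hs * (\<Prod>h\<leftarrow>hs. norm h))"
    using Cons M by (intro mult_mono E_bound assms prod_list_norm_nonneg) auto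
  then show ?case by (simp add: mult_ac)
qed simp

text \<open>The derivative of P_t f at x along \<open>hs\<close>, written in the variable of the
  unit-width kernel. Each derivative brings a factor t^(-1/(2s)) from the rescaling and, by the
  chain rule, the transported direction \<open>E t h\<close>.\<close>

definition smoothing :: "real \<Rightarrow> 'a list \<Rightarrow> ('a \<Rightarrow> real) \<Rightarrow> 'a \<Rightarrow> real" where
  "smoothing t hs f x = t powr (- (real (length hs) / (2 * s))) *
     (\<integral>z. f (E t x + t powr (1 / (2 * s)) *\<^sub>R z) * kernel t (map (E t) hs) z \<partial>lborel)"

lemma smoothing_linear: "smoothing t ((a *\<^sub>R h + h') # hs) f x = a * smoothing t (h # hs) f x + smoothing t (h' # hs) f x"
  if "f \<in> borel_measurable borel" "\<And>x. \<bar>f x\<bar> \<le> A"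
proof -
  have [measurable]: "f \<in> borel_measurable borel" by fact
  let ?f = "\<lambda>z. f (E t x + t powr (1 / (2 * s)) *\<^sub>R z)"
  have m: "?f \<in> borel_measurable borel" by measurable
  have i: "integrable lborel (\<lambda>z. ?f z * kernel t vs z)" for vs
    by (rule integrable_bounded_mult(1)[OF kernel_integrable m that(2)])
  have "(\<integral>z. ?f z * kernel t (map (E t) ((a *\<^sub>R h + h') # hs)) z \<partial>lborel)
     = (\<integral>z. a * (?f z * kernel t (map (E t) (h # hs)) z) + ?f z * kernel t (map (E t) (h' # hs)) z \<partial>lborel)"
    unfolding list.map E_simps kernel_linear by (simp add: algebra_simps)
  also have "\<dots> = a * (\<integral>z. ?f z * kernel t (map (E t) (h # hs)) z \<partial>lborel) + (\<integral>z. ?f z * kernel t (map (E t) (h' # hs)) z \<partial>lborel)"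
    unfolding Bochner_Integration.integral_add[OF integrable_mult_right[OF i] i] integral_mult_right_zero ..
  finally show ?thesis unfolding smoothing_def by (simp add: algebra_simps)
qed

lemma smoothing_segment:
  assumes f: "f \<in> borel_measurable borel" "\<And>x. \<bar>f x\<bar> \<le> A" and t: "0 < t"
  shows "integrable unit_measure (\<lambda>r. smoothing t (h # hs) f (x + r *\<^sub>R h))"
    "smoothing t hs f (x + h) - smoothing t hs f x = (\<integral>r. smoothing t (h # hs) f (x + r *\<^sub>R h) \<partial>unit_measure)"
proof -
  have [measurable]: "f \<in> borel_measurable borel" by fact
  let ?e = "t powr (1 / (2 * s))"
  have e: "0 < ?e" using t by simp
  \<comment> \<open>Moving x by h moves the argument of f by \<open>E t h\<close>; in the kernel
    variable, after division by the width \<open>?e\<close>, this is a shift by w.\<close>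
  define w where "w = (1 / ?e) *\<^sub>R E t h"
  let ?f = "\<lambda>z. f (E t x + ?e *\<^sub>R z)"
  have m: "?f \<in> borel_measurable borel" by measurable
  have ew: "?e *\<^sub>R (z + r *\<^sub>R w) = r *\<^sub>R E t h + ?e *\<^sub>R z" for z r
    using e by (simp add: w_def scaleR_add_right)
  have sh: "?f (z + r *\<^sub>R w) = f (E t (x + r *\<^sub>R h) + ?e *\<^sub>R z)" for z r
    unfolding ew E_simps by (simp add: add.assoc)
  have k: "kernel t (w # map (E t) hs) z = (1 / ?e) * kernel t (map (E t) (h # hs)) z" for z
  proof -
    have z: "kernel t (0 # vs) z = 0" for vs using kernel_linear[of t 1 0 0 vs z] by simp
    show ?thesis using kernel_linear[of t "1 / ?e" "E t h" 0 "map (E t) hs" z] by (simp add: w_def z)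
  qed
  have p: "t powr (- (real (length (h # hs)) / (2 * s))) = t powr (- (real (length hs) / (2 * s))) * (1 / ?e)"
  proof -
    have "1 / ?e = t powr (- (1 / (2 * s)))" by (simp only: powr_minus inverse_eq_divide)
    moreover have "- (real (length (h # hs)) / (2 * s)) = - (real (length hs) / (2 * s)) + - (1 / (2 * s))"
      by (simp add: add_divide_distrib)
    ultimately show ?thesis by (simp only: powr_add)
  qed
  have eq: "smoothing t (h # hs) f (x + r *\<^sub>R h) = t powr (- (real (length hs) / (2 * s))) * (\<integral>z. ?f (z + r *\<^sub>R w) * kernel t (w # map (E t) hs) z \<partial>lborel)" for r
    unfolding smoothing_def p k sh
    by (simp add: mult.left_commute[of "f _"] mult.assoc del: list.map)
  show "integrable unit_measure (\<lambda>r. smoothing t (h # hs) f (x + r *\<^sub>R h))"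
    unfolding eq by (intro integrable_mult_right kernel_shift(1)[OF m f(2)])
  show "smoothing t hs f (x + h) - smoothing t hs f x = (\<integral>r. smoothing t (h # hs) f (x + r *\<^sub>R h) \<partial>unit_measure)"
    unfolding eq integral_mult_right_zero kernel_shift(2)[OF m f(2), symmetric]
    using sh[of _ 1] by (simp add: smoothing_def right_diff_distrib)
qed

text \<open>Sup norm of f times L^1 norm of the kernel; applied below at order 0.\<close>

lemma smoothing_bounded:
  obtains C where "0 \<le> C" "\<And>t hs f x A. 0 < t \<Longrightarrow> t \<le> T \<Longrightarrow> length hs = k \<Longrightarrow> f \<in> borel_measurable borel \<Longrightarrow> (\<And>x. \<bar>f x\<bar> \<le> A) \<Longrightarrow>
     \<bar>smoothing t hs f x\<bar> \<le> C * A * (\<Prod>h\<leftarrow>hs. norm h) * t powr (- (real k / (2 * s)))"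
proof -
  obtain C where C: "0 \<le> C" "\<And>t vs. length vs = k \<Longrightarrow> (\<integral>z. \<bar>kernel t vs z\<bar> \<partial>lborel) \<le> (\<Prod>v\<leftarrow>vs. norm v) * C"
    by (rule kernel_bound[of k]) blast
  show ?thesis
  proof (rule that[of "C * M ^ k"])
    show "0 \<le> C * M ^ k" using C M by simp
    fix t :: real and hs :: "'a list" and f :: "'a \<Rightarrow> real" and x :: 'a and A :: real assume t: "0 < t" "t \<le> T" and hs: "length hs = k" and f[measurable]: "f \<in> borel_measurable borel" and A: "\<And>x. \<bar>f x\<bar> \<le> A"
    have A0: "0 \<le> A" using A[of 0] by linarith
    have m: "(\<lambda>z. f (E t x + t powr (1 / (2 * s)) *\<^sub>R z)) \<in> borel_measurable borel" by measurable
    have "\<bar>\<integral>z. f (E t x + t powr (1 / (2 * s)) *\<^sub>R z) * kernel t (map (E t) hs) z \<partial>lborel\<bar> \<le> A * (\<integral>z. \<bar>kernel t (map (E t) hs) z\<bar> \<partial>lborel)"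
      by (rule integrable_bounded_mult(2)[OF kernel_integrable m A])
    also have "\<dots> \<le> A * ((M ^ k * (\<Prod>h\<leftarrow>hs. norm h)) * C)"
      using C(2)[of "map (E t) hs" t] hs prod_list_E[of t hs] t C(1) A0
      by (intro mult_left_mono order.trans[OF C(2)] mult_right_mono) auto
    finally have "t powr (- (real k / (2 * s))) * \<bar>\<integral>z. f (E t x + t powr (1 / (2 * s)) *\<^sub>R z) * kernel t (map (E t) hs) z \<partial>lborel\<bar>
       \<le> t powr (- (real k / (2 * s))) * (A * ((M ^ k * (\<Prod>h\<leftarrow>hs. norm h)) * C))"
      by (rule mult_left_mono) simp
    also have "\<dots> = C * M ^ k * A * (\<Prod>h\<leftarrow>hs. norm h) * t powr (- (real k / (2 * s)))" by (simp only: mult_ac)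
    finally show "\<bar>smoothing t hs f x\<bar> \<le> C * M ^ k * A * (\<Prod>h\<leftarrow>hs. norm h) * t powr (- (real k / (2 * s)))"
      unfolding smoothing_def abs_mult hs by simp
  qed
qed

text \<open>Over a unit distance of the kernel variable f oscillates by at most A t^(\<alpha>/(2s)),
  which is what \<open>kernel_hoelder\<close> asks for. The bound B secures integrability and stays
  out of the constant.\<close>

lemma smoothing_hoelder:
  assumes \<alpha>: "0 \<le> \<alpha>"
  obtains C where "0 \<le> C" "\<And>t h hs f x A B. 0 < t \<Longrightarrow> t \<le> T \<Longrightarrow> length hs = k \<Longrightarrow> f \<in> borel_measurable borel \<Longrightarrow> (\<And>x. \<bar>f x\<bar> \<le> B) \<Longrightarrow>
     0 \<le> A \<Longrightarrow> (\<And>x y. \<bar>f x - f y\<bar> \<le> A * norm (x - y) powr \<alpha>) \<Longrightarrow>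
     \<bar>smoothing t (h # hs) f x\<bar> \<le> C * A * (\<Prod>h\<leftarrow>h # hs. norm h) * t powr ((\<alpha> - real (Suc k)) / (2 * s))"
proof -
  obtain C where C: "0 \<le> C" "\<And>t vs. length vs = k \<Longrightarrow> (\<integral>z. \<bar>kernel t vs z\<bar> \<partial>lborel) \<le> (\<Prod>v\<leftarrow>vs. norm v) * C"
    by (rule kernel_bound[of k]) blast
  obtain C' where C': "0 \<le> C'" "\<And>t vs. length vs = Suc k \<Longrightarrow> (\<integral>z. \<bar>kernel t vs z\<bar> \<partial>lborel) \<le> (\<Prod>v\<leftarrow>vs. norm v) * C'"
    by (rule kernel_bound[of "Suc k"]) blast
  show ?thesis
  proof (rule that[of "(C' + C) * M ^ Suc k"])
    show "0 \<le> (C' + C) * M ^ Suc k" using C C' M by simp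
    fix t :: real and h :: 'a and hs :: "'a list" and f :: "'a \<Rightarrow> real" and x :: 'a and A B :: real
    assume t: "0 < t" "t \<le> T" and hs: "length hs = k" and f[measurable]: "f \<in> borel_measurable borel" and B: "\<And>x. \<bar>f x\<bar> \<le> B"
      and A: "0 \<le> A" and H: "\<And>x y. \<bar>f x - f y\<bar> \<le> A * norm (x - y) powr \<alpha>"
    let ?e = "t powr (1 / (2 * s))" and ?P = "\<Prod>h\<leftarrow>hs. norm h"
    let ?f = "\<lambda>z. f (E t x + ?e *\<^sub>R z)"
    have m: "?f \<in> borel_measurable borel" by measurable
    have P: "0 \<le> ?P" by (rule prod_list_norm_nonneg)
    have HH: "\<bar>?f y - ?f z\<bar> \<le> A * t powr (\<alpha> / (2 * s))" if "norm (y - z) \<le> 1" for y z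
    proof -
      have "norm (?e *\<^sub>R y - ?e *\<^sub>R z) = ?e * norm (y - z)"
        by (simp add: scaleR_right_diff_distrib[symmetric])
      also have "\<dots> \<le> ?e" using that by (simp add: mult_left_le)
      finally have "norm (?e *\<^sub>R y - ?e *\<^sub>R z) powr \<alpha> \<le> ?e powr \<alpha>" using \<alpha> by (intro powr_mono2) auto
      then have "A * norm (?e *\<^sub>R y - ?e *\<^sub>R z) powr \<alpha> \<le> A * ?e powr \<alpha>" using A by (rule mult_left_mono)
      then show ?thesis using H[of "E t x + ?e *\<^sub>R y" "E t x + ?e *\<^sub>R z"] by (simp add: powr_powr)
    qed
    have main: "\<bar>\<integral>z. ?f z * kernel t (map (E t) (h # hs)) z \<partial>lborel\<bar> \<le> norm (E t h) * (A * t powr (\<alpha> / (2 * s)) * ((C' + C) * (M ^ k * ?P)))"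
    proof (cases "E t h = 0")
      case True
      have "kernel t (0 # vs) z = 0" for vs z using kernel_linear[of t 1 0 0 vs z] by simp
      then show ?thesis using True by simp
    next
      case False
      \<comment> \<open>\<open>kernel_hoelder\<close> works with a unit direction; linearity of the
        kernel in its first direction restores the length.\<close>
      define w where "w = sgn (E t h)"
      have w: "norm w = 1" "E t h = norm (E t h) *\<^sub>R w + 0" using False by (auto simp: w_def norm_sgn sgn_div_norm)
      have z: "kernel t (0 # vs) z = 0" for vs z using kernel_linear[of t 1 0 0 vs z] by simp
      have k: "kernel t (map (E t) (h # hs)) z = norm (E t h) * kernel t (w # map (E t) hs) z" for z
        using kernel_linear[of t "norm (E t h)" w 0 "map (E t) hs" z] w(2) by (simp add: z)
      have "\<bar>\<integral>z. ?f z * kernel t (w # map (E t) hs) z \<partial>lborel\<bar> \<le> A * t powr (\<alpha> / (2 * s)) *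
        ((\<integral>z. \<bar>kernel t (w # map (E t) hs) z\<bar> \<partial>lborel) + (\<integral>z. \<bar>kernel t (map (E t) hs) z\<bar> \<partial>lborel))"
        by (rule kernel_hoelder[OF m B HH w(1)])
      also have "\<dots> \<le> A * t powr (\<alpha> / (2 * s)) * ((M ^ k * ?P) * C' + (M ^ k * ?P) * C)"
      proof (intro mult_left_mono add_mono)
        have le: "(\<Prod>v\<leftarrow>map (E t) hs. norm v) \<le> M ^ k * ?P" using prod_list_E[of t hs] t hs by simp
        show "(\<integral>z. \<bar>kernel t (map (E t) hs) z\<bar> \<partial>lborel) \<le> (M ^ k * ?P) * C"
          by (rule order.trans[OF C(2) mult_right_mono[OF le C(1)]]) (simp add: hs)
        have "(\<integral>z. \<bar>kernel t (w # map (E t) hs) z\<bar> \<partial>lborel) \<le> (\<Prod>v\<leftarrow>w # map (E t) hs. norm v) * C'"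
          by (rule C'(2)) (simp add: hs)
        also have "(\<Prod>v\<leftarrow>w # map (E t) hs. norm v) = (\<Prod>v\<leftarrow>map (E t) hs. norm v)" using w by simp
        also have "\<dots> * C' \<le> (M ^ k * ?P) * C'" by (rule mult_right_mono[OF le C'(1)])
        finally show "(\<integral>z. \<bar>kernel t (w # map (E t) hs) z\<bar> \<partial>lborel) \<le> (M ^ k * ?P) * C'" .
      qed (use A in simp)
      finally have "norm (E t h) * \<bar>\<integral>z. ?f z * kernel t (w # map (E t) hs) z \<partial>lborel\<bar> \<le> norm (E t h) * (A * t powr (\<alpha> / (2 * s)) * ((C' + C) * (M ^ k * ?P)))"
        by (intro mult_left_mono) (auto simp: algebra_simps)
      moreover have "(\<integral>z. ?f z * kernel t (map (E t) (h # hs)) z \<partial>lborel) = norm (E t h) * (\<integral>z. ?f z * kernel t (w # map (E t) hs) z \<partial>lborel)"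
        unfolding k integral_mult_right_zero[symmetric] by (simp add: mult_ac)
      ultimately show ?thesis by (simp add: abs_mult)
    qed
    have "\<bar>smoothing t (h # hs) f x\<bar> \<le> t powr (- (real (Suc k) / (2 * s))) * (norm (E t h) * (A * t powr (\<alpha> / (2 * s)) * ((C' + C) * (M ^ k * ?P))))"
      unfolding smoothing_def abs_mult using main hs by (simp add: mult_left_mono del: list.map)
    also have "\<dots> \<le> t powr (- (real (Suc k) / (2 * s))) * ((M * norm h) * (A * t powr (\<alpha> / (2 * s)) * ((C' + C) * (M ^ k * ?P))))"
      using A C C' M P t by (intro mult_left_mono mult_right_mono E_bound mult_nonneg_nonneg) auto
    also have "\<dots> = (C' + C) * M ^ Suc k * A * (\<Prod>h\<leftarrow>h # hs. norm h) * (t powr (- (real (Suc k) / (2 * s))) * t powr (\<alpha> / (2 * s)))"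
      by simp
    also have "t powr (- (real (Suc k) / (2 * s))) * t powr (\<alpha> / (2 * s)) = t powr ((\<alpha> - real (Suc k)) / (2 * s))"
      unfolding powr_add[symmetric] by (simp add: diff_divide_distrib)
    finally show "\<bar>smoothing t (h # hs) f x\<bar> \<le> (C' + C) * M ^ Suc k * A * (\<Prod>h\<leftarrow>h # hs. norm h) * t powr ((\<alpha> - real (Suc k)) / (2 * s))" .
  qed
qed

text \<open>The elapsed time \<tau> is fixed and only the data and the base point move, so a
  multiple of the modulus of the kernel dominates.\<close>

lemma smoothing_tendsto:
  assumes g: "continuous_on UNIV (\<lambda>(t, x). g t x)" and A: "\<And>t x. \<bar>g t x\<bar> \<le> A" and t: "t \<longlonglongrightarrow> t0" and x: "x \<longlonglongrightarrow> x0"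
  shows "(\<lambda>n. smoothing \<tau> hs (g (t n)) (x n)) \<longlonglongrightarrow> smoothing \<tau> hs (g t0) x0"
proof -
  let ?K = "kernel \<tau> (map (E \<tau>) hs)"
  have gm: "(\<lambda>z. g t (y + c *\<^sub>R z)) \<in> borel_measurable borel" for t y c
  proof -
    have "continuous_on UNIV (\<lambda>z. (t, y + c *\<^sub>R z))" by (intro continuous_intros)
    from continuous_on_compose2[OF g this] show ?thesis by (intro borel_measurable_continuous_onI) simp
  qed
  have "(\<lambda>n. \<integral>z. g (t n) (E \<tau> (x n) + \<tau> powr (1 / (2 * s)) *\<^sub>R z) * ?K z \<partial>lborel) \<longlonglongrightarrow> (\<integral>z. g t0 (E \<tau> x0 + \<tau> powr (1 / (2 * s)) *\<^sub>R z) * ?K z \<partial>lborel)"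
  proof (rule integral_dominated_convergence[where w="\<lambda>z. A * \<bar>?K z\<bar>"])
    show "integrable lborel (\<lambda>z. A * \<bar>?K z\<bar>)" using kernel_integrable by (intro integrable_mult_right integrable_abs)
    show "AE z in lborel. (\<lambda>n. g (t n) (E \<tau> (x n) + \<tau> powr (1 / (2 * s)) *\<^sub>R z) * ?K z) \<longlonglongrightarrow> g t0 (E \<tau> x0 + \<tau> powr (1 / (2 * s)) *\<^sub>R z) * ?K z"
    proof (rule AE_I2)
      fix z
      have "(\<lambda>n. (t n, E \<tau> (x n) + \<tau> powr (1 / (2 * s)) *\<^sub>R z)) \<longlonglongrightarrow> (t0, E \<tau> x0 + \<tau> powr (1 / (2 * s)) *\<^sub>R z)"
        by (intro tendsto_intros t E_tendsto x)
      from continuous_on_tendsto_compose[OF g this]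
      show "(\<lambda>n. g (t n) (E \<tau> (x n) + \<tau> powr (1 / (2 * s)) *\<^sub>R z) * ?K z) \<longlonglongrightarrow> g t0 (E \<tau> x0 + \<tau> powr (1 / (2 * s)) *\<^sub>R z) * ?K z"
        by (intro tendsto_intros) auto
    qed
    show "AE z in lborel. norm (g (t n) (E \<tau> (x n) + \<tau> powr (1 / (2 * s)) *\<^sub>R z) * ?K z) \<le> A * \<bar>?K z\<bar>" for n
      using A by (intro AE_I2) (auto simp: abs_mult intro!: mult_right_mono)
  qed (use gm in \<open>auto intro!: borel_measurable_times\<close>)
  then show ?thesis unfolding smoothing_def by (intro tendsto_intros)
qed

text \<open>Joint in the elapsed time and the point, as required by Fubini in
  \<open>duhamel_segment\<close>.\<close>

lemma smoothing_measurable: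
  assumes g: "continuous_on UNIV (\<lambda>(t, x). g t x)"
  shows "(\<lambda>p. smoothing (fst p) hs (g (t - fst p)) (snd p)) \<in> borel_measurable (borel \<Otimes>\<^sub>M borel)"
proof -
  have gm: "(\<lambda>p. g (fst p) (snd p)) \<in> borel_measurable (borel \<Otimes>\<^sub>M borel)"
    using borel_measurable_continuous_onI[OF g] by (simp add: borel_prod case_prod_beta')
  let ?B = "(borel \<Otimes>\<^sub>M borel) \<Otimes>\<^sub>M (lborel :: 'a measure) :: ((real \<times> 'a) \<times> 'a) measure"
  have 1: "(\<lambda>p. fst (fst p)) \<in> ?B \<rightarrow>\<^sub>M borel" "(\<lambda>p. snd (fst p)) \<in> ?B \<rightarrow>\<^sub>M borel" "(\<lambda>p. snd p) \<in> ?B \<rightarrow>\<^sub>M borel"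
    by measurable
  have 2: "(\<lambda>p. E (fst (fst p)) (snd (fst p)) + fst (fst p) powr (1 / (2 * s)) *\<^sub>R snd p) \<in> borel_measurable ?B"
  proof (intro borel_measurable_add borel_measurable_scaleR)
    show "(\<lambda>p. E (fst (fst p)) (snd (fst p))) \<in> borel_measurable ?B"
      using measurable_compose[OF measurable_Pair[OF 1(1) 1(2)] E_measurable] by simp
    show "(\<lambda>p. fst (fst p) powr (1 / (2 * s))) \<in> borel_measurable ?B" using 1(1) by measurable
  qed (rule 1(3))
  have 3: "(\<lambda>p. g (t - fst (fst p)) (E (fst (fst p)) (snd (fst p)) + fst (fst p) powr (1 / (2 * s)) *\<^sub>R snd p)) \<in> borel_measurable ?B"
    using measurable_compose[OF measurable_Pair[OF borel_measurable_diff[OF borel_measurable_const[of t] 1(1)] 2] gm] by simp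
  have 4: "(\<lambda>p. kernel (fst (fst p)) (map (E (fst (fst p))) hs) (snd p)) \<in> borel_measurable ?B"
    using measurable_compose[OF measurable_Pair[OF 1(1) 1(3)] kernel_measurable[of hs E, OF E_measurable1]] by simp
  show ?thesis unfolding smoothing_def
    by (intro borel_measurable_times lborel.borel_measurable_lebesgue_integral)
      (use borel_measurable_times[OF 3 4] in \<open>simp_all add: case_prod_beta'\<close>)
qed

end

section \<open>The Duhamel integral\<close>

definition difference :: "'a::plus \<Rightarrow> ('a \<Rightarrow> real) \<Rightarrow> 'a \<Rightarrow> real" where
  "difference h f x = f (x + h) - f x"

lemma integral_norm_bound_integral_AE:
  fixes f :: "'a \<Rightarrow> 'b::{banach,second_countable_topology}"
  assumes "integrable M f" "integrable M g" "AE x in M. norm (f x) \<le> g x"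
  shows "norm (\<integral>x. f x \<partial>M) \<le> (\<integral>x. g x \<partial>M)"
proof -
  have "norm (\<integral>x. f x \<partial>M) \<le> (\<integral>x. norm (f x) \<partial>M)" by (rule integral_norm_bound)
  also have "\<dots> \<le> (\<integral>x. g x \<partial>M)" using assms by (intro integral_mono_AE) auto
  finally show ?thesis .
qed

context ou_kernel
begin

text \<open>The data live on all of time, so that t - \<tau> needs no side condition;
  \<open>source_clamp\<close> produces them from [0, T]. At \<alpha> = 0 the last clause bounds the
  oscillation of \<open>g t\<close> by A.\<close>

definition source :: "real \<Rightarrow> real \<Rightarrow> (real \<Rightarrow> 'a \<Rightarrow> real) \<Rightarrow> bool" where
  "source \<alpha> A g \<longleftrightarrow> continuous_on UNIV (\<lambda>(t, x). g t x) \<and> 0 \<le> A \<and> (\<forall>t x. \<bar>g t x\<bar> \<le> A) \<and>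
     (\<forall>t x y. \<bar>g t x - g t y\<bar> \<le> A * norm (x - y) powr \<alpha>)"

lemma sourceD:
  assumes "source \<alpha> A g"
  shows "continuous_on UNIV (\<lambda>(t, x). g t x)" "0 \<le> A" "\<bar>g t x\<bar> \<le> A" "\<bar>g t x - g t y\<bar> \<le> A * norm (x - y) powr \<alpha>"
    "g t \<in> borel_measurable borel"
proof -
  show 1: "continuous_on UNIV (\<lambda>(t, x). g t x)" and "0 \<le> A" "\<bar>g t x\<bar> \<le> A" "\<bar>g t x - g t y\<bar> \<le> A * norm (x - y) powr \<alpha>"
    using assms by (auto simp: source_def)
  have "continuous_on UNIV (\<lambda>x. (t, x))" by (intro continuous_intros)
  from continuous_on_compose2[OF 1 this] show "g t \<in> borel_measurable borel"
    by (intro borel_measurable_continuous_onI) simp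
qed

text \<open>Order 0 is separate: without a derivative the estimate is the sup bound, with no power
  of time in place of \<tau>^(\<alpha>/(2s)).\<close>

definition decay_exponent :: "real \<Rightarrow> nat \<Rightarrow> real" where
  "decay_exponent \<alpha> k = (if k = 0 then 0 else (\<alpha> - real k) / (2 * s))"

text \<open>-1 is the threshold of integrability at time 0; derivatives of every order below
  \<alpha> + 2s therefore pass under the Duhamel integral.\<close>

lemma decay_exponent_gt: "real k < \<alpha> + 2 * s \<Longrightarrow> -1 < decay_exponent \<alpha> k"
  using s by (auto simp: decay_exponent_def field_simps)

lemma smoothing_source_bound:
  assumes \<alpha>: "0 \<le> \<alpha>"
  obtains C where "0 \<le> C" "\<And>\<tau> hs g t x A. 0 < \<tau> \<Longrightarrow> \<tau> \<le> T \<Longrightarrow> length hs = k \<Longrightarrow> source \<alpha> A g \<Longrightarrow>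
     \<bar>smoothing \<tau> hs (g t) x\<bar> \<le> C * A * (\<Prod>h\<leftarrow>hs. norm h) * \<tau> powr decay_exponent \<alpha> k"
proof (cases k)
  case 0
  show ?thesis
  proof (rule smoothing_bounded[of k], rule that)
    fix C :: real and \<tau> :: real and hs :: "'a list" and g :: "real \<Rightarrow> 'a \<Rightarrow> real" and t :: real and x :: 'a and A :: real
    assume C: "\<And>t hs f x A. 0 < t \<Longrightarrow> t \<le> T \<Longrightarrow> length hs = k \<Longrightarrow> f \<in> borel_measurable borel \<Longrightarrow> (\<And>x. \<bar>f x\<bar> \<le> A) \<Longrightarrow>
     \<bar>smoothing t hs f x\<bar> \<le> C * A * (\<Prod>h\<leftarrow>hs. norm h) * t powr (- (real k / (2 * s)))"
     and "0 < \<tau>" "\<tau> \<le> T" "length hs = k" and g: "source \<alpha> A g"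
    then show "\<bar>smoothing \<tau> hs (g t) x\<bar> \<le> C * A * (\<Prod>h\<leftarrow>hs. norm h) * \<tau> powr decay_exponent \<alpha> k"
      using C[of \<tau> hs "g t" A x] sourceD[OF g] 0 by (simp add: decay_exponent_def)
  qed
next
  case (Suc k')
  show ?thesis
  proof (rule smoothing_hoelder[OF \<alpha>, of k'], rule that)
    fix C :: real and \<tau> :: real and hs :: "'a list" and g :: "real \<Rightarrow> 'a \<Rightarrow> real" and t :: real and x :: 'a and A :: real
    assume C: "\<And>t h hs f x A B. 0 < t \<Longrightarrow> t \<le> T \<Longrightarrow> length hs = k' \<Longrightarrow> f \<in> borel_measurable borel \<Longrightarrow> (\<And>x. \<bar>f x\<bar> \<le> B) \<Longrightarrow>
     0 \<le> A \<Longrightarrow> (\<And>x y. \<bar>f x - f y\<bar> \<le> A * norm (x - y) powr \<alpha>) \<Longrightarrow>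
     \<bar>smoothing t (h # hs) f x\<bar> \<le> C * A * (\<Prod>h\<leftarrow>h # hs. norm h) * t powr ((\<alpha> - real (Suc k')) / (2 * s))"
     and \<tau>: "0 < \<tau>" "\<tau> \<le> T" and hs: "length hs = k" and g: "source \<alpha> A g"
    obtain h hs' where eq: "hs = h # hs'" "length hs' = k'" using hs Suc by (cases hs) auto
    show "\<bar>smoothing \<tau> hs (g t) x\<bar> \<le> C * A * (\<Prod>h\<leftarrow>hs. norm h) * \<tau> powr decay_exponent \<alpha> k"
      using C[OF \<tau> eq(2) sourceD(5)[OF g, of t] sourceD(3)[OF g, of t] sourceD(2)[OF g] sourceD(4)[OF g, of t], of h x]
      unfolding eq(1) decay_exponent_def Suc by simp
  qed
qed

lemma smoothing_time_measurable:
  assumes "source \<alpha> A g"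
  shows "(\<lambda>\<tau>. smoothing \<tau> hs (g (t - \<tau>)) x) \<in> borel_measurable borel"
  using measurable_compose[OF _ smoothing_measurable[OF sourceD(1)[OF assms], of hs t], of "\<lambda>\<tau>. (\<tau>, x)" borel] by simp

text \<open>The integration variable is the elapsed time \<tau> = t - r, which puts the singularity
  of the smoothing bound at the fixed point 0.\<close>

definition duhamel :: "real \<Rightarrow> 'a list \<Rightarrow> (real \<Rightarrow> 'a \<Rightarrow> real) \<Rightarrow> 'a \<Rightarrow> real" where
  "duhamel t hs g x = (LINT \<tau>:{0..t}|lborel. smoothing \<tau> hs (g (t - \<tau>)) x)"

lemma powr_set_integrable:
  fixes p t c :: real
  assumes "-1 < p" "0 \<le> t"
  shows "set_integrable lborel {0..t} (\<lambda>\<tau>. c * \<tau> powr p)" "(LINT \<tau>:{0..t}|lborel. c * \<tau> powr p) = c * (t powr (p + 1) / (p + 1))"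
  using set_integrable_powr_near_0[OF assms] by auto

text \<open>The smoothing bound is an integrable power of \<tau>, and enlarging t to T makes its
  integral uniform in t.\<close>

lemma duhamel_bounds:
  assumes \<alpha>: "0 \<le> \<alpha>" and k: "real k < \<alpha> + 2 * s"
  obtains C where "0 \<le> C"
    "\<And>t hs g x A. 0 \<le> t \<Longrightarrow> t \<le> T \<Longrightarrow> length hs = k \<Longrightarrow> source \<alpha> A g \<Longrightarrow> set_integrable lborel {0..t} (\<lambda>\<tau>. smoothing \<tau> hs (g (t - \<tau>)) x)"
    "\<And>t hs g x A. 0 \<le> t \<Longrightarrow> t \<le> T \<Longrightarrow> length hs = k \<Longrightarrow> source \<alpha> A g \<Longrightarrow> \<bar>duhamel t hs g x\<bar> \<le> C * A * (\<Prod>h\<leftarrow>hs. norm h)"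
proof -
  let ?p = "decay_exponent \<alpha> k"
  obtain C where C: "0 \<le> C" "\<And>\<tau> hs g t x A. 0 < \<tau> \<Longrightarrow> \<tau> \<le> T \<Longrightarrow> length hs = k \<Longrightarrow> source \<alpha> A g \<Longrightarrow>
     \<bar>smoothing \<tau> hs (g t) x\<bar> \<le> C * A * (\<Prod>h\<leftarrow>hs. norm h) * \<tau> powr ?p"
    by (rule smoothing_source_bound[OF \<alpha>, of k]) blast
  have p: "-1 < ?p" by (rule decay_exponent_gt[OF k])
  show ?thesis
  proof (rule that[of "C * (T powr (?p + 1) / (?p + 1))"])
    show "0 \<le> C * (T powr (?p + 1) / (?p + 1))" using C p by simp
    fix t :: real and hs :: "'a list" and g :: "real \<Rightarrow> 'a \<Rightarrow> real" and x :: 'a and A :: real assume t: "0 \<le> t" "t \<le> T" and hs: "length hs = k" and g: "source \<alpha> A g"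
    let ?c = "C * A * (\<Prod>h\<leftarrow>hs. norm h)"
    have c: "0 \<le> ?c" using C(1) sourceD(2)[OF g] prod_list_norm_nonneg by (intro mult_nonneg_nonneg)
    note pi = powr_set_integrable[OF p t(1), of ?c]
    have ae: "AE \<tau> in lborel. norm (indicator {0..t} \<tau> *\<^sub>R smoothing \<tau> hs (g (t - \<tau>)) x) \<le> indicator {0..t} \<tau> *\<^sub>R (?c * \<tau> powr ?p)"
      using AE_lborel_singleton[of "0::real"]
      by eventually_elim (use C(2)[OF _ _ hs g] t in \<open>auto simp: indicator_def\<close>)
    have m: "(\<lambda>\<tau>. indicator {0..t} \<tau> *\<^sub>R smoothing \<tau> hs (g (t - \<tau>)) x) \<in> borel_measurable lborel"
      using smoothing_time_measurable[OF g, of hs t x] by measurable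
    show si: "set_integrable lborel {0..t} (\<lambda>\<tau>. smoothing \<tau> hs (g (t - \<tau>)) x)"
      unfolding set_integrable_def
    proof (rule Bochner_Integration.integrable_bound[OF pi(1)[unfolded set_integrable_def] m])
      show "AE \<tau> in lborel. norm (indicator {0..t} \<tau> *\<^sub>R smoothing \<tau> hs (g (t - \<tau>)) x) \<le> norm (indicator {0..t} \<tau> *\<^sub>R (?c * \<tau> powr ?p))"
        using ae by eventually_elim (metis abs_ge_self order.trans real_norm_def)
    qed
    have "norm (duhamel t hs g x) \<le> (LINT \<tau>:{0..t}|lborel. ?c * \<tau> powr ?p)"
      unfolding duhamel_def set_lebesgue_integral_def
      by (rule integral_norm_bound_integral_AE) (use si pi(1) ae in \<open>auto simp: set_integrable_def\<close>)
    also have "\<dots> = ?c * (t powr (?p + 1) / (?p + 1))" by (rule pi(2))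
    also have "\<dots> \<le> ?c * (T powr (?p + 1) / (?p + 1))"
      using c p t by (intro mult_left_mono divide_right_mono powr_mono2) auto
    finally show "\<bar>duhamel t hs g x\<bar> \<le> C * (T powr (?p + 1) / (?p + 1)) * A * (\<Prod>h\<leftarrow>hs. norm h)"
      by (simp add: mult_ac)
  qed
qed

lemma duhamel_set_integrable:
  assumes "0 \<le> \<alpha>" "real (length hs) < \<alpha> + 2 * s" "0 \<le> t" "t \<le> T" "source \<alpha> A g"
  shows "set_integrable lborel {0..t} (\<lambda>\<tau>. smoothing \<tau> hs (g (t - \<tau>)) x)"
  by (rule duhamel_bounds[OF assms(1,2)]) (use assms in blast)

lemma duhamel_linear:
  assumes \<alpha>: "0 \<le> \<alpha>" and k: "real (length (h # hs)) < \<alpha> + 2 * s" and t: "0 \<le> t" "t \<le> T" and g: "source \<alpha> A g"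
  shows "duhamel t ((a *\<^sub>R h + h') # hs) g x = a * duhamel t (h # hs) g x + duhamel t (h' # hs) g x"
proof -
  have i: "set_integrable lborel {0..t} (\<lambda>\<tau>. smoothing \<tau> (v # hs) (g (t - \<tau>)) x)" for v
    by (rule duhamel_set_integrable[OF \<alpha> _ t g]) (use k in simp)
  show ?thesis
    unfolding duhamel_def smoothing_linear[OF sourceD(5)[OF g] sourceD(3)[OF g]]
    by (subst set_integral_add(2)) (auto intro!: i set_integrable_mult_right)
qed

text \<open>Fubini applied to the segment identities of the single times \<tau>; the power with
  exponent \<open>?p\<close> is the majorant in \<tau>.\<close>

lemma duhamel_segment:
  assumes \<alpha>: "0 \<le> \<alpha>" and k: "real (length (h # hs)) < \<alpha> + 2 * s" and t: "0 \<le> t" "t \<le> T" and g: "source \<alpha> A g"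
  shows "duhamel t hs g (x + h) - duhamel t hs g x = (\<integral>r. duhamel t (h # hs) g (x + r *\<^sub>R h) \<partial>unit_measure)"
proof -
  let ?V = "restrict_space lborel {0..t}" and ?p = "decay_exponent \<alpha> (length (h # hs))"
  interpret U: prob_space unit_measure by (rule prob_space_unit_interval)
  interpret V: finite_measure ?V
    by (rule finite_measureI) (simp add: emeasure_restrict_space space_restrict_space t)
  interpret P: pair_sigma_finite ?V unit_measure ..
  obtain C where C: "0 \<le> C" "\<And>\<tau> hs' g t x A. 0 < \<tau> \<Longrightarrow> \<tau> \<le> T \<Longrightarrow> length hs' = length (h # hs) \<Longrightarrow> source \<alpha> A g \<Longrightarrow>
     \<bar>smoothing \<tau> hs' (g t) x\<bar> \<le> C * A * (\<Prod>h\<leftarrow>hs'. norm h) * \<tau> powr ?p"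
    by (rule smoothing_source_bound[OF \<alpha>, of "length (h # hs)"]) blast
  let ?c = "C * A * (\<Prod>h\<leftarrow>h # hs. norm h)"
  have c: "0 \<le> ?c" using C(1) sourceD(2)[OF g] prod_list_norm_nonneg by (intro mult_nonneg_nonneg)
  have p: "-1 < ?p" by (rule decay_exponent_gt[OF k])
  have V: "(\<integral>\<tau>. f \<tau> \<partial>?V) = (LINT \<tau>:{0..t}|lborel. f \<tau>)" for f :: "real \<Rightarrow> real"
    by (simp add: integral_restrict_space set_lebesgue_integral_def)
  have Vi: "integrable ?V f \<longleftrightarrow> set_integrable lborel {0..t} f" for f :: "real \<Rightarrow> real"
    by (simp add: integrable_restrict_space set_integrable_def)
  \<comment> \<open>Time 0 is discarded because the smoothing bounds are stated for positive elapsed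
    time.\<close>
  have V0: "AE \<tau> in ?V. 0 < \<tau> \<and> \<tau> \<le> T"
    using AE_lborel_singleton[of "0::real"] t by (subst AE_restrict_space_iff) (auto elim!: eventually_mono)
  let ?F = "\<lambda>(\<tau>, r). smoothing \<tau> (h # hs) (g (t - \<tau>)) (x + r *\<^sub>R h)"
  have m: "?F \<in> borel_measurable (?V \<Otimes>\<^sub>M unit_measure)"
  proof -
    have 1: "(\<lambda>p. fst p) \<in> ?V \<Otimes>\<^sub>M unit_measure \<rightarrow>\<^sub>M borel" "(\<lambda>p. snd p) \<in> ?V \<Otimes>\<^sub>M unit_measure \<rightarrow>\<^sub>M borel"
      using measurable_compose[OF measurable_fst measurable_restrict_space1[of "\<lambda>x. x" lborel borel "{0..t}"], of unit_measure]
        measurable_compose[OF measurable_snd measurable_restrict_space1[of "\<lambda>x. x" lborel borel "{0..1::real}"], of ?V] by auto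
    have 2: "(\<lambda>p. (fst p, x + snd p *\<^sub>R h)) \<in> ?V \<Otimes>\<^sub>M unit_measure \<rightarrow>\<^sub>M borel \<Otimes>\<^sub>M borel"
      using 1 by (intro measurable_Pair borel_measurable_add borel_measurable_scaleR) auto
    show ?thesis
      using measurable_compose[OF 2 smoothing_measurable[OF sourceD(1)[OF g], of "h # hs" t]] by (simp add: case_prod_beta')
  qed
  have int: "integrable (?V \<Otimes>\<^sub>M unit_measure) ?F"
  proof (rule P.Fubini_integrable[OF m])
    have i1: "AE \<tau> in ?V. integrable unit_measure (\<lambda>r. ?F (\<tau>, r))"
      using V0 by eventually_elim (use smoothing_segment(1)[OF sourceD(5)[OF g] sourceD(3)[OF g]] in simp)
    then show "AE \<tau> in ?V. integrable unit_measure (\<lambda>r. ?F (\<tau>, r))" .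
    show "integrable ?V (\<lambda>\<tau>. \<integral>r. norm (?F (\<tau>, r)) \<partial>unit_measure)"
    proof (rule Bochner_Integration.integrable_bound)
      show "integrable ?V (\<lambda>\<tau>. ?c * \<tau> powr ?p)" unfolding Vi by (rule powr_set_integrable[OF p t(1)])
      show "(\<lambda>\<tau>. \<integral>r. norm (?F (\<tau>, r)) \<partial>unit_measure) \<in> borel_measurable ?V"
        using m by (intro U.borel_measurable_lebesgue_integral borel_measurable_norm) (simp add: case_prod_beta')
      show "AE \<tau> in ?V. norm (\<integral>r. norm (?F (\<tau>, r)) \<partial>unit_measure) \<le> norm (?c * \<tau> powr ?p)"
        using V0 i1
      proof eventually_elim
        case (elim \<tau>)
        have "(\<integral>r. norm (?F (\<tau>, r)) \<partial>unit_measure) \<le> ?c * \<tau> powr ?p"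
          by (rule U.integral_le_const) (use elim C(2)[OF _ _ refl g] in \<open>auto intro!: AE_I2\<close>)
        moreover have "0 \<le> (\<integral>r. norm (?F (\<tau>, r)) \<partial>unit_measure)" by simp
        ultimately show ?case unfolding real_norm_def using abs_ge_self[of "?c * \<tau> powr ?p"] by (subst abs_of_nonneg) linarith+
      qed
    qed
  qed
  have "duhamel t hs g (x + h) - duhamel t hs g x = (LINT \<tau>:{0..t}|lborel. smoothing \<tau> hs (g (t - \<tau>)) (x + h) - smoothing \<tau> hs (g (t - \<tau>)) x)"
    unfolding duhamel_def
    by (intro set_integral_diff(2)[symmetric] duhamel_set_integrable[OF \<alpha> _ t g]) (use k in auto)
  also have "\<dots> = (\<integral>\<tau>. (\<integral>r. smoothing \<tau> (h # hs) (g (t - \<tau>)) (x + r *\<^sub>R h) \<partial>unit_measure) \<partial>?V)"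
    unfolding V[symmetric]
  proof (rule integral_cong_AE)
    have m1: "(\<lambda>\<tau>. smoothing \<tau> hs (g (t - \<tau>)) x) \<in> borel_measurable ?V" for x
      using smoothing_time_measurable[OF g, of hs t x] by (intro measurable_restrict_space1) simp
    then show "(\<lambda>\<tau>. smoothing \<tau> hs (g (t - \<tau>)) (x + h) - smoothing \<tau> hs (g (t - \<tau>)) x) \<in> borel_measurable ?V"
      by (intro borel_measurable_diff)
    show "(\<lambda>\<tau>. \<integral>r. smoothing \<tau> (h # hs) (g (t - \<tau>)) (x + r *\<^sub>R h) \<partial>unit_measure) \<in> borel_measurable ?V"
      using m by (intro U.borel_measurable_lebesgue_integral) simp
    show "AE \<tau> in ?V. smoothing \<tau> hs (g (t - \<tau>)) (x + h) - smoothing \<tau> hs (g (t - \<tau>)) x = (\<integral>r. smoothing \<tau> (h # hs) (g (t - \<tau>)) (x + r *\<^sub>R h) \<partial>unit_measure)"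
      using V0 by eventually_elim (use smoothing_segment(2)[OF sourceD(5)[OF g] sourceD(3)[OF g]] in simp)
  qed
  also have "\<dots> = (\<integral>r. (\<integral>\<tau>. smoothing \<tau> (h # hs) (g (t - \<tau>)) (x + r *\<^sub>R h) \<partial>?V) \<partial>unit_measure)"
    by (rule P.Fubini_integral[OF int, symmetric])
  finally show ?thesis unfolding duhamel_def V .
qed

text \<open>One power of \<tau> on [0, T] dominates for all t n. The moving indicators converge
  except at \<tau> = t0, a null set.\<close>

lemma duhamel_tendsto:
  assumes \<alpha>: "0 \<le> \<alpha>" and k: "real (length hs) < \<alpha> + 2 * s" and g: "source \<alpha> A g"
    and t: "t \<longlonglongrightarrow> t0" "\<And>n. 0 \<le> t n" "\<And>n. t n \<le> T" and x: "x \<longlonglongrightarrow> x0"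
  shows "(\<lambda>n. duhamel (t n) hs g (x n)) \<longlonglongrightarrow> duhamel t0 hs g x0"
proof -
  let ?p = "decay_exponent \<alpha> (length hs)"
  obtain C where C: "0 \<le> C" "\<And>\<tau> hs' g t x A. 0 < \<tau> \<Longrightarrow> \<tau> \<le> T \<Longrightarrow> length hs' = length hs \<Longrightarrow> source \<alpha> A g \<Longrightarrow>
     \<bar>smoothing \<tau> hs' (g t) x\<bar> \<le> C * A * (\<Prod>h\<leftarrow>hs'. norm h) * \<tau> powr ?p"
    by (rule smoothing_source_bound[OF \<alpha>, of "length hs"]) blast
  let ?c = "C * A * (\<Prod>h\<leftarrow>hs. norm h)"
  have c: "0 \<le> ?c" using C(1) sourceD(2)[OF g] prod_list_norm_nonneg by (intro mult_nonneg_nonneg)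
  have p: "-1 < ?p" by (rule decay_exponent_gt[OF k])
  have m: "(\<lambda>\<tau>. indicator {0..t} \<tau> *\<^sub>R smoothing \<tau> hs (g (t - \<tau>)) x) \<in> borel_measurable lborel" for t x
    using smoothing_time_measurable[OF g, of hs t x] by measurable
  show ?thesis
    unfolding duhamel_def set_lebesgue_integral_def
  proof (rule integral_dominated_convergence[where w="\<lambda>\<tau>. indicator {0..T} \<tau> *\<^sub>R (?c * \<tau> powr ?p)"])
    show "integrable lborel (\<lambda>\<tau>. indicator {0..T} \<tau> *\<^sub>R (?c * \<tau> powr ?p))"
      using powr_set_integrable(1)[OF p, of T ?c] T by (simp add: set_integrable_def)
    show "AE \<tau> in lborel. norm (indicator {0..t n} \<tau> *\<^sub>R smoothing \<tau> hs (g (t n - \<tau>)) (x n)) \<le> indicator {0..T} \<tau> *\<^sub>R (?c * \<tau> powr ?p)" for n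
      using AE_lborel_singleton[of "0::real"]
    proof eventually_elim
      case (elim \<tau>)
      show ?case
      proof (cases "\<tau> \<in> {0..t n}")
        case True
        with elim t(3)[of n] have "0 < \<tau>" "\<tau> \<le> T" by auto
        with True show ?thesis using C(2)[OF _ _ refl g, of \<tau> "t n - \<tau>" "x n"] by simp
      next
        case False
        have "0 \<le> indicator {0..T} \<tau> *\<^sub>R (?c * \<tau> powr ?p)" by (rule scaleR_nonneg_nonneg[OF _ mult_nonneg_nonneg[OF c]]) auto
        with False show ?thesis by simp
      qed
    qed
    show "AE \<tau> in lborel. (\<lambda>n. indicator {0..t n} \<tau> *\<^sub>R smoothing \<tau> hs (g (t n - \<tau>)) (x n)) \<longlonglongrightarrow> indicator {0..t0} \<tau> *\<^sub>R smoothing \<tau> hs (g (t0 - \<tau>)) x0"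
      using AE_lborel_singleton[of "t0::real"]
    proof eventually_elim
      case (elim \<tau>)
      have "eventually (\<lambda>n. indicator {0..t n} \<tau> = (indicator {0..t0} \<tau> :: real)) sequentially"
      proof (cases "\<tau> < t0")
        case True
        from order_tendstoD(1)[OF t(1) this] show ?thesis
          by eventually_elim (use True in \<open>auto simp: indicator_def\<close>)
      next
        case False
        with elim have "t0 < \<tau>" by simp
        from order_tendstoD(2)[OF t(1) this] show ?thesis
          by eventually_elim (use \<open>t0 < \<tau>\<close> in \<open>auto simp: indicator_def\<close>)
      qed
      then have "(\<lambda>n. indicator {0..t n} \<tau> :: real) \<longlonglongrightarrow> indicator {0..t0} \<tau>" by (rule tendsto_eventually)
      moreover have "(\<lambda>n. smoothing \<tau> hs (g (t n - \<tau>)) (x n)) \<longlonglongrightarrow> smoothing \<tau> hs (g (t0 - \<tau>)) x0"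
        by (rule smoothing_tendsto[OF sourceD(1)[OF g] sourceD(3)[OF g] _ x]) (intro tendsto_intros t)
      ultimately show ?case by (rule tendsto_scaleR)
    qed
  qed (rule m)+
qed

lemma difference_2: "(difference h ^^ 2) f x = f (x + h + h) - 2 * f (x + h) + f x"
  by (simp add: numeral_2_eq_2 difference_def)

lemma difference_1: "(difference h ^^ 1) f x = f (x + h) - f x"
  by (simp add: difference_def)

text \<open>Each difference is the average of one more derivative over a segment, so m differences
  gain |h|^m at the price of m further orders of smoothing.\<close>

lemma difference_smoothing_large:
  assumes \<alpha>: "0 \<le> \<alpha>" and m: "m \<in> {1, 2}"
  obtains C where "0 \<le> C" "\<And>\<tau> hs h g t x A. 0 < \<tau> \<Longrightarrow> \<tau> \<le> T \<Longrightarrow> length hs = n \<Longrightarrow> source \<alpha> A g \<Longrightarrow>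
     \<bar>(difference h ^^ m) (smoothing \<tau> hs (g t)) x\<bar> \<le> C * A * norm h ^ m * (\<Prod>h\<leftarrow>hs. norm h) * \<tau> powr ((\<alpha> - real (n + m)) / (2 * s))"
proof -
  interpret U: prob_space unit_measure by (rule prob_space_unit_interval)
  obtain C where C: "0 \<le> C" "\<And>\<tau> hs g t x A. 0 < \<tau> \<Longrightarrow> \<tau> \<le> T \<Longrightarrow> length hs = n + m \<Longrightarrow> source \<alpha> A g \<Longrightarrow>
     \<bar>smoothing \<tau> hs (g t) x\<bar> \<le> C * A * (\<Prod>h\<leftarrow>hs. norm h) * \<tau> powr decay_exponent \<alpha> (n + m)"
    by (rule smoothing_source_bound[OF \<alpha>, of "n + m"]) blast
  have seg: "\<bar>smoothing \<tau> hs (g t) (x + h) - smoothing \<tau> hs (g t) x\<bar> \<le> B"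
    if "0 < \<tau>" "source \<alpha> A g" "\<And>x. \<bar>smoothing \<tau> (h # hs) (g t) x\<bar> \<le> B" for \<tau> hs g t x h and A B :: real
  proof -
    note sg = smoothing_segment[OF sourceD(5)[OF that(2)] sourceD(3)[OF that(2)] that(1)]
    have "norm (\<integral>r. smoothing \<tau> (h # hs) (g t) (x + r *\<^sub>R h) \<partial>unit_measure) \<le> (\<integral>r. B \<partial>unit_measure)"
      by (rule Bochner_Integration.integral_norm_bound_integral) (use sg(1) that(3) U.integrable_const in \<open>simp_all only: real_norm_def\<close>)
    then show ?thesis unfolding sg(2) using U.prob_space by simp
  qed
  show ?thesis
  proof (rule that[OF C(1)])
    fix \<tau> :: real and hs :: "'a list" and h :: 'a and g :: "real \<Rightarrow> 'a \<Rightarrow> real" and t :: real and x :: 'a and A :: real assume \<tau>: "0 < \<tau>" "\<tau> \<le> T" and hs: "length hs = n" and g: "source \<alpha> A g"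
    let ?B = "C * A * norm h ^ m * (\<Prod>h\<leftarrow>hs. norm h) * \<tau> powr ((\<alpha> - real (n + m)) / (2 * s))"
    show "\<bar>(difference h ^^ m) (smoothing \<tau> hs (g t)) x\<bar> \<le> ?B"
    proof (cases "m = 1")
      case True
      have "\<bar>smoothing \<tau> (h # hs) (g t) x\<bar> \<le> ?B" for x
        using C(2)[OF \<tau> _ g, of "h # hs" t x] hs True by (simp add: decay_exponent_def mult_ac)
      from seg[OF \<tau>(1) g this] True show ?thesis unfolding True difference_1 by simp
    next
      case False
      with m have m2: "m = 2" by simp
      have "\<bar>smoothing \<tau> (h # h # hs) (g t) x\<bar> \<le> ?B" for x
        using C(2)[OF \<tau> _ g, of "h # h # hs" t x] hs m2 by (simp add: decay_exponent_def mult_ac power2_eq_square)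
      from seg[OF \<tau>(1) g this] have "\<bar>smoothing \<tau> (h # hs) (g t) (y + h) - smoothing \<tau> (h # hs) (g t) y\<bar> \<le> ?B" for y .
      then have B: "\<bar>smoothing \<tau> (h # hs) (g t) ((x + r *\<^sub>R h) + h) - smoothing \<tau> (h # hs) (g t) (x + r *\<^sub>R h)\<bar> \<le> ?B" for r .
      note sg = smoothing_segment[OF sourceD(5)[OF g] sourceD(3)[OF g] \<tau>(1)]
      have ac: "x + r *\<^sub>R h + h = x + h + r *\<^sub>R h" for r by simp
      have i1: "integrable unit_measure (\<lambda>r. smoothing \<tau> (h # hs) (g t) ((x + r *\<^sub>R h) + h) - smoothing \<tau> (h # hs) (g t) (x + r *\<^sub>R h))"
        unfolding ac by (rule Bochner_Integration.integrable_diff[OF sg(1) sg(1)])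
      have B': "norm (smoothing \<tau> (h # hs) (g t) ((x + r *\<^sub>R h) + h) - smoothing \<tau> (h # hs) (g t) (x + r *\<^sub>R h)) \<le> ?B" for r
        unfolding real_norm_def by (rule B)
      \<comment> \<open>The second difference is regrouped as a difference of first differences. It
        becomes the segment integral of the first difference of the derivative, which
        \<open>B\<close> controls.\<close>
      have d1: "(difference h ^^ 2) (smoothing \<tau> hs (g t)) x = (smoothing \<tau> hs (g t) ((x + h) + h) - smoothing \<tau> hs (g t) (x + h)) - (smoothing \<tau> hs (g t) (x + h) - smoothing \<tau> hs (g t) x)"
        unfolding difference_2 by simp
      have d2: "(difference h ^^ 2) (smoothing \<tau> hs (g t)) x = (\<integral>r. smoothing \<tau> (h # hs) (g t) ((x + r *\<^sub>R h) + h) - smoothing \<tau> (h # hs) (g t) (x + r *\<^sub>R h) \<partial>unit_measure)"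
        unfolding d1 ac sg(2)[of hs t "x + h" h] sg(2)[of hs t x h]
        by (rule Bochner_Integration.integral_diff[OF sg(1)[of h hs t "x + h"] sg(1)[of h hs t x], symmetric])
      have d3: "norm (\<integral>r. smoothing \<tau> (h # hs) (g t) ((x + r *\<^sub>R h) + h) - smoothing \<tau> (h # hs) (g t) (x + r *\<^sub>R h) \<partial>unit_measure) \<le> (\<integral>r. ?B \<partial>unit_measure)"
        by (rule Bochner_Integration.integral_norm_bound_integral[OF i1 U.integrable_const B'])
      have d4: "(\<integral>r. c \<partial>unit_measure) = c" for c :: real
        unfolding lebesgue_integral_const U.prob_space by (rule scaleR_one)
      show ?thesis using d3 unfolding d4 m2[symmetric] real_norm_def d2[unfolded m2[symmetric]] .
    qed
  qed
qed

text \<open>No further smoothing is spent. At order 0 the Hoelder bound of \<open>g\<close> passes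
  through the averaging and gives |h|^\<alpha>; at higher order the difference is bounded term by
  term, and 4 = 1 + 2 + 1 covers both kinds.\<close>

lemma difference_smoothing_small:
  assumes \<alpha>: "0 \<le> \<alpha>" and m: "m \<in> {1, 2}"
  obtains C where "0 \<le> C" "\<And>\<tau> hs h g t x A. 0 < \<tau> \<Longrightarrow> \<tau> \<le> T \<Longrightarrow> length hs = n \<Longrightarrow> source \<alpha> A g \<Longrightarrow>
     \<bar>(difference h ^^ m) (smoothing \<tau> hs (g t)) x\<bar> \<le> C * A * (if n = 0 then norm h powr \<alpha> else 1) * (\<Prod>h\<leftarrow>hs. norm h) * \<tau> powr decay_exponent \<alpha> n"
proof (cases n)
  case 0
  obtain C where C: "0 \<le> C" "\<And>t vs. length vs = 0 \<Longrightarrow> (\<integral>z. \<bar>kernel t vs z\<bar> \<partial>lborel) \<le> (\<Prod>v\<leftarrow>vs. norm v) * C"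
    by (rule kernel_bound[of 0]) blast
  show ?thesis
  \<comment> \<open>A second difference consists of two first ones, hence the 2; the power of M
    compares the transported increment \<open>E \<tau> h\<close> with h.\<close>
  proof (rule that[of "2 * C * M powr \<alpha>"])
    show "0 \<le> 2 * C * M powr \<alpha>" using C(1) by simp
    fix \<tau> :: real and hs :: "'a list" and h :: 'a and g :: "real \<Rightarrow> 'a \<Rightarrow> real" and t :: real and x :: 'a and A :: real assume \<tau>: "0 < \<tau>" "\<tau> \<le> T" and hs: "length hs = n" and g: "source \<alpha> A g"
    have "length hs = 0" by (rule trans[OF hs 0])
    then have hs0: "hs = []" by (rule length_0_conv[THEN iffD1])
    let ?B = "A * (M * norm h) powr \<alpha> * C"
    have B: "\<bar>smoothing \<tau> [] (g t) (x + h) - smoothing \<tau> [] (g t) x\<bar> \<le> ?B" for x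
    proof -
      let ?f = "\<lambda>x z. g t (E \<tau> x + \<tau> powr (1 / (2 * s)) *\<^sub>R z)"
      have mf: "?f x \<in> borel_measurable borel" for x
        by (rule measurable_compose[OF _ sourceD(5)[OF g]]) measurable
      have i: "integrable lborel (\<lambda>z. ?f x z * kernel \<tau> [] z)" for x
        by (rule integrable_bounded_mult(1)[OF kernel_integrable mf sourceD(3)[OF g]])
      have d: "smoothing \<tau> [] (g t) (x + h) - smoothing \<tau> [] (g t) x = (\<integral>z. (?f (x + h) z - ?f x z) * kernel \<tau> [] z \<partial>lborel)"
        unfolding smoothing_def left_diff_distrib using \<tau> Bochner_Integration.integral_diff[OF i[of "x + h"] i[of x]] by simp
      have "\<bar>\<integral>z. (?f (x + h) z - ?f x z) * kernel \<tau> [] z \<partial>lborel\<bar> \<le> (A * (M * norm h) powr \<alpha>) * (\<integral>z. \<bar>kernel \<tau> [] z\<bar> \<partial>lborel)"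
      proof (rule integrable_bounded_mult(2)[OF kernel_integrable])
        fix z
        have "\<bar>?f (x + h) z - ?f x z\<bar> \<le> A * norm (E \<tau> h) powr \<alpha>"
          using sourceD(4)[OF g, of t "E \<tau> (x + h) + \<tau> powr (1 / (2 * s)) *\<^sub>R z" "E \<tau> x + \<tau> powr (1 / (2 * s)) *\<^sub>R z"] by (simp add: E_simps)
        also have "\<dots> \<le> A * (M * norm h) powr \<alpha>"
          using E_bound[of \<tau> h] \<tau> \<alpha> sourceD(2)[OF g] by (intro mult_left_mono powr_mono2) auto
        finally show "\<bar>?f (x + h) z - ?f x z\<bar> \<le> A * (M * norm h) powr \<alpha>" .
      qed (rule borel_measurable_diff[OF mf mf])
      also have "\<dots> \<le> A * (M * norm h) powr \<alpha> * C"
        by (intro mult_left_mono order.trans[OF C(2)[of "[]" \<tau>]] mult_nonneg_nonneg sourceD(2)[OF g]) simp_all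
      finally show ?thesis unfolding d .
    qed
    have B0: "0 \<le> ?B" by (intro mult_nonneg_nonneg sourceD(2)[OF g] C(1)) simp
    have "\<bar>(difference h ^^ m) (smoothing \<tau> [] (g t)) x\<bar> \<le> 2 * ?B"
    proof (cases "m = 1")
      case True
      show ?thesis using B[of x] B0 unfolding True difference_1 by linarith
    next
      case False
      with m have m2: "m = 2" by simp
      show ?thesis using B[of x] B[of "x + h"] unfolding m2 difference_2 by linarith
    qed
    also have "2 * ?B = 2 * C * M powr \<alpha> * A * norm h powr \<alpha>" using M by (simp add: powr_mult)
    finally show "\<bar>(difference h ^^ m) (smoothing \<tau> hs (g t)) x\<bar> \<le> 2 * C * M powr \<alpha> * A * (if n = 0 then norm h powr \<alpha> else 1) * (\<Prod>h\<leftarrow>hs. norm h) * \<tau> powr decay_exponent \<alpha> n"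
      using \<tau>(1) by (simp add: hs0 0 decay_exponent_def)
  qed
next
  case (Suc n')
  obtain C where C: "0 \<le> C" "\<And>\<tau> hs g t x A. 0 < \<tau> \<Longrightarrow> \<tau> \<le> T \<Longrightarrow> length hs = n \<Longrightarrow> source \<alpha> A g \<Longrightarrow>
     \<bar>smoothing \<tau> hs (g t) x\<bar> \<le> C * A * (\<Prod>h\<leftarrow>hs. norm h) * \<tau> powr decay_exponent \<alpha> n"
    by (rule smoothing_source_bound[OF \<alpha>, of n]) blast
  show ?thesis
  proof (rule that[of "4 * C"])
    show "0 \<le> 4 * C" using C by simp
    fix \<tau> :: real and hs :: "'a list" and h :: 'a and g :: "real \<Rightarrow> 'a \<Rightarrow> real" and t :: real and x :: 'a and A :: real assume \<tau>: "0 < \<tau>" "\<tau> \<le> T" and hs: "length hs = n" and g: "source \<alpha> A g"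
    let ?B = "C * A * (\<Prod>h\<leftarrow>hs. norm h) * \<tau> powr decay_exponent \<alpha> n"
    note B = C(2)[OF \<tau> hs g, of t]
    have "\<bar>(difference h ^^ m) (smoothing \<tau> hs (g t)) x\<bar> \<le> 4 * ?B"
    proof (cases "m = 1")
      case True
      show ?thesis using B[of x] B[of "x + h"] abs_ge_zero[of "smoothing \<tau> hs (g t) x"] unfolding True difference_1 by linarith
    next
      case False
      with m have m2: "m = 2" by simp
      show ?thesis using B[of x] B[of "x + h"] B[of "x + h + h"] unfolding m2 difference_2 by linarith
    qed
    then show "\<bar>(difference h ^^ m) (smoothing \<tau> hs (g t)) x\<bar> \<le> 4 * C * A * (if n = 0 then norm h powr \<alpha> else 1) * (\<Prod>h\<leftarrow>hs. norm h) * \<tau> powr decay_exponent \<alpha> n"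
      using Suc by (simp add: mult.assoc)
  qed
qed

text \<open>Both pieces scale alike: |h|^\<alpha> (or 1 for n > 0) times |h|^(2s(?a+1)) and |h|^m
  times |h|^(2s(?b+1)) all equal |h|^(\<alpha>+2s-n). Since \<alpha> + 2s < n + m, the far piece may
  be extended to infinity, and t drops out of the bound.\<close>

lemma difference_duhamel:
  assumes \<alpha>: "0 \<le> \<alpha>" and n: "real n < \<alpha> + 2 * s" and m: "m \<in> {1, 2}" "\<alpha> + 2 * s < real (n + m)"
  obtains C where "0 \<le> C" "\<And>t hs h g x A. 0 \<le> t \<Longrightarrow> t \<le> T \<Longrightarrow> length hs = n \<Longrightarrow> source \<alpha> A g \<Longrightarrow> h \<noteq> 0 \<Longrightarrow>
     \<bar>(difference h ^^ m) (duhamel t hs g) x\<bar> \<le> C * A * (\<Prod>h\<leftarrow>hs. norm h) * norm h powr (\<alpha> + 2 * s - real n)"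
proof -
  let ?a = "decay_exponent \<alpha> n" and ?b = "(\<alpha> - real (n + m)) / (2 * s)"
  have a: "-1 < ?a" by (rule decay_exponent_gt[OF n])
  have b: "?b < -1" using m s by (simp add: field_simps)
  obtain C1 where C1: "0 \<le> C1" "\<And>\<tau> hs h g t x A. 0 < \<tau> \<Longrightarrow> \<tau> \<le> T \<Longrightarrow> length hs = n \<Longrightarrow> source \<alpha> A g \<Longrightarrow>
     \<bar>(difference h ^^ m) (smoothing \<tau> hs (g t)) x\<bar> \<le> C1 * A * (if n = 0 then norm h powr \<alpha> else 1) * (\<Prod>h\<leftarrow>hs. norm h) * \<tau> powr ?a"
    by (rule difference_smoothing_small[OF \<alpha> m(1), of n]) blast
  obtain C2 where C2: "0 \<le> C2" "\<And>\<tau> hs h g t x A. 0 < \<tau> \<Longrightarrow> \<tau> \<le> T \<Longrightarrow> length hs = n \<Longrightarrow> source \<alpha> A g \<Longrightarrow>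
     \<bar>(difference h ^^ m) (smoothing \<tau> hs (g t)) x\<bar> \<le> C2 * A * norm h ^ m * (\<Prod>h\<leftarrow>hs. norm h) * \<tau> powr ?b"
    by (rule difference_smoothing_large[OF \<alpha> m(1), of n]) blast
  show ?thesis
  \<comment> \<open>The factors 1/(?a + 1) and -1/(?b + 1) are the integrals of the two powers over
    (0, 1) and (1, \<infinity>).\<close>
  proof (rule that[of "C1 / (?a + 1) + C2 / (- (?b + 1))"])
    show "0 \<le> C1 / (?a + 1) + C2 / (- (?b + 1))"
      by (rule add_nonneg_nonneg; rule divide_nonneg_nonneg) (use C1(1) C2(1) a b in linarith)+
    fix t :: real and hs :: "'a list" and h :: 'a and g :: "real \<Rightarrow> 'a \<Rightarrow> real" and x :: 'a and A :: real assume t: "0 \<le> t" "t \<le> T" and hs: "length hs = n" and g: "source \<alpha> A g" and h: "h \<noteq> 0"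
    let ?P = "\<Prod>h\<leftarrow>hs. norm h" and ?l = "norm h powr (2 * s)"
    let ?c1 = "C1 * A * (if n = 0 then norm h powr \<alpha> else 1) * ?P" and ?c2 = "C2 * A * norm h ^ m * ?P"
    have l: "0 < ?l" using h by simp
    have P: "0 \<le> ?P" by (rule prod_list_norm_nonneg)
    have c1: "0 \<le> ?c1" and c2: "0 \<le> ?c2" using C1(1) C2(1) P sourceD(2)[OF g] by auto
    let ?D = "\<lambda>\<tau>. (difference h ^^ m) (smoothing \<tau> hs (g (t - \<tau>))) x"
    note si = duhamel_set_integrable[OF \<alpha> _ t g, of hs, unfolded hs, OF n]
    have D: "set_integrable lborel {0..t} ?D \<and> (LINT \<tau>:{0..t}|lborel. ?D \<tau>) = (difference h ^^ m) (duhamel t hs g) x"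
    proof (cases "m = 1")
      case True
      show ?thesis unfolding True difference_1 duhamel_def using set_integral_diff[OF si[of "x + h"] si[of x]] by simp
    next
      case False
      with m have m2: "m = 2" by simp
      have i1: "set_integrable lborel {0..t} (\<lambda>\<tau>. smoothing \<tau> hs (g (t - \<tau>)) (x + h + h) - 2 * smoothing \<tau> hs (g (t - \<tau>)) (x + h))"
        by (intro set_integral_diff(1) set_integrable_mult_right si)
      show ?thesis unfolding m2 difference_2 duhamel_def
        using set_integral_add[OF i1 si[of x]] set_integral_diff(2)[OF si[of "x + h + h"] set_integrable_mult_right[OF si[of "x + h"], of 2]] by simp
    qed
    have i: "integrable lborel (\<lambda>\<tau>. indicator {0..?l} \<tau> *\<^sub>R (?c1 * \<tau> powr ?a))" "integrable lborel (\<lambda>\<tau>. indicator {?l..} \<tau> *\<^sub>R (?c2 * \<tau> powr ?b))"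
      using powr_set_integrable(1)[OF a, of ?l ?c1] set_integrable_mult_right[OF set_integrable_powr_at_top(1)[OF b l], of ?c2] l
      by (auto simp: set_integrable_def)
    have "\<bar>(difference h ^^ m) (duhamel t hs g) x\<bar> = norm (\<integral>\<tau>. indicator {0..t} \<tau> *\<^sub>R ?D \<tau> \<partial>lborel)"
      using D by (simp add: set_lebesgue_integral_def)
    also have "\<dots> \<le> (\<integral>\<tau>. indicator {0..?l} \<tau> *\<^sub>R (?c1 * \<tau> powr ?a) + indicator {?l..} \<tau> *\<^sub>R (?c2 * \<tau> powr ?b) \<partial>lborel)"
    proof (rule integral_norm_bound_integral_AE)
      show "integrable lborel (\<lambda>\<tau>. indicator {0..t} \<tau> *\<^sub>R ?D \<tau>)" using D by (simp add: set_integrable_def)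
      show "integrable lborel (\<lambda>\<tau>. indicator {0..?l} \<tau> *\<^sub>R (?c1 * \<tau> powr ?a) + indicator {?l..} \<tau> *\<^sub>R (?c2 * \<tau> powr ?b))"
        using i by (rule Bochner_Integration.integrable_add)
      show "AE \<tau> in lborel. norm (indicator {0..t} \<tau> *\<^sub>R ?D \<tau>) \<le> indicator {0..?l} \<tau> *\<^sub>R (?c1 * \<tau> powr ?a) + indicator {?l..} \<tau> *\<^sub>R (?c2 * \<tau> powr ?b)"
        using AE_lborel_singleton[of "0::real"]
      proof eventually_elim
        case (elim \<tau>)
        have n1: "0 \<le> indicator {0..?l} \<tau> *\<^sub>R (?c1 * \<tau> powr ?a)" by (rule scaleR_nonneg_nonneg[OF _ mult_nonneg_nonneg[OF c1]]) auto
        have n2: "0 \<le> indicator {?l..} \<tau> *\<^sub>R (?c2 * \<tau> powr ?b)" by (rule scaleR_nonneg_nonneg[OF _ mult_nonneg_nonneg[OF c2]]) auto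
        show ?case
        proof (cases "\<tau> \<in> {0..t}")
          case True
          with elim t have \<tau>: "0 < \<tau>" "\<tau> \<le> T" by auto
          show ?thesis
          proof (cases "\<tau> \<le> ?l")
            case le: True
            have "\<bar>?D \<tau>\<bar> \<le> indicator {0..?l} \<tau> *\<^sub>R (?c1 * \<tau> powr ?a)"
              using C1(2)[OF \<tau> hs g, of h "t - \<tau>" x] le \<tau> by simp
            with n2 True show ?thesis by simp
          next
            case False
            have "\<bar>?D \<tau>\<bar> \<le> indicator {?l..} \<tau> *\<^sub>R (?c2 * \<tau> powr ?b)"
              using C2(2)[OF \<tau> hs g, of h "t - \<tau>" x] False \<tau> by simp
            with n1 True show ?thesis by simp
          qed
        next
          case False
          with n1 n2 show ?thesis by simp
        qed
      qed
    qed
    also have "\<dots> = ?c1 * (?l powr (?a + 1) / (?a + 1)) + ?c2 * (- (?l powr (?b + 1)) / (?b + 1))"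
    proof -
      have "(\<integral>\<tau>. indicator {?l..} \<tau> *\<^sub>R (?c2 * \<tau> powr ?b) \<partial>lborel) = ?c2 * (- (?l powr (?b + 1)) / (?b + 1))"
        using set_integral_mult_right[of lborel "{?l..}" ?c2 "\<lambda>\<tau>. \<tau> powr ?b"] set_integrable_powr_at_top(2)[OF b l]
        unfolding set_lebesgue_integral_def by (simp only:)
      moreover have "(\<integral>\<tau>. indicator {0..?l} \<tau> *\<^sub>R (?c1 * \<tau> powr ?a) \<partial>lborel) = ?c1 * (?l powr (?a + 1) / (?a + 1))"
        using powr_set_integrable(2)[OF a less_imp_le[OF l], of ?c1] unfolding set_lebesgue_integral_def .
      ultimately show ?thesis unfolding Bochner_Integration.integral_add[OF i] by (simp only:)
    qed
    also have "\<dots> = (C1 / (?a + 1) + C2 / (- (?b + 1))) * A * ?P * norm h powr (\<alpha> + 2 * s - real n)"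
    proof -
      have s0: "s \<noteq> 0" using s by simp
      have e1: "(if n = 0 then norm h powr \<alpha> else 1) * ?l powr (?a + 1) = norm h powr (\<alpha> + 2 * s - real n)"
      proof (cases "n = 0")
        case True
        then show ?thesis using h by (simp add: decay_exponent_def powr_powr powr_add)
      next
        case False
        have "2 * s * (?a + 1) = \<alpha> + 2 * s - real n" using False s0 by (simp add: decay_exponent_def field_simps)
        then show ?thesis using False by (simp add: powr_powr)
      qed
      have e2: "norm h ^ m * ?l powr (?b + 1) = norm h powr (\<alpha> + 2 * s - real n)"
      proof -
        have "2 * s * (?b + 1) = \<alpha> + 2 * s - real n - real m" using s0 by (simp add: field_simps)
        then have "?l powr (?b + 1) = norm h powr (\<alpha> + 2 * s - real n - real m)" by (simp only: powr_powr)
        moreover have "norm h ^ m = norm h powr real m" using h by (simp add: powr_realpow)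
        ultimately have "norm h ^ m * ?l powr (?b + 1) = norm h powr (real m + (\<alpha> + 2 * s - real n - real m))"
          by (simp only: powr_add)
        also have "real m + (\<alpha> + 2 * s - real n - real m) = \<alpha> + 2 * s - real n" by linarith
        finally show ?thesis .
      qed
      have "?c1 * (?l powr (?a + 1) / (?a + 1)) = C1 / (?a + 1) * A * ?P * ((if n = 0 then norm h powr \<alpha> else 1) * ?l powr (?a + 1))"
        by (simp only: divide_inverse mult_ac)
      moreover have "?c2 * (- (?l powr (?b + 1)) / (?b + 1)) = C2 / (- (?b + 1)) * A * ?P * (norm h ^ m * ?l powr (?b + 1))"
        by (simp only: divide_inverse mult_ac inverse_minus_eq mult_minus_left mult_minus_right)
      ultimately show ?thesis unfolding e1 e2 by (simp only: distrib_right)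
    qed
    finally show "\<bar>(difference h ^^ m) (duhamel t hs g) x\<bar> \<le> (C1 / (?a + 1) + C2 / (- (?b + 1))) * A * ?P * norm h powr (\<alpha> + 2 * s - real n)" .
  qed
qed

end

section \<open>Limits under tight integrals; differentiability from segment identities\<close>

lemma LIMSEQ_approx:
  fixes a :: "nat \<Rightarrow> real"
  assumes "\<And>e. 0 < e \<Longrightarrow> \<exists>u u0. u \<longlonglongrightarrow> u0 \<and> (\<forall>k. \<bar>a k - u k\<bar> \<le> e) \<and> \<bar>a0 - u0\<bar> \<le> e"
  shows "a \<longlonglongrightarrow> a0"
proof (rule LIMSEQ_I)
  fix e :: real assume "0 < e"
  then have e: "0 < e / 4" by simp
  from assms[OF e] obtain u u0 where u: "u \<longlonglongrightarrow> u0" "\<And>k. \<bar>a k - u k\<bar> \<le> e / 4" "\<bar>a0 - u0\<bar> \<le> e / 4" by blast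
  from LIMSEQ_D[OF u(1) e] obtain N where N: "\<And>k. k \<ge> N \<Longrightarrow> norm (u k - u0) < e / 4" by blast
  show "\<exists>N. \<forall>k\<ge>N. norm (a k - a0) < e"
  proof (intro exI allI impI)
    fix k assume "N \<le> k"
    from N[OF this] u(2)[of k] u(3) \<open>0 < e\<close> show "norm (a k - a0) < e" unfolding real_norm_def by linarith
  qed
qed

text \<open>The moment bound makes the mass outside a ball of radius \<rho> at most C (1 +
  \<rho>)^(-p), uniformly in k, while inside the ball the constant D dominates. This stands in for a
  common integrable majorant: the kernels are controlled in sup norm and weighted L^1 norm.\<close>

lemma integral_tendsto_of_tight:
  fixes f :: "nat \<Rightarrow> 'a::euclidean_space \<Rightarrow> real"
  assumes p: "0 < p" and f: "\<And>z. (\<lambda>k. f k z) \<longlonglongrightarrow> f0 z"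
    and D: "\<And>k z. \<bar>f k z\<bar> \<le> D"
    and i: "\<And>k. integrable lborel (f k)" "integrable lborel f0"
    and w: "\<And>k. integrable lborel (\<lambda>z. (1 + norm z) powr p * \<bar>f k z\<bar>)" "\<And>k. (\<integral>z. (1 + norm z) powr p * \<bar>f k z\<bar> \<partial>lborel) \<le> C"
    and w0: "integrable lborel (\<lambda>z. (1 + norm z) powr p * \<bar>f0 z\<bar>)" "(\<integral>z. (1 + norm z) powr p * \<bar>f0 z\<bar> \<partial>lborel) \<le> C"
  shows "(\<lambda>k. \<integral>z. f k z \<partial>lborel) \<longlonglongrightarrow> (\<integral>z. f0 z \<partial>lborel)"
proof (rule LIMSEQ_approx)
  fix e :: real assume e: "0 < e"
  have "((\<lambda>\<rho>. (1 + \<rho>) powr (- p) * C) \<longlongrightarrow> 0 * C) at_top"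
    using p by (intro tendsto_mult tendsto_neg_powr filterlim_tendsto_add_at_top[OF tendsto_const] filterlim_ident tendsto_const) auto
  then have "eventually (\<lambda>\<rho>. (1 + \<rho>) powr (- p) * C < e) at_top" using e by (intro order_tendstoD(2)) auto
  then obtain \<rho> where \<rho>: "0 \<le> \<rho>" "(1 + \<rho>) powr (- p) * C < e"
    by (metis eventually_at_top_linorder linorder_linear)
  have cutoff: "\<bar>(\<integral>z. h z \<partial>lborel) - (\<integral>z. indicator (cball 0 \<rho>) z * h z \<partial>lborel)\<bar> \<le> e"
    if h: "integrable lborel h" "integrable lborel (\<lambda>z. (1 + norm z) powr p * \<bar>h z\<bar>)" "(\<integral>z. (1 + norm z) powr p * \<bar>h z\<bar> \<partial>lborel) \<le> C" for h :: "'a \<Rightarrow> real"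
  proof -
    have hi: "integrable lborel (\<lambda>z. indicator (cball 0 \<rho>) z * h z)"
      using integrable_mult_indicator[of "cball 0 \<rho>" lborel h] h(1) by simp
    have le: "norm (h z - indicator (cball 0 \<rho>) z * h z) \<le> (1 + \<rho>) powr (- p) * ((1 + norm z) powr p * \<bar>h z\<bar>)" for z
    proof (cases "z \<in> cball 0 \<rho>")
      case False
      then have "\<rho> \<le> norm z" by simp
      then have "1 \<le> ((1 + norm z) / (1 + \<rho>)) powr p" using \<rho>(1) p by (intro ge_one_powr_ge_zero) auto
      also have "\<dots> = (1 + \<rho>) powr (- p) * (1 + norm z) powr p" using \<rho>(1) by (simp add: powr_divide powr_minus_divide)
      finally have "1 * \<bar>h z\<bar> \<le> ((1 + \<rho>) powr (- p) * (1 + norm z) powr p) * \<bar>h z\<bar>" by (rule mult_right_mono) simp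
      with False show ?thesis by (simp add: mult.assoc)
    qed simp
    have "norm (\<integral>z. h z - indicator (cball 0 \<rho>) z * h z \<partial>lborel) \<le> (\<integral>z. (1 + \<rho>) powr (- p) * ((1 + norm z) powr p * \<bar>h z\<bar>) \<partial>lborel)"
      by (rule Bochner_Integration.integral_norm_bound_integral[OF Bochner_Integration.integrable_diff[OF h(1) hi] integrable_mult_right[OF h(2)] le])
    then have "\<bar>(\<integral>z. h z \<partial>lborel) - (\<integral>z. indicator (cball 0 \<rho>) z * h z \<partial>lborel)\<bar> \<le> (1 + \<rho>) powr (- p) * (\<integral>z. (1 + norm z) powr p * \<bar>h z\<bar> \<partial>lborel)"
      unfolding Bochner_Integration.integral_diff[OF h(1) hi] by simp
    moreover have "(1 + \<rho>) powr (- p) * (\<integral>z. (1 + norm z) powr p * \<bar>h z\<bar> \<partial>lborel) \<le> (1 + \<rho>) powr (- p) * C"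
      using h(3) by (rule mult_left_mono) simp
    ultimately show ?thesis using \<rho>(2) by linarith
  qed
  have D0: "0 \<le> D" using D[of 0 0] by linarith
  show "\<exists>u u0. u \<longlonglongrightarrow> u0 \<and> (\<forall>k. \<bar>(\<integral>z. f k z \<partial>lborel) - u k\<bar> \<le> e) \<and> \<bar>(\<integral>z. f0 z \<partial>lborel) - u0\<bar> \<le> e"
  proof (intro exI conjI allI)
    show "(\<lambda>k. \<integral>z. indicator (cball 0 \<rho>) z * f k z \<partial>lborel) \<longlonglongrightarrow> (\<integral>z. indicator (cball 0 \<rho>) z * f0 z \<partial>lborel)"
    proof (rule integral_dominated_convergence[where w="\<lambda>z. indicator (cball 0 \<rho>) z * D"])
      show "integrable lborel (\<lambda>z::'a. indicator (cball 0 \<rho>) z * D)"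
        using emeasure_bounded_finite[OF bounded_cball[of 0 \<rho>]]
        by (intro integrable_mult_left integrable_real_indicator) (simp_all add: infinity_ennreal_def)
      show "AE z in lborel. (\<lambda>k. indicator (cball 0 \<rho>) z * f k z) \<longlonglongrightarrow> indicator (cball 0 \<rho>) z * f0 z"
        by (intro AE_I2 tendsto_intros f)
      show "AE z in lborel. norm (indicator (cball 0 \<rho>) z * f k z) \<le> indicator (cball 0 \<rho>) z * D" for k
        using D by (intro AE_I2) (simp add: indicator_def)
    qed (intro borel_measurable_times borel_measurable_indicator borel_measurable_integrable i, simp)+
    show "\<bar>(\<integral>z. f k z \<partial>lborel) - (\<integral>z. indicator (cball 0 \<rho>) z * f k z \<partial>lborel)\<bar> \<le> e" for k
      by (rule cutoff[OF i(1) w])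
    show "\<bar>(\<integral>z. f0 z \<partial>lborel) - (\<integral>z. indicator (cball 0 \<rho>) z * f0 z \<partial>lborel)\<bar> \<le> e"
      by (rule cutoff[OF i(2) w0])
  qed
qed

text \<open>Linearity in h reduces the continuity of \<Psi> to the finitely many basis directions
  and so makes it uniform in h. The average of \<Psi> over a short segment then differs from its
  value at x by at most e |h|.\<close>

lemma has_derivative_segment:
  fixes \<Phi> :: "'a::euclidean_space \<Rightarrow> real"
  assumes lin: "\<And>x. linear (\<Psi> x)"
    and seg: "\<And>h. \<Phi> (x + h) - \<Phi> x = (\<integral>r. \<Psi> (x + r *\<^sub>R h) h \<partial>restrict_space lborel {0..1})"
    and cont: "\<And>h. continuous_on UNIV (\<lambda>x. \<Psi> x h)"
  shows "(\<Phi> has_derivative \<Psi> x) (at x)"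
  unfolding has_derivative_at_alt
proof (intro conjI allI impI)
  interpret U: prob_space "restrict_space lborel {0..1::real}" by (rule prob_space_unit_interval)
  show "bounded_linear (\<Psi> x)" using lin by (simp add: linear_conv_bounded_linear)
  fix e :: real assume e: "0 < e"
  let ?e = "e / DIM('a)"
  have e': "0 < ?e" using e by simp
  have "\<forall>b\<in>Basis. eventually (\<lambda>y. \<bar>\<Psi> y b - \<Psi> x b\<bar> < ?e) (at x)"
  proof
    fix b :: 'a assume "b \<in> Basis"
    have "((\<lambda>y. \<Psi> y b) \<longlongrightarrow> \<Psi> x b) (at x)" using cont[of b] by (simp add: continuous_on_def)
    from tendstoD[OF this e'] show "eventually (\<lambda>y. \<bar>\<Psi> y b - \<Psi> x b\<bar> < ?e) (at x)" by (simp add: dist_real_def)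
  qed
  then have "eventually (\<lambda>y. \<forall>b\<in>Basis. \<bar>\<Psi> y b - \<Psi> x b\<bar> < ?e) (at x)" by (intro eventually_ball_finite) auto
  then obtain d where d: "0 < d" "\<And>y b. y \<noteq> x \<Longrightarrow> dist y x < d \<Longrightarrow> b \<in> Basis \<Longrightarrow> \<bar>\<Psi> y b - \<Psi> x b\<bar> < ?e"
    unfolding eventually_at by auto
  have near: "\<bar>\<Psi> y h - \<Psi> x h\<bar> \<le> e * norm h" if "norm (y - x) < d" for y h
  proof -
    have ex: "\<Psi> y h = (\<Sum>b\<in>Basis. (h \<bullet> b) * \<Psi> y b)" for y
    proof -
      have "\<Psi> y h = \<Psi> y (\<Sum>b\<in>Basis. (h \<bullet> b) *\<^sub>R b)" by (simp add: euclidean_representation)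
      also have "\<dots> = (\<Sum>b\<in>Basis. (h \<bullet> b) * \<Psi> y b)" by (simp add: linear_sum[OF lin] linear_scale[OF lin])
      finally show ?thesis .
    qed
    have "\<bar>\<Psi> y h - \<Psi> x h\<bar> = \<bar>\<Sum>b\<in>Basis. (h \<bullet> b) * (\<Psi> y b - \<Psi> x b)\<bar>"
      unfolding ex sum_subtractf[symmetric] by (simp add: right_diff_distrib)
    moreover have "\<bar>\<Sum>b\<in>Basis. (h \<bullet> b) * (\<Psi> y b - \<Psi> x b)\<bar> \<le> (\<Sum>b\<in>(Basis :: 'a set). norm h * ?e)"
    proof (rule order.trans[OF sum_abs sum_mono])
      fix b :: 'a assume b: "b \<in> Basis"
      have "\<bar>\<Psi> y b - \<Psi> x b\<bar> \<le> ?e" using d(2)[OF _ _ b, of y] that e by (cases "y = x") (auto simp: dist_norm less_imp_le)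
      then show "\<bar>(h \<bullet> b) * (\<Psi> y b - \<Psi> x b)\<bar> \<le> norm h * ?e"
        unfolding abs_mult using Basis_le_norm[OF b] by (intro mult_mono) auto
    qed
    ultimately show ?thesis by (simp add: mult.commute)
  qed
  show "\<exists>d>0. \<forall>y. norm (y - x) < d \<longrightarrow> norm (\<Phi> y - \<Phi> x - \<Psi> x (y - x)) \<le> e * norm (y - x)"
  proof (intro exI conjI allI impI)
    fix y assume y: "norm (y - x) < d"
    define h where "h = y - x"
    have h: "y = x + h" by (simp add: h_def)
    have cr: "continuous_on {0..1} (\<lambda>r. \<Psi> (x + r *\<^sub>R h) h)"
      by (rule continuous_on_compose2[OF cont]) (auto intro!: continuous_intros)
    have ir: "integrable (restrict_space lborel {0..1}) (\<lambda>r. \<Psi> (x + r *\<^sub>R h) h)"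
      using borel_integrable_atLeastAtMost'[OF cr] by (simp add: integrable_restrict_space set_integrable_def)
    have c: "(\<integral>r. a \<partial>restrict_space lborel {0..1::real}) = a" for a :: real
      unfolding lebesgue_integral_const U.prob_space by (rule scaleR_one)
    have "\<Phi> y - \<Phi> x - \<Psi> x h = (\<integral>r. \<Psi> (x + r *\<^sub>R h) h - \<Psi> x h \<partial>restrict_space lborel {0..1})"
      unfolding h seg Bochner_Integration.integral_diff[OF ir U.integrable_const] c ..
    moreover have "norm (\<integral>r. \<Psi> (x + r *\<^sub>R h) h - \<Psi> x h \<partial>restrict_space lborel {0..1}) \<le> (\<integral>r. e * norm h \<partial>restrict_space lborel {0..1::real})"
    proof (rule Bochner_Integration.integral_norm_bound_integral[OF Bochner_Integration.integrable_diff[OF ir U.integrable_const] U.integrable_const])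
      fix r :: real assume "r \<in> space (restrict_space lborel {0..1})"
      then have r: "0 \<le> r" "r \<le> 1" by (auto simp: space_restrict_space)
      have "norm (r *\<^sub>R h) \<le> 1 * norm h" unfolding norm_scaleR using r by (intro mult_right_mono) auto
      then have "norm ((x + r *\<^sub>R h) - x) < d" using y by (simp add: h_def)
      from near[OF this, of h] show "norm (\<Psi> (x + r *\<^sub>R h) h - \<Psi> x h) \<le> e * norm h" by simp
    qed
    ultimately show "norm (\<Phi> y - \<Phi> x - \<Psi> x (y - x)) \<le> e * norm (y - x)" unfolding c by (simp add: h_def)
  qed (rule d(1))
qed

text \<open>\<open>V hs\<close> is a candidate for the derivative along \<open>hs\<close>; the three
  assumptions make each level the Frechet derivative of the previous one. New directions enter at
  the head of the list, as in \<open>partial_derivs\<close>.\<close>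

lemma partial_derivs_segment:
  fixes V :: "(real^'n) list \<Rightarrow> real^'n \<Rightarrow> real"
  assumes lin: "\<And>a h h' hs x. length hs < n \<Longrightarrow> V ((a *\<^sub>R h + h') # hs) x = a * V (h # hs) x + V (h' # hs) x"
    and seg: "\<And>h hs x. length hs < n \<Longrightarrow> V hs (x + h) - V hs x = (\<integral>r. V (h # hs) (x + r *\<^sub>R h) \<partial>restrict_space lborel {0..1})"
    and cont: "\<And>hs. length hs \<le> n \<Longrightarrow> continuous_on UNIV (V hs)"
  shows "length is \<le> n \<Longrightarrow> partial_derivs (V []) is = V (map (\<lambda>i. axis i 1) is)"
    "length is < n \<Longrightarrow> partial_derivs (V []) is differentiable (at x)"
proof -
  have der: "(V hs has_derivative (\<lambda>h. V (h # hs) x)) (at x)" if "length hs < n" for hs x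
  proof (rule has_derivative_segment[where \<Psi>="\<lambda>x h. V (h # hs) x"])
    show "linear (\<lambda>h. V (h # hs) x)" for x
    proof (rule linearI)
      have 0: "V (0 # hs) x = 0" using lin[OF that, of 1 0 0 x] by simp
      show "V ((b1 + b2) # hs) x = V (b1 # hs) x + V (b2 # hs) x" for b1 b2 using lin[OF that, of 1 b1 b2 x] by simp
      show "V ((r *\<^sub>R b) # hs) x = r *\<^sub>R V (b # hs) x" for r b using lin[OF that, of r b 0 x] 0 by simp
    qed
    show "V hs (x + h) - V hs x = (\<integral>r. V (h # hs) (x + r *\<^sub>R h) \<partial>restrict_space lborel {0..1})" for h
      by (rule seg[OF that])
    show "continuous_on UNIV (\<lambda>x. V (h # hs) x)" for h by (rule cont) (use that in simp)
  qed
  have eq: "length is \<le> n \<Longrightarrow> partial_derivs (V []) is = V (map (\<lambda>i. axis i 1) is)" for "is"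
  proof (induction "is")
    case (Cons i "is")
    show ?case
    proof
      fix x
      have "partial_derivs (V []) is = V (map (\<lambda>i. axis i 1) is)" using Cons by simp
      moreover have "frechet_derivative (V (map (\<lambda>i. axis i 1) is)) (at x) = (\<lambda>h. V (h # map (\<lambda>i. axis i 1) is) x)"
        by (rule frechet_derivative_at[OF der, symmetric]) (use Cons.prems in simp)
      ultimately show "partial_derivs (V []) (i # is) x = V (map (\<lambda>i. axis i 1) (i # is)) x" by simp
    qed
  qed (auto simp: fun_eq_iff)
  then show "length is \<le> n \<Longrightarrow> partial_derivs (V []) is = V (map (\<lambda>i. axis i 1) is)" .
  show "partial_derivs (V []) is differentiable (at x)" if "length is < n"
    unfolding eq[OF less_imp_le[OF that]] differentiable_def
    by (rule exI, rule der) (use that in simp)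
qed

section \<open>The contribution of the initial value\<close>

context ou_kernel
begin

text \<open>A transform is bounded by the L^1 norm of its symbol, and the majorant of the symbols
  does not depend on t.\<close>

lemma kernel_sup_bound:
  obtains C where "0 \<le> C" "\<And>t z. \<bar>kernel t [] z\<bar> \<le> C"
proof -
  obtain C where C: "0 \<le> C" "\<And>t \<eta>. norm (stable_symbol (R t) s [] \<eta>) \<le> (\<Prod>v\<leftarrow>[]. norm (v::'a)) * C / (1 + (norm \<eta>)\<^sup>2) ^ DIM('a)"
    by (rule stable_symbol_bounds[OF c s, of 0, where 'a='a]) (use R in force)
  let ?J = "\<integral>\<eta>. C * (1 / (1 + (norm (\<eta> :: 'a))\<^sup>2) ^ DIM('a)) \<partial>lborel"
  have J: "integrable lborel (\<lambda>\<eta>::'a. C * (1 / (1 + (norm \<eta>)\<^sup>2) ^ DIM('a)))"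
    by (intro integrable_mult_right integrable_inverse_1_plus_norm_square_power)
  show ?thesis
  proof (rule that[of ?J])
    show "0 \<le> ?J" using C(1) by (intro integral_nonneg_AE) auto
    fix t z
    have i: "integrable lborel (\<lambda>\<eta>. stable_symbol (R t) s [] \<eta> * exp (- \<i> * of_real (\<eta> \<bullet> z)))"
    proof (rule Bochner_Integration.integrable_bound[OF stable_symbol_integrable[of t "[]"]])
      show "AE \<eta> in lborel. norm (stable_symbol (R t) s [] \<eta> * exp (- \<i> * of_real (\<eta> \<bullet> z))) \<le> norm (stable_symbol (R t) s [] \<eta>)"
        by (intro AE_I2) (simp add: norm_mult)
    qed measurable
    have "norm (fourier (stable_symbol (R t) s []) z) \<le> ?J"
      unfolding fourier_def
    proof (rule Bochner_Integration.integral_norm_bound_integral[OF i J])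
      show "norm (stable_symbol (R t) s [] \<eta> * exp (- \<i> * of_real (\<eta> \<bullet> z))) \<le> C * (1 / (1 + (norm \<eta>)\<^sup>2) ^ DIM('a))" for \<eta>
        using C(2)[of t \<eta>] by (simp add: norm_mult)
    qed
    moreover have "\<bar>kernel t [] z\<bar> \<le> norm (fourier (stable_symbol (R t) s []) z)"
    proof -
      have "1 \<le> (2 * pi) ^ DIM('a)" using pi_ge_two by (intro one_le_power) simp
      then have "\<bar>kernel t [] z\<bar> \<le> \<bar>Re (fourier (stable_symbol (R t) s []) z)\<bar> / 1"
        unfolding kernel_def abs_divide by (intro divide_left_mono) auto
      also have "\<dots> \<le> norm (fourier (stable_symbol (R t) s []) z)" by (simp add: abs_Re_le_cmod)
      finally show ?thesis .
    qed
    ultimately show "\<bar>kernel t [] z\<bar> \<le> ?J" by linarith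
  qed
qed

text \<open>Abstracts the multilinear forms that the derivatives of f up to order n define. In the
  last clause the directions move with the flow, because in \<open>initial\<close> both the point
  and the directions depend on time.\<close>

definition smooth_family :: "nat \<Rightarrow> real \<Rightarrow> ('a list \<Rightarrow> 'a \<Rightarrow> real) \<Rightarrow> bool" where
  "smooth_family n A F \<longleftrightarrow> 0 \<le> A \<and>
     (\<forall>hs y. length hs \<le> n \<longrightarrow> \<bar>F hs y\<bar> \<le> A * (\<Prod>h\<leftarrow>hs. norm h)) \<and>
     (\<forall>a h h' hs y. length hs < n \<longrightarrow> F ((a *\<^sub>R h + h') # hs) y = a * F (h # hs) y + F (h' # hs) y) \<and>
     (\<forall>h hs y. length hs < n \<longrightarrow> F hs (y + h) - F hs y = (\<integral>r. F (h # hs) (y + r *\<^sub>R h) \<partial>unit_measure)) \<and>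
     (\<forall>hs t t0 x x0. length hs \<le> n \<longrightarrow> t \<longlonglongrightarrow> t0 \<longrightarrow> x \<longlonglongrightarrow> x0 \<longrightarrow>
        (\<lambda>k. F (map (E (t k)) hs) (x k)) \<longlonglongrightarrow> F (map (E t0) hs) x0)"

text \<open>The derivatives fall on f and not on the kernel, so nothing is singular at t = 0. There
  the power of 0 is 0 and \<open>kernel 0 []\<close> has mass 1, so the value is
  \<open>F hs x\<close> without a case distinction.\<close>

definition initial :: "real \<Rightarrow> 'a list \<Rightarrow> ('a list \<Rightarrow> 'a \<Rightarrow> real) \<Rightarrow> 'a \<Rightarrow> real" where
  "initial t hs F x = (\<integral>z. F (map (E t) hs) (E t x + t powr (1 / (2 * s)) *\<^sub>R z) * kernel t [] z \<partial>lborel)"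

lemma smooth_familyD:
  assumes "smooth_family n A F"
  shows "0 \<le> A" "length hs \<le> n \<Longrightarrow> \<bar>F hs y\<bar> \<le> A * (\<Prod>h\<leftarrow>hs. norm h)"
    "length hs < n \<Longrightarrow> F ((a *\<^sub>R h + h') # hs) y = a * F (h # hs) y + F (h' # hs) y"
    "length hs < n \<Longrightarrow> F hs (y + h) - F hs y = (\<integral>r. F (h # hs) (y + r *\<^sub>R h) \<partial>unit_measure)"
    "length hs \<le> n \<Longrightarrow> t \<longlonglongrightarrow> t0 \<Longrightarrow> x \<longlonglongrightarrow> x0 \<Longrightarrow> (\<lambda>k. F (map (E (t k)) hs) (x k)) \<longlonglongrightarrow> F (map (E t0) hs) x0"
  using assms unfolding smooth_family_def by blast+

lemma smooth_family_continuous: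
  assumes "smooth_family n A F" "length hs \<le> n"
  shows "continuous_on UNIV (F (map (E t) hs))"
  unfolding continuous_on_sequentially
  using smooth_familyD(5)[OF assms tendsto_const, of _ _ t] by (auto simp: comp_def)

lemma smooth_family_measurable:
  assumes "smooth_family n A F" "length hs \<le> n"
  shows "F (map (E t) hs) \<in> borel_measurable borel"
  by (rule borel_measurable_continuous_onI[OF smooth_family_continuous[OF assms]])

lemma smooth_family_bound:
  assumes F: "smooth_family n A F" "length hs \<le> n" and t: "0 \<le> t" "t \<le> T"
  shows "\<bar>F (map (E t) hs) y\<bar> \<le> A * (M ^ length hs * (\<Prod>h\<leftarrow>hs. norm h))"
proof -
  have "\<bar>F (map (E t) hs) y\<bar> \<le> A * (\<Prod>v\<leftarrow>map (E t) hs. norm v)"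
    by (rule smooth_familyD(2)[OF F(1)]) (use F(2) in simp)
  also have "\<dots> \<le> A * (M ^ length hs * (\<Prod>h\<leftarrow>hs. norm h))"
    by (rule mult_left_mono[OF prod_list_E[OF t] smooth_familyD(1)[OF F(1)]])
  finally show ?thesis .
qed

lemma initial_integrand_measurable:
  assumes F: "smooth_family n A F" "length hs \<le> n"
  shows "(\<lambda>z. F (map (E t) hs) (y + c *\<^sub>R z)) \<in> borel_measurable borel"
  by (rule measurable_compose[OF _ smooth_family_measurable[OF F]]) measurable

lemma initial_integrable:
  assumes F: "smooth_family n A F" "length hs \<le> n" and t: "0 \<le> t" "t \<le> T"
  shows "integrable lborel (\<lambda>z. F (map (E t) hs) (y + c *\<^sub>R z) * kernel t [] z)"
  by (rule integrable_bounded_mult(1)[OF kernel_integrable initial_integrand_measurable[OF F] smooth_family_bound[OF F t]])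

lemma initial_bound:
  obtains C where "0 \<le> C" "\<And>t hs F A x. 0 \<le> t \<Longrightarrow> t \<le> T \<Longrightarrow> length hs = k \<Longrightarrow> k \<le> n \<Longrightarrow> smooth_family n A F \<Longrightarrow>
     \<bar>initial t hs F x\<bar> \<le> C * A * (\<Prod>h\<leftarrow>hs. norm h)"
proof -
  obtain C where C: "0 \<le> C" "\<And>t vs. length vs = 0 \<Longrightarrow> (\<integral>z. \<bar>kernel t vs z\<bar> \<partial>lborel) \<le> (\<Prod>v\<leftarrow>vs. norm v) * C"
    by (rule kernel_bound[of 0]) blast
  show ?thesis
  proof (rule that[of "C * M ^ k"])
    show "0 \<le> C * M ^ k" using C(1) M by simp
    fix t :: real and hs :: "'a list" and F :: "'a list \<Rightarrow> 'a \<Rightarrow> real" and A :: real and x :: 'a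
    assume t: "0 \<le> t" "t \<le> T" and hs: "length hs = k" "k \<le> n" and F: "smooth_family n A F"
    have hn: "length hs \<le> n" using hs by simp
    have "\<bar>initial t hs F x\<bar> \<le> A * (M ^ length hs * (\<Prod>h\<leftarrow>hs. norm h)) * (\<integral>z. \<bar>kernel t [] z\<bar> \<partial>lborel)"
      unfolding initial_def
      by (rule integrable_bounded_mult(2)[OF kernel_integrable initial_integrand_measurable[OF F hn] smooth_family_bound[OF F hn t]])
    also have "\<dots> \<le> A * (M ^ length hs * (\<Prod>h\<leftarrow>hs. norm h)) * C"
      by (intro mult_left_mono order.trans[OF C(2)[of "[]" t]] mult_nonneg_nonneg smooth_familyD(1)[OF F] prod_list_norm_nonneg zero_le_power) (use M in simp_all)
    also have "\<dots> = C * M ^ k * A * (\<Prod>h\<leftarrow>hs. norm h)" unfolding hs(1) by (simp only: mult_ac)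
    finally show "\<bar>initial t hs F x\<bar> \<le> C * M ^ k * A * (\<Prod>h\<leftarrow>hs. norm h)" .
  qed
qed

lemma initial_linear:
  assumes F: "smooth_family n A F" "length hs < n" and t: "0 \<le> t" "t \<le> T"
  shows "initial t ((a *\<^sub>R h + h') # hs) F x = a * initial t (h # hs) F x + initial t (h' # hs) F x"
proof -
  have i: "integrable lborel (\<lambda>z. F (E t v # map (E t) hs) (y + c *\<^sub>R z) * kernel t [] z)" for v y c
    using initial_integrable[OF F(1) _ t, of "v # hs"] F(2) by simp
  have l: "F (map (E t) ((a *\<^sub>R h + h') # hs)) y * k = a * (F (E t h # map (E t) hs) y * k) + F (E t h' # map (E t) hs) y * k" for y k
    unfolding list.map E_simps by (subst smooth_familyD(3)[OF F(1)]) (use F(2) in \<open>simp_all add: algebra_simps\<close>)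
  show ?thesis
    unfolding initial_def l unfolding list.map Bochner_Integration.integral_add[OF integrable_mult_right[OF i] i] integral_mult_right_zero ..
qed

text \<open>The segment identity of F in the transported direction is integrated against the kernel;
  the uniform bound on F one order higher justifies Fubini.\<close>

lemma initial_segment:
  assumes F: "smooth_family n A F" "length hs < n" and t: "0 \<le> t" "t \<le> T"
  shows "initial t hs F (x + h) - initial t hs F x = (\<integral>r. initial t (h # hs) F (x + r *\<^sub>R h) \<partial>unit_measure)"
proof -
  interpret U: prob_space unit_measure by (rule prob_space_unit_interval)
  interpret P: pair_sigma_finite unit_measure "lborel :: 'a measure" ..
  let ?e = "t powr (1 / (2 * s))" and ?G = "F (map (E t) (h # hs))"
  have hn: "length (h # hs) \<le> n" "length hs \<le> n" using F(2) by auto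
  let ?B = "A * (M ^ length (h # hs) * (\<Prod>h\<leftarrow>h # hs. norm h))"
  have K: "integrable (unit_measure \<Otimes>\<^sub>M lborel) (\<lambda>(r, z). kernel t [] z)"
    using integrable_translate_pair[OF kernel_integrable[of t "[]"], of 0] by simp
  have Gm: "(\<lambda>p. ?G (E t x + fst p *\<^sub>R E t h + ?e *\<^sub>R snd p)) \<in> borel_measurable (unit_measure \<Otimes>\<^sub>M lborel)"
  proof (rule measurable_compose[OF _ smooth_family_measurable[OF F(1) hn(1)]])
    have "(\<lambda>p. fst p) \<in> unit_measure \<Otimes>\<^sub>M (lborel :: 'a measure) \<rightarrow>\<^sub>M borel"
      using measurable_compose[OF measurable_fst measurable_restrict_space1[of "\<lambda>x. x" lborel borel "{0..1::real}"], of "lborel :: 'a measure"] by simp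
    then show "(\<lambda>p. E t x + fst p *\<^sub>R E t h + ?e *\<^sub>R snd p) \<in> borel_measurable (unit_measure \<Otimes>\<^sub>M (lborel :: 'a measure))"
      by (intro borel_measurable_add borel_measurable_scaleR) auto
  qed
  have int: "integrable (unit_measure \<Otimes>\<^sub>M lborel) (\<lambda>(r, z). ?G (E t x + r *\<^sub>R E t h + ?e *\<^sub>R z) * kernel t [] z)"
  proof (rule Bochner_Integration.integrable_bound[OF integrable_mult_right[OF K, of ?B]])
    show "(\<lambda>(r, z). ?G (E t x + r *\<^sub>R E t h + ?e *\<^sub>R z) * kernel t [] z) \<in> borel_measurable (unit_measure \<Otimes>\<^sub>M lborel)"
      using borel_measurable_times[OF Gm borel_measurable_integrable[OF K]] by (simp add: case_prod_beta')
    have B: "\<bar>?G y\<bar> \<le> \<bar>?B\<bar>" for y by (rule order.trans[OF smooth_family_bound[OF F(1) hn(1) t] abs_ge_self])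
    show "AE p in unit_measure \<Otimes>\<^sub>M lborel. norm (case p of (r, z) \<Rightarrow> ?G (E t x + r *\<^sub>R E t h + ?e *\<^sub>R z) * kernel t [] z)
        \<le> norm (?B * (case p of (r, z) \<Rightarrow> kernel t [] z))"
      unfolding case_prod_beta real_norm_def abs_mult[of ?B] abs_mult[of "?G _"] by (intro AE_I2 mult_right_mono B abs_ge_zero)
  qed
  have seg: "F (map (E t) hs) (E t (x + h) + ?e *\<^sub>R z) - F (map (E t) hs) (E t x + ?e *\<^sub>R z)
      = (\<integral>r. ?G (E t x + r *\<^sub>R E t h + ?e *\<^sub>R z) \<partial>unit_measure)" for z
  proof -
    have e1: "E t (x + h) + ?e *\<^sub>R z = (E t x + ?e *\<^sub>R z) + E t h" by (simp add: E_simps)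
    have e2: "E t x + r *\<^sub>R E t h + ?e *\<^sub>R z = (E t x + ?e *\<^sub>R z) + r *\<^sub>R E t h" for r by simp
    show ?thesis unfolding e1 e2 list.map by (rule smooth_familyD(4)[OF F(1)]) (use F(2) in simp)
  qed
  have "initial t hs F (x + h) - initial t hs F x = (\<integral>z. (F (map (E t) hs) (E t (x + h) + ?e *\<^sub>R z) - F (map (E t) hs) (E t x + ?e *\<^sub>R z)) * kernel t [] z \<partial>lborel)"
    unfolding initial_def left_diff_distrib
    by (rule Bochner_Integration.integral_diff[OF initial_integrable[OF F(1) hn(2) t] initial_integrable[OF F(1) hn(2) t], symmetric])
  also have "\<dots> = (\<integral>z. (\<integral>r. ?G (E t x + r *\<^sub>R E t h + ?e *\<^sub>R z) * kernel t [] z \<partial>unit_measure) \<partial>lborel)"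
    unfolding seg integral_mult_left_zero ..
  also have "\<dots> = (\<integral>r. (\<integral>z. ?G (E t x + r *\<^sub>R E t h + ?e *\<^sub>R z) * kernel t [] z \<partial>lborel) \<partial>unit_measure)"
    by (rule P.Fubini_integral[OF int])
  finally show ?thesis unfolding initial_def E_simps .
qed

text \<open>Here the weight is spent: the kernels at different times share a moment bound and a sup
  bound, so \<open>integral_tendsto_of_tight\<close> applies, also for t0 = 0.\<close>

lemma initial_tendsto:
  assumes F: "smooth_family n A F" "length hs \<le> n"
    and t: "t \<longlonglongrightarrow> t0" "\<And>k. 0 \<le> t k" "\<And>k. t k \<le> T" and x: "x \<longlonglongrightarrow> x0"
  shows "(\<lambda>k. initial (t k) hs F (x k)) \<longlonglongrightarrow> initial t0 hs F x0"
proof -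
  have t0: "0 \<le> t0" "t0 \<le> T" using LIMSEQ_le_const[OF t(1)] LIMSEQ_le_const2[OF t(1)] t(2,3) by auto
  obtain C where C: "0 \<le> C"
    "\<And>t vs. length vs = 0 \<Longrightarrow> integrable lborel (\<lambda>z. (1 + norm z) powr (s / DIM('a)) * \<bar>kernel t vs z\<bar>)"
    "\<And>t vs. length vs = 0 \<Longrightarrow> (\<integral>z. (1 + norm z) powr (s / DIM('a)) * \<bar>kernel t vs z\<bar> \<partial>lborel) \<le> (\<Prod>v\<leftarrow>vs. norm v) * C"
    by (rule kernel_bound[of 0]) blast
  obtain D where D: "0 \<le> D" "\<And>t z. \<bar>kernel t [] z\<bar> \<le> D" by (rule kernel_sup_bound) blast
  let ?B = "A * (M ^ length hs * (\<Prod>h\<leftarrow>hs. norm h))" and ?w = "\<lambda>z::'a. (1 + norm z) powr (s / DIM('a))"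
  let ?G = "\<lambda>t x z. F (map (E t) hs) (E t x + t powr (1 / (2 * s)) *\<^sub>R z)"
  have B: "\<bar>?G t x z\<bar> \<le> ?B" if "0 \<le> t" "t \<le> T" for t x z by (rule smooth_family_bound[OF F that])
  have B0: "0 \<le> ?B" by (rule order.trans[OF abs_ge_zero B[OF t0]])
  have wi: "integrable lborel (\<lambda>z. ?w z * \<bar>?G t x z * kernel t [] z\<bar>) \<and> (\<integral>z. ?w z * \<bar>?G t x z * kernel t [] z\<bar> \<partial>lborel) \<le> ?B * C" if tT: "0 \<le> t" "t \<le> T" for t x
  proof -
    have Ci: "integrable lborel (\<lambda>z. ?w z * \<bar>kernel t [] z\<bar>)" by (rule C(2)) simp
    have m: "(\<lambda>z. \<bar>?G t x z\<bar>) \<in> borel_measurable borel" by (rule borel_measurable_abs[OF initial_integrand_measurable[OF F]])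
    have b: "\<bar>\<bar>?G t x z\<bar>\<bar> \<le> ?B" for z using B[OF tT] by simp
    have eq: "?w z * \<bar>?G t x z * kernel t [] z\<bar> = \<bar>?G t x z\<bar> * (?w z * \<bar>kernel t [] z\<bar>)" for z by (simp only: abs_mult mult_ac)
    have a: "\<bar>?w z * \<bar>kernel t [] z\<bar>\<bar> = ?w z * \<bar>kernel t [] z\<bar>" for z by (rule abs_of_nonneg) simp
    have "(\<integral>z. ?w z * \<bar>kernel t [] z\<bar> \<partial>lborel) \<le> C" using C(3)[of "[]" t] by simp
    from mult_left_mono[OF this B0] integrable_bounded_mult(2)[OF Ci m b] abs_ge_self
    have "(\<integral>z. \<bar>?G t x z\<bar> * (?w z * \<bar>kernel t [] z\<bar>) \<partial>lborel) \<le> ?B * C" unfolding a by (meson order.trans)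
    with integrable_bounded_mult(1)[OF Ci m b] show ?thesis unfolding eq by blast
  qed
  show ?thesis
    unfolding initial_def
  proof (rule integral_tendsto_of_tight[where p="s / DIM('a)" and C="?B * C" and D="?B * D"])
    show "0 < s / DIM('a)" using s by simp
    show "(\<lambda>k. ?G (t k) (x k) z * kernel (t k) [] z) \<longlonglongrightarrow> ?G t0 x0 z * kernel t0 [] z" for z
    proof (intro tendsto_mult kernel_tendsto t(1) smooth_familyD(5)[OF F] tendsto_add E_tendsto x tendsto_scaleR tendsto_const)
      \<comment> \<open>The exponent is positive and the times are nonnegative, so the power is
        continuous at 0 too.\<close>
      show "(\<lambda>k. t k powr (1 / (2 * s))) \<longlonglongrightarrow> t0 powr (1 / (2 * s))"
        using s t(2) by (intro tendsto_powr' t(1) tendsto_const) auto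
    qed
    show "\<bar>?G (t k) (x k) z * kernel (t k) [] z\<bar> \<le> ?B * D" for k z
      unfolding abs_mult by (rule mult_mono[OF B[OF t(2,3)] D(2) B0 abs_ge_zero])
    show "integrable lborel (\<lambda>z. ?G (t k) (x k) z * kernel (t k) [] z)" for k
      by (rule initial_integrable[OF F t(2,3)])
    show "integrable lborel (\<lambda>z. ?G t0 x0 z * kernel t0 [] z)" by (rule initial_integrable[OF F t0])
  qed (use wi[OF t(2,3)] wi[OF t0] in blast)+
qed

text \<open>Differencing commutes with the integral and acts on F with the increment
  \<open>E t h\<close>, whose length is at most M |h|.\<close>

lemma difference_initial:
  assumes m: "m \<in> {1, 2}" and \<sigma>: "0 \<le> \<sigma>"
  obtains C where "0 \<le> C" "\<And>t hs h F A x. 0 \<le> t \<Longrightarrow> t \<le> T \<Longrightarrow> length hs = n \<Longrightarrow> smooth_family n A F \<Longrightarrow>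
     (\<And>hs h y. length hs = n \<Longrightarrow> \<bar>(difference h ^^ m) (F hs) y\<bar> \<le> A * (\<Prod>h\<leftarrow>hs. norm h) * norm h powr \<sigma>) \<Longrightarrow>
     \<bar>(difference h ^^ m) (initial t hs F) x\<bar> \<le> C * A * (\<Prod>h\<leftarrow>hs. norm h) * norm h powr \<sigma>"
proof -
  obtain C where C: "0 \<le> C" "\<And>t vs. length vs = 0 \<Longrightarrow> (\<integral>z. \<bar>kernel t vs z\<bar> \<partial>lborel) \<le> (\<Prod>v\<leftarrow>vs. norm v) * C"
    by (rule kernel_bound[of 0]) blast
  show ?thesis
  proof (rule that[of "C * M ^ n * M powr \<sigma>"])
    show "0 \<le> C * M ^ n * M powr \<sigma>" using C(1) M by simp
    fix t :: real and hs :: "'a list" and h :: 'a and F :: "'a list \<Rightarrow> 'a \<Rightarrow> real" and A :: real and x :: 'a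
    assume t: "0 \<le> t" "t \<le> T" and hs: "length hs = n" and F: "smooth_family n A F"
      and H: "\<And>hs h y. length hs = n \<Longrightarrow> \<bar>(difference h ^^ m) (F hs) y\<bar> \<le> A * (\<Prod>h\<leftarrow>hs. norm h) * norm h powr \<sigma>"
    have hn: "length hs \<le> n" using hs by simp
    let ?G = "F (map (E t) hs)" and ?e = "t powr (1 / (2 * s))"
    let ?B = "A * (M ^ n * (\<Prod>h\<leftarrow>hs. norm h)) * (M powr \<sigma> * norm h powr \<sigma>)"
    have i: "integrable lborel (\<lambda>z. ?G (y + ?e *\<^sub>R z) * kernel t [] z)" for y by (rule initial_integrable[OF F hn t])
    have mG: "(\<lambda>z. ?G (y + ?e *\<^sub>R z)) \<in> borel_measurable borel" for y by (rule initial_integrand_measurable[OF F hn])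
    have "(difference h ^^ m) (initial t hs F) x = (\<integral>z. (difference (E t h) ^^ m) ?G (E t x + ?e *\<^sub>R z) * kernel t [] z \<partial>lborel)
      \<and> (\<lambda>z. (difference (E t h) ^^ m) ?G (E t x + ?e *\<^sub>R z)) \<in> borel_measurable borel"
    proof (cases "m = 1")
      case True
      have e: "E t x + ?e *\<^sub>R z + E t h = (E t x + E t h) + ?e *\<^sub>R z" for z by simp
      show ?thesis
        unfolding True difference_1 initial_def E_simps e left_diff_distrib
        using Bochner_Integration.integral_diff[OF i i, symmetric] borel_measurable_diff[OF mG mG] by blast
    next
      case False
      with m have m2: "m = 2" by simp
      have e: "E t x + ?e *\<^sub>R z + E t h = (E t x + E t h) + ?e *\<^sub>R z" "E t x + E t h + ?e *\<^sub>R z + E t h = (E t x + E t h + E t h) + ?e *\<^sub>R z" for z by simp_all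
      have i2: "integrable lborel (\<lambda>z. 2 * (?G (y + ?e *\<^sub>R z) * kernel t [] z))" for y by (rule integrable_mult_right[OF i])
      show ?thesis
        unfolding m2 difference_2 initial_def E_simps e left_diff_distrib distrib_right mult.assoc
        unfolding Bochner_Integration.integral_add[OF Bochner_Integration.integrable_diff[OF i i2] i]
          Bochner_Integration.integral_diff[OF i i2] integral_mult_right_zero
        using borel_measurable_add[OF borel_measurable_diff[OF mG borel_measurable_times[OF borel_measurable_const mG]] mG] by blast
    qed
    then have eq: "(difference h ^^ m) (initial t hs F) x = (\<integral>z. (difference (E t h) ^^ m) ?G (E t x + ?e *\<^sub>R z) * kernel t [] z \<partial>lborel)"
      and meas: "(\<lambda>z. (difference (E t h) ^^ m) ?G (E t x + ?e *\<^sub>R z)) \<in> borel_measurable borel" by blast+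
    have b: "\<bar>(difference (E t h) ^^ m) ?G y\<bar> \<le> ?B" for y
    proof -
      have "\<bar>(difference (E t h) ^^ m) ?G y\<bar> \<le> A * (\<Prod>v\<leftarrow>map (E t) hs. norm v) * norm (E t h) powr \<sigma>"
        by (rule H) (use hs in simp)
      also have "\<dots> \<le> A * (M ^ n * (\<Prod>h\<leftarrow>hs. norm h)) * (M * norm h) powr \<sigma>"
        using prod_list_E[OF t, of hs] hs smooth_familyD(1)[OF F] M
        by (intro mult_mono mult_left_mono powr_mono2 E_bound t mult_nonneg_nonneg prod_list_norm_nonneg \<sigma>) simp_all
      also have "(M * norm h) powr \<sigma> = M powr \<sigma> * norm h powr \<sigma>" using M by (simp add: powr_mult)
      finally show ?thesis .
    qed
    have "0 \<le> ?B" by (rule order.trans[OF abs_ge_zero b])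
    have "\<bar>\<integral>z. (difference (E t h) ^^ m) ?G (E t x + ?e *\<^sub>R z) * kernel t [] z \<partial>lborel\<bar> \<le> ?B * (\<integral>z. \<bar>kernel t [] z\<bar> \<partial>lborel)"
      by (rule integrable_bounded_mult(2)[OF kernel_integrable meas b])
    also have "\<dots> \<le> ?B * C"
      using C(2)[of "[]" t] by (intro mult_left_mono \<open>0 \<le> ?B\<close>) simp
    also have "\<dots> = C * M ^ n * M powr \<sigma> * A * (\<Prod>h\<leftarrow>hs. norm h) * norm h powr \<sigma>" by (simp only: mult_ac)
    finally show "\<bar>(difference h ^^ m) (initial t hs F) x\<bar> \<le> C * M ^ n * M powr \<sigma> * A * (\<Prod>h\<leftarrow>hs. norm h) * norm h powr \<sigma>"
      unfolding eq .
  qed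
qed

end

section \<open>The Ornstein-Uhlenbeck data as an instance\<close>

definition ou_flow :: "real^'n^'n \<Rightarrow> real \<Rightarrow> real^'n \<Rightarrow> real^'n" where
  "ou_flow B t x = mat_exp ((- t) *\<^sub>R B) *v x"

text \<open>Clamping t \<theta> to [0, T] makes the bounds hold for all real t and \<theta>, as the
  locale demands; for t in [0, T] and \<theta> in [0, 1] it changes nothing.\<close>

definition ou_rescaled :: "real^'n^'n \<Rightarrow> real^'n^'n \<Rightarrow> real \<Rightarrow> real \<Rightarrow> real \<Rightarrow> real^'n \<Rightarrow> real^'n" where
  "ou_rescaled Q B T t \<theta> \<eta> = mat_sqrt Q *v (mat_exp ((- max 0 (min T (t * \<theta>))) *\<^sub>R transpose B) *v \<eta>)"

lemma continuous_on_matrix_vector_mult: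
  fixes A :: "'a::topological_space \<Rightarrow> real^'n^'m"
  assumes "continuous_on S A" "continuous_on S v"
  shows "continuous_on S (\<lambda>x. A x *v v x)"
  unfolding matrix_vector_mult_def by (intro continuous_on_vec_lambda continuous_intros assms)

lemma continuous_on_mat_exp:
  assumes "continuous_on S a"
  shows "continuous_on S (\<lambda>x. mat_exp (a x *\<^sub>R A))"
  by (rule continuous_on_compose2[OF mat_exp_continuous assms]) simp

lemma mat_exp_minus_bounds:
  fixes A :: "real^'n^'n"
  obtains K where "0 < K" "\<And>x v. 0 \<le> x \<Longrightarrow> x \<le> T \<Longrightarrow> norm (mat_exp ((- x) *\<^sub>R A) *v v) \<le> exp (K * T) * norm v"
    "\<And>x v. 0 \<le> x \<Longrightarrow> x \<le> T \<Longrightarrow> exp (- K * T) * norm v \<le> norm (mat_exp ((- x) *\<^sub>R A) *v v)"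
proof -
  obtain K where K: "0 < K" "\<And>x v. 0 \<le> x \<Longrightarrow> norm (mat_exp (x *\<^sub>R (- A)) *v v) \<le> exp (K * x) * norm v"
    "\<And>x v. 0 \<le> x \<Longrightarrow> exp (- K * x) * norm v \<le> norm (mat_exp (x *\<^sub>R (- A)) *v v)"
    by (rule mat_exp_bounds[of "- A"]) blast
  have eq: "(- x) *\<^sub>R A = x *\<^sub>R (- A)" for x by simp
  show ?thesis
  proof (rule that[OF K(1)])
    fix x :: real and v :: "real^'n" assume x: "0 \<le> x" "x \<le> T"
    have "exp (K * x) * norm v \<le> exp (K * T) * norm v" "exp (- K * T) * norm v \<le> exp (- K * x) * norm v"
      using x K(1) by (auto intro!: mult_right_mono)
    with K(2,3)[OF x(1), of v] show "norm (mat_exp ((- x) *\<^sub>R A) *v v) \<le> exp (K * T) * norm v"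
      "exp (- K * T) * norm v \<le> norm (mat_exp ((- x) *\<^sub>R A) *v v)" unfolding eq by linarith+
  qed
qed

text \<open>The ellipticity constants are products of the bounds for the square root of Q and for
  the exponential of the transpose of B; M comes from the exponential of B itself.\<close>

lemma ou_kernel_rescaled:
  fixes Q B :: "real^'n^'n"
  assumes Q: "sym_pos_def Q" and T: "0 < T" and s: "0 < s" "s < 1"
  obtains c0 c1 M where "ou_kernel (ou_rescaled Q B T) s c0 c1 (ou_flow B) T M"
proof -
  obtain q k where q: "0 < q" "0 < k" "\<And>x. q * norm x \<le> norm (mat_sqrt Q *v x)" "\<And>x. norm (mat_sqrt Q *v x) \<le> k * norm x"
    by (rule mat_sqrt_bounds[OF Q]) blast
  obtain K where K: "0 < K" "\<And>x v. 0 \<le> x \<Longrightarrow> x \<le> T \<Longrightarrow> norm (mat_exp ((- x) *\<^sub>R transpose B) *v v) \<le> exp (K * T) * norm v"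
    "\<And>x v. 0 \<le> x \<Longrightarrow> x \<le> T \<Longrightarrow> exp (- K * T) * norm v \<le> norm (mat_exp ((- x) *\<^sub>R transpose B) *v v)"
    by (rule mat_exp_minus_bounds[of T "transpose B"]) blast
  obtain L where L: "0 < L" "\<And>x v. 0 \<le> x \<Longrightarrow> x \<le> T \<Longrightarrow> norm (mat_exp ((- x) *\<^sub>R B) *v v) \<le> exp (L * T) * norm v"
    by (rule mat_exp_minus_bounds[of T B]) blast
  have cont: "continuous_on S (\<lambda>x. ou_rescaled Q B T (a x) (b x) (v x))"
    if "continuous_on S a" "continuous_on S b" "continuous_on S v" for S :: "'x::topological_space set" and a b v
    unfolding ou_rescaled_def
    by (intro continuous_on_matrix_vector_mult continuous_on_mat_exp continuous_intros that)
  have adm: "admissible (q * exp (- K * T)) (k * exp (K * T)) (ou_rescaled Q B T t)" for t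
    unfolding admissible_def
  proof (intro conjI allI)
    show "continuous_on UNIV (\<lambda>(\<theta>, \<eta>). ou_rescaled Q B T t \<theta> \<eta>)"
      unfolding case_prod_beta' by (intro cont continuous_intros)
    show "linear (ou_rescaled Q B T t \<theta>)" for \<theta>
      by (rule linearI) (simp_all add: ou_rescaled_def matrix_vector_right_distrib matrix_vector_mult_scaleR)
    fix \<theta> \<eta>
    let ?x = "max 0 (min T (t * \<theta>))"
    have x: "0 \<le> ?x" "?x \<le> T" using T by auto
    have "q * exp (- K * T) * norm \<eta> \<le> q * norm (mat_exp ((- ?x) *\<^sub>R transpose B) *v \<eta>)"
      using mult_left_mono[OF K(3)[OF x, of \<eta>], of q] q(1) by (simp add: mult.assoc)
    also have "\<dots> \<le> norm (ou_rescaled Q B T t \<theta> \<eta>)" unfolding ou_rescaled_def by (rule q(3))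
    finally show "q * exp (- K * T) * norm \<eta> \<le> norm (ou_rescaled Q B T t \<theta> \<eta>)" .
    have "norm (ou_rescaled Q B T t \<theta> \<eta>) \<le> k * norm (mat_exp ((- ?x) *\<^sub>R transpose B) *v \<eta>)" unfolding ou_rescaled_def by (rule q(4))
    also have "\<dots> \<le> k * exp (K * T) * norm \<eta>"
      using mult_left_mono[OF K(2)[OF x, of \<eta>], of k] q(2) by (simp add: mult.assoc)
    finally show "norm (ou_rescaled Q B T t \<theta> \<eta>) \<le> k * exp (K * T) * norm \<eta>" .
  qed
  have "ou_kernel (ou_rescaled Q B T) s (q * exp (- K * T)) (k * exp (K * T)) (ou_flow B) T (exp (L * T))"
  proof (intro ou_kernel.intro symbol_family.intro ou_kernel_axioms.intro)
    show "continuous_on UNIV (\<lambda>(t, \<theta>, \<eta>). ou_rescaled Q B T t \<theta> \<eta>)"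
      unfolding case_prod_beta' by (intro cont continuous_intros)
    show "linear (ou_flow B t)" for t
      by (rule linearI) (simp_all add: ou_flow_def matrix_vector_right_distrib matrix_vector_mult_scaleR)
    show "continuous_on UNIV (\<lambda>(t, x). ou_flow B t x)"
      unfolding case_prod_beta' ou_flow_def by (intro continuous_on_matrix_vector_mult continuous_on_mat_exp continuous_intros)
    show "norm (ou_flow B t x) \<le> exp (L * T) * norm x" if "0 \<le> t" "t \<le> T" for t x
      unfolding ou_flow_def by (rule L(2)[OF that])
    show "ou_flow B 0 x = x" for x by (simp add: ou_flow_def mat_exp_0)
  qed (use s T q adm L(1) in auto)
  then show thesis by (rule that)
qed

lemma set_integral_scale:
  fixes \<phi> :: "real \<Rightarrow> real"
  assumes [measurable]: "\<phi> \<in> borel_measurable borel" and t: "0 < t"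
  shows "(LINT \<sigma>:{0..t}|lborel. \<phi> \<sigma>) = t * (\<integral>\<theta>. \<phi> (t * \<theta>) \<partial>restrict_space lborel {0..1})"
proof -
  have "indicator {0..t} (t * \<theta>) = (indicator {0..1} \<theta> :: real)" for \<theta>
    using t by (simp add: indicator_def zero_le_mult_iff)
  then show ?thesis
    unfolding set_lebesgue_integral_def
    by (subst integral_scale[OF _ t]) (auto simp: integral_restrict_space)
qed

context
  fixes Q B :: "real^'n^'n" and s T c0 c1 M :: real
  assumes ou: "ou_kernel (ou_rescaled Q B T) s c0 c1 (ou_flow B) T M"
begin

interpretation ou_kernel "ou_rescaled Q B T" s c0 c1 "ou_flow B" T M by (rule ou)

text \<open>With \<sigma> = t \<theta> and \<xi> = t^(-1/(2s)) \<eta>, homogeneity of order 2s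
  produces 1/t, which cancels the Jacobian t. What remains is elliptic uniformly in t.\<close>

lemma ou_symbol_scale:
  assumes t: "0 < t" "t \<le> T"
  shows "ou_symbol Q B s t (t powr (- (1 / (2 * s))) *\<^sub>R \<eta>) = exp (- stable_exponent (ou_rescaled Q B T t) s \<eta>)"
proof -
  let ?\<phi> = "\<lambda>\<sigma>. norm (mat_sqrt Q *v (mat_exp ((- \<sigma>) *\<^sub>R transpose B) *v (t powr (- (1 / (2 * s))) *\<^sub>R \<eta>))) powr (2 * s)"
  have "continuous_on UNIV (\<lambda>\<sigma>. norm (mat_sqrt Q *v (mat_exp ((- \<sigma>) *\<^sub>R transpose B) *v (t powr (- (1 / (2 * s))) *\<^sub>R \<eta>))))"
    by (intro continuous_on_matrix_vector_mult continuous_on_mat_exp continuous_intros)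
  from borel_measurable_continuous_onI[OF this] have m: "?\<phi> \<in> borel_measurable borel"
    by measurable
  have "?\<phi> (t * \<theta>) = (1 / t) * ((norm (ou_rescaled Q B T t \<theta> \<eta>))\<^sup>2) powr s" if \<theta>: "\<theta> \<in> {0..1}" for \<theta>
  proof -
    have "t * \<theta> \<le> t * 1" using \<theta> t by (intro mult_left_mono) auto
    then have "t * \<theta> \<le> T" using t by linarith
    then have "max 0 (min T (t * \<theta>)) = t * \<theta>" using \<theta> t by simp
    then have "?\<phi> (t * \<theta>) = (t powr (- (1 / (2 * s))) * norm (ou_rescaled Q B T t \<theta> \<eta>)) powr (2 * s)"
      by (simp add: ou_rescaled_def matrix_vector_mult_scaleR)
    also have "\<dots> = (t powr (- (1 / (2 * s)))) powr (2 * s) * norm (ou_rescaled Q B T t \<theta> \<eta>) powr (2 * s)"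
      by (simp add: powr_mult)
    finally have "?\<phi> (t * \<theta>) = (t powr (- (1 / (2 * s)))) powr (2 * s) * norm (ou_rescaled Q B T t \<theta> \<eta>) powr (2 * s)" .
    moreover have "(t powr (- (1 / (2 * s)))) powr (2 * s) = 1 / t"
    proof -
      have e: "(- (1 / (2 * s))) * (2 * s) = - 1" using s by simp
      show ?thesis unfolding powr_powr e using t by (simp add: powr_minus_divide)
    qed
    moreover have "norm v powr (2 * s) = ((norm v)\<^sup>2) powr s" for v :: "real^'n"
    proof (cases "v = 0")
      case False
      then have e: "(norm v)\<^sup>2 = norm v powr 2" by simp
      show ?thesis unfolding e powr_powr ..
    qed simp
    ultimately show ?thesis by (simp only:)
  qed
  then have "(\<integral>\<theta>. ?\<phi> (t * \<theta>) \<partial>unit_measure) = (\<integral>\<theta>. (1 / t) * ((norm (ou_rescaled Q B T t \<theta> \<eta>))\<^sup>2) powr s \<partial>unit_measure)"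
    by (intro Bochner_Integration.integral_cong refl) (simp add: space_restrict_space)
  then have "(LINT \<sigma>:{0..t}|lborel. ?\<phi> \<sigma>) = (\<integral>\<theta>. ((norm (ou_rescaled Q B T t \<theta> \<eta>))\<^sup>2) powr s \<partial>unit_measure)"
    unfolding set_integral_scale[OF m t(1)] using t by simp
  then show ?thesis unfolding ou_symbol_def stable_exponent_def by simp
qed

lemma ou_symbol_measurable:
  assumes t: "0 < t" "t \<le> T"
  shows "ou_symbol Q B s t \<in> borel_measurable borel"
proof -
  have 1: "(\<lambda>\<eta>. ou_symbol Q B s t (t powr (- (1 / (2 * s))) *\<^sub>R \<eta>)) \<in> borel_measurable borel"
  proof -
    have "(\<lambda>\<eta>. Re (stable_symbol (ou_rescaled Q B T t) s [] \<eta>)) \<in> borel_measurable borel" by measurable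
    then show ?thesis unfolding ou_symbol_scale[OF t] by (simp add: stable_symbol_def)
  qed
  have "(\<lambda>\<xi>. ou_symbol Q B s t (t powr (- (1 / (2 * s))) *\<^sub>R (t powr (1 / (2 * s)) *\<^sub>R \<xi>))) \<in> borel_measurable borel"
    by (rule measurable_compose[OF _ 1]) measurable
  moreover have "t powr (- (1 / (2 * s))) * t powr (1 / (2 * s)) = 1" using t by (simp add: powr_minus)
  ultimately show ?thesis by simp
qed

lemma ou_density_kernel:
  assumes t: "0 < t" "t \<le> T"
  shows "ou_density Q B s t z = (t powr (- (1 / (2 * s)))) ^ CARD('n) * kernel t [] (t powr (- (1 / (2 * s))) *\<^sub>R z)"
proof -
  let ?c = "t powr (- (1 / (2 * s)))"
  have c: "0 < ?c" using t by simp
  note [measurable] = ou_symbol_measurable[OF t]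
  have "(\<integral>\<xi>. of_real (ou_symbol Q B s t \<xi>) * exp (- \<i> * of_real (\<xi> \<bullet> z)) \<partial>lborel)
     = ?c ^ CARD('n) *\<^sub>R (\<integral>\<eta>. of_real (ou_symbol Q B s t (?c *\<^sub>R \<eta>)) * exp (- \<i> * of_real ((?c *\<^sub>R \<eta>) \<bullet> z)) \<partial>lborel)"
    by (subst integral_scale[OF _ c]) auto
  also have "(\<integral>\<eta>. of_real (ou_symbol Q B s t (?c *\<^sub>R \<eta>)) * exp (- \<i> * of_real ((?c *\<^sub>R \<eta>) \<bullet> z)) \<partial>lborel)
     = fourier (stable_symbol (ou_rescaled Q B T t) s []) (?c *\<^sub>R z)"
    unfolding ou_symbol_scale[OF t] fourier_def by (simp add: stable_symbol_def)
  finally have "ou_density Q B s t z = Re (1 / (2 * of_real pi) ^ CARD('n) * (?c ^ CARD('n) *\<^sub>R fourier (stable_symbol (ou_rescaled Q B T t) s []) (?c *\<^sub>R z)))"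
    unfolding ou_density_def by (simp only:)
  also have "1 / (2 * of_real pi) ^ CARD('n) = (of_real (1 / (2 * pi) ^ CARD('n)) :: complex)" by simp
  finally show ?thesis by (simp add: kernel_def del: of_real_divide of_real_power of_real_mult)
qed

text \<open>The Jacobian of z -> t^(1/(2s)) z cancels the factor that rescales the density. At t = 0
  both sides are \<open>f x\<close>, as the kernel has mass 1.\<close>

lemma ou_semigroup_kernel:
  assumes t: "0 \<le> t" "t \<le> T" and f: "f \<in> borel_measurable borel"
  shows "ou_semigroup Q B s t f x = (\<integral>z. f (ou_flow B t x + t powr (1 / (2 * s)) *\<^sub>R z) * kernel t [] z \<partial>lborel)"
proof (cases "t = 0")
  case True
  then show ?thesis by (simp add: ou_semigroup_def E_0 integral_kernel)
next
  case False
  with t have t0: "0 < t" by simp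
  let ?c = "t powr (- (1 / (2 * s)))" and ?e = "t powr (1 / (2 * s))"
  have e: "0 < ?e" using t0 by simp
  have ce: "?c * ?e = 1" using t0 by (simp add: powr_minus)
  note [measurable] = f
  have K: "(\<lambda>z. kernel t [] (?c *\<^sub>R z)) \<in> borel_measurable borel"
    by (rule measurable_compose[OF _ kernel_measurable1]) measurable
  have m: "(\<lambda>z. f (ou_flow B t x + z) * (?c ^ CARD('n) * kernel t [] (?c *\<^sub>R z))) \<in> borel_measurable borel"
    by (intro borel_measurable_times K) measurable
  have "ou_semigroup Q B s t f x = (\<integral>z. f (ou_flow B t x + z) * (?c ^ CARD('n) * kernel t [] (?c *\<^sub>R z)) \<partial>lborel)"
    using False unfolding ou_semigroup_def ou_density_kernel[OF t0 t(2)] by (simp add: ou_flow_def)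
  also have "\<dots> = ?e ^ CARD('n) * (\<integral>z. f (ou_flow B t x + ?e *\<^sub>R z) * (?c ^ CARD('n) * kernel t [] (?c *\<^sub>R (?e *\<^sub>R z))) \<partial>lborel)"
    by (subst integral_scale[OF m e]) simp
  also have "\<dots> = ?e ^ CARD('n) * (\<integral>z. ?c ^ CARD('n) * (f (ou_flow B t x + ?e *\<^sub>R z) * kernel t [] z) \<partial>lborel)"
    unfolding scaleR_scaleR mult.commute[of ?e ?c] ce scaleR_one mult.left_commute[of "f _"] ..
  also have "\<dots> = (?c * ?e) ^ CARD('n) * (\<integral>z. f (ou_flow B t x + ?e *\<^sub>R z) * kernel t [] z \<partial>lborel)"
    unfolding integral_mult_right_zero power_mult_distrib by (simp only: mult_ac)
  finally show ?thesis unfolding ce by simp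
qed

text \<open>Reflection r = t - \<tau> of the time integral. Only values of \<open>g\<close> on
  [0, T] occur in it, so the global extension \<open>g'\<close> may take its place.\<close>

lemma ou_mild_solution_duhamel:
  assumes t: "0 \<le> t" "t \<le> T" and f: "f \<in> borel_measurable borel" and F: "F [] = f" and \<alpha>: "0 \<le> \<alpha>"
    and g': "source \<alpha> A g'" and g: "\<And>r. 0 \<le> r \<Longrightarrow> r \<le> T \<Longrightarrow> g r = g' r"
  shows "ou_mild_solution Q B s f g t x = initial t [] F x + duhamel t [] g' x"
proof -
  have 1: "ou_semigroup Q B s t f x = initial t [] F x"
    unfolding ou_semigroup_kernel[OF t f] initial_def by (simp add: F)
  let ?S = "\<lambda>\<tau>. indicator {0..t} \<tau> *\<^sub>R smoothing \<tau> [] (g' (t - \<tau>)) x"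
  have i: "integrable lborel ?S"
    using duhamel_set_integrable[OF \<alpha> _ t g', of "[]" x] s \<alpha> by (simp add: set_integrable_def)
  have i0: "integrable lborel (\<lambda>\<tau>. indicator {0::real} \<tau> * g' t x)"
    by (intro integrable_mult_left integrable_real_indicator) auto
  \<comment> \<open>At \<tau> = 0 the prefactor in \<open>smoothing\<close> is 0 powr 0 = 0, whereas
    the semigroup returns \<open>g' t x\<close>. The indicator of the single point accounts for this
    and integrates to 0.\<close>
  have eq: "indicator {0..t} (t + (- 1) * \<tau>) *\<^sub>R ou_semigroup Q B s (t - (t + (- 1) * \<tau>)) (g (t + (- 1) * \<tau>)) x = ?S \<tau> + indicator {0} \<tau> * g' t x" for \<tau>
  proof (cases "\<tau> \<in> {0..t}")
    case True
    then have \<tau>: "0 \<le> \<tau>" "\<tau> \<le> T" "g (t - \<tau>) = g' (t - \<tau>)" using t g[of "t - \<tau>"] by auto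
    show ?thesis
    proof (cases "\<tau> = 0")
      case True
      then show ?thesis using \<tau> t s by (simp add: ou_semigroup_def smoothing_def)
    next
      case False
      with \<tau> True show ?thesis by (simp add: ou_semigroup_kernel[OF \<tau>(1,2) sourceD(5)[OF g']] smoothing_def)
    qed
  next
    case False
    then show ?thesis using t by (auto simp: indicator_def)
  qed
  have "(\<integral>r. indicator {0..t} r *\<^sub>R ou_semigroup Q B s (t - r) (g r) x \<partial>lborel)
    = \<bar>- 1\<bar> *\<^sub>R (\<integral>\<tau>. indicator {0..t} (t + (- 1) * \<tau>) *\<^sub>R ou_semigroup Q B s (t - (t + (- 1) * \<tau>)) (g (t + (- 1) * \<tau>)) x \<partial>lborel)"
    by (rule lborel_integral_real_affine) simp
  then have "(LINT r:{0..t}|lborel. ou_semigroup Q B s (t - r) (g r) x) = (\<integral>\<tau>. ?S \<tau> + indicator {0} \<tau> * g' t x \<partial>lborel)"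
    unfolding set_lebesgue_integral_def eq abs_minus_cancel abs_one scaleR_one .
  moreover have "(\<integral>\<tau>. ?S \<tau> + indicator {0} \<tau> * g' t x \<partial>lborel) = duhamel t [] g' x + (\<integral>\<tau>. indicator {0::real} \<tau> * g' t x \<partial>lborel)"
    unfolding duhamel_def set_lebesgue_integral_def by (rule Bochner_Integration.integral_add[OF i i0])
  moreover have "(\<integral>\<tau>. indicator {0::real} \<tau> * a \<partial>lborel) = 0" for a :: real by simp
  ultimately show ?thesis unfolding ou_mild_solution_def 1 by (simp only: add_0_right)
qed

end

section \<open>Derivatives of the data as multilinear forms\<close>

text \<open>The multilinear form with coefficient tensor A. It leads from partial derivatives, taken
  in coordinate directions, to the moving directions required by
  \<open>smooth_family\<close>.\<close>

fun directional :: "('n::finite list \<Rightarrow> real) \<Rightarrow> (real^'n) list \<Rightarrow> real" where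
  "directional A [] = A []"
| "directional A (v # vs) = (\<Sum>i\<in>UNIV. v $ i * directional (\<lambda>js. A (i # js)) vs)"

lemma directional_cong:
  "(\<And>js. length js = length vs \<Longrightarrow> A js = A' js) \<Longrightarrow> directional A vs = directional A' vs"
proof (induction vs arbitrary: A A')
  case (Cons v vs)
  have "directional (\<lambda>js. A (i # js)) vs = directional (\<lambda>js. A' (i # js)) vs" for i
    by (rule Cons.IH) (rule Cons.prems, simp)
  then show ?case by simp
qed simp

lemma directional_sum: "directional (\<lambda>js. \<Sum>i\<in>I. c i * A i js) vs = (\<Sum>i\<in>I. c i * directional (A i) vs)"
proof (induction vs arbitrary: A)
  case (Cons v vs)
  have "directional (\<lambda>js. \<Sum>i\<in>I. c i * A i js) (v # vs) = (\<Sum>j\<in>UNIV. \<Sum>i\<in>I. v $ j * (c i * directional (\<lambda>js. A i (j # js)) vs))"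
    by (simp add: Cons.IH sum_distrib_left)
  also have "\<dots> = (\<Sum>i\<in>I. \<Sum>j\<in>UNIV. v $ j * (c i * directional (\<lambda>js. A i (j # js)) vs))" by (rule sum.swap)
  finally show ?case by (simp add: sum_distrib_left mult.left_commute)
qed simp

lemma directional_add: "directional (\<lambda>js. A js + A' js) vs = directional A vs + directional A' vs"
  by (induction vs arbitrary: A A') (simp_all add: distrib_left sum.distrib)

lemma directional_mult: "directional (\<lambda>js. c * A js) vs = c * directional A vs"
  by (induction vs arbitrary: A) (simp_all add: sum_distrib_left mult.left_commute)

lemma directional_diff: "directional (\<lambda>js. A js - A' js) vs = directional A vs - directional A' vs"
  using directional_add[of A "\<lambda>js. - 1 * A' js" vs] unfolding directional_mult by simp

lemma directional_bound:
  "(\<And>js. length js = length vs \<Longrightarrow> \<bar>A js\<bar> \<le> K) \<Longrightarrow> \<bar>directional (A :: 'n::finite list \<Rightarrow> real) vs\<bar> \<le> real CARD('n) ^ length vs * K * (\<Prod>v\<leftarrow>vs. norm v)"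
proof (induction vs arbitrary: A)
  case (Cons v vs)
  let ?B = "real CARD('n) ^ length vs * K * (\<Prod>v\<leftarrow>vs. norm v)"
  have le: "\<bar>directional (\<lambda>js. A (i # js)) vs\<bar> \<le> ?B" for i
    by (rule Cons.IH) (rule Cons.prems, simp)
  have "\<bar>directional A (v # vs)\<bar> \<le> (\<Sum>i\<in>(UNIV :: 'n set). norm v * ?B)"
    unfolding directional.simps
  proof (rule order.trans[OF sum_abs sum_mono])
    show "\<bar>v $ i * directional (\<lambda>js. A (i # js)) vs\<bar> \<le> norm v * ?B" for i
      unfolding abs_mult by (rule mult_mono[OF component_le_norm_cart le norm_ge_zero abs_ge_zero])
  qed
  then show ?case by (simp add: mult_ac)
qed simp

lemma directional_tendsto:
  assumes "\<And>h. (\<lambda>k. E k h) \<longlonglongrightarrow> E0 h"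
  shows "(\<And>js. length js = length hs \<Longrightarrow> (\<lambda>k. A k js) \<longlonglongrightarrow> A0 js) \<Longrightarrow>
    (\<lambda>k. directional (A k) (map (E k) hs)) \<longlonglongrightarrow> directional A0 (map E0 hs)"
proof (induction hs arbitrary: A A0)
  case (Cons h hs)
  show ?case
    unfolding list.map directional.simps
    by (intro tendsto_sum tendsto_mult tendsto_vec_nth assms Cons.IH Cons.prems) simp
qed simp

lemma directional_integral:
  "(\<And>js. length js = length vs \<Longrightarrow> integrable M (\<lambda>r. A r js)) \<Longrightarrow>
    integrable M (\<lambda>r. directional (A r) vs) \<and> (\<integral>r. directional (A r) vs \<partial>M) = directional (\<lambda>js. \<integral>r. A r js \<partial>M) vs"
proof (induction vs arbitrary: A)
  case (Cons v vs)
  have "integrable M (\<lambda>r. directional (\<lambda>js. A r (i # js)) vs) \<and>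
      (\<integral>r. directional (\<lambda>js. A r (i # js)) vs \<partial>M) = directional (\<lambda>js. \<integral>r. A r (i # js) \<partial>M) vs" for i
    by (rule Cons.IH) (rule Cons.prems, simp)
  then show ?case by simp
qed simp

lemma integrable_segment:
  fixes \<phi> :: "'a::real_normed_vector \<Rightarrow> real"
  assumes "continuous_on UNIV \<phi>"
  shows "integrable (restrict_space lborel {0..1}) (\<lambda>r. \<phi> (x + r *\<^sub>R h))"
proof -
  have "continuous_on {0..1} (\<lambda>r. \<phi> (x + r *\<^sub>R h))"
    by (rule continuous_on_compose2[OF assms]) (auto intro!: continuous_intros)
  from borel_integrable_atLeastAtMost'[OF this] show ?thesis
    by (simp add: integrable_restrict_space set_integrable_def)
qed

text \<open>Fundamental theorem of calculus along the segment, with the Frechet derivative in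
  direction w expanded over the coordinate directions.\<close>

lemma partial_derivs_line_integral:
  assumes d: "\<And>x. partial_derivs f js differentiable (at x)"
    and c: "\<And>i. continuous_on UNIV (partial_derivs f (i # js))"
  shows "partial_derivs f js (y + w) - partial_derivs f js y
    = (\<integral>r. (\<Sum>i\<in>UNIV. w $ i * partial_derivs f (i # js) (y + r *\<^sub>R w)) \<partial>restrict_space lborel {0..1})"
proof -
  let ?\<phi> = "partial_derivs f js" and ?d = "\<lambda>x. \<Sum>i\<in>UNIV. w $ i * partial_derivs f (i # js) x"
  have fd: "frechet_derivative ?\<phi> (at x) w = ?d x" for x
  proof -
    have l: "linear (frechet_derivative ?\<phi> (at x))" by (rule linear_frechet_derivative[OF d])
    have w: "(\<Sum>i\<in>UNIV. w $ i *\<^sub>R axis i 1) = w"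
      using basis_expansion[of w] unfolding scalar_mult_eq_scaleR .
    have "frechet_derivative ?\<phi> (at x) (\<Sum>i\<in>UNIV. w $ i *\<^sub>R axis i 1) = (\<Sum>i\<in>UNIV. w $ i * frechet_derivative ?\<phi> (at x) (axis i 1))"
      unfolding linear_sum[OF l] linear_scale[OF l] real_scaleR_def ..
    then show ?thesis unfolding w partial_derivs.simps .
  qed
  have cd: "continuous_on UNIV ?d" by (intro continuous_intros c)
  have "((\<lambda>r. ?d (y + r *\<^sub>R w)) has_integral (?\<phi> (y + 1 *\<^sub>R w) - ?\<phi> (y + 0 *\<^sub>R w))) {0..1}"
  proof (rule fundamental_theorem_of_calculus)
    fix r :: real assume "r \<in> {0..1}"
    have "((\<lambda>r. y + r *\<^sub>R w) has_vector_derivative w) (at r within {0..1})"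
      using has_vector_derivative_add[OF has_vector_derivative_const[of y]
          has_vector_derivative_scaleR[OF DERIV_ident has_vector_derivative_const[of w]], of r "{0..1}"]
      by (simp only: scaleR_zero_right scaleR_one add_0_left)
    moreover have "(?\<phi> has_derivative frechet_derivative ?\<phi> (at (y + r *\<^sub>R w))) (at (y + r *\<^sub>R w) within ((\<lambda>r. y + r *\<^sub>R w) ` {0..1}))"
      by (rule has_derivative_at_withinI[OF frechet_derivative_works[THEN iffD1, OF d]])
    ultimately have "((?\<phi> \<circ> (\<lambda>r. y + r *\<^sub>R w)) has_vector_derivative frechet_derivative ?\<phi> (at (y + r *\<^sub>R w)) w) (at r within {0..1})"
      by (rule vector_derivative_diff_chain_within)
    then show "((\<lambda>r. ?\<phi> (y + r *\<^sub>R w)) has_vector_derivative ?d (y + r *\<^sub>R w)) (at r within {0..1})"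
      unfolding fd comp_def .
  qed (rule zero_le_one)
  moreover have "set_integrable lborel {0..1} (\<lambda>r. ?d (y + r *\<^sub>R w))"
    using integrable_segment[OF cd, of y w] by (simp add: integrable_restrict_space set_integrable_def)
  ultimately show ?thesis
    using set_borel_integral_eq_integral(2)[of "{0..1}" "\<lambda>r. ?d (y + r *\<^sub>R w)"]
    unfolding set_lebesgue_integral_def by (simp add: integral_restrict_space integral_unique del: partial_derivs.simps)
qed

lemma directional_difference:
  assumes "m \<in> {1, 2}"
  shows "(difference h ^^ m) (\<lambda>y. directional (\<lambda>js. P js y) vs) x = directional (\<lambda>js. (difference h ^^ m) (P js) x) vs"
proof (cases "m = 1")
  case True
  show ?thesis unfolding True by (simp add: difference_def directional_diff)
next
  case False
  with assms have m2: "m = 2" by simp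
  have d: "(difference h ^^ 2) p x = (p (x + h + h) + (- 2) * p (x + h)) + p x" for p
    by (simp add: numeral_2_eq_2 difference_def)
  show ?thesis unfolding m2 d directional_add directional_mult ..
qed

lemma difference_add:
  assumes "m \<in> {1, 2}"
  shows "(difference h ^^ m) (\<lambda>y. p y + q y) x = (difference h ^^ m) p x + (difference h ^^ m) q x"
proof (cases "m = 1")
  case True
  show ?thesis unfolding True by (simp add: difference_def)
next
  case False
  with assms have m2: "m = 2" by simp
  show ?thesis unfolding m2 by (simp add: numeral_2_eq_2 difference_def)
qed

section \<open>Regularity of the mild solution\<close>

context
  fixes Q B :: "real^'n^'n" and s T c0 c1 M :: real
  assumes ou: "ou_kernel (ou_rescaled Q B T) s c0 c1 (ou_flow B) T M"
begin

interpretation ou_kernel "ou_rescaled Q B T" s c0 c1 "ou_flow B" T M by (rule ou)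

text \<open>The crude coordinate bound of \<open>directional\<close> accounts for the power of the
  dimension; the segment identity is \<open>partial_derivs_line_integral\<close> passed through the
  form.\<close>

lemma smooth_family_directional:
  assumes f: "f \<in> Cn_space n" and A: "\<And>is x. length is \<le> n \<Longrightarrow> \<bar>partial_derivs f is x\<bar> \<le> A"
  shows "smooth_family n (real CARD('n) ^ n * A) (\<lambda>hs y. directional (\<lambda>js. partial_derivs f js y) hs)"
  unfolding smooth_family_def
proof (intro conjI allI impI)
  have A0: "0 \<le> A" using A[of "[]" 0] by simp
  then show "0 \<le> real CARD('n) ^ n * A" by simp
  have fd: "length is < n \<Longrightarrow> partial_derivs f is differentiable (at x)"
    and fc: "length is \<le> n \<Longrightarrow> continuous_on UNIV (partial_derivs f is)" for "is" x
    using f unfolding Cn_space_def by blast+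
  have card: "1 \<le> real CARD('n)" by (simp add: Suc_leI)
  fix hs :: "(real^'n) list"
  show "\<bar>directional (\<lambda>js. partial_derivs f js y) hs\<bar> \<le> real CARD('n) ^ n * A * (\<Prod>h\<leftarrow>hs. norm h)" if "length hs \<le> n" for y
  proof -
    have "\<bar>directional (\<lambda>js. partial_derivs f js y) hs\<bar> \<le> real CARD('n) ^ length hs * A * (\<Prod>h\<leftarrow>hs. norm h)"
      by (rule directional_bound, rule A) (use that in simp)
    also have "\<dots> \<le> real CARD('n) ^ n * A * (\<Prod>h\<leftarrow>hs. norm h)"
      by (intro mult_right_mono power_increasing that card A0 prod_list_norm_nonneg)
    finally show ?thesis .
  qed
  show "directional (\<lambda>js. partial_derivs f js y) ((a *\<^sub>R h + h') # hs)
     = a * directional (\<lambda>js. partial_derivs f js y) (h # hs) + directional (\<lambda>js. partial_derivs f js y) (h' # hs)" for a h h' y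
    by (simp add: distrib_right sum.distrib sum_distrib_left mult.assoc)
  show "directional (\<lambda>js. partial_derivs f js (y + h)) hs - directional (\<lambda>js. partial_derivs f js y) hs
     = (\<integral>r. directional (\<lambda>js. partial_derivs f js (y + r *\<^sub>R h)) (h # hs) \<partial>unit_measure)" if hs: "length hs < n" for h y
  proof -
    let ?P = "\<lambda>r js. \<Sum>i\<in>UNIV. h $ i * partial_derivs f (i # js) (y + r *\<^sub>R h)"
    have "directional (\<lambda>js. partial_derivs f js (y + h)) hs - directional (\<lambda>js. partial_derivs f js y) hs
      = directional (\<lambda>js. partial_derivs f js (y + h) - partial_derivs f js y) hs" by (rule directional_diff[symmetric])
    moreover have "directional (\<lambda>js. partial_derivs f js (y + h) - partial_derivs f js y) hs = directional (\<lambda>js. \<integral>r. ?P r js \<partial>unit_measure) hs"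
    proof (rule directional_cong)
      fix js :: "'n list" assume "length js = length hs"
      with hs show "partial_derivs f js (y + h) - partial_derivs f js y = (\<integral>r. ?P r js \<partial>unit_measure)"
        by (intro partial_derivs_line_integral fd fc) simp_all
    qed
    moreover have "(\<integral>r. directional (?P r) hs \<partial>unit_measure) = directional (\<lambda>js. \<integral>r. ?P r js \<partial>unit_measure) hs"
    proof (rule directional_integral[THEN conjunct2])
      fix js :: "'n list" assume js: "length js = length hs"
      have "continuous_on UNIV (\<lambda>x. \<Sum>i\<in>UNIV. h $ i * partial_derivs f (i # js) x)"
        by (intro continuous_intros fc) (use hs js in simp)
      then show "integrable unit_measure (\<lambda>r. ?P r js)" by (rule integrable_segment)
    qed
    moreover have "directional (?P r) hs = directional (\<lambda>js. partial_derivs f js (y + r *\<^sub>R h)) (h # hs)" for r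
      unfolding directional_sum directional.simps ..
    ultimately show ?thesis by (simp only:)
  qed
  show "(\<lambda>k. directional (\<lambda>js. partial_derivs f js (x k)) (map (ou_flow B (t k)) hs)) \<longlonglongrightarrow> directional (\<lambda>js. partial_derivs f js x0) (map (ou_flow B t0) hs)"
    if "length hs \<le> n" "t \<longlonglongrightarrow> t0" "x \<longlonglongrightarrow> x0" for t t0 x x0
  proof (rule directional_tendsto)
    show "(\<lambda>k. ou_flow B (t k) h) \<longlonglongrightarrow> ou_flow B t0 h" for h by (rule E_tendsto[OF that(2) tendsto_const])
    fix js :: "'n list" assume "length js = length hs"
    with that(1) have "continuous_on UNIV (partial_derivs f js)" by (intro fc) simp
    from continuous_on_tendsto_compose[OF this that(3)]
    show "(\<lambda>k. partial_derivs f js (x k)) \<longlonglongrightarrow> partial_derivs f js x0" by simp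
  qed
qed

text \<open>Freezing g before time 0 and after time T keeps its continuity and both bounds.\<close>

lemma source_clamp:
  assumes g: "continuous_on ({0..T} \<times> UNIV) (\<lambda>(t, x). g t x)" and A: "\<And>t x. t \<in> {0..T} \<Longrightarrow> \<bar>g t x\<bar> \<le> A"
    and H: "\<And>t x y. t \<in> {0..T} \<Longrightarrow> \<bar>g t x - g t y\<bar> \<le> A * norm (x - y) powr \<alpha>"
  shows "source \<alpha> A (\<lambda>t. g (max 0 (min T t)))"
  unfolding source_def
proof (intro conjI allI)
  have c: "max 0 (min T t) \<in> {0..T}" for t using T by auto
  show "0 \<le> A" using A[OF c, of 0 0] by linarith
  show "\<bar>g (max 0 (min T t)) x\<bar> \<le> A" for t x by (rule A[OF c])
  show "\<bar>g (max 0 (min T t)) x - g (max 0 (min T t)) y\<bar> \<le> A * norm (x - y) powr \<alpha>" for t x y by (rule H[OF c])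
  have c1: "continuous_on UNIV (\<lambda>p. (max 0 (min T (fst p)), snd p) :: real \<times> (real^'n))"
    by (intro continuous_intros)
  have c2: "(\<lambda>p. (max 0 (min T (fst p)), snd p) :: real \<times> (real^'n)) ` UNIV \<subseteq> {0..T} \<times> UNIV" using c by blast
  show "continuous_on UNIV (\<lambda>(t, x). g (max 0 (min T t)) x)"
    using continuous_on_compose2[OF g[unfolded case_prod_beta'] c1 c2] unfolding case_prod_beta' fst_conv snd_conv .
qed

text \<open>One statement for the Hoelder and the Zygmund case: n counts the classical derivatives,
  m is the order of the difference at the top. The constant is fixed before f and g.\<close>

lemma ou_mild_solution_regularity:
  assumes \<alpha>: "0 \<le> \<alpha>" and n: "real n < \<alpha> + 2 * s" and m: "m \<in> {1, 2}" "\<alpha> + 2 * s < real (n + m)"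
  obtains C where "0 \<le> C"
    "\<And>f g A A'. f \<in> Cn_space n \<Longrightarrow> (\<And>is x. length is \<le> n \<Longrightarrow> \<bar>partial_derivs f is x\<bar> \<le> A) \<Longrightarrow>
      (\<And>is x h. length is = n \<Longrightarrow> \<bar>(difference h ^^ m) (partial_derivs f is) x\<bar> \<le> A * norm h powr (\<alpha> + 2 * s - real n)) \<Longrightarrow>
      continuous_on ({0..T} \<times> UNIV) (\<lambda>(t, x). g t x) \<Longrightarrow> (\<And>t x. t \<in> {0..T} \<Longrightarrow> \<bar>g t x\<bar> \<le> A') \<Longrightarrow>
      (\<And>t x y. t \<in> {0..T} \<Longrightarrow> \<bar>g t x - g t y\<bar> \<le> A' * norm (x - y) powr \<alpha>) \<Longrightarrow>
      (\<forall>t\<in>{0..T}. \<forall>is x. length is < n \<longrightarrow> partial_derivs (ou_mild_solution Q B s f g t) is differentiable (at x)) \<and>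
      (\<forall>is. length is \<le> n \<longrightarrow> continuous_on ({0..T} \<times> UNIV) (\<lambda>(t, x). partial_derivs (ou_mild_solution Q B s f g t) is x)) \<and>
      (\<forall>t\<in>{0..T}. \<forall>is x. length is \<le> n \<longrightarrow> \<bar>partial_derivs (ou_mild_solution Q B s f g t) is x\<bar> \<le> C * (A + A')) \<and>
      (\<forall>t\<in>{0..T}. \<forall>is x h. length is = n \<longrightarrow> h \<noteq> 0 \<longrightarrow>
        \<bar>(difference h ^^ m) (partial_derivs (ou_mild_solution Q B s f g t) is) x\<bar> \<le> C * (A + A') * norm h powr (\<alpha> + 2 * s - real n))"
proof -
  let ?\<sigma> = "\<alpha> + 2 * s - real n" and ?N = "real CARD('n) ^ n"
  have \<sigma>: "0 \<le> ?\<sigma>" using n by simp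
  have N: "0 \<le> ?N" by simp
  have "\<exists>C. 0 \<le> C \<and> (\<forall>t hs F A x. 0 \<le> t \<longrightarrow> t \<le> T \<longrightarrow> length hs = k \<longrightarrow> k \<le> n \<longrightarrow> smooth_family n A F \<longrightarrow>
     \<bar>initial t hs F x\<bar> \<le> C * A * (\<Prod>h\<leftarrow>hs. norm h))" for k
    by (rule initial_bound[of k n]) blast
  then obtain Ci where Ci: "\<And>k. 0 \<le> Ci k" "\<And>k t hs F A x. 0 \<le> t \<Longrightarrow> t \<le> T \<Longrightarrow> length hs = k \<Longrightarrow> k \<le> n \<Longrightarrow> smooth_family n A F \<Longrightarrow>
     \<bar>initial t hs F x\<bar> \<le> Ci k * A * (\<Prod>h\<leftarrow>hs. norm h)" by metis
  \<comment> \<open>The guard k \<le> n is needed because the Duhamel bound is available only for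
    orders below \<alpha> + 2s.\<close>
  have "\<exists>C. k \<le> n \<longrightarrow> 0 \<le> C \<and> (\<forall>t hs g x A. 0 \<le> t \<longrightarrow> t \<le> T \<longrightarrow> length hs = k \<longrightarrow> source \<alpha> A g \<longrightarrow>
     \<bar>duhamel t hs g x\<bar> \<le> C * A * (\<Prod>h\<leftarrow>hs. norm h))" for k
  proof (cases "k \<le> n")
    case True
    then have "real k < \<alpha> + 2 * s" using n by simp
    from \<alpha> this show ?thesis by (rule duhamel_bounds) blast
  qed simp
  then obtain Cd where Cd: "\<And>k. k \<le> n \<Longrightarrow> 0 \<le> Cd k" "\<And>k t hs g x A. k \<le> n \<Longrightarrow> 0 \<le> t \<Longrightarrow> t \<le> T \<Longrightarrow> length hs = k \<Longrightarrow> source \<alpha> A g \<Longrightarrow>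
     \<bar>duhamel t hs g x\<bar> \<le> Cd k * A * (\<Prod>h\<leftarrow>hs. norm h)" by metis
  obtain Di where Di: "0 \<le> Di" "\<And>t hs h F A x. 0 \<le> t \<Longrightarrow> t \<le> T \<Longrightarrow> length hs = n \<Longrightarrow> smooth_family n A F \<Longrightarrow>
     (\<And>hs h y. length hs = n \<Longrightarrow> \<bar>(difference h ^^ m) (F hs) y\<bar> \<le> A * (\<Prod>h\<leftarrow>hs. norm h) * norm h powr ?\<sigma>) \<Longrightarrow>
     \<bar>(difference h ^^ m) (initial t hs F) x\<bar> \<le> Di * A * (\<Prod>h\<leftarrow>hs. norm h) * norm h powr ?\<sigma>"
    by (rule difference_initial[OF m(1) \<sigma>, of n]) blast
  obtain Dd where Dd: "0 \<le> Dd" "\<And>t hs h g x A. 0 \<le> t \<Longrightarrow> t \<le> T \<Longrightarrow> length hs = n \<Longrightarrow> source \<alpha> A g \<Longrightarrow> h \<noteq> 0 \<Longrightarrow>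
     \<bar>(difference h ^^ m) (duhamel t hs g) x\<bar> \<le> Dd * A * (\<Prod>h\<leftarrow>hs. norm h) * norm h powr ?\<sigma>"
    by (rule difference_duhamel[OF \<alpha> n m]) blast
  \<comment> \<open>A sum serves as an upper bound for all constants at once. The factor
    \<open>?N\<close> belongs to the initial part, whose family is bounded by
    \<open>?N * A\<close>.\<close>
  define C where "C = (\<Sum>k\<le>n. Ci k * ?N + Cd k) + (Di * ?N + Dd)"
  have sum0: "0 \<le> (\<Sum>k\<le>n. Ci k * ?N + Cd k)" by (intro sum_nonneg add_nonneg_nonneg mult_nonneg_nonneg Ci(1) N Cd(1)) simp
  have D0: "0 \<le> Di * ?N + Dd" by (intro add_nonneg_nonneg mult_nonneg_nonneg Di(1) N Dd(1))
  have C1: "Ci k * ?N + Cd k \<le> C" if "k \<le> n" for k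
  proof -
    have "Ci k * ?N + Cd k \<le> (\<Sum>k\<le>n. Ci k * ?N + Cd k)"
      by (rule member_le_sum) (use that Ci(1) Cd(1) N in auto)
    then show ?thesis unfolding C_def using D0 by linarith
  qed
  have C2: "Di * ?N + Dd \<le> C" unfolding C_def using sum0 by linarith
  have axis: "(\<Prod>h\<leftarrow>map (\<lambda>i. axis i 1 :: real^'n) is. norm h) = 1" for "is" by (induction "is") simp_all
  show thesis
  proof (rule that[of C])
    show C0: "0 \<le> C" unfolding C_def using sum0 D0 by linarith
    fix f :: "real^'n \<Rightarrow> real" and g :: "real \<Rightarrow> real^'n \<Rightarrow> real" and A A' :: real
    assume f: "f \<in> Cn_space n" and A: "\<And>is x. length is \<le> n \<Longrightarrow> \<bar>partial_derivs f is x\<bar> \<le> A"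
      and H: "\<And>is x h. length is = n \<Longrightarrow> \<bar>(difference h ^^ m) (partial_derivs f is) x\<bar> \<le> A * norm h powr ?\<sigma>"
      and g: "continuous_on ({0..T} \<times> UNIV) (\<lambda>(t, x). g t x)" and A': "\<And>t x. t \<in> {0..T} \<Longrightarrow> \<bar>g t x\<bar> \<le> A'"
      and H': "\<And>t x y. t \<in> {0..T} \<Longrightarrow> \<bar>g t x - g t y\<bar> \<le> A' * norm (x - y) powr \<alpha>"
    let ?F = "\<lambda>hs y. directional (\<lambda>js. partial_derivs f js y) hs" and ?g = "\<lambda>t. g (max 0 (min T t))"
    have F: "smooth_family n (?N * A) ?F" by (rule smooth_family_directional[OF f]) (rule A)
    have so: "source \<alpha> A' ?g" by (rule source_clamp[OF g]; (rule A' H'))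
    have A0: "0 \<le> A" using A[of "[]" 0] by simp
    have A'0: "0 \<le> A'" by (rule sourceD(2)[OF so])
    \<comment> \<open>Candidate for the derivative of the mild solution along \<open>hs\<close>;
      \<open>pd\<close> below identifies it with the partial derivatives.\<close>
    define V where "V = (\<lambda>t hs x. initial t hs ?F x + duhamel t hs ?g x)"
    have len: "real (length hs) < \<alpha> + 2 * s" if hs: "length hs \<le> n" for hs :: "(real^'n) list"
      by (rule order.strict_trans1[OF _ n]) (use hs in simp)
    have fm: "f \<in> borel_measurable borel"
    proof -
      have fc: "length is \<le> n \<Longrightarrow> continuous_on UNIV (partial_derivs f is)" for "is" using f unfolding Cn_space_def by blast
      have "partial_derivs f [] = f" by (rule ext) simp
      with fc[of "[]"] show ?thesis by (simp add: borel_measurable_continuous_onI)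
    qed
    have V: "ou_mild_solution Q B s f g t = V t []" if t: "0 \<le> t" "t \<le> T" for t
    proof
      fix x
      show "ou_mild_solution Q B s f g t x = V t [] x"
        unfolding V_def
        by (rule ou_mild_solution_duhamel[OF ou t fm _ \<alpha> so]) (auto simp: fun_eq_iff)
    qed
    have V_tendsto: "(\<lambda>k. V (t k) hs (x k)) \<longlonglongrightarrow> V t0 hs x0"
      if "length hs \<le> n" "t \<longlonglongrightarrow> t0" "\<And>k. 0 \<le> t k" "\<And>k. t k \<le> T" "x \<longlonglongrightarrow> x0" for hs t t0 x x0
      unfolding V_def
      by (intro tendsto_add initial_tendsto[OF F that] duhamel_tendsto[OF \<alpha> len[OF that(1)] so that(2-5)])
    have ci: "continuous_on UNIV (initial t hs ?F)" "continuous_on UNIV (duhamel t hs ?g)" if t: "0 \<le> t" "t \<le> T" and hs: "length hs \<le> n" for t hs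
      unfolding continuous_on_sequentially comp_def
      using initial_tendsto[OF F hs tendsto_const t] duhamel_tendsto[OF \<alpha> len[OF hs] so tendsto_const t] by blast+
    have pd: "length is \<le> n \<Longrightarrow> partial_derivs (V t []) is = V t (map (\<lambda>i. axis i 1) is)"
      and df: "length is < n \<Longrightarrow> partial_derivs (V t []) is differentiable (at x)" if t: "0 \<le> t" "t \<le> T" for t "is" x
    proof -
      have lin: "V t ((a *\<^sub>R h + h') # hs) x = a * V t (h # hs) x + V t (h' # hs) x" if "length hs < n" for a h h' hs x
        unfolding V_def initial_linear[OF F that t] duhamel_linear[OF \<alpha> len t so, of h hs, simplified, OF Suc_leI[OF that]] by (simp add: algebra_simps)
      have seg: "V t hs (x + h) - V t hs x = (\<integral>r. V t (h # hs) (x + r *\<^sub>R h) \<partial>unit_measure)" if hs: "length hs < n" for h hs x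
      proof -
        have hs': "length (h # hs) \<le> n" using hs by simp
        have "V t hs (x + h) - V t hs x = (initial t hs ?F (x + h) - initial t hs ?F x) + (duhamel t hs ?g (x + h) - duhamel t hs ?g x)"
          by (simp add: V_def)
        then show ?thesis
          unfolding initial_segment[OF F hs t] duhamel_segment[OF \<alpha> len[OF hs'] t so] V_def
          using Bochner_Integration.integral_add[OF integrable_segment[OF ci(1)[OF t hs']] integrable_segment[OF ci(2)[OF t hs']], of x h x h] by (simp only:)
      qed
      have cont: "continuous_on UNIV (V t hs)" if "length hs \<le> n" for hs
        unfolding V_def by (rule continuous_on_add[OF ci[OF t that]])
      show "length is \<le> n \<Longrightarrow> partial_derivs (V t []) is = V t (map (\<lambda>i. axis i 1) is)"
        by (rule partial_derivs_segment(1)[where V="V t" and n=n]) (rule lin, assumption | rule seg, assumption | rule cont, assumption | assumption)+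
      show "length is < n \<Longrightarrow> partial_derivs (V t []) is differentiable (at x)"
        by (rule partial_derivs_segment(2)[where V="V t" and n=n]) (rule lin, assumption | rule seg, assumption | rule cont, assumption | assumption)+
    qed
    show "(\<forall>t\<in>{0..T}. \<forall>is x. length is < n \<longrightarrow> partial_derivs (ou_mild_solution Q B s f g t) is differentiable (at x)) \<and>
      (\<forall>is. length is \<le> n \<longrightarrow> continuous_on ({0..T} \<times> UNIV) (\<lambda>(t, x). partial_derivs (ou_mild_solution Q B s f g t) is x)) \<and>
      (\<forall>t\<in>{0..T}. \<forall>is x. length is \<le> n \<longrightarrow> \<bar>partial_derivs (ou_mild_solution Q B s f g t) is x\<bar> \<le> C * (A + A')) \<and>
      (\<forall>t\<in>{0..T}. \<forall>is x h. length is = n \<longrightarrow> h \<noteq> 0 \<longrightarrow>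
        \<bar>(difference h ^^ m) (partial_derivs (ou_mild_solution Q B s f g t) is) x\<bar> \<le> C * (A + A') * norm h powr ?\<sigma>)"
    proof (intro conjI ballI allI impI)
      show "partial_derivs (ou_mild_solution Q B s f g t) is differentiable (at x)" if "t \<in> {0..T}" "length is < n" for t "is" x
        using df[of t "is" x] V[of t] that by simp
      show "continuous_on ({0..T} \<times> UNIV) (\<lambda>(t, x). partial_derivs (ou_mild_solution Q B s f g t) is x)" if hs: "length is \<le> n" for "is"
      proof -
        have "continuous_on ({0..T} \<times> UNIV) (\<lambda>p. V (fst p) (map (\<lambda>i. axis i 1) is) (snd p))"
          unfolding continuous_on_sequentially comp_def
        proof (intro allI ballI impI)
          fix p a assume "a \<in> {0..T} \<times> (UNIV :: (real^'n) set)" and p: "(\<forall>k. p k \<in> {0..T} \<times> (UNIV :: (real^'n) set)) \<and> p \<longlonglongrightarrow> a"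
          then have "0 \<le> fst (p k)" "fst (p k) \<le> T" for k by (auto simp: mem_Times_iff)
          with p hs show "(\<lambda>k. V (fst (p k)) (map (\<lambda>i. axis i 1) is) (snd (p k))) \<longlonglongrightarrow> V (fst a) (map (\<lambda>i. axis i 1) is) (snd a)"
            by (intro V_tendsto tendsto_fst tendsto_snd) auto
        qed
        then show ?thesis
          by (rule continuous_on_eq) (use hs V pd in auto)
      qed
      show "\<bar>partial_derivs (ou_mild_solution Q B s f g t) is x\<bar> \<le> C * (A + A')" if "t \<in> {0..T}" and hs: "length is \<le> n" for t "is" x
      proof -
        have t: "0 \<le> t" "t \<le> T" using that by auto
        let ?hs = "map (\<lambda>i. axis i 1 :: real^'n) is"
        have "\<bar>initial t ?hs ?F x\<bar> \<le> Ci (length is) * (?N * A)"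
          using Ci(2)[OF t _ hs F, of ?hs x] unfolding axis by simp
        also have "\<dots> \<le> C * A"
        proof -
          have "Ci (length is) * ?N \<le> C" using C1[OF hs] Cd(1)[OF hs] by linarith
          from mult_right_mono[OF this A0] show ?thesis by (simp only: mult.assoc)
        qed
        finally have 1: "\<bar>initial t ?hs ?F x\<bar> \<le> C * A" .
        have "\<bar>duhamel t ?hs ?g x\<bar> \<le> Cd (length is) * A'"
          using Cd(2)[OF hs t _ so, of ?hs x] unfolding axis by simp
        also have "\<dots> \<le> C * A'"
        proof (rule mult_right_mono[OF _ A'0])
          have "0 \<le> Ci (length is) * ?N" by (intro mult_nonneg_nonneg Ci(1) N)
          then show "Cd (length is) \<le> C" using C1[OF hs] by linarith
        qed
        finally have "\<bar>duhamel t ?hs ?g x\<bar> \<le> C * A'" .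
        with 1 show ?thesis unfolding V[OF t] pd[OF t hs] unfolding V_def distrib_left by linarith
      qed
      show "\<bar>(difference h ^^ m) (partial_derivs (ou_mild_solution Q B s f g t) is) x\<bar> \<le> C * (A + A') * norm h powr ?\<sigma>"
        if "t \<in> {0..T}" and hs: "length is = n" and h: "h \<noteq> 0" for t "is" x h
      proof -
        have t: "0 \<le> t" "t \<le> T" using that by auto
        let ?hs = "map (\<lambda>i. axis i 1 :: real^'n) is"
        have hs': "length ?hs = n" "length is \<le> n" using hs by auto
        \<comment> \<open>Differencing commutes with \<open>directional\<close>, so the hypothesis
          on the partial derivatives carries over to the forms, at the price of
          \<open>?N\<close>.\<close>
        have HF: "\<bar>(difference h ^^ m) (?F vs) y\<bar> \<le> ?N * A * (\<Prod>h\<leftarrow>vs. norm h) * norm h powr ?\<sigma>" if vs: "length vs = n" for vs h y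
        proof -
          have "\<bar>directional (\<lambda>js. (difference h ^^ m) (partial_derivs f js) y) vs\<bar> \<le> real CARD('n) ^ length vs * (A * norm h powr ?\<sigma>) * (\<Prod>v\<leftarrow>vs. norm v)"
            by (rule directional_bound, rule H) (use vs in simp)
          then show ?thesis unfolding directional_difference[OF m(1)] vs by (simp only: mult_ac)
        qed
        have "\<bar>(difference h ^^ m) (initial t ?hs ?F) x\<bar> \<le> Di * (?N * A) * (\<Prod>h\<leftarrow>?hs. norm h) * norm h powr ?\<sigma>"
          by (rule Di(2)[OF t hs'(1) F]) (rule HF)
        also have "\<dots> = Di * (?N * A) * 1 * norm h powr ?\<sigma>" unfolding axis ..
        also have "\<dots> \<le> C * A * norm h powr ?\<sigma>"
        proof (rule mult_right_mono)
          have "Di * ?N \<le> C" using C2 Dd(1) by linarith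
          from mult_right_mono[OF this A0] show "Di * (?N * A) * 1 \<le> C * A" by (simp only: mult.assoc mult_1_right)
        qed simp
        finally have 1: "\<bar>(difference h ^^ m) (initial t ?hs ?F) x\<bar> \<le> C * A * norm h powr ?\<sigma>" .
        have "\<bar>(difference h ^^ m) (duhamel t ?hs ?g) x\<bar> \<le> Dd * A' * 1 * norm h powr ?\<sigma>"
          using Dd(2)[OF t hs'(1) so h, of x] unfolding axis .
        also have "\<dots> \<le> C * A' * norm h powr ?\<sigma>"
        proof (rule mult_right_mono)
          have "0 \<le> Di * ?N" by (intro mult_nonneg_nonneg Di(1) N)
          then have "Dd \<le> C" using C2 by linarith
          from mult_right_mono[OF this A'0] show "Dd * A' * 1 \<le> C * A'" by (simp only: mult_1_right)
        qed simp
        finally have "\<bar>(difference h ^^ m) (duhamel t ?hs ?g) x\<bar> \<le> C * A' * norm h powr ?\<sigma>" .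
        with 1 show ?thesis
          unfolding V[OF t] pd[OF t hs'(2)] unfolding V_def difference_add[OF m(1)] distrib_left distrib_right by linarith
      qed
    qed
  qed
qed

end

section \<open>From pointwise bounds to the norms of the function spaces\<close>

lemma finite_lists_of_length: "finite {xs :: 'n::finite list. length xs = k}"
  using finite_lists_length_eq[of "UNIV :: 'n set" k] by simp

lemma card_lists_of_length: "card {xs :: 'n::finite list. length xs = k} = CARD('n) ^ k"
  using card_lists_length_eq[of "UNIV :: 'n set" k] by simp

lemma tensor_norm_ge: "\<bar>A is\<bar> \<le> tensor_norm (length is) A"
proof -
  have "(A is)\<^sup>2 \<le> (\<Sum>js | length js = length is. (A js)\<^sup>2)"
    by (rule member_le_sum) (auto simp: finite_lists_of_length)
  then have "sqrt ((A is)\<^sup>2) \<le> tensor_norm (length is) A" unfolding tensor_norm_def by (rule real_sqrt_le_mono)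
  then show ?thesis by simp
qed

lemma tensor_norm_le:
  fixes A :: "'n::finite list \<Rightarrow> real"
  assumes "\<And>is. length is = k \<Longrightarrow> \<bar>A is\<bar> \<le> K"
  shows "tensor_norm k A \<le> real CARD('n) ^ k * K"
proof -
  have "tensor_norm k A \<le> (\<Sum>is | length is = k. \<bar>A is\<bar>)"
    unfolding tensor_norm_def using L2_set_le_sum_abs[of A] unfolding L2_set_def .
  also have "\<dots> \<le> (\<Sum>is\<in>{is :: 'n list. length is = k}. K)" by (rule sum_mono) (use assms in simp)
  also have "\<dots> = real CARD('n) ^ k * K" by (simp add: card_lists_of_length)
  finally show ?thesis .
qed

lemma Cn_norm_ge:
  assumes "length is \<le> n"
  shows "ennreal \<bar>partial_derivs f is x\<bar> \<le> Cn_norm n f"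
proof -
  have "ennreal \<bar>partial_derivs f is x\<bar> \<le> ennreal (tensor_norm (length is) (\<lambda>is. partial_derivs f is x))"
    by (rule ennreal_leI) (rule tensor_norm_ge)
  also have "\<dots> \<le> (SUP x. ennreal (tensor_norm (length is) (\<lambda>is. partial_derivs f is x)))" by (rule SUP_upper) simp
  also have "\<dots> \<le> Cn_norm n f" unfolding Cn_norm_def
    by (rule member_le_sum) (use assms in auto)
  finally show ?thesis .
qed

lemma Cn_norm_le:
  fixes f :: "real^'n \<Rightarrow> real"
  assumes "\<And>is x. length is \<le> n \<Longrightarrow> \<bar>partial_derivs f is x\<bar> \<le> K"
  shows "Cn_norm n f \<le> ennreal ((\<Sum>k\<le>n. real CARD('n) ^ k) * K)"
proof -
  have K: "0 \<le> K" using assms[of "[]" 0] by simp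
  have "Cn_norm n f \<le> (\<Sum>k\<le>n. ennreal (real CARD('n) ^ k * K))"
    unfolding Cn_norm_def
  proof (intro sum_mono SUP_least ennreal_leI tensor_norm_le)
    show "\<bar>partial_derivs f is x\<bar> \<le> K" if "k \<in> {..n}" "length is = k" for k "is" x
      by (rule assms) (use that in simp)
  qed
  also have "\<dots> = ennreal (\<Sum>k\<le>n. real CARD('n) ^ k * K)" by (rule sum_ennreal) (use K in simp)
  finally show ?thesis by (simp add: sum_distrib_right)
qed

text \<open>Common form of the two top-order seminorms: Hoelder for m = 1, Zygmund for m = 2 and
  \<sigma> = 1.\<close>

definition difference_seminorm :: "nat \<Rightarrow> nat \<Rightarrow> real \<Rightarrow> (real^'n \<Rightarrow> real) \<Rightarrow> ennreal" where
  "difference_seminorm m n \<sigma> f = (SUP x. SUP h\<in>-{0}. ennreal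
     (tensor_norm n (\<lambda>is. (difference h ^^ m) (partial_derivs f is) x) / norm h powr \<sigma>))"

lemma hoelder_seminorm_eq: "hoelder_seminorm n \<sigma> f = difference_seminorm 1 n \<sigma> f"
  unfolding hoelder_seminorm_def difference_seminorm_def by (simp add: difference_def)

lemma second_difference: "(difference h ^^ 2) p x = p (x + 2 *\<^sub>R h) - 2 * p (x + h) + p x" for h :: "'a::real_vector"
  by (simp add: numeral_2_eq_2 difference_def scaleR_2[unfolded numeral_2_eq_2] add.assoc)

lemma zygmund_seminorm_eq: "zygmund_seminorm n f = difference_seminorm 2 n 1 f"
  unfolding zygmund_seminorm_def difference_seminorm_def second_difference by simp

text \<open>At h = 0, which the supremum omits, the difference vanishes, so the inequality extends
  to every h.\<close>

lemma difference_seminorm_ge: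
  assumes m: "m \<in> {1, 2}" and A: "difference_seminorm m n \<sigma> f \<le> ennreal A" "0 \<le> A" and "is": "length is = n"
  shows "\<bar>(difference h ^^ m) (partial_derivs f is) x\<bar> \<le> A * norm h powr \<sigma>"
proof (cases "h = 0")
  case True
  have "(difference h ^^ m) (partial_derivs f is) x = 0"
    using m unfolding True by (auto simp: difference_def numeral_2_eq_2)
  then show ?thesis using A(2) by simp
next
  case False
  let ?D = "tensor_norm n (\<lambda>is. (difference h ^^ m) (partial_derivs f is) x)"
  have "ennreal (?D / norm h powr \<sigma>) \<le> (SUP h\<in>-{0}. ennreal (tensor_norm n (\<lambda>is. (difference h ^^ m) (partial_derivs f is) x) / norm h powr \<sigma>))"
    by (rule SUP_upper) (use False in simp)
  also have "\<dots> \<le> difference_seminorm m n \<sigma> f"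
    unfolding difference_seminorm_def by (rule SUP_upper) simp
  also have "\<dots> \<le> ennreal A" by (rule A(1))
  finally have "?D / norm h powr \<sigma> \<le> A" using A(2) by simp
  then have "?D \<le> A * norm h powr \<sigma>" using False by (simp add: pos_divide_le_eq)
  moreover have "\<bar>(difference h ^^ m) (partial_derivs f is) x\<bar> \<le> ?D"
    using tensor_norm_ge[of "\<lambda>is. (difference h ^^ m) (partial_derivs f is) x" "is"] unfolding "is" .
  ultimately show ?thesis by (rule order.trans[rotated])
qed

lemma difference_seminorm_le:
  fixes f :: "real^'n \<Rightarrow> real"
  assumes "\<And>is x h. length is = n \<Longrightarrow> h \<noteq> 0 \<Longrightarrow> \<bar>(difference h ^^ m) (partial_derivs f is) x\<bar> \<le> K * norm h powr \<sigma>"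
  shows "difference_seminorm m n \<sigma> f \<le> ennreal (real CARD('n) ^ n * K)"
  unfolding difference_seminorm_def
proof (intro SUP_least ennreal_leI)
  fix x h :: "real^'n" assume "h \<in> - {0}"
  then have h: "h \<noteq> 0" by simp
  have "tensor_norm n (\<lambda>is. (difference h ^^ m) (partial_derivs f is) x) \<le> real CARD('n) ^ n * (K * norm h powr \<sigma>)"
    by (rule tensor_norm_le) (rule assms[OF _ h])
  then show "tensor_norm n (\<lambda>is. (difference h ^^ m) (partial_derivs f is) x) / norm h powr \<sigma> \<le> real CARD('n) ^ n * K"
    using h by (simp add: pos_divide_le_eq mult.assoc)
qed

lemma sum_ennreal_less_top:
  fixes a :: "'i \<Rightarrow> ennreal"
  assumes "finite I" "\<And>i. i \<in> I \<Longrightarrow> a i < \<infinity>"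
  shows "sum a I < \<infinity>"
  using assms by (induction I) simp_all

text \<open>Each partial derivative has its own bound; there are finitely many lists of each length,
  so the bounds can be added.\<close>

lemma Cn_norm_finite:
  assumes "f \<in> Cn_space n"
  shows "Cn_norm n f < \<infinity>"
proof -
  have "\<exists>K. \<forall>x. \<bar>partial_derivs f is x\<bar> \<le> K" if "length is \<le> n" for "is"
  proof -
    have "bounded (range (partial_derivs f is))" using assms that unfolding Cn_space_def by blast
    then show ?thesis unfolding bounded_iff by auto
  qed
  then obtain K where K: "\<And>is x. length is \<le> n \<Longrightarrow> \<bar>partial_derivs f is x\<bar> \<le> K is" by metis
  have "(SUP x. ennreal (tensor_norm k (\<lambda>is. partial_derivs f is x))) < \<infinity>" if k: "k \<le> n" for k
  proof -
    have "(SUP x. ennreal (tensor_norm k (\<lambda>is. partial_derivs f is x))) \<le> ennreal (\<Sum>is | length is = k. K is)"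
    proof (intro SUP_least ennreal_leI)
      fix x
      have "tensor_norm k (\<lambda>is. partial_derivs f is x) \<le> (\<Sum>is | length is = k. \<bar>partial_derivs f is x\<bar>)"
        unfolding tensor_norm_def using L2_set_le_sum_abs[of "\<lambda>is. partial_derivs f is x"] unfolding L2_set_def .
      also have "\<dots> \<le> (\<Sum>is | length is = k. K is)" by (rule sum_mono, rule K) (use k in simp)
      finally show "tensor_norm k (\<lambda>is. partial_derivs f is x) \<le> (\<Sum>is | length is = k. K is)" .
    qed
    also have "\<dots> < \<infinity>" by simp
    finally show ?thesis .
  qed
  then show ?thesis unfolding Cn_norm_def by (intro sum_ennreal_less_top) simp_all
qed

text \<open>The factor 2 is for \<alpha> = 0, where the norm contains no Hoelder seminorm and the
  oscillation is bounded by twice the sup.\<close>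

lemma C0_space_bounds:
  fixes g :: "real \<Rightarrow> real^'n \<Rightarrow> real"
  assumes \<alpha>: "0 \<le> \<alpha>" "\<alpha> < 1" and g: "g \<in> C0_space T \<alpha>" and t: "t \<in> {0..T}"
  shows "\<bar>g t x\<bar> \<le> 2 * enn2real (C0_norm T \<alpha> g)"
    "\<bar>g t x - g t y\<bar> \<le> 2 * enn2real (C0_norm T \<alpha> g) * norm (x - y) powr \<alpha>"
proof -
  let ?A = "enn2real (C0_norm T \<alpha> g)"
  have fin: "C0_norm T \<alpha> g < \<infinity>" using g unfolding C0_space_def by blast
  have A: "ennreal ?A = C0_norm T \<alpha> g" using fin by simp
  have A0: "0 \<le> ?A" by simp
  have fl: "nat \<lfloor>\<alpha>\<rfloor> = 0" using \<alpha> by simp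
  have "C_norm \<alpha> (g t) \<le> C0_norm T \<alpha> g" unfolding C0_norm_def by (rule SUP_upper[OF t])
  then have le: "C_norm \<alpha> (g t) \<le> ennreal ?A" unfolding A .
  have sup: "\<bar>g t x\<bar> \<le> ?A" for x
  proof -
    have "ennreal \<bar>partial_derivs (g t) [] x\<bar> \<le> Cn_norm 0 (g t)" by (rule Cn_norm_ge) simp
    also have "\<dots> \<le> C_norm \<alpha> (g t)" unfolding C_norm_def fl by simp
    also note le
    finally show ?thesis by simp
  qed
  show "\<bar>g t x\<bar> \<le> 2 * ?A" using sup[of x] A0 by linarith
  show "\<bar>g t x - g t y\<bar> \<le> 2 * ?A * norm (x - y) powr \<alpha>"
  proof (cases "\<alpha> \<in> \<int>")
    case True
    with \<alpha> have a0: "\<alpha> = 0" by (auto elim!: Ints_cases)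
    show ?thesis
    proof (cases "x = y")
      case False
      then have "norm (x - y) powr \<alpha> = 1" unfolding a0 by simp
      then show ?thesis using sup[of x] sup[of y] by simp
    qed simp
  next
    case False
    have "frac \<alpha> = \<alpha>" using \<alpha> by (simp add: frac_eq)
    with False have "difference_seminorm 1 0 \<alpha> (g t) \<le> C_norm \<alpha> (g t)"
      unfolding C_norm_def fl hoelder_seminorm_eq by simp
    also note le
    finally have "\<bar>(difference (x - y) ^^ 1) (partial_derivs (g t) []) y\<bar> \<le> ?A * norm (x - y) powr \<alpha>"
      by (intro difference_seminorm_ge A0) simp_all
    then have "\<bar>g t x - g t y\<bar> \<le> ?A * norm (x - y) powr \<alpha>" by (simp add: difference_def)
    also have "\<dots> \<le> 2 * ?A * norm (x - y) powr \<alpha>" by (intro mult_right_mono) (use A0 in auto)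
    finally show ?thesis .
  qed
qed

text \<open>Passage from real bounds to \<open>ennreal\<close> norms. Finiteness of the right-hand
  side is recorded as well, since membership of the solution in its space is deduced from
  it.\<close>

lemma ou_mild_solution_estimate:
  fixes Q B :: "real^'n^'n"
  assumes Q: "sym_pos_def Q" and T: "T > 0" and s: "0 < s" "s < 1" and \<alpha>: "0 \<le> \<alpha>" "\<alpha> < 1"
    and n: "real n < \<alpha> + 2 * s" and m: "m \<in> {1, 2}" "\<alpha> + 2 * s < real (n + m)"
    and \<sigma>: "\<sigma> = \<alpha> + 2 * s - real n"
  obtains C where "0 < C"
    "\<And>f g. f \<in> Cn_space n \<Longrightarrow> difference_seminorm m n \<sigma> f < \<infinity> \<Longrightarrow> g \<in> C0_space T \<alpha> \<Longrightarrow>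
      bounded_continuous_strip T (ou_mild_solution Q B s f g) \<and>
      (\<forall>t\<in>{0..T}. ou_mild_solution Q B s f g t \<in> Cn_space n) \<and>
      (\<forall>is. length is \<le> n \<longrightarrow> continuous_on ({0..T} \<times> UNIV) (\<lambda>(t, x). partial_derivs (ou_mild_solution Q B s f g t) is x)) \<and>
      (\<forall>t\<in>{0..T}. Cn_norm n (ou_mild_solution Q B s f g t) + difference_seminorm m n \<sigma> (ou_mild_solution Q B s f g t)
        \<le> ennreal C * (Cn_norm n f + difference_seminorm m n \<sigma> f + C0_norm T \<alpha> g)) \<and>
      ennreal C * (Cn_norm n f + difference_seminorm m n \<sigma> f + C0_norm T \<alpha> g) < \<infinity>"
proof -
  obtain c0 c1 M where ou: "ou_kernel (ou_rescaled Q B T) s c0 c1 (ou_flow B) T M"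
    by (rule ou_kernel_rescaled[OF Q T s])
  obtain C where C: "0 \<le> C"
    "\<And>f g A A'. f \<in> Cn_space n \<Longrightarrow> (\<And>is x. length is \<le> n \<Longrightarrow> \<bar>partial_derivs f is x\<bar> \<le> A) \<Longrightarrow>
      (\<And>is x h. length is = n \<Longrightarrow> \<bar>(difference h ^^ m) (partial_derivs f is) x\<bar> \<le> A * norm h powr \<sigma>) \<Longrightarrow>
      continuous_on ({0..T} \<times> UNIV) (\<lambda>(t, x). g t x) \<Longrightarrow> (\<And>t x. t \<in> {0..T} \<Longrightarrow> \<bar>g t x\<bar> \<le> A') \<Longrightarrow>
      (\<And>t x y. t \<in> {0..T} \<Longrightarrow> \<bar>g t x - g t y\<bar> \<le> A' * norm (x - y) powr \<alpha>) \<Longrightarrow>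
      (\<forall>t\<in>{0..T}. \<forall>is x. length is < n \<longrightarrow> partial_derivs (ou_mild_solution Q B s f g t) is differentiable (at x)) \<and>
      (\<forall>is. length is \<le> n \<longrightarrow> continuous_on ({0..T} \<times> UNIV) (\<lambda>(t, x). partial_derivs (ou_mild_solution Q B s f g t) is x)) \<and>
      (\<forall>t\<in>{0..T}. \<forall>is x. length is \<le> n \<longrightarrow> \<bar>partial_derivs (ou_mild_solution Q B s f g t) is x\<bar> \<le> C * (A + A')) \<and>
      (\<forall>t\<in>{0..T}. \<forall>is x h. length is = n \<longrightarrow> h \<noteq> 0 \<longrightarrow>
        \<bar>(difference h ^^ m) (partial_derivs (ou_mild_solution Q B s f g t) is) x\<bar> \<le> C * (A + A') * norm h powr \<sigma>)"
    unfolding \<sigma> by (rule ou_mild_solution_regularity[OF ou \<alpha>(1) n m]) blast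
  \<comment> \<open>Cost of comparing tensor norms with entrywise bounds: a power of the dimension
    for each order up to n, and one more for the top-order difference.\<close>
  let ?S = "(\<Sum>k\<le>n. real CARD('n) ^ k) + real CARD('n) ^ n"
  have S: "0 \<le> ?S" by (simp add: sum_nonneg)
  show thesis
  \<comment> \<open>The 2 comes from \<open>C0_space_bounds\<close>; the 1 keeps the constant
    positive.\<close>
  proof (rule that[of "2 * (?S * C) + 1"])
    show pos: "0 < 2 * (?S * C) + 1" using mult_nonneg_nonneg[OF S C(1)] by linarith
    fix f :: "real^'n \<Rightarrow> real" and g :: "real \<Rightarrow> real^'n \<Rightarrow> real"
    assume f: "f \<in> Cn_space n" and fs: "difference_seminorm m n \<sigma> f < \<infinity>" and g: "g \<in> C0_space T \<alpha>"
    let ?v = "ou_mild_solution Q B s f g" and ?X = "Cn_norm n f + difference_seminorm m n \<sigma> f" and ?Y = "C0_norm T \<alpha> g"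
    let ?A = "enn2real ?X" and ?A' = "2 * enn2real ?Y"
    have X: "?X < \<infinity>" using Cn_norm_finite[OF f] fs by simp
    have Y: "?Y < \<infinity>" using g unfolding C0_space_def by blast
    have A: "ennreal ?A = ?X" using X by simp
    have A': "ennreal (enn2real ?Y) = ?Y" using Y by simp
    have f1: "\<bar>partial_derivs f is x\<bar> \<le> ?A" if "length is \<le> n" for "is" x
    proof -
      have "ennreal \<bar>partial_derivs f is x\<bar> \<le> Cn_norm n f" by (rule Cn_norm_ge[OF that])
      also have "\<dots> \<le> ennreal ?A" unfolding A by simp
      finally show ?thesis by simp
    qed
    have "difference_seminorm m n \<sigma> f \<le> ennreal ?A" unfolding A by simp
    then have f2: "\<bar>(difference h ^^ m) (partial_derivs f is) x\<bar> \<le> ?A * norm h powr \<sigma>" if "length is = n" for "is" x h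
      by (rule difference_seminorm_ge[OF m(1) _ _ that]) simp
    have gc: "continuous_on ({0..T} \<times> UNIV) (\<lambda>(t, x). g t x)"
      using g unfolding C0_space_def bounded_continuous_strip_def by blast
    have main: "(\<forall>t\<in>{0..T}. \<forall>is x. length is < n \<longrightarrow> partial_derivs (?v t) is differentiable (at x)) \<and>
      (\<forall>is. length is \<le> n \<longrightarrow> continuous_on ({0..T} \<times> UNIV) (\<lambda>(t, x). partial_derivs (?v t) is x)) \<and>
      (\<forall>t\<in>{0..T}. \<forall>is x. length is \<le> n \<longrightarrow> \<bar>partial_derivs (?v t) is x\<bar> \<le> C * (?A + ?A')) \<and>
      (\<forall>t\<in>{0..T}. \<forall>is x h. length is = n \<longrightarrow> h \<noteq> 0 \<longrightarrow>
        \<bar>(difference h ^^ m) (partial_derivs (?v t) is) x\<bar> \<le> C * (?A + ?A') * norm h powr \<sigma>)"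
      by (rule C(2)[OF f]) (rule f1 f2 gc C0_space_bounds[OF \<alpha> g]; assumption)+
    have c: "continuous_on ({0..T} \<times> UNIV) (\<lambda>(t, x). partial_derivs (?v t) is x)" if "length is \<le> n" for "is"
      using main that by blast
    have b: "\<bar>partial_derivs (?v t) is x\<bar> \<le> C * (?A + ?A')" if "t \<in> {0..T}" "length is \<le> n" for t "is" x
      using main that by blast
    show "bounded_continuous_strip T ?v \<and> (\<forall>t\<in>{0..T}. ?v t \<in> Cn_space n) \<and>
      (\<forall>is. length is \<le> n \<longrightarrow> continuous_on ({0..T} \<times> UNIV) (\<lambda>(t, x). partial_derivs (?v t) is x)) \<and>
      (\<forall>t\<in>{0..T}. Cn_norm n (?v t) + difference_seminorm m n \<sigma> (?v t) \<le> ennreal (2 * (?S * C) + 1) * (?X + ?Y)) \<and>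
      ennreal (2 * (?S * C) + 1) * (?X + ?Y) < \<infinity>"
    proof (intro conjI ballI allI impI)
      show "bounded_continuous_strip T ?v"
        unfolding bounded_continuous_strip_def
      proof
        show "continuous_on ({0..T} \<times> UNIV) (\<lambda>(t, x). ?v t x)" using c[of "[]"] by simp
        show "bounded ((\<lambda>(t, x). ?v t x) ` ({0..T} \<times> UNIV))"
          unfolding bounded_iff by (rule exI[of _ "C * (?A + ?A')"]) (use b[of _ "[]"] in auto)
      qed
      show "continuous_on ({0..T} \<times> UNIV) (\<lambda>(t, x). partial_derivs (?v t) is x)" if "length is \<le> n" for "is"
        by (rule c[OF that])
      show "ennreal (2 * (?S * C) + 1) * (?X + ?Y) < \<infinity>"
        using X Y by (simp add: ennreal_mult_less_top)
      fix t assume t: "t \<in> {0..T}"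
      show "?v t \<in> Cn_space n"
        unfolding Cn_space_def
      proof (intro CollectI conjI allI impI)
        show "partial_derivs (?v t) is differentiable (at x)" if "length is < n" for "is" x using main t that by blast
        fix "is" :: "'n list" assume l: "length is \<le> n"
        have "continuous_on UNIV (\<lambda>x. (t, x) :: real \<times> (real^'n))" by (intro continuous_intros)
        moreover have "range (\<lambda>x. (t, x) :: real \<times> (real^'n)) \<subseteq> {0..T} \<times> UNIV" using t by blast
        ultimately show "continuous_on UNIV (partial_derivs (?v t) is)"
          using continuous_on_compose2[OF c[OF l], of UNIV "\<lambda>x. (t, x)"] by simp
        show "bounded (range (partial_derivs (?v t) is))" unfolding bounded_iff using b[OF t l] by auto
      qed
      have "Cn_norm n (?v t) \<le> ennreal ((\<Sum>k\<le>n. real CARD('n) ^ k) * (C * (?A + ?A')))"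
        by (rule Cn_norm_le) (rule b[OF t])
      moreover have "difference_seminorm m n \<sigma> (?v t) \<le> ennreal (real CARD('n) ^ n * (C * (?A + ?A')))"
        by (rule difference_seminorm_le) (use main t in blast)
      ultimately have "Cn_norm n (?v t) + difference_seminorm m n \<sigma> (?v t)
          \<le> ennreal ((\<Sum>k\<le>n. real CARD('n) ^ k) * (C * (?A + ?A'))) + ennreal (real CARD('n) ^ n * (C * (?A + ?A')))"
        by (rule add_mono)
      also have "\<dots> = ennreal (?S * (C * (?A + ?A')))"
        using C(1) by (subst ennreal_plus[symmetric]) (auto simp: distrib_right sum_nonneg)
      also have "\<dots> \<le> ennreal ((2 * (?S * C) + 1) * (?A + enn2real ?Y))"
      proof (rule ennreal_leI)
        let ?q = "?S * C" and ?y = "enn2real ?Y"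
        have q: "0 \<le> ?q" by (rule mult_nonneg_nonneg[OF S C(1)])
        have "?A + ?A' \<le> 2 * (?A + ?y)" by simp
        from mult_left_mono[OF this q] have "?q * (?A + ?A') \<le> (2 * ?q) * (?A + ?y)" by (simp only: mult.assoc mult.left_commute)
        moreover have "(2 * ?q + 1) * (?A + ?y) = (2 * ?q) * (?A + ?y) + (?A + ?y)" by (simp only: distrib_right mult_1)
        moreover have "0 \<le> ?A + ?y" by simp
        ultimately show "?S * (C * (?A + ?A')) \<le> (2 * ?q + 1) * (?A + ?y)" unfolding mult.assoc[symmetric] by linarith
      qed
      also have "\<dots> = ennreal (2 * (?S * C) + 1) * (?X + ?Y)"
      proof -
        have "ennreal (?A + enn2real ?Y) = ?X + ?Y" using A A' by (simp add: ennreal_plus)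
        then show ?thesis using pos by (simp add: ennreal_mult less_imp_le)
      qed
      finally show "Cn_norm n (?v t) + difference_seminorm m n \<sigma> (?v t) \<le> ennreal (2 * (?S * C) + 1) * (?X + ?Y)" .
    qed
  qed
qed

theorem theorem4p5:
  fixes Q B :: "real^'n^'n" and T :: real
  assumes "sym_pos_def Q" and "T > 0"
  shows
   "(\<forall>s \<alpha> :: real. 0 < s \<and> s < 1 \<and> 0 \<le> \<alpha> \<and> \<alpha> < 1 \<and> \<alpha> + 2 * s \<notin> {1, 2} \<longrightarrow>
      (\<exists>C > 0. \<forall>f \<in> C_space (\<alpha> + 2 * s). \<forall>g \<in> C0_space T \<alpha>.
         ou_mild_solution Q B s f g \<in> C0_space T (\<alpha> + 2 * s) \<and>
         C0_norm T (\<alpha> + 2 * s) (ou_mild_solution Q B s f g)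
           \<le> ennreal C * (C_norm (\<alpha> + 2 * s) f + C0_norm T \<alpha> g)))
    \<and>
    (\<forall>(s :: real) (\<alpha> :: real) (k :: nat).
      0 < s \<and> s < 1 \<and> 0 \<le> \<alpha> \<and> \<alpha> < 1 \<and> \<alpha> + 2 * s = real k \<and> k \<in> {1, 2} \<longrightarrow>
      (\<exists>C > 0. \<forall>f \<in> Z_space k. \<forall>g \<in> C0_space T \<alpha>.
         ou_mild_solution Q B s f g \<in> Z0_space T k \<and>
         Z0_norm T k (ou_mild_solution Q B s f g)
           \<le> ennreal C * (Z_norm k f + C0_norm T \<alpha> g)))"
proof (intro conjI allI impI)
  fix s \<alpha> :: real
  assume "0 < s \<and> s < 1 \<and> 0 \<le> \<alpha> \<and> \<alpha> < 1 \<and> \<alpha> + 2 * s \<notin> {1, 2}"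
  then have s: "0 < s" "s < 1" and \<alpha>: "0 \<le> \<alpha>" "\<alpha> < 1" and ni: "\<alpha> + 2 * s \<noteq> 1" "\<alpha> + 2 * s \<noteq> 2" by auto
  let ?\<gamma> = "\<alpha> + 2 * s"
  \<comment> \<open>Non-integer case, with m = 1: \<alpha> + 2s lies strictly between n and n + 1,
    and the Hoelder exponent is the fractional part.\<close>
  define n where "n = nat \<lfloor>?\<gamma>\<rfloor>"
  have nf: "\<lfloor>?\<gamma>\<rfloor> = int n" using s \<alpha> by (simp add: n_def)
  \<comment> \<open>\<alpha> + 2s lies strictly between 0 and 3, and the only integers there are the
    two excluded values.\<close>
  have Z: "?\<gamma> \<notin> \<int>"
  proof
    assume "?\<gamma> \<in> \<int>"
    then obtain i :: int where i: "?\<gamma> = of_int i" by (rule Ints_cases)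
    then have "0 < real_of_int i" "real_of_int i < 3" using s \<alpha> by linarith+
    then have "i = 1 \<or> i = 2" by linarith
    with i ni show False by auto
  qed
  have fr: "frac ?\<gamma> = ?\<gamma> - real n" by (simp add: frac_def nf)
  have n1: "real n < ?\<gamma>"
  proof -
    have "real n \<le> ?\<gamma>" using of_int_floor_le[of ?\<gamma>] unfolding nf by simp
    moreover have "real n \<noteq> ?\<gamma>" using Z by (metis Ints_of_nat)
    ultimately show ?thesis by simp
  qed
  have n2: "?\<gamma> < real (n + 1)" using floor_correct[of ?\<gamma>] unfolding nf by simp
  obtain C where C: "0 < C"
    "\<And>f g. f \<in> Cn_space n \<Longrightarrow> difference_seminorm 1 n (frac ?\<gamma>) f < \<infinity> \<Longrightarrow> g \<in> C0_space T \<alpha> \<Longrightarrow>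
      bounded_continuous_strip T (ou_mild_solution Q B s f g) \<and>
      (\<forall>t\<in>{0..T}. ou_mild_solution Q B s f g t \<in> Cn_space n) \<and>
      (\<forall>is. length is \<le> n \<longrightarrow> continuous_on ({0..T} \<times> UNIV) (\<lambda>(t, x). partial_derivs (ou_mild_solution Q B s f g t) is x)) \<and>
      (\<forall>t\<in>{0..T}. Cn_norm n (ou_mild_solution Q B s f g t) + difference_seminorm 1 n (frac ?\<gamma>) (ou_mild_solution Q B s f g t)
        \<le> ennreal C * (Cn_norm n f + difference_seminorm 1 n (frac ?\<gamma>) f + C0_norm T \<alpha> g)) \<and>
      ennreal C * (Cn_norm n f + difference_seminorm 1 n (frac ?\<gamma>) f + C0_norm T \<alpha> g) < \<infinity>"
    by (rule ou_mild_solution_estimate[OF assms s \<alpha> n1 _ n2 fr]) (simp, blast)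
  have N: "C_norm ?\<gamma> f = Cn_norm n f + difference_seminorm 1 n (frac ?\<gamma>) f" for f :: "real^'n \<Rightarrow> real"
    unfolding C_norm_def hoelder_seminorm_eq n_def using Z by simp
  have Sp: "f \<in> C_space ?\<gamma> \<longleftrightarrow> f \<in> Cn_space n \<and> difference_seminorm 1 n (frac ?\<gamma>) f < \<infinity>" for f :: "real^'n \<Rightarrow> real"
    unfolding C_space_def hoelder_seminorm_eq n_def using Z by simp
  show "\<exists>C>0. \<forall>f\<in>C_space ?\<gamma>. \<forall>g\<in>C0_space T \<alpha>. ou_mild_solution Q B s f g \<in> C0_space T ?\<gamma> \<and>
      C0_norm T ?\<gamma> (ou_mild_solution Q B s f g) \<le> ennreal C * (C_norm ?\<gamma> f + C0_norm T \<alpha> g)"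
  proof (rule exI[of _ C], intro conjI ballI)
    show "C > 0" by (rule C(1))
    fix f :: "real^'n \<Rightarrow> real" and g :: "real \<Rightarrow> real^'n \<Rightarrow> real"
    assume f: "f \<in> C_space ?\<gamma>" and g: "g \<in> C0_space T \<alpha>"
    let ?v = "ou_mild_solution Q B s f g" and ?X = "ennreal C * (C_norm ?\<gamma> f + C0_norm T \<alpha> g)"
    have fC: "f \<in> Cn_space n" and fs: "difference_seminorm 1 n (frac ?\<gamma>) f < \<infinity>" using f Sp by auto
    note est = C(2)[OF fC fs g, folded N]
    have r: "bounded_continuous_strip T ?v" "\<forall>t\<in>{0..T}. ?v t \<in> Cn_space n"
      "\<forall>is. length is \<le> n \<longrightarrow> continuous_on ({0..T} \<times> UNIV) (\<lambda>(t, x). partial_derivs (?v t) is x)"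
      "\<forall>t\<in>{0..T}. C_norm ?\<gamma> (?v t) \<le> ?X" "?X < \<infinity>"
      by (rule est[THEN conjunct1] est[THEN conjunct2, THEN conjunct1] est[THEN conjunct2, THEN conjunct2, THEN conjunct1]
          est[THEN conjunct2, THEN conjunct2, THEN conjunct2, THEN conjunct1]
          est[THEN conjunct2, THEN conjunct2, THEN conjunct2, THEN conjunct2])+
    show le: "C0_norm T ?\<gamma> ?v \<le> ?X" unfolding C0_norm_def[of T ?\<gamma> ?v] using r(4) by (intro SUP_least) blast
    have "difference_seminorm 1 n (frac ?\<gamma>) (?v t) < \<infinity>" if "t \<in> {0..T}" for t
    proof -
      have "difference_seminorm 1 n (frac ?\<gamma>) (?v t) \<le> C_norm ?\<gamma> (?v t)" unfolding N by simp
      also have "\<dots> \<le> ?X" using r(4) that by blast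
      also note r(5)
      finally show ?thesis .
    qed
    then show "?v \<in> C0_space T ?\<gamma>"
      unfolding C0_space_def mem_Collect_eq Sp n_def[symmetric]
      using r(1-3) order.strict_trans1[OF le r(5)] by blast
  qed
next
  fix s \<alpha> :: real and k :: nat
  assume "0 < s \<and> s < 1 \<and> 0 \<le> \<alpha> \<and> \<alpha> < 1 \<and> \<alpha> + 2 * s = real k \<and> k \<in> {1, 2}"
  then have s: "0 < s" "s < 1" and \<alpha>: "0 \<le> \<alpha>" "\<alpha> < 1" and \<gamma>: "\<alpha> + 2 * s = real k" and k: "k \<in> {1, 2}" by auto
  define n where "n = k - 1"
  have kn: "k = Suc n" using k by (auto simp: n_def)
  \<comment> \<open>Here n + 1 equals \<alpha> + 2s, so the strict bound \<alpha> + 2s < n + m calls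
    for m = 2; the exponent \<alpha> + 2s - n is 1.\<close>
  have n1: "real n < \<alpha> + 2 * s" "\<alpha> + 2 * s < real (n + 2)" "1 = \<alpha> + 2 * s - real n" unfolding \<gamma> kn by simp_all
  obtain C where C: "0 < C"
    "\<And>f g. f \<in> Cn_space n \<Longrightarrow> difference_seminorm 2 n 1 f < \<infinity> \<Longrightarrow> g \<in> C0_space T \<alpha> \<Longrightarrow>
      bounded_continuous_strip T (ou_mild_solution Q B s f g) \<and>
      (\<forall>t\<in>{0..T}. ou_mild_solution Q B s f g t \<in> Cn_space n) \<and>
      (\<forall>is. length is \<le> n \<longrightarrow> continuous_on ({0..T} \<times> UNIV) (\<lambda>(t, x). partial_derivs (ou_mild_solution Q B s f g t) is x)) \<and>
      (\<forall>t\<in>{0..T}. Cn_norm n (ou_mild_solution Q B s f g t) + difference_seminorm 2 n 1 (ou_mild_solution Q B s f g t)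
        \<le> ennreal C * (Cn_norm n f + difference_seminorm 2 n 1 f + C0_norm T \<alpha> g)) \<and>
      ennreal C * (Cn_norm n f + difference_seminorm 2 n 1 f + C0_norm T \<alpha> g) < \<infinity>"
    by (rule ou_mild_solution_estimate[OF assms s \<alpha> n1(1) _ n1(2,3)]) (simp, blast)
  have N: "Z_norm k f = Cn_norm n f + difference_seminorm 2 n 1 f" for f :: "real^'n \<Rightarrow> real"
    unfolding Z_norm_def zygmund_seminorm_eq n_def ..
  have Sp: "f \<in> Z_space k \<longleftrightarrow> f \<in> Cn_space n \<and> difference_seminorm 2 n 1 f < \<infinity>" for f :: "real^'n \<Rightarrow> real"
    unfolding Z_space_def zygmund_seminorm_eq n_def by simp
  show "\<exists>C>0. \<forall>f\<in>Z_space k. \<forall>g\<in>C0_space T \<alpha>. ou_mild_solution Q B s f g \<in> Z0_space T k \<and>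
      Z0_norm T k (ou_mild_solution Q B s f g) \<le> ennreal C * (Z_norm k f + C0_norm T \<alpha> g)"
  proof (rule exI[of _ C], intro conjI ballI)
    show "C > 0" by (rule C(1))
    fix f :: "real^'n \<Rightarrow> real" and g :: "real \<Rightarrow> real^'n \<Rightarrow> real"
    assume f: "f \<in> Z_space k" and g: "g \<in> C0_space T \<alpha>"
    let ?v = "ou_mild_solution Q B s f g" and ?X = "ennreal C * (Z_norm k f + C0_norm T \<alpha> g)"
    have fC: "f \<in> Cn_space n" and fs: "difference_seminorm 2 n 1 f < \<infinity>" using f Sp by auto
    note est = C(2)[OF fC fs g, folded N]
    have r: "bounded_continuous_strip T ?v" "\<forall>t\<in>{0..T}. ?v t \<in> Cn_space n"
      "\<forall>is. length is \<le> n \<longrightarrow> continuous_on ({0..T} \<times> UNIV) (\<lambda>(t, x). partial_derivs (?v t) is x)"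
      "\<forall>t\<in>{0..T}. Z_norm k (?v t) \<le> ?X" "?X < \<infinity>"
      by (rule est[THEN conjunct1] est[THEN conjunct2, THEN conjunct1] est[THEN conjunct2, THEN conjunct2, THEN conjunct1]
          est[THEN conjunct2, THEN conjunct2, THEN conjunct2, THEN conjunct1]
          est[THEN conjunct2, THEN conjunct2, THEN conjunct2, THEN conjunct2])+
    show le: "Z0_norm T k ?v \<le> ?X" unfolding Z0_norm_def using r(4) by (intro SUP_least) blast
    have part: "difference_seminorm 2 n 1 (?v t) < \<infinity>" "Cn_norm n (?v t) \<le> ?X" if "t \<in> {0..T}" for t
    proof -
      have Zle: "Z_norm k (?v t) \<le> ?X" using r(4) that by blast
      have "difference_seminorm 2 n 1 (?v t) \<le> Z_norm k (?v t)" unfolding N by simp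
      also note Zle
      also note r(5)
      finally show "difference_seminorm 2 n 1 (?v t) < \<infinity>" .
      have "Cn_norm n (?v t) \<le> Z_norm k (?v t)" unfolding N by simp
      also note Zle
      finally show "Cn_norm n (?v t) \<le> ?X" .
    qed
    \<comment> \<open>The order k - 1 is an integer, so its norm is \<open>Cn_norm\<close> alone,
      already bounded by the estimate; the argument treats k = 1 and k = 2 together.\<close>
    have "?v \<in> C0_space T (real (k - 1))"
    proof -
      have fl: "nat \<lfloor>real n\<rfloor> = n" and Zn: "real n \<in> \<int>" by simp_all
      have "C0_norm T (real n) ?v \<le> ?X"
        unfolding C0_norm_def[of T "real n" ?v] C_norm_def[of "real n"] fl using Zn part(2) by (intro SUP_least) simp
      from order.strict_trans1[OF this r(5)] have "C0_norm T (real n) ?v < \<infinity>" .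
      with r(1-3) Zn show ?thesis
        unfolding n_def[symmetric] C0_space_def C_space_def mem_Collect_eq fl by blast
    qed
    with r(1,2) part(1) order.strict_trans1[OF le r(5)] show "?v \<in> Z0_space T k"
      unfolding Z0_space_def mem_Collect_eq Sp by blast
  qed
qed

end
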